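(* (i) Let $\left((F,\nu,M),[\,,]_{F},\rho\right)$ be a Lie algebroid over $M$, $(E,\pi,M)$ a vector bundle with dual $\varpi:E^{*}\to M$, and $\rho\Gamma$ a $\rho$-connection for $E^{*}$. Let $\mathring D$ be a distinguished linear $\rho$-connection for the generalized tangent bundle $\rho TE^{*}\to E^{*}$ with components $(\rho\mathring H^{\alpha}_{\beta\gamma},\rho\mathring H^{a}_{b\gamma},\rho\mathring V^{\alpha c}_{\beta},\rho\mathring V^{ac}_{b})$ and let $G=g_{\alpha\beta}\,d\tilde z^{\alpha}\otimes d\tilde z^{\beta}+g^{ab}\,\delta\tilde p_a\otimes\delta\tilde p_b$ be a (pseudo)metrical structure. Then the local functions $$\begin{aligned} \rho H^{\alpha}_{\beta\gamma}={}&\tfrac12\tilde g^{\alpha\varepsilon}\Big(\tilde\rho(\tilde\delta_\gamma)g_{\varepsilon\beta}+\tilde\rho(\tilde\delta_\beta)g_{\varepsilon\gamma}-\tilde\rho(\tilde\delta_\varepsilon)g_{\beta\gamma}+g_{\theta\varepsilon}\,(L^{\theta}_{\gamma\beta}\circ\varpi)-g_{\beta\theta}\,(L^{\theta}_{\gamma\varepsilon}\circ\varpi)-g_{\theta\gamma}\,(L^{\theta}_{\beta\varepsilon}\circ\varpi)\Big),\\ \rho H^{a}_{b\gamma}={}&\rho\mathring H^{a}_{b\gamma}+\tfrac12\tilde g_{be}\,g^{ea}{}_{\overset{0}{|}\gamma},\qquad \rho V^{\alpha c}_{\beta}=\rho\mathring V^{\alpha c}_{\beta}+\tfrac12\tilde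 g^{\alpha\varepsilon}\,g_{\varepsilon\beta}\overset{0}{|}{}^{c},\\ \rho V^{ac}_{b}={}&\tfrac12\tilde g_{be}\Big(\tilde\rho(\dot{\tilde\partial}{}^{c})g^{ea}+\tilde\rho(\dot{\tilde\partial}{}^{a})g^{ec}-\tilde\rho(\dot{\tilde\partial}{}^{e})g^{ac}\Big) \end{aligned}$$ are the components of a distinguished linear $\rho$-connection $D$ with $D_XG=0$ for every section $X$ of $\rho TE^{*}$. (ii) In the classical case $F=TM$, $\rho=\mathrm{Id}_{TM}$, with the coordinate frames $\partial/\partial x^{i}$ of $TM$, where $\rho TE^{*}$ is identified with $TE^{*}$ and the adapted base is $(\delta_i,\dot\partial^{a})=\left(\frac{\partial}{\partial x^{i}}+\Gamma_{bi}\frac{\partial}{\partial p_b},\frac{\partial}{\partial p_a}\right)$, these formulas become $$\begin{aligned} H^{i}_{jk}&=\tfrac12\tilde g^{il}\left(\delta_kg_{lj}+\delta_jg_{lk}-\delta_lg_{jk}\right),& H^{a}_{bk}&=\mathring H^{a}_{bk}+\tfrac12\tilde g_{be}\,g^{ea}{}_{\overset{0}{|}k},\\ V^{ic}_{j}&=\mathring V^{ic}_{j}+\tfrac12\tilde g^{il}\,g_{lj}\overset{0}{|}{}^{c},& V^{ac}_{b}&=\tfrac12\tilde g_{be}\left(\dot\partial^{c}g^{ea}+\dot\partial^{a}g^{ec}-\dot\partial^{e}g^{ac}\right), \end{aligned}$$ and they are the components of a distinguished linear connection $D$ on $TE^{*}$ with $D_XG=0$ for every vector field $X$ on $E^{*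}$.
   Context: All manifolds, bundles and maps are smooth; repeated indices are summed. Local data: $(t_\alpha)$ is a local frame of the Lie algebroid $F$, $[t_\alpha,t_\beta]_F=L^{\gamma}_{\alpha\beta}t_\gamma$, $\rho(t_\alpha)=\rho^{i}_{\alpha}\frac{\partial}{\partial x^{i}}$. $(x^i,p_a)$ are vector bundle coordinates on $E^{*}$. $T_\alpha$ is the local frame of $\varpi^{*}F\to E^{*}$ induced by $t_\alpha$. Greek indices run over $1,\dots,\mathrm{rank}\,F$, $i,j,k,l$ over $1,\dots,\dim M$, and $a,b,c,d,e$ over $1,\dots,\mathrm{rank}\,E$. Generalized tangent bundle: $\rho TE^{*}$ is the vector subbundle of $\varpi^{*}F\oplus TE^{*}$ locally generated by the linearly independent sections $\tilde\partial_\alpha=T_\alpha\oplus(\rho^{i}_{\alpha}\circ\varpi)\frac{\partial}{\partial x^{i}}$ and $\dot{\tilde\partial}{}^{a}=0\oplus\frac{\partial}{\partial p_a}$. Its anchor $\tilde\rho:\rho TE^{*}\to TE^{*}$ is $\tilde\rho(Z^{\alpha}\tilde\partial_\alpha+Y_a\dot{\tilde\partial}{}^{a})=Z^{\alpha}(\rho^{i}_{\alpha}\circ\varpi)\frac{\partial}{\partial x^{i}}+Y_a\frac{\partial}{\partial p_a}$. The vertical subbundle is locally spanned by the $\dot{\tilde\partial}{}^{a}$. $\rho$-connection: a vector bundle morphism $\rho\Gamma$ over $\mathrm{Id}_{E^*}$ from $\rho TE^{*}$ to its vertical subbundle restricting to the identity on the vertical subbundle, written locally $Z^{\alpha}\tilde\partial_\alpha+Y_b\dot{\tilde\partial}{}^{b}\mapsto(Y_b-\rho\Gamma_{b\alpha}Z^{\alpha})\dot{\tilde\partial}{}^{b}$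 (components $\Gamma_{bi}$ in the classical case). Its kernel is the horizontal subbundle, locally spanned by $\tilde\delta_\alpha=\tilde\partial_\alpha+\rho\Gamma_{b\alpha}\dot{\tilde\partial}{}^{b}$. $(\tilde\delta_\alpha,\dot{\tilde\partial}{}^{a})$ is the adapted base; $(d\tilde z^{\alpha},\delta\tilde p_a)$ denotes its dual frame. Distinguished linear $\rho$-connection: a covariant derivative $(X,T)\mapsto D_XT$ on the tensor algebra of $\rho TE^{*}$, $X\in\Gamma(\rho TE^{*})$ ($C^\infty(E^* )$-linear in $X$, additive in $T$, $D_Xf=\tilde\rho(X)f$ on functions, a derivation of the tensor product commuting with contractions), such that $D_X$ maps horizontal sections to horizontal sections and vertical sections to vertical sections. Its components are defined by $D_{\tilde\delta_\gamma}\tilde\delta_\beta=\rho H^{\alpha}_{\beta\gamma}\tilde\delta_\alpha$, $D_{\tilde\delta_\gamma}\dot{\tilde\partial}{}^{a}=\rho H^{a}_{b\gamma}\dot{\tilde\partial}{}^{b}$, $D_{\dot{\tilde\partial}{}^{c}}\tilde\delta_\beta=\rho V^{\alpha c}_{\beta}\tilde\delta_\alpha$, $D_{\dot{\tilde\partial}{}^{c}}\dot{\tilde\partial}{}^{a}=\rho V^{ac}_{b}\dot{\tilde\partial}{}^{b}$; in the classical case they are written $H^{i}_{jk},H^{a}_{bk},V^{ic}_{j},V^{ac}_{b}$ and $D$ is called a distinguished linear connection. That given local functions (one family for each choice of charts and frames) "are the components" of such a connection means that there is a globally defined $D$ having these components in every choice. Pseudometrical structure: a tensor field $G=g_{\alpha\beta}\,d\tilde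 z^{\alpha}\otimes d\tilde z^{\beta}+g^{ab}\,\delta\tilde p_a\otimes\delta\tilde p_b$ with symmetric components and with $\|g_{\alpha\beta}\|$ and $\|g^{ab}\|$ nondegenerate at every point of $E^*$; it is a metrical structure if moreover these matrices have constant signature. "(Pseudo)" means that the statement holds both for pseudometrical and for metrical structures. $\|\tilde g^{\alpha\beta}\|=\|g_{\alpha\beta}\|^{-1}$ and $\|\tilde g_{ab}\|=\|g^{ab}\|^{-1}$. Covariant derivatives with respect to $\mathring D$: $g^{ea}{}_{\overset{0}{|}\gamma}=\tilde\rho(\tilde\delta_\gamma)g^{ea}-\rho\mathring H^{e}_{d\gamma}g^{da}-\rho\mathring H^{a}_{d\gamma}g^{ed}$ and $g_{\varepsilon\beta}\overset{0}{|}{}^{c}=\tilde\rho(\dot{\tilde\partial}{}^{c})g_{\varepsilon\beta}-\rho\mathring V^{\theta c}_{\varepsilon}g_{\theta\beta}-\rho\mathring V^{\theta c}_{\beta}g_{\varepsilon\theta}$, and likewise with Latin indices in the classical case. *)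

theory Defs
  imports "HOL-Analysis.Analysis" "HOL-Library.Function_Algebras"
begin

instantiation "fun" :: (type, real_vector) real_vector
begin
definition scaleR_fun :: "real \<Rightarrow> ('a \<Rightarrow> 'b) \<Rightarrow> 'a \<Rightarrow> 'b"
  where "scaleR_fun r f = (\<lambda>x. r *\<^sub>R f x)"
instance
  by standard (simp_all add: fun_eq_iff scaleR_fun_def algebra_simps)
end

section \<open>Manifolds\<close>

text \<open>\<^term>\<open>Ck_on k S f\<close> is meant for open \<^term>\<open>S\<close>.\<close>

primrec Ck_on ::
  "nat \<Rightarrow> 'c::euclidean_space set \<Rightarrow> ('c \<Rightarrow> 'd::real_normed_vector) \<Rightarrow> bool" where
  "Ck_on 0 S f = continuous_on S f"
| "Ck_on (Suc k) S f =
     ((\<forall>x\<in>S. f differentiable (at x)) \<and>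
      (\<forall>v. Ck_on k S (\<lambda>x. frechet_derivative f (at x) v)))"

definition smooth_on :: "'c::euclidean_space set \<Rightarrow> ('c \<Rightarrow> 'd::real_normed_vector) \<Rightarrow> bool"
  where "smooth_on S f \<longleftrightarrow> (\<forall>k. Ck_on k S f)"

text \<open>A chart is a pair of its domain and its coordinate map (whose values outside the domain
  are irrelevant). A manifold is a set with an atlas, carrying the topology that the atlas induces.
  The atlas need not be maximal, but may be; the same holds for the sets of local frames of
  vector bundles below. Quantifying over the charts and frames of an arbitrary such structure
  therefore includes quantifying over all charts and all local frames.\<close>

type_synonym ('p, 'c) chart = "'p set \<times> ('p \<Rightarrow> 'c)"
type_synonym ('p, 'c) atlas = "('p, 'c) chart set"

definition points :: "('p, 'c) atlas \<Rightarrow> 'p set"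
  where "points A = \<Union> (fst ` A)"

definition open_in :: "('p, 'c::euclidean_space) atlas \<Rightarrow> 'p set \<Rightarrow> bool"
  where "open_in A W \<longleftrightarrow> W \<subseteq> points A \<and> (\<forall>(U, \<phi>)\<in>A. open (\<phi> ` (U \<inter> W)))"

definition smooth_atlas :: "('p, 'c::euclidean_space) atlas \<Rightarrow> bool"
  where "smooth_atlas A \<longleftrightarrow>
    (\<forall>(U, \<phi>)\<in>A. inj_on \<phi> U \<and> open (\<phi> ` U)) \<and>
    (\<forall>(U, \<phi>)\<in>A. \<forall>(V, \<psi>)\<in>A. open (\<phi> ` (U \<inter> V)) \<and>
       smooth_on (\<phi> ` (U \<inter> V)) (\<psi> \<circ> inv_into U \<phi>))"

definition manifold :: "('p, 'c::euclidean_space) atlas \<Rightarrow> bool"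
  where "manifold A \<longleftrightarrow> smooth_atlas A \<and>
    Hausdorff_space (topology (open_in A)) \<and> second_countable (topology (open_in A))"

definition smooth_fun :: "('p, 'c::euclidean_space) atlas \<Rightarrow> 'p set \<Rightarrow> ('p \<Rightarrow> real) \<Rightarrow> bool"
  where "smooth_fun A W f \<longleftrightarrow> (\<forall>(U, \<phi>)\<in>A. smooth_on (\<phi> ` (U \<inter> W)) (f \<circ> inv_into U \<phi>))"

definition smooth_near :: "('p, 'c::euclidean_space) atlas \<Rightarrow> 'p \<Rightarrow> ('p \<Rightarrow> real) \<Rightarrow> bool"
  where "smooth_near A x f \<longleftrightarrow> (\<exists>W. open_in A W \<and> x \<in> W \<and> smooth_fun A W f)"

text \<open>Tangent vectors at \<^term>\<open>x\<close> are the derivations of germs at \<^term>\<open>x\<close>. They are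
  made functions on all of \<^typ>\<open>'p \<Rightarrow> real\<close> by the value 0 at functions not smooth near \<^term>\<open>x\<close>.
  \<^term>\<open>partial A c v x\<close> is the derivative at \<^term>\<open>x\<close> in the direction \<^term>\<open>v\<close> of the chart \<^term>\<open>c\<close>;
  by the chain rule each chart at \<^term>\<open>x\<close> gives all of the tangent space.\<close>

definition "partial" ::
  "('p, 'c::euclidean_space) atlas \<Rightarrow> ('p, 'c) chart \<Rightarrow> 'c \<Rightarrow> 'p \<Rightarrow> ('p \<Rightarrow> real) \<Rightarrow> real"
  where "partial A c v x = (\<lambda>f. if smooth_near A x f
    then frechet_derivative (f \<circ> inv_into (fst c) (snd c)) (at (snd c x)) v else 0)"

definition tangent_space ::
  "('p, 'c::euclidean_space) atlas \<Rightarrow> 'p \<Rightarrow> (('p \<Rightarrow> real) \<Rightarrow> real) set"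
  where "tangent_space A x = {partial A c v x |c v. c \<in> A \<and> x \<in> fst c}"

section \<open>Vector bundles\<close>

text \<open>The fibres are linear subspaces of one real vector space \<^typ>\<open>'w\<close>, and the bundle
  structure is given by local frames with smooth transition matrices. The rank is the
  cardinality of the index type \<^typ>\<open>'k\<close>. All sections are total functions, of
  which only the values over the open set under consideration matter.\<close>

record ('p, 'c, 'w, 'k) vbundle =
  base :: "('p, 'c) atlas"
  fibre :: "'p \<Rightarrow> 'w set"
  frames :: "('p set \<times> ('k \<Rightarrow> 'p \<Rightarrow> 'w)) set"

text \<open>\<^term>\<open>coeff s x k\<close> is the \<^term>\<open>k\<close>-th element of the dual frame of \<^term>\<open>s\<close> at \<^term>\<open>x\<close>,
  extended by 0 outside the fibre.\<close>

definition coeff :: "('k \<Rightarrow> 'p \<Rightarrow> 'w::real_vector) \<Rightarrow> 'p \<Rightarrow> 'k \<Rightarrow> 'w \<Rightarrow> real"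
  where "coeff s x k w = representation (range (\<lambda>j. s j x)) w (s k x)"

definition vector_bundle ::
  "('p, 'c::euclidean_space, 'w::real_vector, 'k::finite) vbundle \<Rightarrow> bool"
  where "vector_bundle B \<longleftrightarrow> manifold (base B) \<and>
    \<Union> (fst ` frames B) = points (base B) \<and>
    (\<forall>(U, s)\<in>frames B. open_in (base B) U \<and>
       (\<forall>x\<in>U. inj (\<lambda>k. s k x) \<and> independent (range (\<lambda>k. s k x)) \<and>
               span (range (\<lambda>k. s k x)) = fibre B x)) \<and>
    (\<forall>(U, s)\<in>frames B. \<forall>(V, t)\<in>frames B. \<forall>j k.
       smooth_fun (base B) (U \<inter> V) (\<lambda>x. coeff s x k (t j x)))"

definition smooth_section ::
  "('p, 'c::euclidean_space, 'w::real_vector, 'k) vbundle \<Rightarrow> 'p set \<Rightarrow> ('p \<Rightarrow> 'w) \<Rightarrow> bool"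
  where "smooth_section B W X \<longleftrightarrow> (\<forall>x\<in>W. X x \<in> fibre B x) \<and>
    (\<forall>(U, s)\<in>frames B. \<forall>k. smooth_fun (base B) (U \<inter> W) (\<lambda>x. coeff s x k (X x)))"

definition bundle_morphism ::
  "('p, 'c::euclidean_space, 'w::real_vector, 'k) vbundle \<Rightarrow>
   ('p, 'c, 'z::real_vector, 'l) vbundle \<Rightarrow> ('p \<Rightarrow> 'w \<Rightarrow> 'z) \<Rightarrow> bool"
  where "bundle_morphism B C h \<longleftrightarrow>
    (\<forall>x\<in>points (base B). \<forall>v\<in>fibre B x. h x v \<in> fibre C x \<and>
       (\<forall>w\<in>fibre B x. h x (v + w) = h x v + h x w) \<and> (\<forall>r. h x (r *\<^sub>R v) = r *\<^sub>R h x v)) \<and>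
    (\<forall>W X. open_in (base B) W \<and> smooth_section B W X \<longrightarrow>
       smooth_section C W (\<lambda>x. h x (X x)))"

text \<open>In the tangent bundle, \<^term>\<open>b\<close> enumerates the standard basis of the model space.\<close>

definition coord_frame ::
  "('k \<Rightarrow> 'c) \<Rightarrow> ('p, 'c::euclidean_space) atlas \<Rightarrow> ('p, 'c) chart \<Rightarrow>
   'k \<Rightarrow> 'p \<Rightarrow> ('p \<Rightarrow> real) \<Rightarrow> real"
  where "coord_frame b A c k x = partial A c (b k) x"

definition tangent_bundle ::
  "('k \<Rightarrow> 'c) \<Rightarrow> ('p, 'c::euclidean_space) atlas \<Rightarrow>
   ('p, 'c, ('p \<Rightarrow> real) \<Rightarrow> real, 'k) vbundle"
  where "tangent_bundle b A = \<lparr> base = A, fibre = tangent_space A,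
    frames = {(fst c, coord_frame b A c) |c. c \<in> A} \<rparr>"

definition base_dir :: "'m::finite \<Rightarrow> real^'m"
  where "base_dir i = axis i 1"

definition total_dir :: "'m::finite + 'e::finite \<Rightarrow> (real^'m) \<times> (real^'e)"
  where "total_dir = case_sum (\<lambda>i. (axis i 1, 0)) (\<lambda>a. (0, axis a 1))"

section \<open>Lie algebroids\<close>

text \<open>The bracket is taken as an operator on local sections: over each open set it maps sections
  to sections, compatibly with restriction. Anchors act on tangent vectors, hence on functions.\<close>

definition lie_algebroid ::
  "('p, real^'m::finite, 'f::real_vector, 'k::finite) vbundle \<Rightarrow>
   (('p \<Rightarrow> 'f) \<Rightarrow> ('p \<Rightarrow> 'f) \<Rightarrow> 'p \<Rightarrow> 'f) \<Rightarrow>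
   ('p \<Rightarrow> 'f \<Rightarrow> ('p \<Rightarrow> real) \<Rightarrow> real) \<Rightarrow> bool"
  where "lie_algebroid F br \<rho> \<longleftrightarrow> vector_bundle F \<and>
    bundle_morphism F (tangent_bundle base_dir (base F)) \<rho> \<and>
    (\<forall>W. open_in (base F) W \<longrightarrow>
      (\<forall>X Y. smooth_section F W X \<and> smooth_section F W Y \<longrightarrow>
         smooth_section F W (br X Y) \<and>
         (\<forall>X' Y'. (\<forall>x\<in>W. X' x = X x \<and> Y' x = Y x) \<longrightarrow> (\<forall>x\<in>W. br X' Y' x = br X Y x)) \<and>
         (\<forall>x\<in>W. br X Y x = - br Y X x) \<and>
         (\<forall>f. smooth_fun (base F) W f \<longrightarrow>
            (\<forall>x\<in>W. br X (\<lambda>y. f y *\<^sub>R Y y) x = f x *\<^sub>R br X Y x + \<rho> x (X x) f *\<^sub>R Y x) \<and>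
            (\<forall>x\<in>W. \<rho> x (br X Y x) f =
               \<rho> x (X x) (\<lambda>y. \<rho> y (Y y) f) - \<rho> x (Y x) (\<lambda>y. \<rho> y (X y) f)))) \<and>
      (\<forall>X Y Z. smooth_section F W X \<and> smooth_section F W Y \<and> smooth_section F W Z \<longrightarrow>
         (\<forall>x\<in>W. br X (\<lambda>y. Y y + Z y) x = br X Y x + br X Z x) \<and>
         (\<forall>x\<in>W. br X (br Y Z) x + br Y (br Z X) x + br Z (br X Y) x = 0)))"

definition struct_fun ::
  "(('p \<Rightarrow> 'f::real_vector) \<Rightarrow> ('p \<Rightarrow> 'f) \<Rightarrow> 'p \<Rightarrow> 'f) \<Rightarrow> ('k \<Rightarrow> 'p \<Rightarrow> 'f) \<Rightarrow>
   'k \<Rightarrow> 'k \<Rightarrow> 'k \<Rightarrow> 'p \<Rightarrow> real"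
  where "struct_fun br t \<gamma> \<alpha> \<beta> x = coeff t x \<gamma> (br (t \<alpha>) (t \<beta>) x)"

definition lie_bracket ::
  "('p, 'c::euclidean_space) atlas \<Rightarrow> ('p \<Rightarrow> ('p \<Rightarrow> real) \<Rightarrow> real) \<Rightarrow>
   ('p \<Rightarrow> ('p \<Rightarrow> real) \<Rightarrow> real) \<Rightarrow> 'p \<Rightarrow> ('p \<Rightarrow> real) \<Rightarrow> real"
  where "lie_bracket A X Y x = (\<lambda>f. if smooth_near A x f
    then X x (\<lambda>y. Y y f) - Y x (\<lambda>y. X y f) else 0)"

section \<open>The dual bundle and the generalized tangent bundle\<close>

text \<open>Linear functionals on a subspace, extended by 0.\<close>

definition dual_space :: "'w::real_vector set \<Rightarrow> ('w \<Rightarrow> real) set"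
  where "dual_space S = {p. (\<forall>v\<in>S. \<forall>w\<in>S. p (v + w) = p v + p w) \<and>
    (\<forall>r. \<forall>v\<in>S. p (r *\<^sub>R v) = r * p v) \<and> (\<forall>v. v \<notin> S \<longrightarrow> p v = 0)}"

text \<open>The total space of the dual of \<^term>\<open>E\<close> consists of pairs \<open>(x, p)\<close> with \<open>p\<close> in the dual of
  the fibre at \<open>x\<close>; a chart of the base and a frame of \<^term>\<open>E\<close> give the vector bundle
  coordinates \<open>(x\<^sup>i, p\<^sub>a)\<close>.\<close>

definition dual_chart ::
  "('p, real^'m, 'w::real_vector, 'e::finite) vbundle \<Rightarrow> ('p, real^'m) chart \<Rightarrow>
   'p set \<times> ('e \<Rightarrow> 'p \<Rightarrow> 'w) \<Rightarrow> ('p \<times> ('w \<Rightarrow> real), (real^'m) \<times> (real^'e)) chart"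
  where "dual_chart E c s =
    ({(x, p). x \<in> fst c \<inter> fst s \<and> p \<in> dual_space (fibre E x)},
     \<lambda>(x, p). (snd c x, \<chi> a. p (snd s a x)))"

definition dual_atlas ::
  "('p, real^'m, 'w::real_vector, 'e::finite) vbundle \<Rightarrow>
   ('p \<times> ('w \<Rightarrow> real), (real^'m) \<times> (real^'e)) atlas"
  where "dual_atlas E = {dual_chart E c s |c s. c \<in> base E \<and> s \<in> frames E}"

text \<open>The local frame \<open>(\<partial>\<^sub>\<alpha>, \<partial>\<^sup>a)\<close> of the generalized tangent bundle belonging to a chart \<^term>\<open>c\<close>,
  a frame \<^term>\<open>t\<close> of \<open>F\<close> and a frame \<^term>\<open>s\<close> of \<^term>\<open>E\<close>. The index type is a sum:
  \<^const>\<open>Inl\<close> for Greek, \<^const>\<open>Inr\<close> for Latin indices. Elements of \<open>F \<oplus> TE\<^sup>*\<close> are pairs.\<close>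

definition gt_frame ::
  "('p \<Rightarrow> 'f \<Rightarrow> ('p \<Rightarrow> real) \<Rightarrow> real) \<Rightarrow>
   ('p, real^'m::finite, 'w::real_vector, 'e::finite) vbundle \<Rightarrow> ('p, real^'m) chart \<Rightarrow>
   'p set \<times> ('k \<Rightarrow> 'p \<Rightarrow> 'f) \<Rightarrow> 'p set \<times> ('e \<Rightarrow> 'p \<Rightarrow> 'w) \<Rightarrow>
   'k + 'e \<Rightarrow> 'p \<times> ('w \<Rightarrow> real) \<Rightarrow> 'f::real_vector \<times> (('p \<times> ('w \<Rightarrow> real) \<Rightarrow> real) \<Rightarrow> real)"
  where "gt_frame \<rho> E c t s k = (\<lambda>(x, p).
    let dd = coord_frame total_dir (dual_atlas E) (dual_chart E c s) in
    (case k of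
       Inl \<alpha> \<Rightarrow> (snd t \<alpha> x,
         \<Sum>i\<in>UNIV. coeff (coord_frame base_dir (base E) c) x i (\<rho> x (snd t \<alpha> x)) *\<^sub>R dd (Inl i) (x, p))
     | Inr a \<Rightarrow> (0, dd (Inr a) (x, p))))"

definition gt_dom ::
  "('p, real^'m::finite, 'w::real_vector, 'e::finite) vbundle \<Rightarrow> ('p, real^'m) chart \<Rightarrow>
   'p set \<times> ('k \<Rightarrow> 'p \<Rightarrow> 'f) \<Rightarrow> 'p set \<times> ('e \<Rightarrow> 'p \<Rightarrow> 'w) \<Rightarrow> ('p \<times> ('w \<Rightarrow> real)) set"
  where "gt_dom E c t s = {(x, p). x \<in> fst c \<inter> fst t \<inter> fst s \<and> p \<in> dual_space (fibre E x)}"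

text \<open>The union in \<^const>\<open>fibre\<close> is over frames that all span the same space.\<close>

definition gen_tangent ::
  "('p, real^'m::finite, 'f::real_vector, 'k::finite) vbundle \<Rightarrow>
   ('p \<Rightarrow> 'f \<Rightarrow> ('p \<Rightarrow> real) \<Rightarrow> real) \<Rightarrow>
   ('p, real^'m, 'w::real_vector, 'e::finite) vbundle \<Rightarrow>
   ('p \<times> ('w \<Rightarrow> real), (real^'m) \<times> (real^'e),
    'f \<times> (('p \<times> ('w \<Rightarrow> real) \<Rightarrow> real) \<Rightarrow> real), 'k + 'e) vbundle"
  where "gen_tangent F \<rho> E = \<lparr> base = dual_atlas E,
    fibre = (\<lambda>u. \<Union> {span (range (\<lambda>k. gt_frame \<rho> E c t s k u)) |c t s.
      c \<in> base E \<and> t \<in> frames F \<and> s \<in> frames E \<and> u \<in> gt_dom E c t s}),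
    frames = {(gt_dom E c t s, gt_frame \<rho> E c t s) |c t s.
      c \<in> base E \<and> t \<in> frames F \<and> s \<in> frames E} \<rparr>"

text \<open>The anchor of the generalized tangent bundle is the projection to the tangent bundle
  of the total space, since \<open>Z\<^sup>\<alpha>\<partial>\<^sub>\<alpha> + Y\<^sub>a\<partial>\<^sup>a\<close> is the pair of \<open>Z\<^sup>\<alpha>T\<^sub>\<alpha>\<close> and its image under the anchor.\<close>

definition gt_anchor ::
  "'q \<Rightarrow> 'f \<times> (('q \<Rightarrow> real) \<Rightarrow> real) \<Rightarrow> ('q \<Rightarrow> real) \<Rightarrow> real"
  where "gt_anchor u w = snd w"

section \<open>Connections\<close>

text \<open>The following notions are stated for any bundle with frames indexed by \<open>'k + 'e\<close>, so that
  they apply both to the generalized tangent bundle and to the tangent bundle of the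
  total space of the dual bundle.\<close>

definition vertical ::
  "('q, 'c, 'w::real_vector, 'k + 'e) vbundle \<Rightarrow> ('q, 'c, 'w, 'e) vbundle"
  where "vertical B = \<lparr> base = base B,
    fibre = (\<lambda>u. \<Union> {span (range (\<lambda>a. s (Inr a) u)) |U s. (U, s) \<in> frames B \<and> u \<in> U}),
    frames = {(U, \<lambda>a. s (Inr a)) |U s. (U, s) \<in> frames B} \<rparr>"

definition rho_connection ::
  "('q, 'c::euclidean_space, 'w::real_vector, 'k + 'e) vbundle \<Rightarrow> ('q \<Rightarrow> 'w \<Rightarrow> 'w) \<Rightarrow> bool"
  where "rho_connection B \<Gamma> \<longleftrightarrow> bundle_morphism B (vertical B) \<Gamma> \<and>
    (\<forall>u\<in>points (base B). \<forall>w\<in>fibre (vertical B) u. \<Gamma> u w = w)"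

definition horizontal ::
  "('q, 'c, 'w::real_vector, 'k + 'e) vbundle \<Rightarrow> ('q \<Rightarrow> 'w \<Rightarrow> 'w) \<Rightarrow> 'q \<Rightarrow> 'w set"
  where "horizontal B \<Gamma> u = {w \<in> fibre B u. \<Gamma> u w = 0}"

definition Gamma_comp ::
  "('q \<Rightarrow> 'w \<Rightarrow> 'w) \<Rightarrow> ('k + 'e \<Rightarrow> 'q \<Rightarrow> 'w::real_vector) \<Rightarrow> 'e \<Rightarrow> 'k \<Rightarrow> 'q \<Rightarrow> real"
  where "Gamma_comp \<Gamma> s b \<alpha> u = - coeff s u (Inr b) (\<Gamma> u (s (Inl \<alpha>) u))"

definition adapted ::
  "('q \<Rightarrow> 'w \<Rightarrow> 'w) \<Rightarrow> ('k + 'e::finite \<Rightarrow> 'q \<Rightarrow> 'w::real_vector) \<Rightarrow> 'k + 'e \<Rightarrow> 'q \<Rightarrow> 'w"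
  where "adapted \<Gamma> s k u = (case k of
      Inl \<alpha> \<Rightarrow> s (Inl \<alpha>) u + (\<Sum>b\<in>UNIV. Gamma_comp \<Gamma> s b \<alpha> u *\<^sub>R s (Inr b) u)
    | Inr a \<Rightarrow> s (Inr a) u)"

subsection \<open>Tensor fields\<close>

text \<open>A tensor of type \<open>(r, q)\<close> is a multilinear function of \<open>r\<close> covectors and \<open>q\<close> vectors,
  extended by 0 to all other pairs of lists.\<close>

type_synonym 'w tensor = "('w \<Rightarrow> real) list \<Rightarrow> 'w list \<Rightarrow> real"

definition tensor_at :: "nat \<Rightarrow> nat \<Rightarrow> 'w::real_vector set \<Rightarrow> 'w tensor \<Rightarrow> bool"
  where "tensor_at r q S T \<longleftrightarrow> (\<forall>ws vs.
    if length ws = r \<and> set ws \<subseteq> dual_space S \<and> length vs = q \<and> set vs \<subseteq> S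
    then (\<forall>i<r. \<forall>\<omega>\<in>dual_space S. \<forall>\<eta>\<in>dual_space S. \<forall>c.
            T (ws[i := c *\<^sub>R \<omega> + \<eta>]) vs = c * T (ws[i := \<omega>]) vs + T (ws[i := \<eta>]) vs) \<and>
         (\<forall>j<q. \<forall>v\<in>S. \<forall>w\<in>S. \<forall>c.
            T ws (vs[j := c *\<^sub>R v + w]) = c * T ws (vs[j := v]) + T ws (vs[j := w]))
    else T ws vs = 0)"

definition tensor_field ::
  "('q, 'c::euclidean_space, 'w::real_vector, 'k) vbundle \<Rightarrow> 'q set \<Rightarrow> nat \<Rightarrow> nat \<Rightarrow>
   ('q \<Rightarrow> 'w tensor) \<Rightarrow> bool"
  where "tensor_field B W r q T \<longleftrightarrow> (\<forall>u\<in>W. tensor_at r q (fibre B u) (T u)) \<and>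
    (\<forall>(U, s)\<in>frames B. \<forall>is js. length is = r \<and> length js = q \<longrightarrow>
       smooth_fun (base B) (U \<inter> W) (\<lambda>u. T u (map (coeff s u) is) (map (\<lambda>j. s j u) js)))"

definition tensor_prod :: "nat \<Rightarrow> nat \<Rightarrow> 'w tensor \<Rightarrow> 'w tensor \<Rightarrow> 'w tensor"
  where "tensor_prod r q S T = (\<lambda>ws vs. S (take r ws) (take q vs) * T (drop r ws) (drop q vs))"

text \<open>Contraction of the \<open>i\<close>-th contravariant with the \<open>j\<close>-th covariant slot, computed in the
  frame \<^term>\<open>s\<close> (on which the result does not depend).\<close>

definition contract ::
  "('k::finite \<Rightarrow> 'q \<Rightarrow> 'w::real_vector) \<Rightarrow> nat \<Rightarrow> nat \<Rightarrow> 'q \<Rightarrow> 'w tensor \<Rightarrow> 'w tensor"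
  where "contract s i j u T = (\<lambda>ws vs. \<Sum>k\<in>UNIV.
    T (take i ws @ coeff s u k # drop i ws) (take j vs @ s k u # drop j vs))"

text \<open>Functions, vectors and covectors as tensors of type (0,0), (1,0) and (0,1).\<close>

definition fun_tensor :: "real \<Rightarrow> 'w tensor"
  where "fun_tensor c = (\<lambda>ws vs. if ws = [] \<and> vs = [] then c else 0)"

definition vec_tensor :: "'w::real_vector set \<Rightarrow> 'w \<Rightarrow> 'w tensor"
  where "vec_tensor S v =
    (\<lambda>ws vs. if length ws = 1 \<and> set ws \<subseteq> dual_space S \<and> vs = [] then hd ws v else 0)"

definition cov_tensor :: "('w \<Rightarrow> real) \<Rightarrow> 'w tensor"
  where "cov_tensor \<omega> = (\<lambda>ws vs. if ws = [] \<and> length vs = 1 then \<omega> (hd vs) else 0)"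

abbreviation vec_field ::
  "('q, 'c, 'w::real_vector, 'k) vbundle \<Rightarrow> ('q \<Rightarrow> 'w) \<Rightarrow> 'q \<Rightarrow> 'w tensor"
  where "vec_field B Y \<equiv> (\<lambda>u. vec_tensor (fibre B u) (Y u))"

subsection \<open>Covariant derivatives\<close>

text \<open>As for the bracket above, a covariant derivative acts on sections and tensor fields
  over any open set \<^term>\<open>W\<close>, compatibly with restriction; \<open>W\<close> may be the whole space. \<open>a\<close> is the
  anchor.\<close>

definition linear_connection ::
  "('q, 'c::euclidean_space, 'w::real_vector, 'k::finite) vbundle \<Rightarrow>
   ('q \<Rightarrow> 'w \<Rightarrow> ('q \<Rightarrow> real) \<Rightarrow> real) \<Rightarrow>
   (('q \<Rightarrow> 'w) \<Rightarrow> ('q \<Rightarrow> 'w tensor) \<Rightarrow> 'q \<Rightarrow> 'w tensor) \<Rightarrow> bool"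
  where "linear_connection B a D \<longleftrightarrow> (\<forall>W X. open_in (base B) W \<and> smooth_section B W X \<longrightarrow>
    (\<forall>r q T. tensor_field B W r q T \<longrightarrow>
       tensor_field B W r q (D X T) \<and>
       (\<forall>X' T'. (\<forall>u\<in>W. X' u = X u \<and> T' u = T u) \<longrightarrow> (\<forall>u\<in>W. D X' T' u = D X T u)) \<and>
       (\<forall>f Y. smooth_fun (base B) W f \<and> smooth_section B W Y \<longrightarrow>
          (\<forall>u\<in>W. D (\<lambda>u. f u *\<^sub>R X u + Y u) T u = f u *\<^sub>R D X T u + D Y T u)) \<and>
       (\<forall>S. tensor_field B W r q S \<longrightarrow> (\<forall>u\<in>W. D X (\<lambda>u. T u + S u) u = D X T u + D X S u)) \<and>
       (\<forall>r' q' S. tensor_field B W r' q' S \<longrightarrow>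
          (\<forall>u\<in>W. D X (\<lambda>u. tensor_prod r q (T u) (S u)) u =
             tensor_prod r q (D X T u) (S u) + tensor_prod r q (T u) (D X S u))) \<and>
       (\<forall>(U, s)\<in>frames B. \<forall>i<r. \<forall>j<q. W \<subseteq> U \<longrightarrow>
          (\<forall>u\<in>W. D X (\<lambda>u. contract s i j u (T u)) u = contract s i j u (D X T u)))) \<and>
    (\<forall>f. smooth_fun (base B) W f \<longrightarrow>
       (\<forall>u\<in>W. D X (\<lambda>u. fun_tensor (f u)) u = fun_tensor (a u (X u) f))))"

definition distinguished ::
  "('q, 'c::euclidean_space, 'w::real_vector, 'k::finite + 'e::finite) vbundle \<Rightarrow>
   ('q \<Rightarrow> 'w \<Rightarrow> ('q \<Rightarrow> real) \<Rightarrow> real) \<Rightarrow> ('q \<Rightarrow> 'w \<Rightarrow> 'w) \<Rightarrow>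
   (('q \<Rightarrow> 'w) \<Rightarrow> ('q \<Rightarrow> 'w tensor) \<Rightarrow> 'q \<Rightarrow> 'w tensor) \<Rightarrow> bool"
  where "distinguished B a \<Gamma> D \<longleftrightarrow> linear_connection B a D \<and>
    (\<forall>W X Y. open_in (base B) W \<and> smooth_section B W X \<and> smooth_section B W Y \<longrightarrow>
       ((\<forall>u\<in>W. Y u \<in> horizontal B \<Gamma> u) \<longrightarrow>
          (\<forall>u\<in>W. D X (vec_field B Y) u \<in> vec_tensor (fibre B u) ` horizontal B \<Gamma> u)) \<and>
       ((\<forall>u\<in>W. Y u \<in> fibre (vertical B) u) \<longrightarrow>
          (\<forall>u\<in>W. D X (vec_field B Y) u \<in> vec_tensor (fibre B u) ` fibre (vertical B) u)))"

text \<open>The index order of component functions is \<open>H \<alpha> \<beta> \<gamma>\<close> for \<open>H\<^sup>\<alpha>\<^sub>\<beta>\<^sub>\<gamma>\<close>, \<open>Hv a b \<gamma>\<close> for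
  \<open>H\<^sup>a\<^sub>b\<^sub>\<gamma>\<close>, \<open>V \<alpha> \<beta> c\<close> for \<open>V\<^sup>\<alpha>\<^sup>c\<^sub>\<beta>\<close> and \<open>Vv a b c\<close> for \<open>V\<^sup>a\<^sup>c\<^sub>b\<close>.\<close>

definition has_components ::
  "('q, 'c::euclidean_space, 'w::real_vector, 'k::finite + 'e::finite) vbundle \<Rightarrow>
   (('q \<Rightarrow> 'w) \<Rightarrow> ('q \<Rightarrow> 'w tensor) \<Rightarrow> 'q \<Rightarrow> 'w tensor) \<Rightarrow>
   'q set \<Rightarrow> ('k + 'e \<Rightarrow> 'q \<Rightarrow> 'w) \<Rightarrow>
   ('k \<Rightarrow> 'k \<Rightarrow> 'k \<Rightarrow> 'q \<Rightarrow> real) \<Rightarrow> ('e \<Rightarrow> 'e \<Rightarrow> 'k \<Rightarrow> 'q \<Rightarrow> real) \<Rightarrow>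
   ('k \<Rightarrow> 'k \<Rightarrow> 'e \<Rightarrow> 'q \<Rightarrow> real) \<Rightarrow> ('e \<Rightarrow> 'e \<Rightarrow> 'e \<Rightarrow> 'q \<Rightarrow> real) \<Rightarrow> bool"
  where "has_components B D U \<delta> H Hv V Vv \<longleftrightarrow>
    (\<forall>\<beta> \<gamma>. \<forall>u\<in>U. D (\<delta> (Inl \<gamma>)) (vec_field B (\<delta> (Inl \<beta>))) u =
       vec_tensor (fibre B u) (\<Sum>\<alpha>\<in>UNIV. H \<alpha> \<beta> \<gamma> u *\<^sub>R \<delta> (Inl \<alpha>) u)) \<and>
    (\<forall>a \<gamma>. \<forall>u\<in>U. D (\<delta> (Inl \<gamma>)) (vec_field B (\<delta> (Inr a))) u =
       vec_tensor (fibre B u) (\<Sum>b\<in>UNIV. Hv a b \<gamma> u *\<^sub>R \<delta> (Inr b) u)) \<and>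
    (\<forall>\<beta> c. \<forall>u\<in>U. D (\<delta> (Inr c)) (vec_field B (\<delta> (Inl \<beta>))) u =
       vec_tensor (fibre B u) (\<Sum>\<alpha>\<in>UNIV. V \<alpha> \<beta> c u *\<^sub>R \<delta> (Inl \<alpha>) u)) \<and>
    (\<forall>a c. \<forall>u\<in>U. D (\<delta> (Inr c)) (vec_field B (\<delta> (Inr a))) u =
       vec_tensor (fibre B u) (\<Sum>b\<in>UNIV. Vv a b c u *\<^sub>R \<delta> (Inr b) u))"

subsection \<open>Pseudometrical structures\<close>

definition metric_h ::
  "('q \<Rightarrow> 'w tensor) \<Rightarrow> ('k + 'e \<Rightarrow> 'q \<Rightarrow> 'w) \<Rightarrow> 'k \<Rightarrow> 'k \<Rightarrow> 'q \<Rightarrow> real"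
  where "metric_h G \<delta> \<alpha> \<beta> u = G u [] [\<delta> (Inl \<alpha>) u, \<delta> (Inl \<beta>) u]"

definition metric_v ::
  "('q \<Rightarrow> 'w tensor) \<Rightarrow> ('k + 'e \<Rightarrow> 'q \<Rightarrow> 'w) \<Rightarrow> 'e \<Rightarrow> 'e \<Rightarrow> 'q \<Rightarrow> real"
  where "metric_v G \<delta> a b u = G u [] [\<delta> (Inr a) u, \<delta> (Inr b) u]"

definition mat_of :: "('n \<Rightarrow> 'n \<Rightarrow> 'q \<Rightarrow> real) \<Rightarrow> 'q \<Rightarrow> real^'n^'n"
  where "mat_of g u = (\<chi> i j. g i j u)"

definition inv_comp :: "('n::finite \<Rightarrow> 'n \<Rightarrow> 'q \<Rightarrow> real) \<Rightarrow> 'n \<Rightarrow> 'n \<Rightarrow> 'q \<Rightarrow> real"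
  where "inv_comp g i j u = matrix_inv (mat_of g u) $ i $ j"

definition pseudometrical ::
  "('q, 'c::euclidean_space, 'w::real_vector, 'k::finite + 'e::finite) vbundle \<Rightarrow>
   ('q \<Rightarrow> 'w \<Rightarrow> 'w) \<Rightarrow> ('q \<Rightarrow> 'w tensor) \<Rightarrow> bool"
  where "pseudometrical B \<Gamma> G \<longleftrightarrow> tensor_field B (points (base B)) 0 2 G \<and>
    (\<forall>(U, s)\<in>frames B. let \<delta> = adapted \<Gamma> s; g = metric_h G \<delta>; h = metric_v G \<delta> in
       \<forall>u\<in>U.
         G u = (\<Sum>\<alpha>\<in>UNIV. \<Sum>\<beta>\<in>UNIV. g \<alpha> \<beta> u *\<^sub>R
                  tensor_prod 0 1 (cov_tensor (coeff \<delta> u (Inl \<alpha>))) (cov_tensor (coeff \<delta> u (Inl \<beta>)))) +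
               (\<Sum>a\<in>UNIV. \<Sum>b\<in>UNIV. h a b u *\<^sub>R
                  tensor_prod 0 1 (cov_tensor (coeff \<delta> u (Inr a))) (cov_tensor (coeff \<delta> u (Inr b)))) \<and>
         (\<forall>\<alpha> \<beta>. g \<alpha> \<beta> u = g \<beta> \<alpha> u) \<and> (\<forall>a b. h a b u = h b a u) \<and>
         invertible (mat_of g u) \<and> invertible (mat_of h u))"

text \<open>For invertible symmetric matrices: \<open>m\<close> positive and \<open>n\<close> negative squares.\<close>

definition has_signature :: "real^'n::finite^'n \<Rightarrow> nat \<Rightarrow> nat \<Rightarrow> bool"
  where "has_signature A m n \<longleftrightarrow> (\<exists>P (d :: 'n \<Rightarrow> real). invertible P \<and>
    transpose P ** A ** P = (\<chi> i j. if i = j then d i else 0) \<and>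
    range d \<subseteq> {1, -1} \<and> card {i. d i = 1} = m \<and> card {i. d i = -1} = n)"

definition metrical ::
  "('q, 'c::euclidean_space, 'w::real_vector, 'k::finite + 'e::finite) vbundle \<Rightarrow>
   ('q \<Rightarrow> 'w \<Rightarrow> 'w) \<Rightarrow> ('q \<Rightarrow> 'w tensor) \<Rightarrow> bool"
  where "metrical B \<Gamma> G \<longleftrightarrow> pseudometrical B \<Gamma> G \<and>
    (\<exists>m n m' n'. \<forall>(U, s)\<in>frames B. \<forall>u\<in>U.
       has_signature (mat_of (metric_h G (adapted \<Gamma> s)) u) m n \<and>
       has_signature (mat_of (metric_v G (adapted \<Gamma> s)) u) m' n')"

section \<open>The formulas\<close>

text \<open>\<^term>\<open>conn_coeff B D \<delta> i j k u\<close> is the \<open>i\<close>-th coefficient of the derivative of \<open>\<delta> j\<close> along \<open>\<delta> k\<close>.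
  The next four definitions put it in the index order of \<^const>\<open>has_components\<close>.\<close>

definition conn_coeff ::
  "('q, 'c, 'w::real_vector, 'k) vbundle \<Rightarrow>
   (('q \<Rightarrow> 'w) \<Rightarrow> ('q \<Rightarrow> 'w tensor) \<Rightarrow> 'q \<Rightarrow> 'w tensor) \<Rightarrow>
   ('k \<Rightarrow> 'q \<Rightarrow> 'w) \<Rightarrow> 'k \<Rightarrow> 'k \<Rightarrow> 'k \<Rightarrow> 'q \<Rightarrow> real"
  where "conn_coeff B D \<delta> i j k u = D (\<delta> k) (vec_field B (\<delta> j)) u [coeff \<delta> u i] []"

definition "comp_H B D \<delta> \<alpha> \<beta> \<gamma> = conn_coeff B D \<delta> (Inl \<alpha>) (Inl \<beta>) (Inl \<gamma>)"
definition "comp_Hv B D \<delta> a b \<gamma> = conn_coeff B D \<delta> (Inr b) (Inr a) (Inl \<gamma>)"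
definition "comp_V B D \<delta> \<alpha> \<beta> c = conn_coeff B D \<delta> (Inl \<alpha>) (Inl \<beta>) (Inr c)"
definition "comp_Vv B D \<delta> a b c = conn_coeff B D \<delta> (Inr b) (Inr a) (Inr c)"

definition cov_deriv_v ::
  "('q, 'c, 'w::real_vector, 'k + 'e::finite) vbundle \<Rightarrow>
   ('q \<Rightarrow> 'w \<Rightarrow> ('q \<Rightarrow> real) \<Rightarrow> real) \<Rightarrow>
   (('q \<Rightarrow> 'w) \<Rightarrow> ('q \<Rightarrow> 'w tensor) \<Rightarrow> 'q \<Rightarrow> 'w tensor) \<Rightarrow> ('q \<Rightarrow> 'w tensor) \<Rightarrow>
   ('k + 'e \<Rightarrow> 'q \<Rightarrow> 'w) \<Rightarrow> 'e \<Rightarrow> 'e \<Rightarrow> 'k \<Rightarrow> 'q \<Rightarrow> real"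
  where "cov_deriv_v B an D0 G \<delta> e a \<gamma> u =
    an u (\<delta> (Inl \<gamma>) u) (metric_v G \<delta> e a)
    - (\<Sum>d\<in>UNIV. comp_Hv B D0 \<delta> e d \<gamma> u * metric_v G \<delta> d a u)
    - (\<Sum>d\<in>UNIV. comp_Hv B D0 \<delta> a d \<gamma> u * metric_v G \<delta> e d u)"

definition cov_deriv_h ::
  "('q, 'c, 'w::real_vector, 'k::finite + 'e) vbundle \<Rightarrow>
   ('q \<Rightarrow> 'w \<Rightarrow> ('q \<Rightarrow> real) \<Rightarrow> real) \<Rightarrow>
   (('q \<Rightarrow> 'w) \<Rightarrow> ('q \<Rightarrow> 'w tensor) \<Rightarrow> 'q \<Rightarrow> 'w tensor) \<Rightarrow> ('q \<Rightarrow> 'w tensor) \<Rightarrow>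
   ('k + 'e \<Rightarrow> 'q \<Rightarrow> 'w) \<Rightarrow> 'k \<Rightarrow> 'k \<Rightarrow> 'e \<Rightarrow> 'q \<Rightarrow> real"
  where "cov_deriv_h B an D0 G \<delta> \<epsilon> \<beta> c u =
    an u (\<delta> (Inr c) u) (metric_h G \<delta> \<epsilon> \<beta>)
    - (\<Sum>\<theta>\<in>UNIV. comp_V B D0 \<delta> \<theta> \<epsilon> c u * metric_h G \<delta> \<theta> \<beta> u)
    - (\<Sum>\<theta>\<in>UNIV. comp_V B D0 \<delta> \<theta> \<beta> c u * metric_h G \<delta> \<epsilon> \<theta> u)"

definition new_H ::
  "('p \<times> 'o \<Rightarrow> 'w \<Rightarrow> ('p \<times> 'o \<Rightarrow> real) \<Rightarrow> real) \<Rightarrow> ('p \<times> 'o \<Rightarrow> 'w tensor) \<Rightarrow>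
   ('k + 'e \<Rightarrow> 'p \<times> 'o \<Rightarrow> 'w) \<Rightarrow> ('k \<Rightarrow> 'k \<Rightarrow> 'k \<Rightarrow> 'p \<Rightarrow> real) \<Rightarrow>
   'k::finite \<Rightarrow> 'k \<Rightarrow> 'k \<Rightarrow> 'p \<times> 'o \<Rightarrow> real"
  where "new_H an G \<delta> L \<alpha> \<beta> \<gamma> u = (let g = metric_h G \<delta>; gi = inv_comp g in
    1/2 * (\<Sum>\<epsilon>\<in>UNIV. gi \<alpha> \<epsilon> u *
      (an u (\<delta> (Inl \<gamma>) u) (g \<epsilon> \<beta>) + an u (\<delta> (Inl \<beta>) u) (g \<epsilon> \<gamma>) - an u (\<delta> (Inl \<epsilon>) u) (g \<beta> \<gamma>)
       + (\<Sum>\<theta>\<in>UNIV. g \<theta> \<epsilon> u * L \<theta> \<gamma> \<beta> (fst u))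
       - (\<Sum>\<theta>\<in>UNIV. g \<beta> \<theta> u * L \<theta> \<gamma> \<epsilon> (fst u))
       - (\<Sum>\<theta>\<in>UNIV. g \<theta> \<gamma> u * L \<theta> \<beta> \<epsilon> (fst u)))))"

definition new_Hv ::
  "('q, 'c, 'w::real_vector, 'k + 'e::finite) vbundle \<Rightarrow>
   ('q \<Rightarrow> 'w \<Rightarrow> ('q \<Rightarrow> real) \<Rightarrow> real) \<Rightarrow>
   (('q \<Rightarrow> 'w) \<Rightarrow> ('q \<Rightarrow> 'w tensor) \<Rightarrow> 'q \<Rightarrow> 'w tensor) \<Rightarrow> ('q \<Rightarrow> 'w tensor) \<Rightarrow>
   ('k + 'e \<Rightarrow> 'q \<Rightarrow> 'w) \<Rightarrow> 'e \<Rightarrow> 'e \<Rightarrow> 'k \<Rightarrow> 'q \<Rightarrow> real"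
  where "new_Hv B an D0 G \<delta> a b \<gamma> u = comp_Hv B D0 \<delta> a b \<gamma> u
    + 1/2 * (\<Sum>e\<in>UNIV. inv_comp (metric_v G \<delta>) b e u * cov_deriv_v B an D0 G \<delta> e a \<gamma> u)"

definition new_V ::
  "('q, 'c, 'w::real_vector, 'k::finite + 'e) vbundle \<Rightarrow>
   ('q \<Rightarrow> 'w \<Rightarrow> ('q \<Rightarrow> real) \<Rightarrow> real) \<Rightarrow>
   (('q \<Rightarrow> 'w) \<Rightarrow> ('q \<Rightarrow> 'w tensor) \<Rightarrow> 'q \<Rightarrow> 'w tensor) \<Rightarrow> ('q \<Rightarrow> 'w tensor) \<Rightarrow>
   ('k + 'e \<Rightarrow> 'q \<Rightarrow> 'w) \<Rightarrow> 'k \<Rightarrow> 'k \<Rightarrow> 'e \<Rightarrow> 'q \<Rightarrow> real"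
  where "new_V B an D0 G \<delta> \<alpha> \<beta> c u = comp_V B D0 \<delta> \<alpha> \<beta> c u
    + 1/2 * (\<Sum>\<epsilon>\<in>UNIV. inv_comp (metric_h G \<delta>) \<alpha> \<epsilon> u * cov_deriv_h B an D0 G \<delta> \<epsilon> \<beta> c u)"

definition new_Vv ::
  "('q \<Rightarrow> 'w \<Rightarrow> ('q \<Rightarrow> real) \<Rightarrow> real) \<Rightarrow> ('q \<Rightarrow> 'w tensor) \<Rightarrow>
   ('k + 'e::finite \<Rightarrow> 'q \<Rightarrow> 'w) \<Rightarrow> 'e \<Rightarrow> 'e \<Rightarrow> 'e \<Rightarrow> 'q \<Rightarrow> real"
  where "new_Vv an G \<delta> a b c u = (let g = metric_v G \<delta>; gi = inv_comp g in
    1/2 * (\<Sum>e\<in>UNIV. gi b e u *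
      (an u (\<delta> (Inr c) u) (g e a) + an u (\<delta> (Inr a) u) (g e c) - an u (\<delta> (Inr e) u) (g a c))))"

text \<open>In the classical case the members of \<open>\<delta>\<close> are themselves derivations of functions on the total
  space, so no anchor appears.\<close>

definition classical_H ::
  "('q \<Rightarrow> (('q \<Rightarrow> real) \<Rightarrow> real) tensor) \<Rightarrow> ('m + 'e \<Rightarrow> 'q \<Rightarrow> ('q \<Rightarrow> real) \<Rightarrow> real) \<Rightarrow>
   'm::finite \<Rightarrow> 'm \<Rightarrow> 'm \<Rightarrow> 'q \<Rightarrow> real"
  where "classical_H G \<delta> i j k u = (let g = metric_h G \<delta> in
    1/2 * (\<Sum>l\<in>UNIV. inv_comp g i l u *
      (\<delta> (Inl k) u (g l j) + \<delta> (Inl j) u (g l k) - \<delta> (Inl l) u (g j k))))"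

definition classical_Hv ::
  "('q, 'c, ('q \<Rightarrow> real) \<Rightarrow> real, 'm + 'e::finite) vbundle \<Rightarrow>
   (('q \<Rightarrow> ('q \<Rightarrow> real) \<Rightarrow> real) \<Rightarrow> ('q \<Rightarrow> (('q \<Rightarrow> real) \<Rightarrow> real) tensor) \<Rightarrow>
     'q \<Rightarrow> (('q \<Rightarrow> real) \<Rightarrow> real) tensor) \<Rightarrow>
   ('q \<Rightarrow> (('q \<Rightarrow> real) \<Rightarrow> real) tensor) \<Rightarrow> ('m + 'e \<Rightarrow> 'q \<Rightarrow> ('q \<Rightarrow> real) \<Rightarrow> real) \<Rightarrow>
   'e \<Rightarrow> 'e \<Rightarrow> 'm \<Rightarrow> 'q \<Rightarrow> real"
  where "classical_Hv B D0 G \<delta> a b k u = (let g = metric_v G \<delta>; H = comp_Hv B D0 \<delta> in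
    H a b k u + 1/2 * (\<Sum>e\<in>UNIV. inv_comp g b e u *
      (\<delta> (Inl k) u (g e a) - (\<Sum>d\<in>UNIV. H e d k u * g d a u) - (\<Sum>d\<in>UNIV. H a d k u * g e d u))))"

definition classical_V ::
  "('q, 'c, ('q \<Rightarrow> real) \<Rightarrow> real, 'm::finite + 'e) vbundle \<Rightarrow>
   (('q \<Rightarrow> ('q \<Rightarrow> real) \<Rightarrow> real) \<Rightarrow> ('q \<Rightarrow> (('q \<Rightarrow> real) \<Rightarrow> real) tensor) \<Rightarrow>
     'q \<Rightarrow> (('q \<Rightarrow> real) \<Rightarrow> real) tensor) \<Rightarrow>
   ('q \<Rightarrow> (('q \<Rightarrow> real) \<Rightarrow> real) tensor) \<Rightarrow> ('m + 'e \<Rightarrow> 'q \<Rightarrow> ('q \<Rightarrow> real) \<Rightarrow> real) \<Rightarrow>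
   'm \<Rightarrow> 'm \<Rightarrow> 'e \<Rightarrow> 'q \<Rightarrow> real"
  where "classical_V B D0 G \<delta> i j c u = (let g = metric_h G \<delta>; V = comp_V B D0 \<delta> in
    V i j c u + 1/2 * (\<Sum>l\<in>UNIV. inv_comp g i l u *
      (\<delta> (Inr c) u (g l j) - (\<Sum>k\<in>UNIV. V k l c u * g k j u) - (\<Sum>k\<in>UNIV. V k j c u * g l k u))))"

definition classical_Vv ::
  "('q \<Rightarrow> (('q \<Rightarrow> real) \<Rightarrow> real) tensor) \<Rightarrow> ('m + 'e \<Rightarrow> 'q \<Rightarrow> ('q \<Rightarrow> real) \<Rightarrow> real) \<Rightarrow>
   'e::finite \<Rightarrow> 'e \<Rightarrow> 'e \<Rightarrow> 'q \<Rightarrow> real"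
  where "classical_Vv G \<delta> a b c u = (let g = metric_v G \<delta> in
    1/2 * (\<Sum>e\<in>UNIV. inv_comp g b e u *
      (\<delta> (Inr c) u (g e a) + \<delta> (Inr a) u (g e c) - \<delta> (Inr e) u (g a c))))"

end

theory Submission
  imports Defs
begin

text \<open>
  Any linear connection differs from \<open>D0\<close> by the action of a field \<open>S(X)\<close> of endomorphisms on the
  tensor algebra, so \<open>D = D0 + S\<close> can be constructed without any gluing: all axioms except smoothness
  are pointwise algebra. \<open>S\<close> is prescribed by \<open>2 G(S(X) Y, Z) = K(X, Y, Z)\<close>, where \<open>K\<close> is a Koszul
  expression in the covariant derivative \<open>Q = D0 G\<close> and in the torsion of \<open>D0\<close> restricted to pairs of
  horizontal and to pairs of vertical vectors. The symmetric part \<open>K(X, Y, Z) + K(X, Z, Y) = 2 Q(X, Y, Z)\<close>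
  gives \<open>D G = 0\<close>. The torsion is the only ingredient whose independence of the adapted frame is not
  formal: it rests on the transformation law of the structure functions, which are \<open>L\<close> on horizontal
  pairs and zero on vertical ones. The generalized tangent bundle and, with \<open>L = 0\<close>, the tangent bundle
  of \<open>E\<^sup>*\<close> are two instances of the same construction.
\<close>

section \<open>Smooth maps between Euclidean spaces\<close>

text \<open>Two linear conditions on \<open>S\<close> produce \<open>K\<close>: metricity, G(S(X) Y,
  Z) + G(Y, S(X) Z) = Q(X, Y, Z), and, for arguments from one and the same subbundle, S(X) Y - S(Y)
  X = - T(X, Y), which makes the restricted torsion of the new connection vanish. The cyclic sum
  known from the Levi-Civita connection solves them, and there the result no longer depends on
  \<open>D0\<close>; hence \<open>new_H\<close> and \<open>new_Vv\<close> do not mention it. For X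
  in the other subbundle no torsion condition is imposed, and \<open>S\<close> is the self-adjoint
  solution of the first condition, half of Q with an index raised; hence the correction terms of
  \<open>new_Hv\<close> and \<open>new_V\<close>.

  The obstacle is that the bracket of adapted sections involves the curvature of \<Gamma>, which the
  formulas do not contain. Structure functions replace it. This is tensorial within each subbundle
  because the transition coefficients are lifted from the base: vertical vectors annihilate them, so
  the vertical correction in an adapted vector does not affect their derivatives, and zero is a
  consistent choice for vertical pairs.\<close>

lemma Ck_on_subset: "Ck_on k S f \<Longrightarrow> T \<subseteq> S \<Longrightarrow> Ck_on k T f"
  by (induction k arbitrary: f) (auto intro: continuous_on_subset)

lemma smooth_on_subset: "smooth_on S f \<Longrightarrow> T \<subseteq> S \<Longrightarrow> smooth_on T f"
  by (auto simp: smooth_on_def intro: Ck_on_subset)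

text \<open>On an open set, agreement on \<open>S\<close> is agreement near each point, so the
  derivatives \<open>at x\<close> coincide as well; the induction runs over both functions because
  it passes to their directional derivatives.\<close>

lemma Ck_on_cong:
  assumes "open S" "\<And>x. x \<in> S \<Longrightarrow> f x = g x" "Ck_on k S f"
  shows "Ck_on k S g"
  using assms(2,3)
proof (induction k arbitrary: f g)
  case 0
  then show ?case by (auto cong: continuous_on_cong)
next
  case (Suc k)
  have *: "(g has_derivative frechet_derivative f (at x)) (at x)" if "x \<in> S" for x
    using Suc.prems that \<open>open S\<close>
    by (auto simp: frechet_derivative_works intro: has_derivative_transform_within_open)
  then have fd: "frechet_derivative g (at x) = frechet_derivative f (at x)" if "x \<in> S" for x
    using frechet_derivative_at that by metis
  show ?case
    using Suc.prems(2) * Suc.IH[of "\<lambda>x. frechet_derivative f (at x) v" "\<lambda>x. frechet_derivative g (at x) v" for v]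
    by (auto simp: fd differentiable_def)
qed

lemma smooth_on_cong:
  assumes "open S" "\<And>x. x \<in> S \<Longrightarrow> f x = g x" "smooth_on S f"
  shows "smooth_on S g"
  using assms Ck_on_cong unfolding smooth_on_def by blast

lemma Ck_on_continuous: "Ck_on k S f \<Longrightarrow> continuous_on S f"
  by (cases k) (auto intro!: differentiable_imp_continuous_on
      simp: differentiable_on_def differentiable_at_withinI)

lemma Ck_on_SucD: "Ck_on (Suc k) S f \<Longrightarrow> Ck_on k S f"
proof (induction k arbitrary: f)
  case 0
  then show ?case using Ck_on_continuous[of "Suc 0"] by auto
qed auto

lemma Ck_on_local:
  assumes "\<And>x. x \<in> S \<Longrightarrow> \<exists>T. open T \<and> x \<in> T \<and> Ck_on k T f"
  shows "Ck_on k S f"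
  using assms
proof (induction k arbitrary: f)
  case 0
  have "continuous (at x within S) f" if x: "x \<in> S" for x
  proof -
    obtain T where "open T" "x \<in> T" "continuous_on T f" using 0[OF x] by auto
    then show ?thesis
      by (simp add: continuous_on_eq_continuous_at continuous_at_imp_continuous_at_within)
  qed
  then show ?case by (simp add: continuous_on_eq_continuous_within)
next
  case (Suc k)
  have "f differentiable at x" if "x \<in> S" for x
    using Suc.prems[OF that] by auto
  moreover have "Ck_on k S (\<lambda>x. frechet_derivative f (at x) v)" for v
    by (rule Suc.IH) (use Suc.prems in fastforce)
  ultimately show ?case by simp
qed

lemma smooth_on_local:
  assumes "\<And>x. x \<in> S \<Longrightarrow> \<exists>T. open T \<and> x \<in> T \<and> smooth_on T f"
  shows "smooth_on S f"
  using assms Ck_on_local unfolding smooth_on_def by metis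

lemma smooth_on_differentiable: "smooth_on S f \<Longrightarrow> x \<in> S \<Longrightarrow> f differentiable at x"
  unfolding smooth_on_def by (metis Ck_on.simps(2))

lemma smooth_on_has_derivative:
  "smooth_on S f \<Longrightarrow> x \<in> S \<Longrightarrow> (f has_derivative frechet_derivative f (at x)) (at x)"
  using smooth_on_differentiable frechet_derivative_works by blast

lemma smooth_on_deriv: "smooth_on S f \<Longrightarrow> smooth_on S (\<lambda>x. frechet_derivative f (at x) v)"
  unfolding smooth_on_def by (metis Ck_on.simps(2))

lemma smooth_on_continuous: "smooth_on S f \<Longrightarrow> continuous_on S f"
  unfolding smooth_on_def by (metis Ck_on.simps(1))

section \<open>Closure properties of the classes of differentiable maps\<close>

lemma Ck_on_const: "Ck_on k S (\<lambda>x. c)"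
  by (induction k arbitrary: c) auto

lemma Ck_on_bounded_linear:
  assumes "bounded_linear h"
  shows "Ck_on k S h"
proof -
  have d: "(h has_derivative h) (at x)" for x
    using assms by (rule bounded_linear_imp_has_derivative)
  then have "frechet_derivative h (at x) = h" for x
    by (metis frechet_derivative_at)
  then show ?thesis
    using assms d by (cases k) (auto simp: Ck_on_const differentiable_def linear_continuous_on)
qed

text \<open>By uniqueness of derivatives, any explicit derivative may stand for
  \<open>frechet_derivative\<close>. The closure rules below then become inductions in which the
  explicit derivative is assembled from functions of lower order.\<close>

lemma Ck_on_SucI:
  assumes "open S" "\<And>x. x \<in> S \<Longrightarrow> (f has_derivative f' x) (at x)"
    "\<And>v. Ck_on k S (\<lambda>x. f' x v)"
  shows "Ck_on (Suc k) S f"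
proof -
  have "f' x = frechet_derivative f (at x)" if "x \<in> S" for x
    using assms(2) that frechet_derivative_at by blast
  then have "Ck_on k S (\<lambda>x. frechet_derivative f (at x) v)" for v
    by (intro Ck_on_cong[OF assms(1) _ assms(3)[of v]]) simp
  then show ?thesis using assms(2) by (auto simp: differentiable_def)
qed

lemma Ck_on_SucD2:
  "Ck_on (Suc k) S f \<Longrightarrow> x \<in> S \<Longrightarrow> (f has_derivative frechet_derivative f (at x)) (at x)"
  by (auto simp: frechet_derivative_works)

lemma Ck_on_linear_compose:
  assumes "open S" "bounded_linear h" "Ck_on k S f"
  shows "Ck_on k S (\<lambda>x. h (f x))"
  using assms(3)
proof (induction k arbitrary: f)
  case 0
  then show ?case using assms(2) by (simp add: bounded_linear.continuous_on)
next
  case (Suc k)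
  show ?case
  proof (rule Ck_on_SucI[OF assms(1)])
    show "((\<lambda>x. h (f x)) has_derivative (\<lambda>v. h (frechet_derivative f (at x) v))) (at x)"
      if "x \<in> S" for x
      using bounded_linear.has_derivative[OF assms(2) Ck_on_SucD2[OF Suc.prems that]] .
    show "Ck_on k S (\<lambda>x. h (frechet_derivative f (at x) v))" for v
      using Suc by auto
  qed
qed

lemma Ck_on_add:
  assumes "open S" "Ck_on k S f" "Ck_on k S g"
  shows "Ck_on k S (\<lambda>x. f x + g x)"
  using assms(2,3)
proof (induction k arbitrary: f g)
  case 0
  then show ?case by (simp add: continuous_on_add)
next
  case (Suc k)
  show ?case
  proof (rule Ck_on_SucI[OF assms(1)])
    show "((\<lambda>x. f x + g x) has_derivative (\<lambda>v. frechet_derivative f (at x) v + frechet_derivative g (at x) v)) (at x)"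
      if "x \<in> S" for x
      by (intro has_derivative_add Ck_on_SucD2[OF Suc.prems(1) that] Ck_on_SucD2[OF Suc.prems(2) that])
    show "Ck_on k S (\<lambda>x. frechet_derivative f (at x) v + frechet_derivative g (at x) v)" for v
      using Suc by auto
  qed
qed

lemma Ck_on_scaleR:
  fixes f :: "'c::euclidean_space \<Rightarrow> real" and g :: "'c \<Rightarrow> 'd::real_normed_vector"
  assumes "open S" "Ck_on k S f" "Ck_on k S g"
  shows "Ck_on k S (\<lambda>x. f x *\<^sub>R g x)"
  using assms(2,3)
proof (induction k arbitrary: f g)
  case 0
  then show ?case by (simp add: continuous_on_scaleR)
next
  case (Suc k)
  show ?case
  proof (rule Ck_on_SucI[OF assms(1)])
    show "((\<lambda>x. f x *\<^sub>R g x) has_derivative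
      (\<lambda>v. f x *\<^sub>R frechet_derivative g (at x) v + frechet_derivative f (at x) v *\<^sub>R g x)) (at x)"
      if "x \<in> S" for x
      by (intro has_derivative_scaleR Ck_on_SucD2[OF Suc.prems(1) that] Ck_on_SucD2[OF Suc.prems(2) that])
    show "Ck_on k S (\<lambda>x. f x *\<^sub>R frechet_derivative g (at x) v + frechet_derivative f (at x) v *\<^sub>R g x)" for v
      using Suc.prems Ck_on_SucD[OF Suc.prems(1)] Ck_on_SucD[OF Suc.prems(2)]
      by (intro Ck_on_add[OF assms(1)] Suc.IH) simp_all
  qed
qed

lemma Ck_on_sum:
  assumes "open S" "\<And>i. i \<in> I \<Longrightarrow> Ck_on k S (f i)"
  shows "Ck_on k S (\<lambda>x. \<Sum>i\<in>I. f i x)"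
  using assms(2)
  by (induction I rule: infinite_finite_induct) (auto intro: Ck_on_add[OF assms(1)] simp: Ck_on_const)

lemma Ck_on_compose:
  fixes f :: "'c::euclidean_space \<Rightarrow> 'd::euclidean_space" and g :: "'d \<Rightarrow> 'a::real_normed_vector"
  assumes "open S" "Ck_on k S f" "Ck_on k T g" "f ` S \<subseteq> T"
  shows "Ck_on k S (\<lambda>x. g (f x))"
  using assms(2,3)
proof (induction k arbitrary: g)
  case 0
  then show ?case using assms(4) by (auto intro: continuous_on_compose2)
next
  case (Suc k)
  let ?f' = "\<lambda>x. frechet_derivative f (at x)" and ?g' = "\<lambda>x. frechet_derivative g (at x)"
  show ?case
  proof (rule Ck_on_SucI[OF assms(1)])
    \<comment> \<open>The derivative of \<open>g\<close> is expanded over the basis because the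
      induction hypothesis speaks of directional derivatives in a fixed direction, whereas the chain
      rule produces the direction \<open>?f' x v\<close>, which moves with \<open>x\<close>.\<close>
    show "((\<lambda>x. g (f x)) has_derivative (\<lambda>v. \<Sum>b\<in>Basis. (?f' x v \<bullet> b) *\<^sub>R ?g' (f x) b)) (at x)"
      if x: "x \<in> S" for x
    proof -
      have g: "(g has_derivative ?g' (f x)) (at (f x))"
        using Ck_on_SucD2[OF Suc.prems(2)] x assms(4) by auto
      have "((\<lambda>x. g (f x)) has_derivative (\<lambda>v. ?g' (f x) (?f' x v))) (at x)"
        using has_derivative_compose[OF Ck_on_SucD2[OF Suc.prems(1) x] g] .
      moreover have "?g' (f x) (?f' x v) = (\<Sum>b\<in>Basis. (?f' x v \<bullet> b) *\<^sub>R ?g' (f x) b)" for v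
      proof -
        have lin: "linear (?g' (f x))"
          using g by (intro linear_frechet_derivative) (auto simp: differentiable_def)
        have "?g' (f x) (?f' x v) = ?g' (f x) (\<Sum>b\<in>Basis. (?f' x v \<bullet> b) *\<^sub>R b)"
          by (simp add: euclidean_representation)
        then show ?thesis using lin by (simp add: linear_sum linear_scale)
      qed
      ultimately show ?thesis by simp
    qed
    show "Ck_on k S (\<lambda>x. \<Sum>b\<in>Basis. (?f' x v \<bullet> b) *\<^sub>R ?g' (f x) b)" for v
    proof (intro Ck_on_sum[OF assms(1)] Ck_on_scaleR[OF assms(1)])
      show "Ck_on k S (\<lambda>x. ?f' x v \<bullet> b)" for b
        using Suc.prems by (intro Ck_on_linear_compose[OF assms(1) bounded_linear_inner_left]) auto
      show "Ck_on k S (\<lambda>x. ?g' (f x) b)" for b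
        using Suc.prems Ck_on_SucD[OF Suc.prems(1)] by (intro Suc.IH) auto
    qed
  qed
qed

lemma Ck_on_inverse:
  fixes f :: "'c::euclidean_space \<Rightarrow> real"
  assumes "open S" "Ck_on k S f" "\<And>x. x \<in> S \<Longrightarrow> f x \<noteq> 0"
  shows "Ck_on k S (\<lambda>x. inverse (f x))"
  using assms(2)
proof (induction k)
  case 0
  then show ?case using assms(3) by (auto intro: continuous_on_inverse)
next
  case (Suc k)
  show ?case
  proof (rule Ck_on_SucI[OF assms(1)])
    \<comment> \<open>The derivative is bracketed as two nested multiplications by
      \<open>inverse (f x)\<close>, so that \<open>Ck_on_scaleR\<close> and the induction hypothesis
      for the inverse itself suffice.\<close>
    show "((\<lambda>x. inverse (f x)) has_derivative
       (\<lambda>v. inverse (f x) *\<^sub>R (inverse (f x) *\<^sub>R - frechet_derivative f (at x) v))) (at x)"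
      if "x \<in> S" for x
      using Deriv.has_derivative_inverse[OF assms(3)[OF that] Ck_on_SucD2[OF Suc.prems that]]
      by (simp add: algebra_simps)
    show "Ck_on k S (\<lambda>x. inverse (f x) *\<^sub>R (inverse (f x) *\<^sub>R - frechet_derivative f (at x) v))" for v
      using Suc Ck_on_SucD[OF Suc.prems] Ck_on_linear_compose[OF assms(1) bounded_linear_minus[OF bounded_linear_ident]]
      by (intro Ck_on_scaleR[OF assms(1)]) auto
  qed
qed

lemma smooth_on_const: "smooth_on S (\<lambda>x. c)"
  by (simp add: smooth_on_def Ck_on_const)

lemma smooth_on_bounded_linear: "bounded_linear h \<Longrightarrow> smooth_on S h"
  by (simp add: smooth_on_def Ck_on_bounded_linear)

lemma smooth_on_add:
  "open S \<Longrightarrow> smooth_on S f \<Longrightarrow> smooth_on S g \<Longrightarrow> smooth_on S (\<lambda>x. f x + g x)"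
  by (simp add: smooth_on_def Ck_on_add)

lemma smooth_on_scaleR:
  "open S \<Longrightarrow> smooth_on S f \<Longrightarrow> smooth_on S g \<Longrightarrow> smooth_on S (\<lambda>x. f x *\<^sub>R g x)"
  by (simp add: smooth_on_def Ck_on_scaleR)

lemma smooth_on_mult:
  fixes f g :: "'c::euclidean_space \<Rightarrow> real"
  shows "open S \<Longrightarrow> smooth_on S f \<Longrightarrow> smooth_on S g \<Longrightarrow> smooth_on S (\<lambda>x. f x * g x)"
  using smooth_on_scaleR[of S f g] by simp

lemma smooth_on_sum:
  "open S \<Longrightarrow> (\<And>i. i \<in> I \<Longrightarrow> smooth_on S (f i)) \<Longrightarrow> smooth_on S (\<lambda>x. \<Sum>i\<in>I. f i x)"
  by (simp add: smooth_on_def Ck_on_sum)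

lemma smooth_on_compose:
  fixes f :: "'c::euclidean_space \<Rightarrow> 'd::euclidean_space"
  shows "open S \<Longrightarrow> smooth_on S f \<Longrightarrow> smooth_on T g \<Longrightarrow> f ` S \<subseteq> T \<Longrightarrow> smooth_on S (\<lambda>x. g (f x))"
  unfolding smooth_on_def using Ck_on_compose by blast

lemma smooth_on_inverse:
  fixes f :: "'c::euclidean_space \<Rightarrow> real"
  shows "open S \<Longrightarrow> smooth_on S f \<Longrightarrow> (\<And>x. x \<in> S \<Longrightarrow> f x \<noteq> 0) \<Longrightarrow> smooth_on S (\<lambda>x. inverse (f x))"
  by (simp add: smooth_on_def Ck_on_inverse)

lemma smooth_on_components:
  fixes f :: "'c::euclidean_space \<Rightarrow> 'd::euclidean_space"
  assumes "open S" "\<And>b. b \<in> Basis \<Longrightarrow> smooth_on S (\<lambda>x. f x \<bullet> b)"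
  shows "smooth_on S f"
proof -
  have "smooth_on S (\<lambda>x. \<Sum>b\<in>Basis. (f x \<bullet> b) *\<^sub>R b)"
    using assms by (intro smooth_on_sum smooth_on_scaleR smooth_on_const) auto
  then show ?thesis by (simp add: euclidean_representation)
qed

text \<open>The mean value theorem is used twice: along \<open>v\<close> for the increment of
  \<open>f\<close> in direction \<open>w\<close>, then along \<open>w\<close> for the derivative of
  \<open>f\<close> in direction \<open>v\<close>. The point of the statement is that its left-hand
  side is symmetric in \<open>v\<close> and \<open>w\<close>.\<close>

lemma second_difference:
  fixes f :: "'c::euclidean_space \<Rightarrow> real"
  assumes f: "smooth_on S f" and h: "h > 0"
    and S: "\<And>s t. 0 \<le> s \<Longrightarrow> s \<le> h \<Longrightarrow> 0 \<le> t \<Longrightarrow> t \<le> h \<Longrightarrow> x + s *\<^sub>R v + t *\<^sub>R w \<in> S"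
  shows "\<exists>s t. 0 < s \<and> s < h \<and> 0 < t \<and> t < h \<and>
    f (x + h *\<^sub>R v + h *\<^sub>R w) - f (x + h *\<^sub>R v) - f (x + h *\<^sub>R w) + f x =
     h * (h * frechet_derivative (\<lambda>y. frechet_derivative f (at y) v) (at (x + s *\<^sub>R v + t *\<^sub>R w)) w)"
proof -
  let ?D = "\<lambda>y. frechet_derivative f (at y) v"
  have D: "smooth_on S ?D" using f by (rule smooth_on_deriv)
  have comp: "((\<lambda>s. g (p + s *\<^sub>R d)) has_real_derivative frechet_derivative g (at (p + s *\<^sub>R d)) d) (at s)"
    if "smooth_on S g" "p + s *\<^sub>R d \<in> S" for g :: "'c \<Rightarrow> real" and p d s
  proof -
    have g: "(g has_derivative frechet_derivative g (at (p + s *\<^sub>R d))) (at (p + s *\<^sub>R d))"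
      using smooth_on_has_derivative that by blast
    have "((\<lambda>s. p + s *\<^sub>R d) has_derivative (\<lambda>r. r *\<^sub>R d)) (at s)"
      by (auto intro!: derivative_eq_intros)
    from has_derivative_compose[OF this g]
    have "((\<lambda>s. g (p + s *\<^sub>R d)) has_derivative (\<lambda>r. frechet_derivative g (at (p + s *\<^sub>R d)) (r *\<^sub>R d))) (at s)" .
    moreover have "linear (frechet_derivative g (at (p + s *\<^sub>R d)))"
      using g by (intro linear_frechet_derivative) (auto simp: differentiable_def)
    ultimately show ?thesis
      by (simp add: has_field_derivative_def linear_scale mult_commute_abs)
  qed
  let ?\<phi> = "\<lambda>s. f (x + h *\<^sub>R w + s *\<^sub>R v) - f (x + s *\<^sub>R v)"
  have "(?\<phi> has_real_derivative (?D (x + h *\<^sub>R w + s *\<^sub>R v) - ?D (x + s *\<^sub>R v))) (at s)"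
    if "0 \<le> s" "s \<le> h" for s
    using S[of s h] S[of s 0] that h f by (intro DERIV_diff comp) (auto simp: algebra_simps)
  from MVT2[OF h this] obtain s where s: "0 < s" "s < h"
    "?\<phi> h - ?\<phi> 0 = h * (?D (x + h *\<^sub>R w + s *\<^sub>R v) - ?D (x + s *\<^sub>R v))"
    by auto
  have "((\<lambda>t. ?D (x + s *\<^sub>R v + t *\<^sub>R w)) has_real_derivative
      frechet_derivative ?D (at (x + s *\<^sub>R v + t *\<^sub>R w)) w) (at t)" if "0 \<le> t" "t \<le> h" for t
    using S[of s t] that s D by (intro comp) auto
  from MVT2[OF h this] obtain t where t: "0 < t" "t < h"
    "?D (x + s *\<^sub>R v + h *\<^sub>R w) - ?D (x + s *\<^sub>R v + 0 *\<^sub>R w)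
      = h * frechet_derivative ?D (at (x + s *\<^sub>R v + t *\<^sub>R w)) w"
    by auto
  show ?thesis
    using s t by (intro exI[of _ s] exI[of _ t]) (auto simp: algebra_simps)
qed

text \<open>Schwarz's theorem. Evaluating the symmetric second difference in both orders gives, in
  every neighbourhood of \<open>x\<close>, a point for each mixed derivative at which the two values
  agree; continuity of both transfers the equality to \<open>x\<close>.\<close>

lemma symmetric_second_derivative:
  fixes f :: "'c::euclidean_space \<Rightarrow> real"
  assumes "open S" "smooth_on S f" "x \<in> S"
  shows "frechet_derivative (\<lambda>y. frechet_derivative f (at y) v) (at x) w =
         frechet_derivative (\<lambda>y. frechet_derivative f (at y) w) (at x) v"
proof -
  have key: "\<exists>y z. dist x y < e \<and> dist x z < e \<and>
     frechet_derivative (\<lambda>y. frechet_derivative f (at y) v) (at y) w =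
     frechet_derivative (\<lambda>y. frechet_derivative f (at y) w) (at z) v" if "e > 0" for e
  proof -
    obtain d where d: "d > 0" "ball x d \<subseteq> S" using assms openE by blast
    define c where "c = min d e"
    \<comment> \<open>Small enough that the whole parallelogram with sides \<open>h\<close> times
      \<open>v\<close> and \<open>w\<close> stays within distance \<open>c\<close> of
      \<open>x\<close>. The summand 1 keeps the denominator positive when both vectors
      vanish.\<close>
    define h where "h = c / (2 * (1 + norm v + norm w))"
    have c: "c > 0" using d that by (simp add: c_def)
    have n: "1 + norm v + norm w > 0" by (smt (verit) norm_ge_zero)
    have h: "h > 0" unfolding h_def using c n by auto
    have close: "dist x (x + s *\<^sub>R v + t *\<^sub>R w) < c" if "0 \<le> s" "s \<le> h" "0 \<le> t" "t \<le> h" for s t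
    proof -
      have "dist x (x + s *\<^sub>R v + t *\<^sub>R w) = norm (s *\<^sub>R v + t *\<^sub>R w)"
        unfolding dist_norm norm_minus_commute[of x] by (simp add: algebra_simps)
      also have "\<dots> \<le> s * norm v + t * norm w"
        using that by (intro order_trans[OF norm_triangle_ineq]) simp
      also have "\<dots> \<le> h * norm v + h * norm w"
        using that by (intro add_mono mult_right_mono) auto
      also have "\<dots> < h * (2 * (1 + norm v + norm w))"
        using h n mult_pos_pos[OF h n] by (simp add: algebra_simps)
      also have "\<dots> = c" using n by (simp add: h_def)
      finally show ?thesis .
    qed
    have inS: "x + s *\<^sub>R v + t *\<^sub>R w \<in> S" if "0 \<le> s" "s \<le> h" "0 \<le> t" "t \<le> h" for s t
      using close[OF that] d by (auto simp: c_def)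
    have inS': "x + s *\<^sub>R w + t *\<^sub>R v \<in> S" if "0 \<le> s" "s \<le> h" "0 \<le> t" "t \<le> h" for s t
      using inS[of t s] that by (simp add: algebra_simps)
    obtain s t where st: "0 < s" "s < h" "0 < t" "t < h"
      "f (x + h *\<^sub>R v + h *\<^sub>R w) - f (x + h *\<^sub>R v) - f (x + h *\<^sub>R w) + f x =
       h * (h * frechet_derivative (\<lambda>y. frechet_derivative f (at y) v) (at (x + s *\<^sub>R v + t *\<^sub>R w)) w)"
      using second_difference[OF assms(2) h inS] by blast
    obtain s' t' where st': "0 < s'" "s' < h" "0 < t'" "t' < h"
      "f (x + h *\<^sub>R w + h *\<^sub>R v) - f (x + h *\<^sub>R w) - f (x + h *\<^sub>R v) + f x =
       h * (h * frechet_derivative (\<lambda>y. frechet_derivative f (at y) w) (at (x + s' *\<^sub>R w + t' *\<^sub>R v)) v)"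
      using second_difference[OF assms(2) h inS'] by blast
    have "h * (h * frechet_derivative (\<lambda>y. frechet_derivative f (at y) v) (at (x + s *\<^sub>R v + t *\<^sub>R w)) w)
      = h * (h * frechet_derivative (\<lambda>y. frechet_derivative f (at y) w) (at (x + s' *\<^sub>R w + t' *\<^sub>R v)) v)"
      unfolding st(5)[symmetric] st'(5)[symmetric] by (simp add: algebra_simps)
    moreover have "dist x (x + s' *\<^sub>R w + t' *\<^sub>R v) < c"
      using close[of t' s'] st' by (simp add: algebra_simps)
    moreover have "dist x (x + s *\<^sub>R v + t *\<^sub>R w) < c" using close[of s t] st by simp
    ultimately show ?thesis
      using h by (intro exI[of _ "x + s *\<^sub>R v + t *\<^sub>R w"] exI[of _ "x + s' *\<^sub>R w + t' *\<^sub>R v"]) (auto simp: c_def)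
  qed
  have cont: "isCont (\<lambda>y. frechet_derivative (\<lambda>y. frechet_derivative f (at y) a) (at y) b) x" for a b
    using smooth_on_continuous[OF smooth_on_deriv[OF smooth_on_deriv[OF assms(2)]]] assms(1,3)
    by (simp add: continuous_on_eq_continuous_at)
  let ?A = "\<lambda>y. frechet_derivative (\<lambda>y. frechet_derivative f (at y) v) (at y) w"
  let ?B = "\<lambda>y. frechet_derivative (\<lambda>y. frechet_derivative f (at y) w) (at y) v"
  have "dist (?A x) (?B x) < e" if e: "e > 0" for e
  proof -
    obtain d1 where d1: "d1 > 0" "\<And>y. dist y x < d1 \<Longrightarrow> dist (?A y) (?A x) < e/2"
      using cont[of v w] half_gt_zero[OF e] unfolding continuous_at_eps_delta by blast
    obtain d2 where d2: "d2 > 0" "\<And>y. dist y x < d2 \<Longrightarrow> dist (?B y) (?B x) < e/2"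
      using cont[of w v] half_gt_zero[OF e] unfolding continuous_at_eps_delta by blast
    obtain y z where "dist x y < min d1 d2" "dist x z < min d1 d2" "?A y = ?B z"
      using key[of "min d1 d2"] d1 d2 by auto
    then have yz: "dist y x < d1" "dist z x < d2" "?A y = ?B z" by (simp_all add: dist_commute)
    then have "dist (?A x) (?A y) < e/2" "dist (?B x) (?B z) < e/2"
      using d1(2)[of y] d2(2)[of z] by (simp_all only: dist_commute)
    then have "dist (?A x) (?B z) < e/2" "dist (?B x) (?B z) < e/2" using yz by simp_all
    then show ?thesis by (rule dist_triangle_half_l)
  qed
  then show ?thesis using zero_less_dist_iff less_irrefl by blast
qed

section \<open>Functions and tangent vectors on a manifold\<close>

abbreviation chart_inv :: "('p, 'c) chart \<Rightarrow> 'c \<Rightarrow> 'p"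
  where "chart_inv c \<equiv> inv_into (fst c) (snd c)"

locale smooth_manifold =
  fixes A :: "('p, 'c::euclidean_space) atlas"
  assumes atlas: "smooth_atlas A"
begin

lemma chart_inj: "c \<in> A \<Longrightarrow> inj_on (snd c) (fst c)"
  using atlas by (auto simp: smooth_atlas_def)

lemma chart_inv_left: "c \<in> A \<Longrightarrow> x \<in> fst c \<Longrightarrow> chart_inv c (snd c x) = x"
  by (simp add: chart_inj)

lemma chart_transition:
  "c \<in> A \<Longrightarrow> c' \<in> A \<Longrightarrow> smooth_on (snd c ` (fst c \<inter> fst c')) (\<lambda>z. snd c' (chart_inv c z))"
  using atlas by (cases c; cases c') (fastforce simp: smooth_atlas_def o_def)

lemma open_in_iff:
  "open_in A W \<longleftrightarrow> W \<subseteq> points A \<and> (\<forall>c\<in>A. open (snd c ` (fst c \<inter> W)))"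
  by (auto simp: open_in_def split_beta)

lemma chart_open: "c \<in> A \<Longrightarrow> open_in A W \<Longrightarrow> open (snd c ` (fst c \<inter> W))"
  by (simp add: open_in_iff)

lemma open_in_chart: "c \<in> A \<Longrightarrow> open_in A (fst c)"
  using atlas by (cases c) (fastforce simp: open_in_def smooth_atlas_def points_def)

lemma open_in_Int: 
  assumes "open_in A V" "open_in A W" shows "open_in A (V \<inter> W)"
  unfolding open_in_iff
proof (intro conjI ballI)
  fix c assume c: "c \<in> A"
  have "snd c ` (fst c \<inter> (V \<inter> W)) = snd c ` ((fst c \<inter> V) \<inter> (fst c \<inter> W))" by (rule arg_cong[of _ _ "image (snd c)"]) blast
  also have "\<dots> = snd c ` (fst c \<inter> V) \<inter> snd c ` (fst c \<inter> W)"
    using chart_inj[OF c] by (intro inj_on_image_Int) auto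
  finally show "open (snd c ` (fst c \<inter> (V \<inter> W)))"
    using assms c by (simp add: chart_open open_Int)
qed (use assms in \<open>auto simp: open_in_iff\<close>)

lemma open_in_points: "open_in A (points A)"
  unfolding open_in_iff
proof (intro conjI ballI)
  fix c assume c: "c \<in> A"
  then have "fst c \<inter> points A = fst c \<inter> fst c" by (auto simp: points_def)
  then show "open (snd c ` (fst c \<inter> points A))"
    using chart_open[OF c open_in_chart[OF c]] by simp
qed simp

lemma open_in_subset_points: "open_in A W \<Longrightarrow> W \<subseteq> points A"
  by (simp add: open_in_iff)

lemma points_chart: "x \<in> points A \<Longrightarrow> \<exists>c\<in>A. x \<in> fst c"
  by (auto simp: points_def)

lemma smooth_fun_iff:
  "smooth_fun A W f \<longleftrightarrow> (\<forall>c\<in>A. smooth_on (snd c ` (fst c \<inter> W)) (\<lambda>z. f (chart_inv c z)))"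
  by (auto simp: smooth_fun_def split_beta o_def)

lemma smooth_fun_subset: "smooth_fun A W f \<Longrightarrow> V \<subseteq> W \<Longrightarrow> smooth_fun A V f"
  unfolding smooth_fun_iff by (blast intro: smooth_on_subset)

lemma smooth_fun_cong:
  assumes "open_in A W" "\<And>x. x \<in> W \<Longrightarrow> f x = g x" "smooth_fun A W f"
  shows "smooth_fun A W g"
  unfolding smooth_fun_iff
proof
  fix c assume c: "c \<in> A"
  show "smooth_on (snd c ` (fst c \<inter> W)) (\<lambda>z. g (chart_inv c z))"
  proof (rule smooth_on_cong[OF chart_open[OF c assms(1)]])
    show "smooth_on (snd c ` (fst c \<inter> W)) (\<lambda>z. f (chart_inv c z))"
      using assms(3) c by (simp add: smooth_fun_iff)
  qed (use assms(2) c in \<open>auto simp: chart_inv_left\<close>)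
qed

lemma smooth_fun_local:
  assumes "\<And>x. x \<in> W \<Longrightarrow> \<exists>V. open_in A V \<and> x \<in> V \<and> smooth_fun A V f"
  shows "smooth_fun A W f"
  unfolding smooth_fun_iff
proof (intro ballI smooth_on_local)
  fix c z assume c: "c \<in> A" and "z \<in> snd c ` (fst c \<inter> W)"
  then obtain x where x: "x \<in> fst c" "x \<in> W" "z = snd c x" by auto
  then obtain V where "open_in A V" "x \<in> V" "smooth_fun A V f" using assms[OF x(2)] by blast
  then show "\<exists>T. open T \<and> z \<in> T \<and> smooth_on T (\<lambda>z. f (chart_inv c z))"
    using c x chart_open by (auto simp: smooth_fun_iff intro!: exI[of _ "snd c ` (fst c \<inter> V)"])
qed

lemma smooth_fun_const: "smooth_fun A W (\<lambda>x. r)"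
  by (simp add: smooth_fun_iff smooth_on_const)

lemma smooth_fun_add:
  "open_in A W \<Longrightarrow> smooth_fun A W f \<Longrightarrow> smooth_fun A W g \<Longrightarrow> smooth_fun A W (\<lambda>x. f x + g x)"
  by (simp add: smooth_fun_iff smooth_on_add chart_open)

lemma smooth_fun_mult:
  "open_in A W \<Longrightarrow> smooth_fun A W f \<Longrightarrow> smooth_fun A W g \<Longrightarrow> smooth_fun A W (\<lambda>x. f x * g x)"
  by (simp add: smooth_fun_iff smooth_on_mult chart_open)

lemma smooth_fun_minus:
  "open_in A W \<Longrightarrow> smooth_fun A W f \<Longrightarrow> smooth_fun A W (\<lambda>x. - f x)"
  using smooth_fun_mult[OF _ smooth_fun_const[of W "-1"], of f] by simp

lemma smooth_fun_diff:
  "open_in A W \<Longrightarrow> smooth_fun A W f \<Longrightarrow> smooth_fun A W g \<Longrightarrow> smooth_fun A W (\<lambda>x. f x - g x)"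
  using smooth_fun_add[OF _ _ smooth_fun_minus, of W f g] by simp

lemma smooth_fun_sum:
  "open_in A W \<Longrightarrow> (\<And>i. i \<in> I \<Longrightarrow> smooth_fun A W (f i)) \<Longrightarrow> smooth_fun A W (\<lambda>x. \<Sum>i\<in>I. f i x)"
  by (simp add: smooth_fun_iff smooth_on_sum chart_open)

lemma smooth_fun_prod:
  "open_in A W \<Longrightarrow> (\<And>i. i \<in> I \<Longrightarrow> smooth_fun A W (f i)) \<Longrightarrow> smooth_fun A W (\<lambda>x. \<Prod>i\<in>I. f i x)"
  by (induction I rule: infinite_finite_induct) (auto simp: smooth_fun_const intro: smooth_fun_mult)

lemma smooth_fun_inverse:
  "open_in A W \<Longrightarrow> smooth_fun A W f \<Longrightarrow> (\<And>x. x \<in> W \<Longrightarrow> f x \<noteq> 0) \<Longrightarrow>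
   smooth_fun A W (\<lambda>x. inverse (f x))"
  unfolding smooth_fun_iff
proof (intro ballI smooth_on_inverse chart_open)
  fix c z assume "c \<in> A" "z \<in> snd c ` (fst c \<inter> W)" "\<And>x. x \<in> W \<Longrightarrow> f x \<noteq> 0"
  then show "f (chart_inv c z) \<noteq> 0" using chart_inv_left[of c] by auto
qed auto

text \<open>The transition maps are smooth, so one chart that covers \<open>W\<close> decides about
  smoothness in all of them.\<close>

lemma smooth_fun_in_chart:
  assumes c: "c \<in> A" and W: "W \<subseteq> fst c" "open_in A W"
    and f: "smooth_on (snd c ` W) (\<lambda>z. f (chart_inv c z))"
  shows "smooth_fun A W f"
  unfolding smooth_fun_iff
proof
  fix c' assume c': "c' \<in> A"
  let ?S = "snd c' ` (fst c' \<inter> W)"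
  have S: "open ?S" using c' W by (simp add: chart_open)
  have "smooth_on ?S (\<lambda>z. snd c (chart_inv c' z))"
    using chart_transition[OF c' c] W by (auto intro: smooth_on_subset)
  moreover have eq: "chart_inv c' z \<in> W" if "z \<in> ?S" for z
    using that chart_inv_left[OF c'] by auto
  ultimately have "smooth_on ?S (\<lambda>z. f (chart_inv c (snd c (chart_inv c' z))))"
    by (intro smooth_on_compose[OF S _ f]) auto
  then show "smooth_on ?S (\<lambda>z. f (chart_inv c' z))"
    by (rule smooth_on_cong[OF S, rotated]) (use eq W chart_inv_left[OF c] in \<open>simp add: subset_iff\<close>)
qed

lemma smooth_fun_coord: 
  assumes c: "c \<in> A" shows "smooth_fun A (fst c) (\<lambda>x. snd c x \<bullet> b)"
proof (rule smooth_fun_in_chart[OF c subset_refl open_in_chart[OF c]])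
  have o: "open (snd c ` fst c)" using chart_open[OF c open_in_chart[OF c]] by simp
  show "smooth_on (snd c ` fst c) (\<lambda>z. snd c (chart_inv c z) \<bullet> b)"
    by (rule smooth_on_cong[OF o _ smooth_on_bounded_linear[OF bounded_linear_inner_left[of b]]])
       (auto simp: chart_inv_left c)
qed

lemma smooth_nearI: "open_in A W \<Longrightarrow> x \<in> W \<Longrightarrow> smooth_fun A W f \<Longrightarrow> smooth_near A x f"
  by (auto simp: smooth_near_def)

lemma smooth_near_cong:
  assumes "open_in A W" "x \<in> W" "\<And>y. y \<in> W \<Longrightarrow> f y = g y"
  shows "smooth_near A x f \<longleftrightarrow> smooth_near A x g"
proof -
  have "smooth_near A x g" if f: "smooth_near A x f" and eq: "\<And>y. y \<in> W \<Longrightarrow> f y = g y" for f g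
  proof -
    obtain V where V: "open_in A V" "x \<in> V" "smooth_fun A V f" using f by (auto simp: smooth_near_def)
    have "smooth_fun A (V \<inter> W) g"
      by (rule smooth_fun_cong[OF open_in_Int[OF V(1) assms(1)] _ smooth_fun_subset[OF V(3)]]) (auto simp: eq)
    then show ?thesis using V assms by (blast intro: smooth_nearI open_in_Int)
  qed
  from this[of f g] this[of g f] show ?thesis using assms(3) by auto
qed

lemma smooth_near2:
  assumes "smooth_near A x f" "smooth_near A x g"
  obtains W where "open_in A W" "x \<in> W" "smooth_fun A W f" "smooth_fun A W g"
proof -
  obtain V W where VW: "open_in A V" "x \<in> V" "smooth_fun A V f" "open_in A W" "x \<in> W" "smooth_fun A W g"
    using assms by (auto simp: smooth_near_def)
  show thesis
    using VW by (intro that[of "V \<inter> W"] open_in_Int smooth_fun_subset[OF VW(3)] smooth_fun_subset[OF VW(6)]) auto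
qed

lemma smooth_near_const: "x \<in> points A \<Longrightarrow> smooth_near A x (\<lambda>y. r)"
  using smooth_nearI[OF open_in_points _ smooth_fun_const] .

lemma smooth_near_add:
  "smooth_near A x f \<Longrightarrow> smooth_near A x g \<Longrightarrow> smooth_near A x (\<lambda>y. f y + g y)"
  by (erule (1) smooth_near2) (blast intro: smooth_nearI smooth_fun_add)

lemma smooth_near_mult:
  "smooth_near A x f \<Longrightarrow> smooth_near A x g \<Longrightarrow> smooth_near A x (\<lambda>y. f y * g y)"
  by (erule (1) smooth_near2) (blast intro: smooth_nearI smooth_fun_mult)

lemma smooth_near_sum:
  "x \<in> points A \<Longrightarrow> (\<And>i. i \<in> I \<Longrightarrow> smooth_near A x (f i)) \<Longrightarrow> smooth_near A x (\<lambda>y. \<Sum>i\<in>I. f i y)"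
  by (induction I rule: infinite_finite_induct) (auto intro: smooth_near_const smooth_near_add)

lemma smooth_near_coord: "c \<in> A \<Longrightarrow> x \<in> fst c \<Longrightarrow> smooth_near A x (\<lambda>y. snd c y \<bullet> b)"
  using smooth_nearI[OF open_in_chart _ smooth_fun_coord] .

section \<open>Directional derivatives in charts and tangent vectors as derivations\<close>

lemma near_has_derivative:
  assumes "c \<in> A" "x \<in> fst c" "smooth_near A x f"
  shows "((\<lambda>z. f (chart_inv c z)) has_derivative (\<lambda>v. partial A c v x f)) (at (snd c x))"
proof -
  obtain W where W: "open_in A W" "x \<in> W" "smooth_fun A W f"
    using assms(3) by (auto simp: smooth_near_def)
  have "smooth_on (snd c ` (fst c \<inter> W)) (\<lambda>z. f (chart_inv c z))"
    using W assms(1) by (simp add: smooth_fun_iff)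
  from smooth_on_has_derivative[OF this] show ?thesis
    using assms W by (simp add: partial_def o_def)
qed

lemma partial_eqI:
  assumes "c \<in> A" "x \<in> fst c" "smooth_near A x f"
    "((\<lambda>z. f (chart_inv c z)) has_derivative D) (at (snd c x))"
  shows "partial A c v x f = D v"
  using fun_cong[OF has_derivative_unique[OF near_has_derivative[OF assms(1-3)] assms(4)]] .

lemma partial_not_near: "\<not> smooth_near A x f \<Longrightarrow> partial A c v x f = 0"
  by (simp add: partial_def)

lemma partial_linear:
  assumes "c \<in> A" "x \<in> fst c"
  shows "linear (\<lambda>v. partial A c v x f)"
proof (cases "smooth_near A x f")
  case True
  then show ?thesis
    using near_has_derivative[OF assms] has_derivative_linear by blast
qed (simp add: partial_not_near linear_zero)

lemma partial_lincomb:
  "c \<in> A \<Longrightarrow> x \<in> fst c \<Longrightarrow> partial A c (r *\<^sub>R v + w) x f = r * partial A c v x f + partial A c w x f"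
  using partial_linear[of c x f] by (simp add: linear_add[where f = "\<lambda>v. partial A c v x f"]
      linear_scale[where f = "\<lambda>v. partial A c v x f"])

lemma partial_zero: "c \<in> A \<Longrightarrow> x \<in> fst c \<Longrightarrow> partial A c 0 x f = 0"
  using partial_lincomb[of c x 1 0 0 f] by simp

lemma partial_sum:
  "c \<in> A \<Longrightarrow> x \<in> fst c \<Longrightarrow>
   partial A c (\<Sum>b\<in>I. r b *\<^sub>R v b) x f = (\<Sum>b\<in>I. r b * partial A c (v b) x f)"
  by (induction I rule: infinite_finite_induct) (simp_all add: partial_zero partial_lincomb)

lemma has_derivative_eventually_chart:
  assumes "c \<in> A" "x \<in> fst c" "open_in A W" "x \<in> W" "\<And>y. y \<in> fst c \<Longrightarrow> y \<in> W \<Longrightarrow> f y = g y"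
    "((\<lambda>z. f (chart_inv c z)) has_derivative D) (at (snd c x))"
  shows "((\<lambda>z. g (chart_inv c z)) has_derivative D) (at (snd c x))"
  by (rule has_derivative_transform_within_open[OF assms(6) chart_open[OF assms(1,3)]])
     (use assms in \<open>auto simp: chart_inv_left\<close>)

lemma partial_coord:
  assumes c: "c \<in> A" and x: "x \<in> fst c"
  shows "partial A c v x (\<lambda>y. snd c y \<bullet> b) = v \<bullet> b"
proof (rule partial_eqI[OF c x smooth_near_coord[OF c x]])
  have "((\<lambda>z. z \<bullet> b) has_derivative (\<lambda>v. v \<bullet> b)) (at (snd c x))"
    by (auto intro!: derivative_eq_intros)
  then show "((\<lambda>z. snd c (chart_inv c z) \<bullet> b) has_derivative (\<lambda>v. v \<bullet> b)) (at (snd c x))"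
    by (rule has_derivative_transform_within_open[OF _ chart_open[OF c open_in_chart[OF c]]])
       (use c x in \<open>auto simp: chart_inv_left\<close>)
qed

text \<open>The chain rule for the coordinate change. If \<open>f\<close> is not smooth near
  \<open>x\<close>, both sides are 0 by the default value in \<open>partial\<close>.\<close>

lemma partial_expand:
  assumes c: "c \<in> A" "c' \<in> A" and x: "x \<in> fst c" "x \<in> fst c'"
  shows "partial A c' v x f =
    (\<Sum>b\<in>Basis. partial A c' v x (\<lambda>y. snd c y \<bullet> b) * partial A c b x f)"
proof (cases "smooth_near A x f")
  case True
  let ?D = "\<lambda>v. \<Sum>b\<in>Basis. partial A c' v x (\<lambda>y. snd c y \<bullet> b) *\<^sub>R b"
  have "((\<lambda>z. \<Sum>b\<in>Basis. (snd c (chart_inv c' z) \<bullet> b) *\<^sub>R b) has_derivative ?D) (at (snd c' x))"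
    using c x by (intro has_derivative_sum has_derivative_scaleR_left near_has_derivative smooth_near_coord)
  then have 1: "((\<lambda>z. snd c (chart_inv c' z)) has_derivative ?D) (at (snd c' x))"
    by (simp add: euclidean_representation)
  have 2: "((\<lambda>z. f (chart_inv c z)) has_derivative (\<lambda>v. partial A c v x f)) (at (snd c (chart_inv c' (snd c' x))))"
    using near_has_derivative[OF c(1) x(1) True] c x by (simp add: chart_inv_left)
  have "((\<lambda>z. f (chart_inv c (snd c (chart_inv c' z)))) has_derivative (\<lambda>v. partial A c (?D v) x f)) (at (snd c' x))"
    using has_derivative_compose[OF 1 2] .
  then have "((\<lambda>z. f (chart_inv c' z)) has_derivative (\<lambda>v. partial A c (?D v) x f)) (at (snd c' x))"
    by (rule has_derivative_eventually_chart
        [where c = c' and W = "fst c" and f = "\<lambda>y. f (chart_inv c (snd c y))", rotated -1])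
      (use c x in \<open>simp_all add: chart_inv_left open_in_chart\<close>)
  then have "partial A c' v x f = partial A c (?D v) x f"
    by (rule partial_eqI[OF c(2) x(2) True])
  also have "\<dots> = (\<Sum>b\<in>Basis. partial A c' v x (\<lambda>y. snd c y \<bullet> b) * partial A c b x f)"
    using c x by (simp add: partial_sum)
  finally show ?thesis .
qed (simp add: partial_not_near)

lemma partial_smooth:
  assumes c: "c \<in> A" and W: "open_in A W" "W \<subseteq> fst c" and f: "smooth_fun A W f"
  shows "smooth_fun A W (\<lambda>x. partial A c v x f)"
proof (rule smooth_fun_in_chart[OF c W(2,1)])
  have eq: "fst c \<inter> W = W" using W by auto
  have o: "open (snd c ` W)" using chart_open[OF c W(1)] eq by simp
  have "smooth_on (snd c ` W) (\<lambda>z. f (chart_inv c z))"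
    using f c eq by (fastforce simp: smooth_fun_iff)
  from smooth_on_deriv[OF this]
  show "smooth_on (snd c ` W) (\<lambda>z. partial A c v (chart_inv c z) f)"
    by (rule smooth_on_cong[OF o, rotated])
       (use W f c in \<open>auto simp: partial_def o_def chart_inv_left subset_iff smooth_near_def\<close>)
qed

text \<open>The symmetry of second derivatives on a manifold. It is what makes coordinate frames
  have vanishing structure functions in the classical case.\<close>

lemma partial_commute:
  assumes c: "c \<in> A" and x: "x \<in> fst c" and f: "smooth_near A x f"
  shows "partial A c v x (\<lambda>y. partial A c w y f) = partial A c w x (\<lambda>y. partial A c v y f)"
proof -
  obtain V where V: "open_in A V" "x \<in> V" "smooth_fun A V f" using f by (auto simp: smooth_near_def)
  define W where "W = fst c \<inter> V"
  have W: "open_in A W" "W \<subseteq> fst c" "x \<in> W"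
    using V x c open_in_Int open_in_chart by (auto simp: W_def)
  have fW: "smooth_fun A W f" using V by (auto simp: W_def intro: smooth_fun_subset)
  let ?f = "\<lambda>z. f (chart_inv c z)"
  have eq: "fst c \<inter> W = W" using W by auto
  have o: "open (snd c ` W)" using chart_open[OF c W(1)] eq by simp
  have s: "smooth_on (snd c ` W) ?f" using fW c eq by (fastforce simp: smooth_fun_iff)
  have near: "smooth_near A x (\<lambda>y. partial A c w y f)" for w
    using smooth_nearI[OF W(1,3) partial_smooth[OF c W(1,2) fW]] .
  have *: "partial A c v x (\<lambda>y. partial A c w y f) =
      frechet_derivative (\<lambda>z. frechet_derivative ?f (at z) w) (at (snd c x)) v" for v w
  proof (rule partial_eqI[OF c x near])
    have "((\<lambda>z. frechet_derivative ?f (at z) w) has_derivative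
       (\<lambda>v. frechet_derivative (\<lambda>z. frechet_derivative ?f (at z) w) (at (snd c x)) v)) (at (snd c x))"
      using smooth_on_has_derivative[OF smooth_on_deriv[OF s]] W by auto
    then show "((\<lambda>z. partial A c w (chart_inv c z) f) has_derivative
       (\<lambda>v. frechet_derivative (\<lambda>z. frechet_derivative ?f (at z) w) (at (snd c x)) v)) (at (snd c x))"
      by (rule has_derivative_transform_within_open[OF _ o])
        (use W fW c in \<open>auto simp: partial_def o_def chart_inv_left subset_iff smooth_near_def\<close>)
  qed
  show ?thesis unfolding * using symmetric_second_derivative[OF o s] W by auto
qed

lemma tangent_space_chart:
  assumes "X \<in> tangent_space A x" "c \<in> A" "x \<in> fst c"
  obtains v where "X = partial A c v x"
proof -
  obtain c' w where c': "X = partial A c' w x" "c' \<in> A" "x \<in> fst c'"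
    using assms(1) by (auto simp: tangent_space_def)
  have "partial A c' w x f =
     partial A c (\<Sum>b\<in>Basis. partial A c' w x (\<lambda>y. snd c y \<bullet> b) *\<^sub>R b) x f" for f
    using partial_expand[OF assms(2) c'(2) assms(3) c'(3), of w f] assms(2,3) by (simp add: partial_sum)
  then have "X = partial A c (\<Sum>b\<in>Basis. partial A c' w x (\<lambda>y. snd c y \<bullet> b) *\<^sub>R b) x"
    unfolding c'(1) by (rule ext)
  then show thesis by (rule that)
qed

lemma tangent_expand:
  assumes "X \<in> tangent_space A x" "c \<in> A" "x \<in> fst c"
  shows "X f = (\<Sum>b\<in>Basis. X (\<lambda>y. snd c y \<bullet> b) * partial A c b x f)"
  using assms(1) partial_expand[OF assms(2) _ assms(3)] by (auto simp: tangent_space_def)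

lemma tangent_points: "X \<in> tangent_space A x \<Longrightarrow> x \<in> points A"
  by (force simp: tangent_space_def points_def)

lemma partial_in_tangent: "c \<in> A \<Longrightarrow> x \<in> fst c \<Longrightarrow> partial A c v x \<in> tangent_space A x"
  unfolding tangent_space_def by blast

lemma tangent_not_near: "X \<in> tangent_space A x \<Longrightarrow> \<not> smooth_near A x f \<Longrightarrow> X f = 0"
  by (auto simp: tangent_space_def partial_not_near)

lemma tangent_space_lincomb:
  assumes "X \<in> tangent_space A x" "Y \<in> tangent_space A x"
  shows "r *\<^sub>R X + Y \<in> tangent_space A x"
proof -
  obtain c v where c: "X = partial A c v x" "c \<in> A" "x \<in> fst c"
    using assms(1) by (auto simp: tangent_space_def)
  obtain w where w: "Y = partial A c w x"
    using tangent_space_chart[OF assms(2) c(2,3)] .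
  have "r *\<^sub>R X + Y = partial A c (r *\<^sub>R v + w) x"
    using c(2,3) by (simp add: c(1) w fun_eq_iff scaleR_fun_def partial_lincomb)
  then show ?thesis using partial_in_tangent[OF c(2,3)] by simp
qed

lemma subspace_tangent_space: 
  assumes "x \<in> points A" shows "subspace (tangent_space A x)"
proof -
  obtain c where c: "c \<in> A" "x \<in> fst c" using points_chart[OF assms] by blast
  have "(0::('p \<Rightarrow> real) \<Rightarrow> real) = partial A c 0 x"
    using c by (simp add: fun_eq_iff partial_zero)
  then have 0: "0 \<in> tangent_space A x" by (metis partial_in_tangent[OF c])
  show ?thesis
    using tangent_space_lincomb[of _ x _ 1] tangent_space_lincomb[OF _ 0] 0
    by (auto simp: subspace_def)
qed

lemma tangent_add:
  assumes X: "X \<in> tangent_space A x" and "smooth_near A x f" "smooth_near A x g"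
  shows "X (\<lambda>y. f y + g y) = X f + X g"
proof -
  obtain c v where c: "X = partial A c v x" "c \<in> A" "x \<in> fst c"
    using X by (auto simp: tangent_space_def)
  show ?thesis
    unfolding c(1)
    by (rule partial_eqI[OF c(2,3) smooth_near_add[OF assms(2,3)]])
       (intro has_derivative_add near_has_derivative c(2,3) assms(2,3))
qed

lemma tangent_mult:
  assumes X: "X \<in> tangent_space A x" and "smooth_near A x f" "smooth_near A x g"
  shows "X (\<lambda>y. f y * g y) = f x * X g + X f * g x"
proof -
  obtain c v where c: "X = partial A c v x" "c \<in> A" "x \<in> fst c"
    using X by (auto simp: tangent_space_def)
  show ?thesis
    unfolding c(1)
    using has_derivative_mult[OF near_has_derivative[OF c(2,3) assms(2)] near_has_derivative[OF c(2,3) assms(3)]]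
      c by (intro partial_eqI[OF c(2,3) smooth_near_mult[OF assms(2,3)]]) (simp add: chart_inv_left)
qed

lemma tangent_const:
  assumes X: "X \<in> tangent_space A x" shows "X (\<lambda>y. r) = 0"
proof -
  obtain c v where c: "X = partial A c v x" "c \<in> A" "x \<in> fst c"
    using X by (auto simp: tangent_space_def)
  show ?thesis
    unfolding c(1)
    by (rule partial_eqI[OF c(2,3) smooth_near_const]) (auto simp: tangent_points[OF X])
qed

lemma tangent_sum:
  assumes X: "X \<in> tangent_space A x" and "\<And>i. i \<in> I \<Longrightarrow> smooth_near A x (f i)"
  shows "X (\<lambda>y. \<Sum>i\<in>I. f i y) = (\<Sum>i\<in>I. X (f i))"
  using assms(2)
  by (induction I rule: infinite_finite_induct)
     (simp_all add: tangent_const[OF X] tangent_add[OF X] smooth_near_sum tangent_points[OF X])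

text \<open>Tangent vectors depend on germs only. This extends to functions that are not smooth near
  \<open>x\<close>, since smoothness near \<open>x\<close> is itself a property of the germ and the
  value is 0 otherwise.\<close>

lemma tangent_cong:
  assumes X: "X \<in> tangent_space A x" and W: "open_in A W" "x \<in> W" and eq: "\<And>y. y \<in> W \<Longrightarrow> f y = g y"
  shows "X f = X g"
proof (cases "smooth_near A x f")
  case True
  obtain c v where c: "X = partial A c v x" "c \<in> A" "x \<in> fst c"
    using X by (auto simp: tangent_space_def)
  have g: "smooth_near A x g" using smooth_near_cong[OF W eq] True by simp
  show ?thesis
    unfolding c(1)
    using partial_eqI[OF c(2,3) g has_derivative_eventually_chart[OF c(2,3) W eq near_has_derivative[OF c(2,3) True]]]
    by simp
next
  case False
  then show ?thesis using smooth_near_cong[OF W eq] tangent_not_near[OF X] by simp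
qed

end

section \<open>Frames of a vector space\<close>

text \<open>Linearity is relative to a subspace because fibres are subspaces of one large vector
  space and the maps on them have default values elsewhere.\<close>

definition lin_on :: "'w::real_vector set \<Rightarrow> ('w \<Rightarrow> 'z::real_vector) \<Rightarrow> bool"
  where "lin_on V h \<longleftrightarrow> (\<forall>v\<in>V. \<forall>w\<in>V. h (v + w) = h v + h w) \<and> (\<forall>r. \<forall>v\<in>V. h (r *\<^sub>R v) = r *\<^sub>R h v)"

lemma lin_on_add: "lin_on V h \<Longrightarrow> v \<in> V \<Longrightarrow> w \<in> V \<Longrightarrow> h (v + w) = h v + h w"
  and lin_on_scale: "lin_on V h \<Longrightarrow> v \<in> V \<Longrightarrow> h (r *\<^sub>R v) = r *\<^sub>R h v"
  by (auto simp: lin_on_def)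

lemma lin_on_zero: "lin_on V h \<Longrightarrow> subspace V \<Longrightarrow> h 0 = 0"
  using lin_on_scale[of V h 0 0] by (simp add: subspace_0)

lemma lin_on_sum:
  assumes "lin_on V h" "subspace V" "\<And>i. i \<in> I \<Longrightarrow> f i \<in> V"
  shows "h (\<Sum>i\<in>I. f i) = (\<Sum>i\<in>I. h (f i))"
  using assms(3)
  by (induction I rule: infinite_finite_induct)
     (auto simp: lin_on_zero[OF assms(1,2)] lin_on_add[OF assms(1)] subspace_sum assms(2))

lemma dual_space_iff: "p \<in> dual_space V \<longleftrightarrow> lin_on V p \<and> (\<forall>v. v \<notin> V \<longrightarrow> p v = 0)"
  by (auto simp: dual_space_def lin_on_def)

definition basis_at :: "('k \<Rightarrow> 'p \<Rightarrow> 'w::real_vector) \<Rightarrow> 'p \<Rightarrow> 'w set \<Rightarrow> bool"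
  where "basis_at s x V \<longleftrightarrow> inj (\<lambda>k. s k x) \<and> independent (range (\<lambda>k. s k x)) \<and>
    span (range (\<lambda>k. s k x)) = V"

lemma basis_at_subspace: "basis_at s x V \<Longrightarrow> subspace V"
  by (auto simp: basis_at_def)

lemma basis_at_in: "basis_at s x V \<Longrightarrow> s k x \<in> V"
  by (auto simp: basis_at_def intro: span_base)

lemma basis_atI:
  fixes s :: "'k::finite \<Rightarrow> 'p \<Rightarrow> 'w::real_vector"
  assumes ind: "\<And>c k. (\<Sum>k\<in>UNIV. c k *\<^sub>R s k x) = 0 \<Longrightarrow> c k = 0"
    and sp: "span (range (\<lambda>k. s k x)) = V"
  shows "basis_at s x V"
proof -
  have inj: "inj (\<lambda>k. s k x)"
  proof (rule injI, rule ccontr)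
    fix i j assume ij: "s i x = s j x" "i \<noteq> j"
    \<comment> \<open>Two equal members of the family would satisfy the nontrivial relation with
      coefficient 1 at \<open>i\<close> and -1 at \<open>j\<close>.\<close>
    have "(\<Sum>k\<in>UNIV. ((if k = i then 1 else 0) - (if k = j then 1 else 0)) *\<^sub>R s k x) = 0"
      by (simp add: algebra_simps sum_subtractf if_distrib[of "\<lambda>r. r *\<^sub>R _"] ij cong: if_cong)
    from ind[OF this, of i] ij show False by simp
  qed
  have "independent (range (\<lambda>k. s k x))"
  proof (rule independent_if_scalars_zero)
    fix f v assume f: "(\<Sum>v\<in>range (\<lambda>k. s k x). f v *\<^sub>R v) = 0" and v: "v \<in> range (\<lambda>k. s k x)"
    have "(\<Sum>k\<in>UNIV. f (s k x) *\<^sub>R s k x) = 0" using f inj by (simp add: sum.reindex)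
    then show "f v = 0" using ind[of "\<lambda>k. f (s k x)"] v by blast
  qed simp
  then show ?thesis using inj sp by (simp add: basis_at_def)
qed

lemma coeff_expand:
  fixes s :: "'k::finite \<Rightarrow> 'p \<Rightarrow> 'w::real_vector"
  assumes "basis_at s x V" "w \<in> V"
  shows "(\<Sum>k\<in>UNIV. coeff s x k w *\<^sub>R s k x) = w"
proof -
  have inj: "inj (\<lambda>k. s k x)" and ind: "independent (range (\<lambda>k. s k x))"
    and w: "w \<in> span (range (\<lambda>k. s k x))"
    using assms by (auto simp: basis_at_def)
  have "(\<Sum>b\<in>range (\<lambda>k. s k x). representation (range (\<lambda>k. s k x)) w b *\<^sub>R b) = w"
    by (rule sum_representation_eq[OF ind w]) auto
  then show ?thesis using inj by (simp add: sum.reindex coeff_def)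
qed

lemma coeff_outside: "basis_at s x V \<Longrightarrow> w \<notin> V \<Longrightarrow> coeff s x k w = 0"
  by (auto simp: basis_at_def coeff_def representation_def)

lemma coeff_lin_on:
  assumes "basis_at s x V" shows "lin_on V (coeff s x k)"
  using assms by (auto simp: basis_at_def lin_on_def coeff_def representation_add representation_scale)

lemma coeff_in_dual: "basis_at s x V \<Longrightarrow> coeff s x k \<in> dual_space V"
  by (simp add: dual_space_iff coeff_lin_on coeff_outside)

lemma coeff_basis:
  assumes "basis_at s x V" shows "coeff s x k (s j x) = (if k = j then 1 else 0)"
  using assms by (auto simp: basis_at_def coeff_def representation_basis dest: injD)

lemma coeff_lincomb:
  fixes s :: "'k::finite \<Rightarrow> 'p \<Rightarrow> 'w::real_vector"
  assumes "basis_at s x V" 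
  shows "coeff s x k (\<Sum>j\<in>UNIV. c j *\<^sub>R s j x) = c k"
proof -
  have "coeff s x k (\<Sum>j\<in>UNIV. c j *\<^sub>R s j x) = (\<Sum>j\<in>UNIV. coeff s x k (c j *\<^sub>R s j x))"
    using basis_at_in[OF assms] basis_at_subspace[OF assms]
    by (intro lin_on_sum[OF coeff_lin_on[OF assms]]) (auto intro: subspace_scale)
  also have "\<dots> = (\<Sum>j\<in>UNIV. if k = j then c j else 0)"
    using basis_at_in[OF assms]
    by (intro sum.cong) (auto simp: lin_on_scale[OF coeff_lin_on[OF assms]] coeff_basis[OF assms])
  finally show ?thesis by simp
qed

lemma lin_on_expand:
  fixes s :: "'k::finite \<Rightarrow> 'p \<Rightarrow> 'w::real_vector"
  assumes "basis_at s x V" "lin_on V h" "w \<in> V"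
  shows "h w = (\<Sum>k\<in>UNIV. coeff s x k w *\<^sub>R h (s k x))"
proof -
  have "h w = h (\<Sum>k\<in>UNIV. coeff s x k w *\<^sub>R s k x)" using coeff_expand[OF assms(1,3)] by simp
  also have "\<dots> = (\<Sum>k\<in>UNIV. h (coeff s x k w *\<^sub>R s k x))"
    using basis_at_in[OF assms(1)] basis_at_subspace[OF assms(1)]
    by (intro lin_on_sum[OF assms(2)]) (auto intro: subspace_scale)
  finally show ?thesis using basis_at_in[OF assms(1)] by (simp add: lin_on_scale[OF assms(2)])
qed

lemma sum_apply: "(\<Sum>i\<in>I. f i) x = (\<Sum>i\<in>I. f i x)"
  by (induction I rule: infinite_finite_induct) auto

text \<open>This is an equality of total functions: outside \<open>V\<close> both sides are 0, by
  the conventions in \<open>dual_space\<close> and \<open>coeff\<close>.\<close>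

lemma dual_expand:
  fixes s :: "'k::finite \<Rightarrow> 'p \<Rightarrow> 'w::real_vector"
  assumes "basis_at s x V" "p \<in> dual_space V"
  shows "p = (\<Sum>k\<in>UNIV. p (s k x) *\<^sub>R coeff s x k)"
proof
  fix w
  have *: "(\<Sum>k\<in>UNIV. p (s k x) *\<^sub>R coeff s x k) w = (\<Sum>k\<in>UNIV. p (s k x) * coeff s x k w)"
    by (simp add: sum_apply scaleR_fun_def)
  show "p w = (\<Sum>k\<in>UNIV. p (s k x) *\<^sub>R coeff s x k) w"
  proof (cases "w \<in> V")
    case True
    then show ?thesis
      using lin_on_expand[OF assms(1) _ True, of p] assms(2) unfolding *
      by (simp add: dual_space_iff mult.commute)
  next
    case False
    then show ?thesis using assms coeff_outside[OF assms(1)] unfolding * by (simp add: dual_space_iff)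
  qed
qed

lemma subspace_dual_space: "subspace (dual_space V)"
  by (auto simp: subspace_def dual_space_def scaleR_fun_def algebra_simps)

lemma coeff_change:
  fixes s t :: "'k::finite \<Rightarrow> 'p \<Rightarrow> 'w::real_vector"
  assumes "basis_at s x V" "basis_at t x V" "w \<in> V"
  shows "coeff s x i w = (\<Sum>j\<in>UNIV. coeff s x i (t j x) * coeff t x j w)"
  using lin_on_expand[OF assms(2) coeff_lin_on[OF assms(1)] assms(3), of i] by (simp add: mult.commute)

lemma matrix_inv_right: "invertible A \<Longrightarrow> A ** matrix_inv A = mat 1"
  and matrix_inv_left: "invertible A \<Longrightarrow> matrix_inv A ** A = mat 1"
  unfolding invertible_def matrix_inv_def by (metis (mono_tags, lifting) someI_ex)+

text \<open>By Cramer's rule each entry of the inverse is a quotient of two determinants, and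
  determinants are polynomials in the smooth entries.\<close>

lemma (in smooth_manifold) smooth_matrix_inv:
  fixes M :: "'p \<Rightarrow> real^'n^'n"
  assumes W: "open_in A W" and M: "\<And>i j. smooth_fun A W (\<lambda>x. M x $ i $ j)"
    and inv: "\<And>x. x \<in> W \<Longrightarrow> invertible (M x)"
  shows "smooth_fun A W (\<lambda>x. matrix_inv (M x) $ i $ j)"
proof -
  have det: "smooth_fun A W (\<lambda>x. det (N x))"
    if "\<And>i j. smooth_fun A W (\<lambda>x. N x $ i $ j)" for N :: "'p \<Rightarrow> real^'n^'n"
    unfolding det_def
    by (intro smooth_fun_sum smooth_fun_mult smooth_fun_prod smooth_fun_const W that)
  \<comment> \<open>The matrix \<open>M x\<close> with its \<open>i\<close>-th column replaced by
    the \<open>j\<close>-th unit vector.\<close>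
  let ?N = "\<lambda>x. \<chi> k l. if l = i then axis j 1 $ k else M x $ k $ l"
  have "matrix_inv (M x) $ i $ j = det (?N x) * inverse (det (M x))" if x: "x \<in> W" for x
  proof -
    have "M x *v (matrix_inv (M x) *v axis j 1) = axis j 1"
      using matrix_inv_right[OF inv[OF x]] by (simp add: matrix_vector_mul_assoc)
    moreover have "det (M x) \<noteq> 0" using inv[OF x] invertible_det_nz by blast
    ultimately have "matrix_inv (M x) *v axis j 1 =
        (\<chi> k. det (\<chi> i' l. if l = k then axis j 1 $ i' else M x $ i' $ l) / det (M x))"
      using cramer by blast
    moreover have "matrix_inv (M x) $ i $ j = (matrix_inv (M x) *v axis j 1) $ i"
      by (simp add: matrix_vector_mul_component inner_axis)
    ultimately show ?thesis by (simp add: divide_inverse)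
  qed
  moreover have "smooth_fun A W (\<lambda>x. det (?N x) * inverse (det (M x)))"
  proof (intro smooth_fun_mult smooth_fun_inverse det W M)
    show "smooth_fun A W (\<lambda>x. ?N x $ k $ l)" for k l
      using M smooth_fun_const by (cases "l = i") auto
    show "det (M x) \<noteq> 0" if "x \<in> W" for x using inv[OF that] invertible_det_nz by blast
  qed
  ultimately show ?thesis
    using smooth_fun_cong[OF W, of "\<lambda>x. det (?N x) * inverse (det (M x))" "\<lambda>x. matrix_inv (M x) $ i $ j"]
    by simp
qed

section \<open>Smooth sections\<close>

text \<open>The algebraic and local content of \<open>vector_bundle\<close>. It is derived for the
  given bundles and established directly for the tangent bundle and for the generalized tangent
  bundle over the dual atlas.\<close>

locale framed_bundle = smooth_manifold "base B"
  for B :: "('p, 'c::euclidean_space, 'w::real_vector, 'k::finite) vbundle" +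
  assumes frames_cover: "\<Union> (fst ` frames B) = points (base B)"
    and frame_open: "(U, s) \<in> frames B \<Longrightarrow> open_in (base B) U"
    and frame_basis: "(U, s) \<in> frames B \<Longrightarrow> x \<in> U \<Longrightarrow> basis_at s x (fibre B x)"
    and frame_smooth: "(U, s) \<in> frames B \<Longrightarrow> (V, t) \<in> frames B \<Longrightarrow>
      smooth_fun (base B) (U \<inter> V) (\<lambda>x. coeff s x j (t k x))"
begin

lemma point_frame:
  assumes "x \<in> points (base B)" obtains U s where "(U, s) \<in> frames B" "x \<in> U"
proof -
  have "x \<in> \<Union> (fst ` frames B)" using assms frames_cover by simp
  then show thesis using that by fastforce
qed

lemma subspace_fibre: "x \<in> points (base B) \<Longrightarrow> subspace (fibre B x)"
  by (erule point_frame) (blast intro: basis_at_subspace frame_basis)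

lemma sectionD: "smooth_section B W X \<Longrightarrow> x \<in> W \<Longrightarrow> X x \<in> fibre B x"
  by (auto simp: smooth_section_def)

lemma section_coeff: 
  "smooth_section B W X \<Longrightarrow> (U, s) \<in> frames B \<Longrightarrow> smooth_fun (base B) (U \<inter> W) (\<lambda>x. coeff s x k (X x))"
  by (auto simp: smooth_section_def)

lemma sectionI:
  "(\<And>x. x \<in> W \<Longrightarrow> X x \<in> fibre B x) \<Longrightarrow>
   (\<And>U s k. (U, s) \<in> frames B \<Longrightarrow> smooth_fun (base B) (U \<inter> W) (\<lambda>x. coeff s x k (X x))) \<Longrightarrow>
   smooth_section B W X"
  by (auto simp: smooth_section_def)

lemma section_subset: "smooth_section B W X \<Longrightarrow> V \<subseteq> W \<Longrightarrow> smooth_section B V X"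
  by (rule sectionI) (auto dest: sectionD intro: smooth_fun_subset[OF section_coeff])

lemma frame_section: "(U, s) \<in> frames B \<Longrightarrow> smooth_section B U (s k)"
  by (rule sectionI) (auto intro: basis_at_in frame_basis frame_smooth)

lemma section_cong:
  assumes "open_in (base B) W" "\<And>x. x \<in> W \<Longrightarrow> X x = Y x" "smooth_section B W X"
  shows "smooth_section B W Y"
proof (rule sectionI)
  show "smooth_fun (base B) (U \<inter> W) (\<lambda>x. coeff s x k (Y x))" if "(U, s) \<in> frames B" for U s k
    by (rule smooth_fun_cong[OF open_in_Int[OF frame_open[OF that] assms(1)] _ section_coeff[OF assms(3) that]])
       (simp add: assms(2))
qed (use assms sectionD in force)

lemma section_lincomb:
  assumes W: "open_in (base B) W" and f: "smooth_fun (base B) W f"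
    and X: "smooth_section B W X" and Y: "smooth_section B W Y"
  shows "smooth_section B W (\<lambda>x. f x *\<^sub>R X x + Y x)"
proof (rule sectionI)
  have sub: "subspace (fibre B x)" if "x \<in> W" for x
    using subspace_fibre open_in_subset_points[OF W] that by blast
  show "f x *\<^sub>R X x + Y x \<in> fibre B x" if "x \<in> W" for x
    using sub[OF that] sectionD[OF X that] sectionD[OF Y that] by (simp add: subspace_add subspace_scale)
  fix U s k assume s: "(U, s) \<in> frames B"
  have o: "open_in (base B) (U \<inter> W)" using frame_open[OF s] W by (rule open_in_Int)
  have "smooth_fun (base B) (U \<inter> W) (\<lambda>x. f x * coeff s x k (X x) + coeff s x k (Y x))"
    by (intro smooth_fun_add smooth_fun_mult o section_coeff[OF X s] section_coeff[OF Y s] smooth_fun_subset[OF f]) auto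
  then show "smooth_fun (base B) (U \<inter> W) (\<lambda>x. coeff s x k (f x *\<^sub>R X x + Y x))"
  proof (rule smooth_fun_cong[OF o, rotated])
    fix x assume x: "x \<in> U \<inter> W"
    have l: "lin_on (fibre B x) (coeff s x k)" using coeff_lin_on[OF frame_basis[OF s]] x by blast
    show "f x * coeff s x k (X x) + coeff s x k (Y x) = coeff s x k (f x *\<^sub>R X x + Y x)"
      using x sectionD[OF X, of x] sectionD[OF Y, of x] sub[of x]
      by (simp add: lin_on_add[OF l] lin_on_scale[OF l] subspace_scale)
  qed
qed

lemma section_zero: assumes "open_in (base B) W" shows "smooth_section B W (\<lambda>x. 0)"
proof (rule sectionI)
  have sub: "subspace (fibre B x)" if "x \<in> W" for x
    using subspace_fibre open_in_subset_points[OF assms] that by blast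
  show "0 \<in> fibre B x" if "x \<in> W" for x using sub[OF that] by (rule subspace_0)
  fix U s k assume s: "(U, s) \<in> frames B"
  show "smooth_fun (base B) (U \<inter> W) (\<lambda>x. coeff s x k 0)"
    using lin_on_zero[OF coeff_lin_on[OF frame_basis[OF s]] basis_at_subspace[OF frame_basis[OF s]]]
    by (intro smooth_fun_cong[OF open_in_Int[OF frame_open[OF s] assms] _ smooth_fun_const[of _ 0]]) simp
qed

lemma section_add:
  "open_in (base B) W \<Longrightarrow> smooth_section B W X \<Longrightarrow> smooth_section B W Y \<Longrightarrow>
   smooth_section B W (\<lambda>x. X x + Y x)"
  using section_lincomb[OF _ smooth_fun_const[of W 1]] by simp

lemma section_scale:
  "open_in (base B) W \<Longrightarrow> smooth_fun (base B) W f \<Longrightarrow> smooth_section B W X \<Longrightarrow>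
   smooth_section B W (\<lambda>x. f x *\<^sub>R X x)"
  using section_lincomb[OF _ _ _ section_zero] by simp

lemma section_sum:
  "open_in (base B) W \<Longrightarrow> (\<And>i. i \<in> I \<Longrightarrow> smooth_section B W (X i)) \<Longrightarrow>
   smooth_section B W (\<lambda>x. \<Sum>i\<in>I. X i x)"
  by (induction I rule: infinite_finite_induct) (auto simp: section_zero intro: section_add)

lemma section_local:
  assumes "\<And>x. x \<in> W \<Longrightarrow> \<exists>V. open_in (base B) V \<and> x \<in> V \<and> smooth_section B V X"
  shows "smooth_section B W X"
proof (rule sectionI)
  show "X x \<in> fibre B x" if "x \<in> W" for x using assms[OF that] sectionD by blast
  fix U s k assume s: "(U, s) \<in> frames B"
  show "smooth_fun (base B) (U \<inter> W) (\<lambda>x. coeff s x k (X x))"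
  proof (rule smooth_fun_local)
    fix x assume x: "x \<in> U \<inter> W"
    then obtain V where V: "open_in (base B) V" "x \<in> V" "smooth_section B V X" using assms by blast
    then show "\<exists>V. open_in (base B) V \<and> x \<in> V \<and> smooth_fun (base B) V (\<lambda>x. coeff s x k (X x))"
      using x by (intro exI[of _ "U \<inter> V"]) (auto intro: open_in_Int frame_open[OF s] section_coeff[OF _ s])
  qed
qed

text \<open>Intended for adapted frames, which need not be among the frames listed in
  \<open>frames B\<close>.\<close>

definition local_frame :: "'p set \<Rightarrow> ('k \<Rightarrow> 'p \<Rightarrow> 'w) \<Rightarrow> bool"
  where "local_frame U \<delta> \<longleftrightarrow> open_in (base B) U \<and> (\<forall>x\<in>U. basis_at \<delta> x (fibre B x)) \<and>
    (\<forall>k. smooth_section B U (\<delta> k))"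

text \<open>The matrix \<open>M\<close> of \<open>\<delta>\<close> in a frame of the bundle is
  smooth and invertible. Coefficients with respect to \<open>\<delta>\<close> arise from those in
  the bundle frame by applying the inverse of \<open>M\<close>, which is smooth by Cramer's
  rule.\<close>

lemma local_frame_coeff:
  assumes U: "local_frame U \<delta>" and W: "open_in (base B) W" and X: "smooth_section B W X"
  shows "smooth_fun (base B) (U \<inter> W) (\<lambda>x. coeff \<delta> x k (X x))"
proof (rule smooth_fun_local)
  fix x assume x: "x \<in> U \<inter> W"
  then have "x \<in> points (base B)" using open_in_subset_points[OF W] by blast
  then obtain V s where s: "(V, s) \<in> frames B" "x \<in> V" by (rule point_frame)
  let ?N = "V \<inter> (U \<inter> W)"
  have N: "open_in (base B) ?N" using U W frame_open[OF s(1)] by (auto simp: local_frame_def intro: open_in_Int)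
  define M :: "'p \<Rightarrow> real^'k^'k" where "M = (\<lambda>x. \<chi> i j. coeff s x i (\<delta> j x))"
  have bs: "basis_at s y (fibre B y)" and bd: "basis_at \<delta> y (fibre B y)" if "y \<in> ?N" for y
    using frame_basis[OF s(1)] U that by (auto simp: local_frame_def)
  have inv: "invertible (M y)" if y: "y \<in> ?N" for y
  proof -
    have "(\<Sum>k\<in>UNIV. coeff s y i (\<delta> k y) * coeff \<delta> y k (s j y)) = (if i = j then 1 else 0)" for i j
      using coeff_change[OF bs[OF y] bd[OF y] basis_at_in[OF bs[OF y]], of i j] coeff_basis[OF bs[OF y]] by simp
    moreover have "(\<Sum>k\<in>UNIV. coeff \<delta> y i (s k y) * coeff s y k (\<delta> j y)) = (if i = j then 1 else 0)" for i j
      using coeff_change[OF bd[OF y] bs[OF y] basis_at_in[OF bd[OF y]], of i j] coeff_basis[OF bd[OF y]] by simp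
    ultimately show ?thesis
      unfolding invertible_def M_def
      by (intro exI[of _ "\<chi> i j. coeff \<delta> y i (s j y)"]) (simp add: matrix_matrix_mult_def mat_def)
  qed
  have "smooth_fun (base B) ?N (\<lambda>y. \<Sum>j\<in>UNIV. matrix_inv (M y) $ k $ j * coeff s y j (X y))"
  proof (intro smooth_fun_sum smooth_fun_mult N smooth_matrix_inv inv)
    show "smooth_fun (base B) ?N (\<lambda>y. M y $ i $ j)" for i j
      using section_coeff[of U "\<delta> j" V s i] U s
      by (auto simp: M_def local_frame_def intro: smooth_fun_subset)
    show "smooth_fun (base B) ?N (\<lambda>y. coeff s y j (X y))" for j
      using section_coeff[OF X s(1)] by (rule smooth_fun_subset) auto
  qed
  moreover have "(\<Sum>j\<in>UNIV. matrix_inv (M y) $ k $ j * coeff s y j (X y)) = coeff \<delta> y k (X y)" if y: "y \<in> ?N" for y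
  proof -
    have "M y *v (\<chi> j. coeff \<delta> y j (X y)) = (\<chi> j. coeff s y j (X y))"
      using coeff_change[OF bs[OF y] bd[OF y] sectionD[OF X]] y
      by (simp add: M_def matrix_vector_mult_def vec_eq_iff)
    then have "matrix_inv (M y) *v (\<chi> j. coeff s y j (X y)) = matrix_inv (M y) *v (M y *v (\<chi> j. coeff \<delta> y j (X y)))"
      by simp
    also have "\<dots> = (\<chi> j. coeff \<delta> y j (X y))"
      using matrix_inv_left[OF inv[OF y]] by (simp add: matrix_vector_mul_assoc)
    finally show ?thesis by (simp add: matrix_vector_mult_def vec_eq_iff)
  qed
  ultimately have "smooth_fun (base B) ?N (\<lambda>y. coeff \<delta> y k (X y))"
    using smooth_fun_cong[OF N, of "\<lambda>y. \<Sum>j\<in>UNIV. matrix_inv (M y) $ k $ j * coeff s y j (X y)"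
        "\<lambda>y. coeff \<delta> y k (X y)"] by simp
  then show "\<exists>V. open_in (base B) V \<and> x \<in> V \<and> smooth_fun (base B) V (\<lambda>y. coeff \<delta> y k (X y))"
    using N x s by blast
qed

end

lemma vector_bundle_framed: 
  assumes "vector_bundle B" shows "framed_bundle B"
proof
  show "smooth_atlas (base B)" "\<Union> (fst ` frames B) = points (base B)"
    using assms by (auto simp: vector_bundle_def manifold_def)
  show "open_in (base B) U" if "(U, s) \<in> frames B" for U s
    using assms that by (auto simp: vector_bundle_def)
  show "basis_at s x (fibre B x)" if "(U, s) \<in> frames B" "x \<in> U" for U s x
  proof -
    have "\<forall>p\<in>frames B. \<forall>x\<in>fst p. basis_at (snd p) x (fibre B x)"
      using assms by (simp add: vector_bundle_def basis_at_def split_beta)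
    then show ?thesis using that by fastforce
  qed
  show "smooth_fun (base B) (U \<inter> V) (\<lambda>x. coeff s x j (t k x))"
    if "(U, s) \<in> frames B" "(V, t) \<in> frames B" for U s V t j k
  proof -
    have *: "\<forall>p\<in>frames B. \<forall>q\<in>frames B. \<forall>j k.
        smooth_fun (base B) (fst p \<inter> fst q) (\<lambda>x. coeff (snd p) x j (snd q k x))"
      using assms by (simp add: vector_bundle_def split_beta)
    show ?thesis using bspec[OF bspec[OF * that(1)] that(2)] by simp
  qed
qed

section \<open>Tensors and their derivations\<close>

definition slots :: "nat \<Rightarrow> nat \<Rightarrow> 'w::real_vector set \<Rightarrow> ('w \<Rightarrow> real) list \<Rightarrow> 'w list \<Rightarrow> bool"
  where "slots r q F ws vs \<longleftrightarrow> length ws = r \<and> set ws \<subseteq> dual_space F \<and> length vs = q \<and> set vs \<subseteq> F"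

lemma tensor_at_iff: "tensor_at r q F T \<longleftrightarrow> (\<forall>ws vs.
    if slots r q F ws vs
    then (\<forall>i<r. \<forall>\<omega>\<in>dual_space F. \<forall>\<eta>\<in>dual_space F. \<forall>c.
            T (ws[i := c *\<^sub>R \<omega> + \<eta>]) vs = c * T (ws[i := \<omega>]) vs + T (ws[i := \<eta>]) vs) \<and>
         (\<forall>j<q. \<forall>v\<in>F. \<forall>w\<in>F. \<forall>c.
            T ws (vs[j := c *\<^sub>R v + w]) = c * T ws (vs[j := v]) + T ws (vs[j := w]))
    else T ws vs = 0)"
  by (simp add: tensor_at_def slots_def)

lemma tensor_at_outside: "tensor_at r q F T \<Longrightarrow> \<not> slots r q F ws vs \<Longrightarrow> T ws vs = 0"
  by (simp add: tensor_at_iff split: if_splits)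

lemma tensor_at_cov:
  assumes "tensor_at r q F T" "slots r q F ws vs" "i < r" "\<omega> \<in> dual_space F" "\<eta> \<in> dual_space F"
  shows "T (ws[i := c *\<^sub>R \<omega> + \<eta>]) vs = c * T (ws[i := \<omega>]) vs + T (ws[i := \<eta>]) vs"
  using spec[OF spec[OF assms(1)[unfolded tensor_at_iff], of ws], of vs] assms(2-) by simp

lemma tensor_at_vec:
  assumes "tensor_at r q F T" "slots r q F ws vs" "j < q" "v \<in> F" "w \<in> F"
  shows "T ws (vs[j := c *\<^sub>R v + w]) = c * T ws (vs[j := v]) + T ws (vs[j := w])"
  using spec[OF spec[OF assms(1)[unfolded tensor_at_iff], of ws], of vs] assms(2-) by simp

lemma tensor_atI:
  assumes "\<And>ws vs. \<not> slots r q F ws vs \<Longrightarrow> T ws vs = 0"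
    and "\<And>ws vs i \<omega> \<eta> c. slots r q F ws vs \<Longrightarrow> i < r \<Longrightarrow> \<omega> \<in> dual_space F \<Longrightarrow> \<eta> \<in> dual_space F \<Longrightarrow>
      T (ws[i := c *\<^sub>R \<omega> + \<eta>]) vs = c * T (ws[i := \<omega>]) vs + T (ws[i := \<eta>]) vs"
    and "\<And>ws vs j v w c. slots r q F ws vs \<Longrightarrow> j < q \<Longrightarrow> v \<in> F \<Longrightarrow> w \<in> F \<Longrightarrow>
      T ws (vs[j := c *\<^sub>R v + w]) = c * T ws (vs[j := v]) + T ws (vs[j := w])"
  shows "tensor_at r q F T"
  unfolding tensor_at_iff by (auto simp: assms)

lemma slots_cov: "slots r q F ws vs \<Longrightarrow> \<omega> \<in> dual_space F \<Longrightarrow> slots r q F (ws[i := \<omega>]) vs"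
  unfolding slots_def using set_update_subset_insert by fastforce

lemma slots_vec: "slots r q F ws vs \<Longrightarrow> v \<in> F \<Longrightarrow> slots r q F ws (vs[i := v])"
  unfolding slots_def using set_update_subset_insert by fastforce

lemma tensor_at_cov_lin:
  assumes "tensor_at r q F T" "slots r q F ws vs" "i < r"
  shows "lin_on (dual_space F) (\<lambda>\<omega>. T (ws[i := \<omega>]) vs)"
proof -
  have 0: "0 \<in> dual_space F" by (rule subspace_0[OF subspace_dual_space])
  have "T (ws[i := 0]) vs = 0"
    using tensor_at_cov[OF assms 0 0, of 1] by simp
  then show ?thesis
    using tensor_at_cov[OF assms, of _ _ 1] tensor_at_cov[OF assms _ 0]
    by (simp add: lin_on_def)
qed

lemma tensor_at_vec_lin:
  assumes "tensor_at r q F T" "slots r q F ws vs" "j < q" "subspace F"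
  shows "lin_on F (\<lambda>v. T ws (vs[j := v]))"
proof -
  have 0: "0 \<in> F" by (rule subspace_0[OF assms(4)])
  have "T ws (vs[j := 0]) = 0"
    using tensor_at_vec[OF assms(1-3) 0 0, of 1] by simp
  then show ?thesis
    using tensor_at_vec[OF assms(1-3), of _ _ 1] tensor_at_vec[OF assms(1-3) _ 0]
    by (simp add: lin_on_def)
qed

lemma tensor_at_prod:
  assumes T: "tensor_at r q F T" and S: "tensor_at r' q' F S"
  shows "tensor_at (r + r') (q + q') F (tensor_prod r q T S)"
proof (rule tensor_atI)
  have sl: "slots r q F (take r ws) (take q vs)" "slots r' q' F (drop r ws) (drop q vs)"
    if "slots (r + r') (q + q') F ws vs" for ws vs
    using that by (auto simp: slots_def dest: in_set_takeD in_set_dropD)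
  show "tensor_prod r q T S ws vs = 0" if n: "\<not> slots (r + r') (q + q') F ws vs" for ws vs
  proof (rule ccontr)
    assume "tensor_prod r q T S ws vs \<noteq> 0"
    then have "slots r q F (take r ws) (take q vs)" "slots r' q' F (drop r ws) (drop q vs)"
      using tensor_at_outside[OF T] tensor_at_outside[OF S] by (auto simp: tensor_prod_def)
    moreover have "set ws = set (take r ws) \<union> set (drop r ws)" "set vs = set (take q vs) \<union> set (drop q vs)"
      by (metis append_take_drop_id set_append)+
    ultimately show False using n by (auto simp: slots_def)
  qed
  show "tensor_prod r q T S (ws[i := c *\<^sub>R \<omega> + \<eta>]) vs =
      c * tensor_prod r q T S (ws[i := \<omega>]) vs + tensor_prod r q T S (ws[i := \<eta>]) vs"
    if "slots (r + r') (q + q') F ws vs" "i < r + r'" "\<omega> \<in> dual_space F" "\<eta> \<in> dual_space F" for ws vs i \<omega> \<eta> c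
  proof (cases "i < r")
    case True
    then show ?thesis
      using tensor_at_cov[OF T sl(1)[OF that(1)] True that(3,4)]
      by (simp add: tensor_prod_def take_update_swap algebra_simps)
  next
    case False
    then show ?thesis
      using tensor_at_cov[OF S sl(2)[OF that(1)] _ that(3,4), of "i - r"] that(2)
      by (simp add: tensor_prod_def drop_update_swap algebra_simps)
  qed
  show "tensor_prod r q T S ws (vs[i := c *\<^sub>R v + w]) =
      c * tensor_prod r q T S ws (vs[i := v]) + tensor_prod r q T S ws (vs[i := w])"
    if "slots (r + r') (q + q') F ws vs" "i < q + q'" "v \<in> F" "w \<in> F" for ws vs i v w c
  proof (cases "i < q")
    case True
    then show ?thesis
      using tensor_at_vec[OF T sl(1)[OF that(1)] True that(3,4)]
      by (simp add: tensor_prod_def take_update_swap algebra_simps)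
  next
    case False
    then show ?thesis
      using tensor_at_vec[OF S sl(2)[OF that(1)] _ that(3,4), of "i - q"] that(2)
      by (simp add: tensor_prod_def drop_update_swap algebra_simps)
  qed
qed

lemma dual_space_lincomb: "\<omega> \<in> dual_space F \<Longrightarrow> \<eta> \<in> dual_space F \<Longrightarrow> c *\<^sub>R \<omega> + \<eta> \<in> dual_space F"
  by (intro subspace_add subspace_scale subspace_dual_space)

lemma tensor_at_vec_tensor: "v \<in> F \<Longrightarrow> tensor_at 1 0 F (vec_tensor F v)"
proof (rule tensor_atI)
  show "vec_tensor F v ws vs = 0" if "\<not> slots 1 0 F ws vs" for ws vs
    using that by (auto simp: vec_tensor_def slots_def)
  show "vec_tensor F v (ws[i := c *\<^sub>R \<omega> + \<eta>]) vs =
      c * vec_tensor F v (ws[i := \<omega>]) vs + vec_tensor F v (ws[i := \<eta>]) vs"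
    if "slots 1 0 F ws vs" "i < 1" "\<omega> \<in> dual_space F" "\<eta> \<in> dual_space F" for ws vs i \<omega> \<eta> c
  proof -
    have "c *\<^sub>R \<omega> + \<eta> \<in> dual_space F"
      using that by (intro dual_space_lincomb)
    then show ?thesis
      using that by (auto simp: vec_tensor_def slots_def length_Suc_conv scaleR_fun_def)
  qed
qed auto

lemma tensor_at_fun_tensor: "tensor_at 0 0 F (fun_tensor c)"
  by (rule tensor_atI) (auto simp: fun_tensor_def slots_def)

text \<open>The value 0 outside \<open>F\<close> is what keeps the composite of a covector with
  \<open>A\<close> inside \<open>dual_space F\<close>.\<close>

definition endo :: "'w::real_vector set \<Rightarrow> ('w \<Rightarrow> 'w) \<Rightarrow> bool"
  where "endo F A \<longleftrightarrow> lin_on F A \<and> (\<forall>v\<in>F. A v \<in> F) \<and> (\<forall>v. v \<notin> F \<longrightarrow> A v = 0)"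

text \<open>The derivation of the tensor algebra that kills functions and is \<open>A\<close> on vectors.\<close>

definition act :: "'w::real_vector set \<Rightarrow> ('w \<Rightarrow> 'w) \<Rightarrow> 'w tensor \<Rightarrow> 'w tensor"
  where "act F A T ws vs = (if set ws \<subseteq> dual_space F \<and> set vs \<subseteq> F then
      (\<Sum>i<length ws. T (ws[i := ws ! i \<circ> A]) vs) - (\<Sum>j<length vs. T ws (vs[j := A (vs ! j)])) else 0)"

lemma endo_dual:
  assumes "endo F A" "\<omega> \<in> dual_space F" "subspace F" shows "\<omega> \<circ> A \<in> dual_space F"
proof -
  have "\<omega> 0 = 0" using lin_on_zero[of F \<omega>] assms by (simp add: dual_space_iff)
  then show ?thesis using assms by (auto simp: endo_def dual_space_iff lin_on_def)
qed

lemma act_outside: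
  assumes T: "tensor_at r q F T" and n: "\<not> slots r q F ws vs"
  shows "act F A T ws vs = 0"
proof (cases "set ws \<subseteq> dual_space F \<and> set vs \<subseteq> F")
  case True
  then have "length ws \<noteq> r \<or> length vs \<noteq> q" using n by (auto simp: slots_def)
  then have "T (ws[i := x]) vs = 0" "T ws (vs[j := y]) = 0" for i j x y
    by (intro tensor_at_outside[OF T]; auto simp: slots_def)+
  then show ?thesis by (simp add: act_def)
qed (auto simp: act_def)

lemma act_slots:
  "slots r q F ws vs \<Longrightarrow> act F A T ws vs =
     (\<Sum>i<r. T (ws[i := ws ! i \<circ> A]) vs) - (\<Sum>j<q. T ws (vs[j := A (vs ! j)]))"
  by (auto simp: act_def slots_def)

lemma slots_nth: "slots r q F ws vs \<Longrightarrow> i < r \<Longrightarrow> ws ! i \<in> dual_space F"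
  "slots r q F ws vs \<Longrightarrow> j < q \<Longrightarrow> vs ! j \<in> F"
  by (auto simp: slots_def)

lemma comp_lincomb: "(c *\<^sub>R \<omega> + \<eta>) \<circ> A = c *\<^sub>R (\<omega> \<circ> A) + (\<eta> \<circ> A)" for \<omega> \<eta> :: "'w \<Rightarrow> real"
  by (auto simp: scaleR_fun_def)

text \<open>In every summand the slot altered by \<open>A\<close> is either the slot whose linearity
  is tested, where linearity of \<open>A\<close> or of composition with \<open>A\<close> is used, or
  a different one, where the two list updates commute.\<close>

lemma tensor_at_act:
  assumes T: "tensor_at r q F T" and A: "endo F A" and F: "subspace F"
  shows "tensor_at r q F (act F A T)"
proof (rule tensor_atI)
  fix ws vs i \<omega> \<eta> and c :: real
  assume s: "slots r q F ws vs" and i: "i < r" and \<omega>: "\<omega> \<in> dual_space F" and \<eta>: "\<eta> \<in> dual_space F"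
  have lc: "c *\<^sub>R \<omega> + \<eta> \<in> dual_space F"
    using \<omega> \<eta> by (rule dual_space_lincomb)
  have A\<omega>: "\<omega> \<circ> A \<in> dual_space F" "\<eta> \<circ> A \<in> dual_space F" using endo_dual[OF A _ F] \<omega> \<eta> by auto
  have len: "length ws = r" using s by (simp add: slots_def)
  have 1: "T (ws[i := c *\<^sub>R \<omega> + \<eta>, a := ws[i := c *\<^sub>R \<omega> + \<eta>] ! a \<circ> A]) vs =
      c * T (ws[i := \<omega>, a := ws[i := \<omega>] ! a \<circ> A]) vs + T (ws[i := \<eta>, a := ws[i := \<eta>] ! a \<circ> A]) vs" if a: "a < r" for a
  proof (cases "a = i")
    case True
    then show ?thesis using tensor_at_cov[OF T s i A\<omega>] len i by (simp add: comp_lincomb)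
  next
    case False
    have "slots r q F (ws[a := ws ! a \<circ> A]) vs"
      using s a by (intro slots_cov endo_dual[OF A _ F] slots_nth)
    from tensor_at_cov[OF T this i \<omega> \<eta>] show ?thesis
      using False by (simp add: list_update_swap[of i a])
  qed
  have 2: "T (ws[i := c *\<^sub>R \<omega> + \<eta>]) (vs[b := A (vs ! b)]) =
      c * T (ws[i := \<omega>]) (vs[b := A (vs ! b)]) + T (ws[i := \<eta>]) (vs[b := A (vs ! b)])" if b: "b < q" for b
    using A b s i \<omega> \<eta> slots_nth(2)[OF s b] by (intro tensor_at_cov[OF T] slots_vec) (auto simp: endo_def)
  show "act F A T (ws[i := c *\<^sub>R \<omega> + \<eta>]) vs = c * act F A T (ws[i := \<omega>]) vs + act F A T (ws[i := \<eta>]) vs"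
    unfolding act_slots[OF slots_cov[OF s lc]] act_slots[OF slots_cov[OF s \<omega>]] act_slots[OF slots_cov[OF s \<eta>]]
    using 1 2 by (simp add: sum.distrib sum_distrib_left algebra_simps)
next
  fix ws vs j v w and c :: real
  assume s: "slots r q F ws vs" and j: "j < q" and v: "v \<in> F" and w: "w \<in> F"
  have lc: "c *\<^sub>R v + w \<in> F" using v w F by (simp add: subspace_add subspace_scale)
  have Av: "A v \<in> F" "A w \<in> F" using A v w by (auto simp: endo_def)
  have Alc: "A (c *\<^sub>R v + w) = c *\<^sub>R A v + A w"
    using A v w F by (simp add: endo_def lin_on_def subspace_scale)
  have len: "length vs = q" using s by (simp add: slots_def)
  have 1: "T ws (vs[j := c *\<^sub>R v + w, a := A (vs[j := c *\<^sub>R v + w] ! a)]) =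
      c * T ws (vs[j := v, a := A (vs[j := v] ! a)]) + T ws (vs[j := w, a := A (vs[j := w] ! a)])" if a: "a < q" for a
  proof (cases "a = j")
    case True
    then show ?thesis using tensor_at_vec[OF T s j Av] len j by (simp add: Alc)
  next
    case False
    have "slots r q F ws (vs[a := A (vs ! a)])"
      using s a A slots_nth(2)[OF s a] by (intro slots_vec) (auto simp: endo_def)
    from tensor_at_vec[OF T this j v w] show ?thesis
      using False by (simp add: list_update_swap[of j a])
  qed
  have 2: "T (ws[b := ws ! b \<circ> A]) (vs[j := c *\<^sub>R v + w]) =
      c * T (ws[b := ws ! b \<circ> A]) (vs[j := v]) + T (ws[b := ws ! b \<circ> A]) (vs[j := w])" if b: "b < r" for b
    using b s j v w by (intro tensor_at_vec[OF T] slots_cov endo_dual[OF A _ F] slots_nth)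
  show "act F A T ws (vs[j := c *\<^sub>R v + w]) = c * act F A T ws (vs[j := v]) + act F A T ws (vs[j := w])"
    unfolding act_slots[OF slots_vec[OF s lc]] act_slots[OF slots_vec[OF s v]] act_slots[OF slots_vec[OF s w]]
    using 1 2 by (simp add: sum.distrib sum_distrib_left algebra_simps)
qed (rule act_outside[OF T])

text \<open>Linearity in the endomorphism; it will make the modified derivative linear over
  functions in its direction.\<close>

lemma act_endo_lincomb:
  assumes T: "tensor_at r q F T" and A: "endo F A" "endo F A'" and F: "subspace F"
    and A'': "\<And>v. A'' v = c *\<^sub>R A v + A' v"
  shows "act F A'' T = c *\<^sub>R act F A T + act F A' T"
proof (intro ext)
  fix ws vs
  show "act F A'' T ws vs = (c *\<^sub>R act F A T + act F A' T) ws vs"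
  proof (cases "slots r q F ws vs")
    case True
    have 1: "T (ws[i := ws ! i \<circ> A'']) vs = c * T (ws[i := ws ! i \<circ> A]) vs + T (ws[i := ws ! i \<circ> A']) vs" if "i < r" for i
    proof -
      have \<omega>: "ws ! i \<in> dual_space F" using slots_nth(1)[OF True that] .
      have "ws ! i \<circ> A'' = c *\<^sub>R (ws ! i \<circ> A) + (ws ! i \<circ> A')"
      proof
        fix v
        have "(ws ! i) 0 = 0" using lin_on_zero[of F "ws ! i"] \<omega> F by (simp add: dual_space_iff)
        then show "(ws ! i \<circ> A'') v = (c *\<^sub>R (ws ! i \<circ> A) + (ws ! i \<circ> A')) v"
          using \<omega> A F by (cases "v \<in> F") (auto simp: A'' dual_space_iff lin_on_def endo_def scaleR_fun_def subspace_scale)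
      qed
      then show ?thesis
        using tensor_at_cov[OF T True that] endo_dual[OF A(1) \<omega> F] endo_dual[OF A(2) \<omega> F] by simp
    qed
    have 2: "T ws (vs[j := A'' (vs ! j)]) = c * T ws (vs[j := A (vs ! j)]) + T ws (vs[j := A' (vs ! j)])" if "j < q" for j
      using tensor_at_vec[OF T True that] slots_nth(2)[OF True that] A by (simp add: A'' endo_def)
    show ?thesis
      using 1 2 by (simp add: act_slots[OF True] scaleR_fun_def sum.distrib sum_distrib_left algebra_simps)
  next
    case False
    then show ?thesis by (simp add: act_outside[OF T] scaleR_fun_def)
  qed
qed

lemma act_add: "act F A (T + S) = act F A T + act F A S"
  by (auto simp: act_def fun_eq_iff sum.distrib)

lemma act_fun_tensor: "act F A (fun_tensor c) = 0"
  by (auto simp: act_def fun_eq_iff fun_tensor_def intro!: sum.neutral)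

lemma act_vec_tensor:
  assumes A: "endo F A" and v: "v \<in> F" and F: "subspace F"
  shows "act F A (vec_tensor F v) = vec_tensor F (A v)"
proof (intro ext)
  fix ws vs
  show "act F A (vec_tensor F v) ws vs = vec_tensor F (A v) ws vs"
  proof (cases "slots 1 0 F ws vs")
    case True
    then obtain \<omega> where "ws = [\<omega>]" "vs = []" "\<omega> \<in> dual_space F"
      by (auto simp: slots_def length_Suc_conv)
    then show ?thesis using endo_dual[OF A _ F] by (auto simp: act_def vec_tensor_def)
  next
    case False
    moreover have "A v \<in> F" using A v by (simp add: endo_def)
    ultimately show ?thesis
      using act_outside[OF tensor_at_vec_tensor[OF v] False]
        tensor_at_outside[OF tensor_at_vec_tensor[OF \<open>A v \<in> F\<close>] False] by simp
  qed
qed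

lemma act_02:
  assumes "v \<in> F" "w \<in> F"
  shows "act F A G [] [v, w] = - G [] [A v, w] - G [] [v, A w]"
  using assms by (simp add: act_def)

lemma act_prod:
  assumes T: "tensor_at r q F T" and S: "tensor_at r' q' F S"
    and A: "endo F A" and F: "subspace F"
  shows "act F A (tensor_prod r q T S) = tensor_prod r q (act F A T) S + tensor_prod r q T (act F A S)"
proof (intro ext)
  fix ws vs
  let ?P = "tensor_prod r q T S"
  show "act F A ?P ws vs = (tensor_prod r q (act F A T) S + tensor_prod r q T (act F A S)) ws vs"
  proof (cases "slots (r + r') (q + q') F ws vs")
    case True
    have s1: "slots r q F (take r ws) (take q vs)" and s2: "slots r' q' F (drop r ws) (drop q vs)"
      using True by (auto simp: slots_def dest: in_set_takeD in_set_dropD)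
    have len: "length ws = r + r'" "length vs = q + q'" using True by (auto simp: slots_def)
    have split: "(\<Sum>i<m + n. f i) = (\<Sum>i<m. f i) + (\<Sum>i<n. f (m + i))" for f :: "nat \<Rightarrow> real" and m n
      by (induction n) (auto simp: algebra_simps)
    have "act F A ?P ws vs =
        (\<Sum>i<r. T ((take r ws)[i := take r ws ! i \<circ> A]) (take q vs) * S (drop r ws) (drop q vs))
        + (\<Sum>i<r'. T (take r ws) (take q vs) * S ((drop r ws)[i := drop r ws ! i \<circ> A]) (drop q vs))
        - (\<Sum>j<q. T (take r ws) ((take q vs)[j := A (take q vs ! j)]) * S (drop r ws) (drop q vs))
        - (\<Sum>j<q'. T (take r ws) (take q vs) * S (drop r ws) ((drop q vs)[j := A (drop q vs ! j)]))"
      unfolding act_slots[OF True] split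
      by (simp add: tensor_prod_def take_update_swap drop_update_swap len list_update_beyond)
    then show ?thesis
      by (simp add: tensor_prod_def act_slots[OF s1] act_slots[OF s2] sum_distrib_left sum_distrib_right algebra_simps)
  next
    case False
    then show ?thesis
      using act_outside[OF tensor_at_prod[OF T S] False]
        tensor_at_outside[OF tensor_at_prod[OF tensor_at_act[OF T A F] S] False]
        tensor_at_outside[OF tensor_at_prod[OF T tensor_at_act[OF S A F]] False] by simp
  qed
qed

abbreviation insert_at :: "nat \<Rightarrow> 'b \<Rightarrow> 'b list \<Rightarrow> 'b list"
  where "insert_at i x xs \<equiv> take i xs @ x # drop i xs"

text \<open>In a sum over the slots of a list with one inserted entry, the term of the inserted slot
  is split off. In \<open>act_contract\<close> this isolates the terms in which the contracted pair
  is touched.\<close>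

lemma sum_insert_at:
  fixes f :: "'b list \<Rightarrow> real"
  assumes "i \<le> length xs"
  shows "(\<Sum>a<Suc (length xs). f ((insert_at i x xs)[a := g (insert_at i x xs ! a)])) =
    f (insert_at i (g x) xs) + (\<Sum>a<length xs. f (insert_at i x (xs[a := g (xs ! a)])))"
proof -
  let ?h = "\<lambda>a. f ((insert_at i x xs)[a := g (insert_at i x xs ! a)])"
  have "(\<Sum>a<Suc (length xs). ?h a) = ?h i + (\<Sum>a\<in>{..<Suc (length xs)} - {i}. ?h a)"
    using assms by (intro sum.remove) auto
  also have "(\<Sum>a\<in>{..<Suc (length xs)} - {i}. ?h a) =
      (\<Sum>a<length xs. f (insert_at i x (xs[a := g (xs ! a)])))"
  \<comment> \<open>Removing the inserted slot leaves the positions before \<open>i\<close>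
    unchanged and lowers the later ones by one.\<close>
  proof (rule sum.reindex_bij_witness[where i = "\<lambda>a. if a < i then a else Suc a" and j = "\<lambda>a. if a < i then a else a - 1"])
    fix a assume "a \<in> {..<Suc (length xs)} - {i}"
    then have a: "a < Suc (length xs)" "a \<noteq> i" by auto
    show "f (insert_at i x (xs[if a < i then a else a - 1 := g (xs ! (if a < i then a else a - 1))])) = ?h a"
    proof (cases "a < i")
      case True
      then show ?thesis using assms by (simp add: nth_append list_update_append take_update_swap)
    next
      case False
      then obtain b where b: "a = Suc b" "i \<le> b" using a by (cases a) auto
      then have "insert_at i x xs ! a = xs ! b"
        using assms a by (simp add: nth_append Suc_diff_le)
      moreover have "(insert_at i x xs)[a := y] = insert_at i x (xs[b := y])" for y
        using assms a b by (simp add: list_update_append Suc_diff_le drop_update_swap)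
      ultimately show ?thesis using b by simp
    qed
  qed (use assms in \<open>auto split: if_splits\<close>)
  also have "?h i = f (insert_at i (g x) xs)"
    using assms by (simp add: nth_append list_update_append)
  finally show ?thesis .
qed

lemma insert_at_update: "i \<le> length xs \<Longrightarrow> (insert_at i x xs)[i := y] = insert_at i y xs"
  by (simp add: list_update_append)

text \<open>The terms in which \<open>A\<close> hits the contracted covector and those in which it
  hits the contracted vector have opposite signs and cancel: expanded in the frame, both are the
  same double sum of matrix entries of \<open>A\<close> times components of \<open>T\<close>, with
  the two summation indices exchanged.\<close>

lemma act_contract:
  fixes s :: "'k::finite \<Rightarrow> 'q \<Rightarrow> 'w::real_vector"
  assumes T: "tensor_at r q F T" and A: "endo F A" and s: "basis_at s u F" and ij: "i < r" "j < q"
  shows "act F A (contract s i j u T) = contract s i j u (act F A T)"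
proof (intro ext)
  fix ws vs
  have F: "subspace F" using s by (rule basis_at_subspace)
  show "act F A (contract s i j u T) ws vs = contract s i j u (act F A T) ws vs"
  \<comment> \<open>A contraction leaves one argument fewer of each kind; the truncated subtraction
    is exact because \<open>i < r\<close> and \<open>j < q\<close>.\<close>
  proof (cases "slots (r - 1) (q - 1) F ws vs")
    case True
    let ?w = "\<lambda>\<omega>. insert_at i \<omega> ws" and ?v = "\<lambda>v. insert_at j v vs"
    have len: "length ws = r - 1" "length vs = q - 1" "i \<le> length ws" "j \<le> length vs"
       "Suc (length ws) = r" "Suc (length vs) = q"
      using True ij by (auto simp: slots_def)
    have sl: "slots r q F (?w \<omega>) (?v v)" if "\<omega> \<in> dual_space F" "v \<in> F" for \<omega> v
      using True that ij by (auto simp: slots_def dest: in_set_takeD in_set_dropD)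
    have slk: "slots r q F (?w (coeff s u k)) (?v (s k u))" for k
      by (intro sl coeff_in_dual[OF s] basis_at_in[OF s])
    have As: "A (s k u) \<in> F" for k using A basis_at_in[OF s] by (auto simp: endo_def)
    have 1: "T (?w (coeff s u k \<circ> A)) (?v (s k u)) =
        (\<Sum>l\<in>UNIV. coeff s u k (A (s l u)) * T (?w (coeff s u l)) (?v (s k u)))" for k
    proof -
      have lin: "lin_on (dual_space F) (\<lambda>\<omega>. T (?w \<omega>) (?v (s k u)))"
        using tensor_at_cov_lin[OF T slk[of k] ij(1)] by (simp only: insert_at_update[OF len(3)])
      have "coeff s u k \<circ> A = (\<Sum>l\<in>UNIV. coeff s u k (A (s l u)) *\<^sub>R coeff s u l)"
        using dual_expand[OF s endo_dual[OF A coeff_in_dual[OF s] F]] by simp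
      then have "T (?w (coeff s u k \<circ> A)) (?v (s k u)) =
         (\<Sum>l\<in>UNIV. T (?w (coeff s u k (A (s l u)) *\<^sub>R coeff s u l)) (?v (s k u)))"
        using lin_on_sum[OF lin subspace_dual_space, of UNIV "\<lambda>l. coeff s u k (A (s l u)) *\<^sub>R coeff s u l"]
        by (simp add: subspace_scale[OF subspace_dual_space] coeff_in_dual[OF s])
      then show ?thesis using lin_on_scale[OF lin coeff_in_dual[OF s]] by simp
    qed
    have 2: "T (?w (coeff s u k)) (?v (A (s k u))) =
        (\<Sum>l\<in>UNIV. coeff s u l (A (s k u)) * T (?w (coeff s u k)) (?v (s l u)))" for k
    proof -
      have lin: "lin_on F (\<lambda>v. T (?w (coeff s u k)) (?v v))"
        using tensor_at_vec_lin[OF T slk[of k] ij(2) F] by (simp only: insert_at_update[OF len(4)])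
      show ?thesis using lin_on_expand[OF s lin As[of k]] by simp
    qed
    have "(\<Sum>k\<in>UNIV. T (?w (coeff s u k \<circ> A)) (?v (s k u))) = (\<Sum>k\<in>UNIV. T (?w (coeff s u k)) (?v (A (s k u))))"
      unfolding 1 2 by (rule sum.swap)
    moreover have "act F A T (?w \<omega>) (?v v) =
        (T (?w (\<omega> \<circ> A)) (?v v) + (\<Sum>a<length ws. T (insert_at i \<omega> (ws[a := ws ! a \<circ> A])) (?v v))) -
        (T (?w \<omega>) (?v (A v)) + (\<Sum>b<length vs. T (?w \<omega>) (insert_at j v (vs[b := A (vs ! b)]))))"
      if "\<omega> \<in> dual_space F" "v \<in> F" for \<omega> v
      using act_slots[OF sl[OF that], of A T, folded len(5,6)]
        sum_insert_at[OF len(3), of "\<lambda>ws. T ws (?v v)" \<omega> "\<lambda>\<omega>. \<omega> \<circ> A"]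
        sum_insert_at[OF len(4), of "\<lambda>vs. T (?w \<omega>) vs" v A]
      by linarith
    ultimately have "contract s i j u (act F A T) ws vs =
        (\<Sum>k\<in>UNIV. \<Sum>a<length ws. T (insert_at i (coeff s u k) (ws[a := ws ! a \<circ> A])) (?v (s k u))) -
        (\<Sum>k\<in>UNIV. \<Sum>b<length vs. T (?w (coeff s u k)) (insert_at j (s k u) (vs[b := A (vs ! b)])))"
      by (simp add: contract_def coeff_in_dual[OF s] basis_at_in[OF s] sum.distrib sum_subtractf)
    also have "\<dots> = act F A (contract s i j u T) ws vs"
      unfolding act_slots[OF True] contract_def len(1)[symmetric] len(2)[symmetric]
      by (simp only: sum.swap[of _ UNIV])
    finally show ?thesis ..
  next
    case False
    have no: "\<not> slots r q F (insert_at i \<omega> ws') (insert_at j v vs')" if "\<not> slots (r - 1) (q - 1) F ws' vs'" for \<omega> v ws' vs'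
    proof
      assume sl: "slots r q F (insert_at i \<omega> ws') (insert_at j v vs')"
      have "set ws' = set (take i ws') \<union> set (drop i ws')" "set vs' = set (take j vs') \<union> set (drop j vs')"
        by (metis append_take_drop_id set_append)+
      with sl that ij show False by (auto simp: slots_def)
    qed
    have "contract s i j u T ws' vs' = 0" if "\<not> slots (r - 1) (q - 1) F ws' vs'" for ws' vs'
      unfolding contract_def by (intro sum.neutral ballI tensor_at_outside[OF T] no that)
    moreover have "\<not> slots (r - 1) (q - 1) F (ws[a := x]) vs \<and> \<not> slots (r - 1) (q - 1) F ws (vs[b := y])"
      if "set ws \<subseteq> dual_space F" "set vs \<subseteq> F" for a b x y
      using False that by (auto simp: slots_def)
    ultimately have "act F A (contract s i j u T) ws vs = 0" by (simp add: act_def)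
    moreover have "contract s i j u (act F A T) ws vs = 0"
      unfolding contract_def by (intro sum.neutral ballI act_outside[OF T] no False)
    ultimately show ?thesis by simp
  qed
qed

section \<open>Linear connections\<close>

context framed_bundle
begin

lemma tensor_fieldI:
  assumes "\<And>u. u \<in> W \<Longrightarrow> tensor_at r q (fibre B u) (T u)"
    and "\<And>U s is js. (U, s) \<in> frames B \<Longrightarrow> length is = r \<Longrightarrow> length js = q \<Longrightarrow>
      smooth_fun (base B) (U \<inter> W) (\<lambda>u. T u (map (coeff s u) is) (map (\<lambda>j. s j u) js))"
  shows "tensor_field B W r q T"
  using assms by (auto simp: tensor_field_def)

lemma tensor_fieldD: "tensor_field B W r q T \<Longrightarrow> u \<in> W \<Longrightarrow> tensor_at r q (fibre B u) (T u)"
  by (simp add: tensor_field_def)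

lemma tensor_field_comp:
  "tensor_field B W r q T \<Longrightarrow> (U, s) \<in> frames B \<Longrightarrow> length is = r \<Longrightarrow> length js = q \<Longrightarrow>
    smooth_fun (base B) (U \<inter> W) (\<lambda>u. T u (map (coeff s u) is) (map (\<lambda>j. s j u) js))"
  by (auto simp: tensor_field_def)

lemma tensor_field_subset: "tensor_field B W r q T \<Longrightarrow> V \<subseteq> W \<Longrightarrow> tensor_field B V r q T"
  by (rule tensor_fieldI) (auto intro: tensor_fieldD smooth_fun_subset[OF tensor_field_comp])

lemma frame_slots:
  assumes "(U, s) \<in> frames B" "u \<in> U" "length is = r" "length js = q"
  shows "slots r q (fibre B u) (map (coeff s u) is) (map (\<lambda>j. s j u) js)"
  using coeff_in_dual[OF frame_basis[OF assms(1,2)]] basis_at_in[OF frame_basis[OF assms(1,2)]] assms(3,4)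
  by (auto simp: slots_def)

lemma tensor_field_prod:
  assumes W: "open_in (base B) W" and T: "tensor_field B W r q T" and S: "tensor_field B W r' q' S"
  shows "tensor_field B W (r + r') (q + q') (\<lambda>u. tensor_prod r q (T u) (S u))"
proof (rule tensor_fieldI)
  fix U s and "is" js :: "'k list" assume s: "(U, s) \<in> frames B" "length is = r + r'" "length js = q + q'"
  show "smooth_fun (base B) (U \<inter> W) (\<lambda>u. tensor_prod r q (T u) (S u) (map (coeff s u) is) (map (\<lambda>j. s j u) js))"
    unfolding tensor_prod_def take_map drop_map
    by (intro smooth_fun_mult open_in_Int frame_open[OF s(1)] W tensor_field_comp[OF T s(1)] tensor_field_comp[OF S s(1)])
      (use s in auto)
qed (intro tensor_at_prod tensor_fieldD[OF T] tensor_fieldD[OF S])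

lemma tensor_field_fun:
  assumes "smooth_fun (base B) W f" shows "tensor_field B W 0 0 (\<lambda>u. fun_tensor (f u))"
  using assms
  by (intro tensor_fieldI tensor_at_fun_tensor) (auto simp: fun_tensor_def intro: smooth_fun_subset)

lemma tensor_field_vec:
  assumes W: "open_in (base B) W" and Y: "smooth_section B W Y"
  shows "tensor_field B W 1 0 (vec_field B Y)"
proof (rule tensor_fieldI)
  fix U s and "is" js :: "'k list" assume s: "(U, s) \<in> frames B" "length is = 1" "length js = 0"
  then obtain k where k: "is = [k]" "js = []" by (auto simp: length_Suc_conv)
  show "smooth_fun (base B) (U \<inter> W) (\<lambda>u. vec_tensor (fibre B u) (Y u) (map (coeff s u) is) (map (\<lambda>j. s j u) js))"
    by (rule smooth_fun_cong[OF open_in_Int[OF frame_open[OF s(1)] W] _ section_coeff[OF Y s(1), of k]])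
       (use coeff_in_dual[OF frame_basis[OF s(1)]] in \<open>auto simp: vec_tensor_def k\<close>)
qed (intro tensor_at_vec_tensor sectionD[OF Y])

lemma section_vec:
  assumes W: "open_in (base B) W" and T: "tensor_field B W 1 0 (vec_field B Y)"
    and Y: "\<And>u. u \<in> W \<Longrightarrow> Y u \<in> fibre B u"
  shows "smooth_section B W Y"
proof (rule sectionI)
  fix U s k assume s: "(U, s) \<in> frames B"
  show "smooth_fun (base B) (U \<inter> W) (\<lambda>u. coeff s u k (Y u))"
    by (rule smooth_fun_cong[OF open_in_Int[OF frame_open[OF s] W] _ tensor_field_comp[OF T s, of "[k]" "[]"]])
       (use coeff_in_dual[OF frame_basis[OF s]] in \<open>auto simp: vec_tensor_def\<close>)
qed (rule Y)

lemma vec_tensor_coeff: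
  "basis_at s u F \<Longrightarrow> vec_tensor F v [coeff s u k] [] = coeff s u k v"
  by (simp add: vec_tensor_def coeff_in_dual)

lemma vec_tensor_inject:
  fixes s :: "'k \<Rightarrow> 'p \<Rightarrow> 'w"
  assumes "basis_at s u F" "v \<in> F" "w \<in> F" "vec_tensor F v = vec_tensor F w" shows "v = w"
proof -
  have "coeff s u k v = coeff s u k w" for k
    using vec_tensor_coeff[OF assms(1), of v k] vec_tensor_coeff[OF assms(1), of w k]
    unfolding assms(4) by simp
  then have "(\<Sum>k\<in>UNIV. coeff s u k v *\<^sub>R s k u) = (\<Sum>k\<in>UNIV. coeff s u k w *\<^sub>R s k u)"
    by (intro sum.cong) auto
  then show ?thesis unfolding coeff_expand[OF assms(1,2)] coeff_expand[OF assms(1,3)] .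
qed

lemma vec_tensor_zero: "subspace F \<Longrightarrow> vec_tensor F 0 = 0"
  by (auto simp: vec_tensor_def fun_eq_iff dual_space_iff length_Suc_conv dest: lin_on_zero)

lemma vec_tensor_lincomb:
  assumes "v \<in> F" "w \<in> F" "subspace F"
  shows "vec_tensor F (c *\<^sub>R v + w) = c *\<^sub>R vec_tensor F v + vec_tensor F w"
proof (intro ext)
  fix ws vs
  show "vec_tensor F (c *\<^sub>R v + w) ws vs = (c *\<^sub>R vec_tensor F v + vec_tensor F w) ws vs"
  proof (cases "slots 1 0 F ws vs")
    case True
    then obtain \<omega> where "ws = [\<omega>]" "vs = []" "\<omega> \<in> dual_space F"
      by (auto simp: slots_def length_Suc_conv)
    then show ?thesis
      using assms by (simp add: vec_tensor_def scaleR_fun_def dual_space_iff lin_on_def subspace_scale)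
  qed (auto simp: vec_tensor_def slots_def scaleR_fun_def)
qed

text \<open>Reflexivity in finite dimension: a linear functional on covectors is evaluation at the
  vector built from its values on the dual frame. Through this the derivative of a vector field,
  which a connection delivers as a tensor, is again a vector field.\<close>

lemma tensor_at_1_0:
  fixes s :: "'k \<Rightarrow> 'p \<Rightarrow> 'w"
  assumes s: "basis_at s u F" and T: "tensor_at 1 0 F T"
  shows "T = vec_tensor F (\<Sum>k\<in>UNIV. T [coeff s u k] [] *\<^sub>R s k u)"
proof (intro ext)
  fix ws vs
  let ?v = "\<Sum>k\<in>UNIV. T [coeff s u k] [] *\<^sub>R s k u"
  show "T ws vs = vec_tensor F ?v ws vs"
  proof (cases "slots 1 0 F ws vs")
    case True
    then obtain \<omega> where \<omega>: "ws = [\<omega>]" "vs = []" "\<omega> \<in> dual_space F"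
      by (auto simp: slots_def length_Suc_conv)
    have lin: "lin_on (dual_space F) (\<lambda>\<omega>. T [\<omega>] [])"
      using tensor_at_cov_lin[OF T True, of 0] by (simp add: \<omega>)
    have lin\<omega>: "lin_on F \<omega>" using \<omega> by (simp add: dual_space_iff)
    have "T [\<omega>] [] = T [\<Sum>k\<in>UNIV. \<omega> (s k u) *\<^sub>R coeff s u k] []"
      using dual_expand[OF s \<omega>(3)] by simp
    also have "\<dots> = (\<Sum>k\<in>UNIV. \<omega> (s k u) * T [coeff s u k] [])"
      using coeff_in_dual[OF s]
      by (subst lin_on_sum[OF lin subspace_dual_space])
         (auto simp: subspace_scale[OF subspace_dual_space] lin_on_scale[OF lin])
    also have "\<dots> = \<omega> ?v"
      using basis_at_in[OF s] basis_at_subspace[OF s]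
      by (subst lin_on_sum[OF lin\<omega>]) (auto simp: subspace_scale lin_on_scale[OF lin\<omega>] mult.commute)
    finally show ?thesis using \<omega> by (simp add: vec_tensor_def)
  next
    case False
    then show ?thesis using tensor_at_outside[OF T False] by (auto simp: vec_tensor_def slots_def)
  qed
qed

text \<open>Expanding the images under \<open>A\<close> in the frame turns the components of the
  result into sums of products of smooth functions.\<close>

lemma tensor_field_act:
  assumes W: "open_in (base B) W" and T: "tensor_field B W r q T"
    and A: "\<And>u. u \<in> W \<Longrightarrow> endo (fibre B u) (A u)"
    and sm: "\<And>U s k. (U, s) \<in> frames B \<Longrightarrow> smooth_section B (U \<inter> W) (\<lambda>u. A u (s k u))"
  shows "tensor_field B W r q (\<lambda>u. act (fibre B u) (A u) (T u))"
proof (rule tensor_fieldI)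
  have sub: "subspace (fibre B u)" if "u \<in> W" for u
    using subspace_fibre open_in_subset_points[OF W] that by blast
  show "tensor_at r q (fibre B u) (act (fibre B u) (A u) (T u))" if "u \<in> W" for u
    using that by (intro tensor_at_act tensor_fieldD[OF T] A sub)
  fix U s and "is" js :: "'k list" assume s: "(U, s) \<in> frames B" and len: "length is = r" "length js = q"
  have o: "open_in (base B) (U \<inter> W)" using open_in_Int[OF frame_open[OF s] W] .
  let ?c = "\<lambda>u l k. coeff s u l (A u (s k u))"
  have c: "smooth_fun (base B) (U \<inter> W) (\<lambda>u. ?c u l k)" for l k
    using section_coeff[OF sm[OF s] s] by (rule smooth_fun_subset) auto
  let ?T = "\<lambda>u is js. T u (map (coeff s u) is) (map (\<lambda>j. s j u) js)"
  have "smooth_fun (base B) (U \<inter> W) (\<lambda>u.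
      (\<Sum>i<r. \<Sum>l\<in>UNIV. ?c u (is ! i) l * ?T u (is[i := l]) js) -
      (\<Sum>j<q. \<Sum>l\<in>UNIV. ?c u l (js ! j) * ?T u is (js[j := l])))"
    by (intro smooth_fun_diff smooth_fun_sum smooth_fun_mult o c tensor_field_comp[OF T s]) (auto simp: len)
  then show "smooth_fun (base B) (U \<inter> W)
      (\<lambda>u. act (fibre B u) (A u) (T u) (map (coeff s u) is) (map (\<lambda>j. s j u) js))"
  proof (rule smooth_fun_cong[OF o, rotated])
    fix u assume u: "u \<in> U \<inter> W"
    have b: "basis_at s u (fibre B u)" using frame_basis[OF s] u by blast
    have F: "subspace (fibre B u)" and e: "endo (fibre B u) (A u)" and Tu: "tensor_at r q (fibre B u) (T u)"
      using sub A tensor_fieldD[OF T] u by auto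
    have sl: "slots r q (fibre B u) (map (coeff s u) is) (map (\<lambda>j. s j u) js)"
      using frame_slots[OF s _ len] u by blast
    have 1: "T u ((map (coeff s u) is)[i := map (coeff s u) is ! i \<circ> A u]) (map (\<lambda>j. s j u) js) =
        (\<Sum>l\<in>UNIV. ?c u (is ! i) l * ?T u (is[i := l]) js)" if i: "i < r" for i
    proof -
      have lin: "lin_on (dual_space (fibre B u)) (\<lambda>\<omega>. T u ((map (coeff s u) is)[i := \<omega>]) (map (\<lambda>j. s j u) js))"
        using tensor_at_cov_lin[OF Tu sl i] .
      have "coeff s u (is ! i) \<circ> A u = (\<Sum>l\<in>UNIV. ?c u (is ! i) l *\<^sub>R coeff s u l)"
        using dual_expand[OF b endo_dual[OF e coeff_in_dual[OF b] F]] by simp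
      then have "T u ((map (coeff s u) is)[i := map (coeff s u) is ! i \<circ> A u]) (map (\<lambda>j. s j u) js) =
         (\<Sum>l\<in>UNIV. T u ((map (coeff s u) is)[i := ?c u (is ! i) l *\<^sub>R coeff s u l]) (map (\<lambda>j. s j u) js))"
        using lin_on_sum[OF lin subspace_dual_space, of UNIV "\<lambda>l. ?c u (is ! i) l *\<^sub>R coeff s u l"] i len
        by (simp add: subspace_scale[OF subspace_dual_space] coeff_in_dual[OF b])
      then show ?thesis
        using lin_on_scale[OF lin coeff_in_dual[OF b]] by (simp add: map_update)
    qed
    have 2: "T u (map (coeff s u) is) ((map (\<lambda>j. s j u) js)[j := A u (map (\<lambda>j. s j u) js ! j)]) =
        (\<Sum>l\<in>UNIV. ?c u l (js ! j) * ?T u is (js[j := l]))" if j: "j < q" for j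
    proof -
      have lin: "lin_on (fibre B u) (\<lambda>v. T u (map (coeff s u) is) ((map (\<lambda>j. s j u) js)[j := v]))"
        using tensor_at_vec_lin[OF Tu sl j F] .
      have "A u (s (js ! j) u) \<in> fibre B u" using e basis_at_in[OF b] by (auto simp: endo_def)
      from lin_on_expand[OF b lin this] show ?thesis using j len by (simp add: map_update)
    qed
    show "(\<Sum>i<r. \<Sum>l\<in>UNIV. ?c u (is ! i) l * ?T u (is[i := l]) js) -
        (\<Sum>j<q. \<Sum>l\<in>UNIV. ?c u l (js ! j) * ?T u is (js[j := l])) =
      act (fibre B u) (A u) (T u) (map (coeff s u) is) (map (\<lambda>j. s j u) js)"
      unfolding act_slots[OF sl] using 1 2 by simp
  qed
qed

lemma tensor_field_add:
  assumes W: "open_in (base B) W" and T: "tensor_field B W r q T" and S: "tensor_field B W r q S"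
  shows "tensor_field B W r q (\<lambda>u. T u + S u)"
proof (rule tensor_fieldI)
  show "tensor_at r q (fibre B u) (T u + S u)" if "u \<in> W" for u
    using tensor_fieldD[OF T that] tensor_fieldD[OF S that]
    by (intro tensor_atI) (simp_all add: tensor_at_outside tensor_at_cov tensor_at_vec distrib_left)
  fix U s and "is" js :: "'k list" assume s: "(U, s) \<in> frames B" "length is = r" "length js = q"
  show "smooth_fun (base B) (U \<inter> W) (\<lambda>u. (T u + S u) (map (coeff s u) is) (map (\<lambda>j. s j u) js))"
    unfolding plus_fun_apply
    by (intro smooth_fun_add open_in_Int frame_open[OF s(1)] W tensor_field_comp[OF T s] tensor_field_comp[OF S s])
qed

end

section \<open>Connections: consequences of the axioms, change by an endomorphism field, derivatives
  of sections\<close>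

locale bundle_connection = framed_bundle B
  for B :: "('p, 'c::euclidean_space, 'w::real_vector, 'k::finite) vbundle" +
  fixes a :: "'p \<Rightarrow> 'w \<Rightarrow> ('p \<Rightarrow> real) \<Rightarrow> real"
    and D :: "('p \<Rightarrow> 'w) \<Rightarrow> ('p \<Rightarrow> 'w tensor) \<Rightarrow> 'p \<Rightarrow> 'w tensor"
  assumes connection: "linear_connection B a D"
begin

lemma
  assumes "open_in (base B) W" "smooth_section B W X" "tensor_field B W r q T"
  shows D_tensor: "tensor_field B W r q (D X T)"
    and D_cong: "\<And>X' T' u. (\<And>u. u \<in> W \<Longrightarrow> X' u = X u) \<Longrightarrow> (\<And>u. u \<in> W \<Longrightarrow> T' u = T u) \<Longrightarrow> u \<in> W \<Longrightarrow>
      D X' T' u = D X T u"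
    and D_lincomb: "\<And>f Y u. smooth_fun (base B) W f \<Longrightarrow> smooth_section B W Y \<Longrightarrow> u \<in> W \<Longrightarrow>
      D (\<lambda>u. f u *\<^sub>R X u + Y u) T u = f u *\<^sub>R D X T u + D Y T u"
    and D_add: "\<And>S u. tensor_field B W r q S \<Longrightarrow> u \<in> W \<Longrightarrow> D X (\<lambda>u. T u + S u) u = D X T u + D X S u"
    and D_prod: "\<And>r' q' S u. tensor_field B W r' q' S \<Longrightarrow> u \<in> W \<Longrightarrow>
      D X (\<lambda>u. tensor_prod r q (T u) (S u)) u = tensor_prod r q (D X T u) (S u) + tensor_prod r q (T u) (D X S u)"
    and D_contract: "\<And>U s i j u. (U, s) \<in> frames B \<Longrightarrow> i < r \<Longrightarrow> j < q \<Longrightarrow> W \<subseteq> U \<Longrightarrow> u \<in> W \<Longrightarrow>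
      D X (\<lambda>u. contract s i j u (T u)) u = contract s i j u (D X T u)"
proof -
  note * = connection[unfolded linear_connection_def, rule_format, of W X, OF conjI[OF assms(1,2)],
      THEN conjunct1, rule_format, OF assms(3)]
  show "tensor_field B W r q (D X T)" using * by blast
  show "D X' T' u = D X T u" if "\<And>u. u \<in> W \<Longrightarrow> X' u = X u" "\<And>u. u \<in> W \<Longrightarrow> T' u = T u" "u \<in> W" for X' T' u
    using *[THEN conjunct2, THEN conjunct1] that by blast
  show "D (\<lambda>u. f u *\<^sub>R X u + Y u) T u = f u *\<^sub>R D X T u + D Y T u"
    if "smooth_fun (base B) W f" "smooth_section B W Y" "u \<in> W" for f Y u
    using *[THEN conjunct2, THEN conjunct2, THEN conjunct1] that by blast
  show "D X (\<lambda>u. T u + S u) u = D X T u + D X S u" if "tensor_field B W r q S" "u \<in> W" for S u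
    using *[THEN conjunct2, THEN conjunct2, THEN conjunct2, THEN conjunct1] that by blast
  show "D X (\<lambda>u. tensor_prod r q (T u) (S u)) u = tensor_prod r q (D X T u) (S u) + tensor_prod r q (T u) (D X S u)"
    if "tensor_field B W r' q' S" "u \<in> W" for r' q' S u
    using *[THEN conjunct2, THEN conjunct2, THEN conjunct2, THEN conjunct2, THEN conjunct1] that by blast
  show "D X (\<lambda>u. contract s i j u (T u)) u = contract s i j u (D X T u)"
    if "(U, s) \<in> frames B" "i < r" "j < q" "W \<subseteq> U" "u \<in> W" for U s i j u
    using *[THEN conjunct2, THEN conjunct2, THEN conjunct2, THEN conjunct2, THEN conjunct2] that by blast
qed

lemma D_fun:
  "open_in (base B) W \<Longrightarrow> smooth_section B W X \<Longrightarrow> smooth_fun (base B) W f \<Longrightarrow> u \<in> W \<Longrightarrow>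
   D X (\<lambda>u. fun_tensor (f u)) u = fun_tensor (a u (X u) f)"
  using connection[unfolded linear_connection_def, THEN spec, THEN spec, THEN mp, THEN conjunct2, of W X] by simp

text \<open>The difference term is pointwise in direction and tensor, and it is a derivation of the
  tensor algebra that kills functions and commutes with contractions. Hence each axiom for the sum
  is the axiom for \<open>D\<close> plus an algebraic identity for \<open>act\<close>; only
  smoothness uses the hypothesis on sections.\<close>

lemma add_endomorphism:
  assumes S: "\<And>u x. u \<in> points (base B) \<Longrightarrow> x \<in> fibre B u \<Longrightarrow> endo (fibre B u) (S u x)"
    and lin: "\<And>u x y c v. u \<in> points (base B) \<Longrightarrow> x \<in> fibre B u \<Longrightarrow> y \<in> fibre B u \<Longrightarrow>
       S u (c *\<^sub>R x + y) v = c *\<^sub>R S u x v + S u y v"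
    and sm: "\<And>W X Y. open_in (base B) W \<Longrightarrow> smooth_section B W X \<Longrightarrow> smooth_section B W Y \<Longrightarrow>
       smooth_section B W (\<lambda>u. S u (X u) (Y u))"
  shows "linear_connection B a (\<lambda>X T u. D X T u + act (fibre B u) (S u (X u)) (T u))"
  unfolding linear_connection_def
proof (intro allI impI conjI)
  fix W X assume "open_in (base B) W \<and> smooth_section B W X"
  then have W: "open_in (base B) W" and X: "smooth_section B W X" by auto
  have pt: "u \<in> points (base B)" if "u \<in> W" for u using open_in_subset_points[OF W] that by blast
  have F: "subspace (fibre B u)" if "u \<in> W" for u using subspace_fibre[OF pt[OF that]] .
  have e: "endo (fibre B u) (S u (X u))" if "u \<in> W" for u using S[OF pt[OF that] sectionD[OF X that]] .
  show "\<forall>u\<in>W. D X (\<lambda>u. fun_tensor (f u)) u + act (fibre B u) (S u (X u)) (fun_tensor (f u)) = fun_tensor (a u (X u) f)"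
    if "smooth_fun (base B) W f" for f
    using D_fun[OF W X that] by (simp add: act_fun_tensor)
  fix r q T assume T: "tensor_field B W r q T"
  show "tensor_field B W r q (\<lambda>u. D X T u + act (fibre B u) (S u (X u)) (T u))"
  proof (intro tensor_field_add[OF W D_tensor[OF W X T]] tensor_field_act[OF W T e])
    fix U s k assume s: "(U, s) \<in> frames B"
    show "smooth_section B (U \<inter> W) (\<lambda>u. S u (X u) (s k u))"
      using section_subset[OF X, of "U \<inter> W"] section_subset[OF frame_section[OF s, of k], of "U \<inter> W"]
      by (intro sm open_in_Int frame_open[OF s] W) auto
  qed
  show "\<forall>u\<in>W. D X' T' u + act (fibre B u) (S u (X' u)) (T' u) = D X T u + act (fibre B u) (S u (X u)) (T u)"
    if "\<forall>u\<in>W. X' u = X u \<and> T' u = T u" for X' T'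
    using D_cong[OF W X T, of X' T'] that by simp
  show "\<forall>u\<in>W. D (\<lambda>u. f u *\<^sub>R X u + Y u) T u + act (fibre B u) (S u (f u *\<^sub>R X u + Y u)) (T u) =
      f u *\<^sub>R (D X T u + act (fibre B u) (S u (X u)) (T u)) + (D Y T u + act (fibre B u) (S u (Y u)) (T u))"
    if "smooth_fun (base B) W f \<and> smooth_section B W Y" for f Y
  proof
    fix u assume u: "u \<in> W"
    have Y: "smooth_section B W Y" using that by blast
    have "act (fibre B u) (S u (f u *\<^sub>R X u + Y u)) (T u) =
        f u *\<^sub>R act (fibre B u) (S u (X u)) (T u) + act (fibre B u) (S u (Y u)) (T u)"
      by (intro act_endo_lincomb[OF tensor_fieldD[OF T u] e[OF u] S[OF pt[OF u] sectionD[OF Y u]] F[OF u]]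
          lin pt u sectionD[OF X] sectionD[OF Y])
    then show "D (\<lambda>u. f u *\<^sub>R X u + Y u) T u + act (fibre B u) (S u (f u *\<^sub>R X u + Y u)) (T u) =
      f u *\<^sub>R (D X T u + act (fibre B u) (S u (X u)) (T u)) + (D Y T u + act (fibre B u) (S u (Y u)) (T u))"
      using D_lincomb[OF W X T, of f Y u] that u by (simp add: scaleR_add_right add_ac)
  qed
  show "\<forall>u\<in>W. D X (\<lambda>u. T u + S' u) u + act (fibre B u) (S u (X u)) (T u + S' u) =
      D X T u + act (fibre B u) (S u (X u)) (T u) + (D X S' u + act (fibre B u) (S u (X u)) (S' u))"
    if "tensor_field B W r q S'" for S'
    using D_add[OF W X T that] by (simp add: act_add add_ac)
  show "\<forall>u\<in>W. D X (\<lambda>u. tensor_prod r q (T u) (S' u)) u + act (fibre B u) (S u (X u)) (tensor_prod r q (T u) (S' u)) =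
      tensor_prod r q (D X T u + act (fibre B u) (S u (X u)) (T u)) (S' u) +
      tensor_prod r q (T u) (D X S' u + act (fibre B u) (S u (X u)) (S' u))"
    if S': "tensor_field B W r' q' S'" for r' q' S'
  proof
    fix u assume u: "u \<in> W"
    have "tensor_prod r q (T1 + T2) T3 = tensor_prod r q T1 T3 + tensor_prod r q T2 T3"
      "tensor_prod r q T3 (T1 + T2) = tensor_prod r q T3 T1 + tensor_prod r q T3 T2" for T1 T2 T3 :: "'w tensor"
      by (auto simp: tensor_prod_def algebra_simps fun_eq_iff)
    then show "D X (\<lambda>u. tensor_prod r q (T u) (S' u)) u + act (fibre B u) (S u (X u)) (tensor_prod r q (T u) (S' u)) =
      tensor_prod r q (D X T u + act (fibre B u) (S u (X u)) (T u)) (S' u) +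
      tensor_prod r q (T u) (D X S' u + act (fibre B u) (S u (X u)) (S' u))"
      using D_prod[OF W X T S' u] act_prod[OF tensor_fieldD[OF T u] tensor_fieldD[OF S' u] e[OF u] F[OF u]]
      by (simp add: add_ac)
  qed
  have "D X (\<lambda>u. contract s i j u (T u)) u + act (fibre B u) (S u (X u)) (contract s i j u (T u)) =
      contract s i j u (D X T u + act (fibre B u) (S u (X u)) (T u))"
    if s: "(U, s) \<in> frames B" and ij: "i < r" "j < q" and WU: "W \<subseteq> U" and u: "u \<in> W" for U s i j u
  proof -
    have "basis_at s u (fibre B u)" using frame_basis[OF s] WU u by blast
    from act_contract[OF tensor_fieldD[OF T u] e[OF u] this ij] show ?thesis
      using D_contract[OF W X T s ij WU u] by (simp add: contract_def fun_eq_iff sum.distrib)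
  qed
  then show "\<forall>(U, s)\<in>frames B. \<forall>i<r. \<forall>j<q. W \<subseteq> U \<longrightarrow>
      (\<forall>u\<in>W. D X (\<lambda>u. contract s i j u (T u)) u + act (fibre B u) (S u (X u)) (contract s i j u (T u)) =
        contract s i j u (D X T u + act (fibre B u) (S u (X u)) (T u)))"
    by blast
qed

lemma D_zero:
  assumes W: "open_in (base B) W" and T: "tensor_field B W r q T" and u: "u \<in> W"
  shows "D (\<lambda>u. 0) T u = 0"
proof -
  have "D (\<lambda>u. 0) T u = D (\<lambda>u. 0) T u + D (\<lambda>u. 0) T u"
    using D_lincomb[OF W section_zero[OF W] T smooth_fun_const[of W 1] section_zero[OF W] u] by simp
  then show ?thesis by simp
qed

lemma D_sum:
  assumes W: "open_in (base B) W" and T: "tensor_field B W r q T"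
    and f: "\<And>k. smooth_fun (base B) W (f k)" and X: "\<And>k. smooth_section B W (X k)" and u: "u \<in> W"
  shows "D (\<lambda>u. \<Sum>k\<in>I. f k u *\<^sub>R X k u) T u = (\<Sum>k\<in>I. f k u *\<^sub>R D (X k) T u)"
proof (induction I rule: infinite_finite_induct)
  case (insert k I)
  have "D (\<lambda>u. f k u *\<^sub>R X k u + (\<Sum>k\<in>I. f k u *\<^sub>R X k u)) T u =
      f k u *\<^sub>R D (X k) T u + D (\<lambda>u. \<Sum>k\<in>I. f k u *\<^sub>R X k u) T u"
    by (intro D_lincomb[OF W X T f _ u] section_sum section_scale W f X)
  then show ?case using insert by simp
qed (simp_all add: D_zero[OF W T u])

text \<open>The derivative of a section as a section again. The chosen vector is unique because
  \<open>vec_tensor\<close> is injective on the fibre.\<close>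

definition cov :: "('p \<Rightarrow> 'w) \<Rightarrow> ('p \<Rightarrow> 'w) \<Rightarrow> 'p \<Rightarrow> 'w"
  where "cov X Y u = (SOME v. v \<in> fibre B u \<and> D X (vec_field B Y) u = vec_tensor (fibre B u) v)"

lemma
  assumes W: "open_in (base B) W" and X: "smooth_section B W X" and Y: "smooth_section B W Y" and u: "u \<in> W"
  shows cov_in: "cov X Y u \<in> fibre B u"
    and D_vec: "D X (vec_field B Y) u = vec_tensor (fibre B u) (cov X Y u)"
proof -
  have pt: "u \<in> points (base B)" using open_in_subset_points[OF W] u by blast
  then obtain U s where s: "(U, s) \<in> frames B" "u \<in> U" by (rule point_frame)
  have b: "basis_at s u (fibre B u)" using frame_basis[OF s] .
  let ?v = "\<Sum>k\<in>UNIV. D X (vec_field B Y) u [coeff s u k] [] *\<^sub>R s k u"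
  have "?v \<in> fibre B u"
    using basis_at_in[OF b] basis_at_subspace[OF b] by (intro subspace_sum) (auto intro: subspace_scale)
  moreover have "D X (vec_field B Y) u = vec_tensor (fibre B u) ?v"
    using tensor_at_1_0[OF b tensor_fieldD[OF D_tensor[OF W X tensor_field_vec[OF W Y]] u]] .
  ultimately have "\<exists>v. v \<in> fibre B u \<and> D X (vec_field B Y) u = vec_tensor (fibre B u) v" by blast
  from someI_ex[OF this] show "cov X Y u \<in> fibre B u" "D X (vec_field B Y) u = vec_tensor (fibre B u) (cov X Y u)"
    unfolding cov_def by auto
qed

lemma cov_eqI:
  assumes "open_in (base B) W" "smooth_section B W X" "smooth_section B W Y" "u \<in> W"
    and "v \<in> fibre B u" "D X (vec_field B Y) u = vec_tensor (fibre B u) v"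
  shows "cov X Y u = v"
proof -
  have "u \<in> points (base B)" using open_in_subset_points[OF assms(1)] assms(4) by blast
  then obtain U s where s: "(U, s) \<in> frames B" "u \<in> U" by (rule point_frame)
  show ?thesis
    using vec_tensor_inject[OF frame_basis[OF s] cov_in[OF assms(1-4)] assms(5)] D_vec[OF assms(1-4)] assms(6)
    by simp
qed

lemma cov_section:
  assumes W: "open_in (base B) W" and X: "smooth_section B W X" and Y: "smooth_section B W Y"
  shows "smooth_section B W (cov X Y)"
proof (rule section_vec[OF W _ cov_in[OF W X Y]])
  have *: "tensor_field B W 1 0 (D X (vec_field B Y))" by (rule D_tensor[OF W X tensor_field_vec[OF W Y]])
  show "tensor_field B W 1 0 (vec_field B (cov X Y))"
  proof (rule tensor_fieldI)
    show "tensor_at 1 0 (fibre B u) (vec_tensor (fibre B u) (cov X Y u))" if "u \<in> W" for u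
      using tensor_at_vec_tensor cov_in[OF W X Y that] by blast
    fix U s and "is" js :: "'k list" assume s: "(U, s) \<in> frames B" "length is = 1" "length js = 0"
    show "smooth_fun (base B) (U \<inter> W) (\<lambda>u. vec_tensor (fibre B u) (cov X Y u) (map (coeff s u) is) (map (\<lambda>j. s j u) js))"
      by (rule smooth_fun_cong[OF open_in_Int[OF frame_open[OF s(1)] W] _ tensor_field_comp[OF * s]])
         (simp add: D_vec[OF W X Y])
  qed
qed

lemma cov_cong:
  assumes W: "open_in (base B) W" and X: "smooth_section B W X" and Y: "smooth_section B W Y" and u: "u \<in> W"
    and eq: "\<And>u. u \<in> W \<Longrightarrow> X' u = X u" "\<And>u. u \<in> W \<Longrightarrow> Y' u = Y u"
  shows "cov X' Y' u = cov X Y u"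
  using D_cong[OF W X tensor_field_vec[OF W Y], of X' "vec_field B Y'" u] eq u by (simp add: cov_def)

lemma cov_sum_left:
  assumes W: "open_in (base B) W" and f: "\<And>k::'i::finite. smooth_fun (base B) W (f k)"
    and X: "\<And>k. smooth_section B W (X k)" and Y: "smooth_section B W Y" and u: "u \<in> W"
  shows "cov (\<lambda>u. \<Sum>k\<in>UNIV. f k u *\<^sub>R X k u) Y u = (\<Sum>k\<in>UNIV. f k u *\<^sub>R cov (X k) Y u)"
proof (rule cov_eqI[OF W _ Y u])
  have F: "subspace (fibre B u)" using subspace_fibre open_in_subset_points[OF W] u by blast
  have in': "(\<Sum>k\<in>I. f k u *\<^sub>R cov (X k) Y u) \<in> fibre B u" for I
    using cov_in[OF W X Y u] F by (intro subspace_sum) (auto intro: subspace_scale)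
  show "smooth_section B W (\<lambda>u. \<Sum>k\<in>UNIV. f k u *\<^sub>R X k u)" by (intro section_sum section_scale W f X)
  show "(\<Sum>k\<in>UNIV. f k u *\<^sub>R cov (X k) Y u) \<in> fibre B u" by (rule in')
  have "vec_tensor (fibre B u) (\<Sum>k\<in>I. f k u *\<^sub>R cov (X k) Y u) =
      (\<Sum>k\<in>I. f k u *\<^sub>R vec_tensor (fibre B u) (cov (X k) Y u))" if "finite I" for I
    using that
  proof induction
    case empty
    then show ?case by (simp add: vec_tensor_zero[OF F])
  next
    case (insert k I)
    then show ?case using vec_tensor_lincomb[OF cov_in[OF W X Y u] in' F] by simp
  qed
  then show "D (\<lambda>u. \<Sum>k\<in>UNIV. f k u *\<^sub>R X k u) (vec_field B Y) u =
      vec_tensor (fibre B u) (\<Sum>k\<in>UNIV. f k u *\<^sub>R cov (X k) Y u)"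
    using D_sum[OF W tensor_field_vec[OF W Y] f X u] D_vec[OF W X Y u] by simp
qed

lemma cov_add:
  assumes W: "open_in (base B) W" and X: "smooth_section B W X"
    and Y: "smooth_section B W Y" and Z: "smooth_section B W Z" and u: "u \<in> W"
  shows "cov X (\<lambda>u. Y u + Z u) u = cov X Y u + cov X Z u"
proof (rule cov_eqI[OF W X section_add[OF W Y Z] u])
  have F: "subspace (fibre B u)" if "u \<in> W" for u using subspace_fibre open_in_subset_points[OF W] that by blast
  show "cov X Y u + cov X Z u \<in> fibre B u"
    using F[OF u] cov_in[OF W X Y u] cov_in[OF W X Z u] by (simp add: subspace_add)
  have eq: "vec_tensor (fibre B u) (Y u + Z u) = vec_tensor (fibre B u) (Y u) + vec_tensor (fibre B u) (Z u)"
    if "u \<in> W" for u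
    using vec_tensor_lincomb[OF sectionD[OF Y that] sectionD[OF Z that] F[OF that], of 1] by simp
  have "D X (vec_field B (\<lambda>u. Y u + Z u)) u = D X (\<lambda>u. vec_field B Y u + vec_field B Z u) u"
    by (rule D_cong[OF W X tensor_field_add[OF W tensor_field_vec[OF W Y] tensor_field_vec[OF W Z]]])
       (simp_all add: eq u)
  also have "\<dots> = D X (vec_field B Y) u + D X (vec_field B Z) u"
    using D_add[OF W X tensor_field_vec[OF W Y] tensor_field_vec[OF W Z] u] .
  also have "\<dots> = vec_tensor (fibre B u) (cov X Y u + cov X Z u)"
    using vec_tensor_lincomb[OF cov_in[OF W X Y u] cov_in[OF W X Z u] F[OF u], of 1]
    by (simp add: D_vec[OF W X Y u] D_vec[OF W X Z u])
  finally show "D X (vec_field B (\<lambda>u. Y u + Z u)) u = vec_tensor (fibre B u) (cov X Y u + cov X Z u)" .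
qed

text \<open>The section \<open>f\<close> times \<open>Y\<close>, read as a tensor, is the product of
  a tensor of type (0,0) with one of type (1,0), so the product axiom yields the Leibniz
  rule.\<close>

lemma cov_scale:
  assumes W: "open_in (base B) W" and X: "smooth_section B W X" and Y: "smooth_section B W Y"
    and f: "smooth_fun (base B) W f" and u: "u \<in> W"
  shows "cov X (\<lambda>u. f u *\<^sub>R Y u) u = f u *\<^sub>R cov X Y u + a u (X u) f *\<^sub>R Y u"
proof (rule cov_eqI[OF W X section_scale[OF W f Y] u])
  have F: "subspace (fibre B u)" if "u \<in> W" for u using subspace_fibre open_in_subset_points[OF W] that by blast
  have z: "vec_tensor (fibre B u) 0 = 0" if "u \<in> W" for u
    using vec_tensor_zero[OF F[OF that]] .
  have sc: "vec_tensor (fibre B u) (c *\<^sub>R v) = tensor_prod 0 0 (fun_tensor c) (vec_tensor (fibre B u) v)"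
    if "u \<in> W" "v \<in> fibre B u" for u c v
    using vec_tensor_lincomb[OF that(2) subspace_0[OF F[OF that(1)]] F[OF that(1)], of c] z[OF that(1)]
    by (auto simp: tensor_prod_def fun_tensor_def fun_eq_iff scaleR_fun_def)
  show "f u *\<^sub>R cov X Y u + a u (X u) f *\<^sub>R Y u \<in> fibre B u"
    using F[OF u] cov_in[OF W X Y u] sectionD[OF Y u] by (simp add: subspace_add subspace_scale)
  have "D X (vec_field B (\<lambda>u. f u *\<^sub>R Y u)) u = D X (\<lambda>u. tensor_prod 0 0 (fun_tensor (f u)) (vec_field B Y u)) u"
    by (rule D_cong[OF W X tensor_field_prod[OF W tensor_field_fun[OF f] tensor_field_vec[OF W Y]]])
       (simp_all add: sc sectionD[OF Y] u)
  also have "\<dots> = tensor_prod 0 0 (fun_tensor (a u (X u) f)) (vec_field B Y u) +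
      tensor_prod 0 0 (fun_tensor (f u)) (vec_tensor (fibre B u) (cov X Y u))"
    using D_prod[OF W X tensor_field_fun[OF f] tensor_field_vec[OF W Y] u] D_fun[OF W X f u]
    by (simp add: D_vec[OF W X Y u])
  also have "\<dots> = vec_tensor (fibre B u) (a u (X u) f *\<^sub>R Y u) + vec_tensor (fibre B u) (f u *\<^sub>R cov X Y u)"
    using sc[OF u sectionD[OF Y u]] sc[OF u cov_in[OF W X Y u]] by simp
  also have "\<dots> = vec_tensor (fibre B u) (f u *\<^sub>R cov X Y u + a u (X u) f *\<^sub>R Y u)"
    using vec_tensor_lincomb[OF subspace_scale[OF F[OF u] cov_in[OF W X Y u]]
        subspace_scale[OF F[OF u] sectionD[OF Y u]] F[OF u], of 1 "f u" "a u (X u) f"]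
    by (simp add: add.commute)
  finally show "D X (vec_field B (\<lambda>u. f u *\<^sub>R Y u)) u =
      vec_tensor (fibre B u) (f u *\<^sub>R cov X Y u + a u (X u) f *\<^sub>R Y u)" .
qed

lemma cov_zero:
  assumes W: "open_in (base B) W" and X: "smooth_section B W X" and u: "u \<in> W"
  shows "cov X (\<lambda>u. 0) u = 0"
  using cov_add[OF W X section_zero[OF W] section_zero[OF W] u] by simp

lemma cov_sum_right:
  assumes W: "open_in (base B) W" and f: "\<And>k. smooth_fun (base B) W (f k)"
    and Y: "\<And>k. smooth_section B W (Y k)" and X: "smooth_section B W X" and u: "u \<in> W"
  shows "cov X (\<lambda>u. \<Sum>k\<in>I. f k u *\<^sub>R Y k u) u =
    (\<Sum>k\<in>I. f k u *\<^sub>R cov X (Y k) u + a u (X u) (f k) *\<^sub>R Y k u)"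
proof (induction I rule: infinite_finite_induct)
  case (insert k I)
  have "cov X (\<lambda>u. f k u *\<^sub>R Y k u + (\<Sum>k\<in>I. f k u *\<^sub>R Y k u)) u =
      cov X (\<lambda>u. f k u *\<^sub>R Y k u) u + cov X (\<lambda>u. \<Sum>k\<in>I. f k u *\<^sub>R Y k u) u"
    by (intro cov_add[OF W X _ _ u] section_sum section_scale W f Y)
  then show ?case using insert cov_scale[OF W X Y f u] by simp
qed (simp_all add: cov_zero[OF W X u])

text \<open>Evaluation at a vector expressed by product and contraction, which are the operations
  that the axioms of a connection control.\<close>

lemma contract_vec:
  assumes s: "basis_at s u F" and T: "tensor_at 0 (Suc q) F T" and v: "v \<in> F" and vs: "slots 0 q F [] vs"
  shows "contract s 0 0 u (tensor_prod 0 (Suc q) T (vec_tensor F v)) [] vs = T [] (v # vs)"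
proof -
  have F: "subspace F" using s by (rule basis_at_subspace)
  have len: "length vs = q" and sl: "slots 0 (Suc q) F [] (v # vs)" using vs v by (auto simp: slots_def)
  have lin: "lin_on F (\<lambda>v. T [] (v # vs))" using tensor_at_vec_lin[OF T sl _ F, of 0] by simp
  show ?thesis
    using lin_on_expand[OF s lin v] coeff_in_dual[OF s] len
    by (simp add: contract_def tensor_prod_def vec_tensor_def mult.commute)
qed

text \<open>The Leibniz rule for \<open>G(Y, Z)\<close>, from the two contractions that turn \<open>G \<otimes> Y\<close> into the
  covector field \<open>G(Y, _)\<close> and the product of this with \<open>Z\<close> into \<open>G(Y, Z)\<close>.\<close>

lemma D_metric:
  assumes W: "open_in (base B) W" and X: "smooth_section B W X"
    and Y: "smooth_section B W Y" and Z: "smooth_section B W Z" and u: "u \<in> W"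
    and G: "tensor_field B W 0 2 G"
  shows "D X G u [] [Y u, Z u] = a u (X u) (\<lambda>u. G u [] [Y u, Z u])
    - G u [] [cov X Y u, Z u] - G u [] [Y u, cov X Z u]"
proof -
  have "u \<in> points (base B)" using open_in_subset_points[OF W] u by blast
  then obtain U s where s: "(U, s) \<in> frames B" "u \<in> U" by (rule point_frame)
  \<comment> \<open>The contraction axiom applies only over open sets contained in the domain of a
    frame.\<close>
  define V where "V = U \<inter> W"
  have V: "open_in (base B) V" "V \<subseteq> W" "V \<subseteq> U" "u \<in> V"
    using open_in_Int[OF frame_open[OF s(1)] W] s u by (auto simp: V_def)
  note XV = section_subset[OF X V(2)] and YV = section_subset[OF Y V(2)] and ZV = section_subset[OF Z V(2)]
  have GV: "tensor_field B V 0 (Suc (Suc 0)) G" using tensor_field_subset[OF G V(2)] by (simp add: numeral_2_eq_2)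
  have b: "basis_at s v (fibre B v)" if "v \<in> V" for v using frame_basis[OF s(1)] V(3) that by blast
  note F = basis_at_subspace[OF b]
  define \<theta> where "\<theta> = (\<lambda>u. contract s 0 0 u (tensor_prod 0 2 (G u) (vec_field B Y u)))"
  have \<theta>: "\<theta> v [] [w] = G v [] [Y v, w]" if "v \<in> V" "w \<in> fibre B v" for v w
    using contract_vec[OF b[OF that(1)] tensor_fieldD[OF GV that(1)] sectionD[OF YV that(1)], of "[w]"] that(2)
    by (simp add: \<theta>_def slots_def numeral_2_eq_2)
  have prodY: "tensor_field B V 1 2 (\<lambda>u. tensor_prod 0 2 (G u) (vec_field B Y u))"
    using tensor_field_prod[OF V(1) GV tensor_field_vec[OF V(1) YV]] by (simp add: numeral_2_eq_2)
  have \<theta>0: "\<theta> v ws vs = 0" if v: "v \<in> V" and n: "\<not> slots 0 1 (fibre B v) ws vs" for v ws vs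
    unfolding \<theta>_def contract_def
    by (intro sum.neutral ballI tensor_at_outside[OF tensor_fieldD[OF prodY v]]) (use n in \<open>auto simp: slots_def\<close>)
  have \<theta>field: "tensor_field B V 0 1 \<theta>"
  proof (rule tensor_fieldI)
    fix v assume v: "v \<in> V"
    show "tensor_at 0 1 (fibre B v) (\<theta> v)"
    proof (rule tensor_atI)
      fix ws vs x y and j :: nat and c :: real
      assume sl: "slots 0 1 (fibre B v) ws vs" "j < 1" and xy: "x \<in> fibre B v" "y \<in> fibre B v"
      then obtain w where w: "ws = []" "vs = [w]" "j = 0" "w \<in> fibre B v"
        by (auto simp: slots_def length_Suc_conv)
      have "slots 0 (Suc (Suc 0)) (fibre B v) [] [Y v, w]"
        using sectionD[OF YV v] w by (simp add: slots_def)
      from tensor_at_vec[OF tensor_fieldD[OF GV v] this _ xy, of 1 c]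
      show "\<theta> v ws (vs[j := c *\<^sub>R x + y]) = c * \<theta> v ws (vs[j := x]) + \<theta> v ws (vs[j := y])"
        using xy F[OF v] by (simp add: w \<theta>[OF v] subspace_add subspace_scale)
    qed (use \<theta>0[OF v] in auto)
  next
    fix U' s' and "is" js :: "'k list" assume s': "(U', s') \<in> frames B" and len: "length is = 0" "length js = 1"
    obtain j where j: "is = []" "js = [j]" using len by (auto simp: length_Suc_conv)
    have o: "open_in (base B) (U' \<inter> V)" using open_in_Int[OF frame_open[OF s'] V(1)] .
    have "smooth_fun (base B) (U' \<inter> V) (\<lambda>v. \<Sum>k\<in>UNIV. coeff s' v k (Y v) * G v [] [s' k v, s' j v])"
    proof (intro smooth_fun_sum smooth_fun_mult o section_coeff[OF YV s'])
      show "smooth_fun (base B) (U' \<inter> V) (\<lambda>v. G v [] [s' k v, s' j v])" for k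
        using tensor_field_comp[OF GV s', of "[]" "[k, j]"] by simp
    qed
    then show "smooth_fun (base B) (U' \<inter> V) (\<lambda>v. \<theta> v (map (coeff s' v) is) (map (\<lambda>j. s' j v) js))"
    proof (rule smooth_fun_cong[OF o, rotated])
      fix v assume v: "v \<in> U' \<inter> V"
      have b': "basis_at s' v (fibre B v)" using frame_basis[OF s'] v by blast
      have sl: "slots 0 (Suc (Suc 0)) (fibre B v) [] [Y v, s' j v]"
        using sectionD[OF YV] basis_at_in[OF b'] v by (auto simp: slots_def)
      have lin: "lin_on (fibre B v) (\<lambda>y. G v [] [y, s' j v])"
        using tensor_at_vec_lin[OF tensor_fieldD[OF GV] sl _ F, of 0] v by simp
      show "(\<Sum>k\<in>UNIV. coeff s' v k (Y v) * G v [] [s' k v, s' j v]) = \<theta> v (map (coeff s' v) is) (map (\<lambda>j. s' j v) js)"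
        using lin_on_expand[OF b' lin sectionD[OF YV]] v basis_at_in[OF b'] by (simp add: j \<theta>)
    qed
  qed
  have DG: "tensor_at 0 (Suc (Suc 0)) (fibre B u) (D X G u)"
    using tensor_fieldD[OF D_tensor[OF V(1) XV GV] V(4)] .
  have Gu: "tensor_at 0 (Suc (Suc 0)) (fibre B u) (G u)" using tensor_fieldD[OF GV V(4)] .
  have c_add: "contract s 0 0 u (S + T) ws vs = contract s 0 0 u S ws vs + contract s 0 0 u T ws vs"
    for S T :: "'w tensor" and ws vs
    by (simp add: contract_def sum.distrib)
  have D\<theta>: "D X \<theta> u [] [w] = D X G u [] [Y u, w] + G u [] [cov X Y u, w]" if w: "w \<in> fibre B u" for w
  proof -
    have "D X \<theta> u = contract s 0 0 u (D X (\<lambda>u. tensor_prod 0 2 (G u) (vec_field B Y u)) u)"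
      unfolding \<theta>_def by (rule D_contract[OF V(1) XV prodY s(1) _ _ V(3,4)]) auto
    also have "D X (\<lambda>u. tensor_prod 0 2 (G u) (vec_field B Y u)) u =
        tensor_prod 0 2 (D X G u) (vec_field B Y u) + tensor_prod 0 2 (G u) (vec_tensor (fibre B u) (cov X Y u))"
      using D_prod[OF V(1) XV GV tensor_field_vec[OF V(1) YV] V(4)] D_vec[OF V(1) XV YV V(4)]
      by (simp add: numeral_2_eq_2)
    finally have *: "D X \<theta> u = contract s 0 0 u
      (tensor_prod 0 2 (D X G u) (vec_field B Y u) + tensor_prod 0 2 (G u) (vec_tensor (fibre B u) (cov X Y u)))" .
    show ?thesis
      unfolding * c_add
      using contract_vec[OF b[OF V(4)] DG sectionD[OF YV V(4)], of "[w]"]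
        contract_vec[OF b[OF V(4)] Gu cov_in[OF V(1) XV YV V(4)], of "[w]"] w
      by (simp add: slots_def numeral_2_eq_2)
  qed
  let ?f = "\<lambda>u. G u [] [Y u, Z u]"
  have \<theta>Z: "contract s 0 0 v (tensor_prod 0 1 (\<theta> v) (vec_field B Z v)) = fun_tensor (?f v)" if v: "v \<in> V" for v
  proof (intro ext)
    fix ws vs
    show "contract s 0 0 v (tensor_prod 0 1 (\<theta> v) (vec_field B Z v)) ws vs = fun_tensor (?f v) ws vs"
    proof (cases "ws = [] \<and> vs = []")
      case True
      then show ?thesis
        using contract_vec[OF b[OF v] _ sectionD[OF ZV v], of 0 "\<theta> v" "[]"] tensor_fieldD[OF \<theta>field v]
          \<theta>[OF v sectionD[OF ZV v]] by (simp add: slots_def fun_tensor_def)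
    next
      case False
      have "contract s 0 0 v (tensor_prod 0 1 (\<theta> v) (vec_field B Z v)) ws vs = 0"
        unfolding contract_def
        by (intro sum.neutral ballI tensor_at_outside[OF tensor_at_prod[OF tensor_fieldD[OF \<theta>field v]
              tensor_at_vec_tensor[OF sectionD[OF ZV v]]]]) (use False in \<open>auto simp: slots_def\<close>)
      then show ?thesis using False by (auto simp: fun_tensor_def)
    qed
  qed
  have f: "smooth_fun (base B) V ?f"
  proof (rule smooth_fun_cong[OF V(1)])
    have "smooth_fun (base B) (U \<inter> V) (\<lambda>v. \<Sum>k\<in>UNIV. coeff s v k (Z v) * \<theta> v [] [s k v])"
      using tensor_field_comp[OF \<theta>field s(1), of "[]" "[_]"]
      by (intro smooth_fun_sum smooth_fun_mult open_in_Int frame_open[OF s(1)] V(1) section_coeff[OF ZV s(1)]) simp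
    then show "smooth_fun (base B) V (\<lambda>v. \<Sum>k\<in>UNIV. coeff s v k (Z v) * \<theta> v [] [s k v])"
      using V(3) by (simp add: Int_absorb1)
    fix v assume v: "v \<in> V"
    have "slots 0 1 (fibre B v) [] [Z v]" using sectionD[OF ZV v] by (simp add: slots_def)
    from tensor_at_vec_lin[OF tensor_fieldD[OF \<theta>field v] this _ F[OF v], of 0]
    have lin: "lin_on (fibre B v) (\<lambda>y. \<theta> v [] [y])" by simp
    show "(\<Sum>k\<in>UNIV. coeff s v k (Z v) * \<theta> v [] [s k v]) = ?f v"
      using lin_on_expand[OF b[OF v] lin sectionD[OF ZV v]] \<theta>[OF v sectionD[OF ZV v]] by simp
  qed
  have prodZ: "tensor_field B V 1 1 (\<lambda>u. tensor_prod 0 1 (\<theta> u) (vec_field B Z u))"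
    using tensor_field_prod[OF V(1) \<theta>field tensor_field_vec[OF V(1) ZV]] by simp
  have "fun_tensor (a u (X u) ?f) = D X (\<lambda>u. fun_tensor (?f u)) u"
    using D_fun[OF V(1) XV f V(4)] by simp
  also have "\<dots> = D X (\<lambda>u. contract s 0 0 u (tensor_prod 0 1 (\<theta> u) (vec_field B Z u))) u"
    by (rule D_cong[OF V(1) XV tensor_field_fun[OF f], symmetric]) (simp_all only: \<theta>Z V(4))
  also have "\<dots> = contract s 0 0 u (D X (\<lambda>u. tensor_prod 0 1 (\<theta> u) (vec_field B Z u)) u)"
    by (rule D_contract[OF V(1) XV prodZ s(1) _ _ V(3,4)]) auto
  also have "D X (\<lambda>u. tensor_prod 0 1 (\<theta> u) (vec_field B Z u)) u =
      tensor_prod 0 1 (D X \<theta> u) (vec_field B Z u) + tensor_prod 0 1 (\<theta> u) (vec_tensor (fibre B u) (cov X Z u))"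
    using D_prod[OF V(1) XV \<theta>field tensor_field_vec[OF V(1) ZV] V(4)] D_vec[OF V(1) XV ZV V(4)] by simp
  finally have *: "fun_tensor (a u (X u) ?f) = contract s 0 0 u (tensor_prod 0 1 (D X \<theta> u) (vec_field B Z u) +
      tensor_prod 0 1 (\<theta> u) (vec_tensor (fibre B u) (cov X Z u)))" .
  have "a u (X u) ?f = (fun_tensor (a u (X u) ?f) :: 'w tensor) [] []" by (simp add: fun_tensor_def)
  also have "\<dots> = D X \<theta> u [] [Z u] + \<theta> u [] [cov X Z u]"
  proof -
    have \<theta>u: "tensor_at 0 (Suc 0) (fibre B u) (\<theta> u)" "tensor_at 0 (Suc 0) (fibre B u) (D X \<theta> u)"
      using tensor_fieldD[OF \<theta>field V(4)] tensor_fieldD[OF D_tensor[OF V(1) XV \<theta>field] V(4)] by simp_all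
    have sl: "slots 0 0 (fibre B u) [] []" by (simp add: slots_def)
    show ?thesis
      unfolding * c_add One_nat_def contract_vec[OF b[OF V(4)] \<theta>u(2) sectionD[OF ZV V(4)] sl]
        contract_vec[OF b[OF V(4)] \<theta>u(1) cov_in[OF V(1) XV ZV V(4)] sl] ..
  qed
  finally have "a u (X u) ?f = D X \<theta> u [] [Z u] + \<theta> u [] [cov X Z u]" .
  then show ?thesis
    using D\<theta>[OF sectionD[OF ZV V(4)]] \<theta>[OF V(4) cov_in[OF V(1) XV ZV V(4)]] by simp
qed

end

lemma lin_on_add_fun: "lin_on V f \<Longrightarrow> lin_on V g \<Longrightarrow> lin_on V (\<lambda>x. f x + g x)"
  by (auto simp: lin_on_def scaleR_add_right)

lemma lin_on_diff_fun: "lin_on V f \<Longrightarrow> lin_on V g \<Longrightarrow> lin_on V (\<lambda>x. f x - g x)"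
  by (auto simp: lin_on_def scaleR_diff_right)

lemma lin_on_scale_fun: "lin_on V f \<Longrightarrow> lin_on V (\<lambda>x. c *\<^sub>R f x)"
  by (auto simp: lin_on_def algebra_simps)

lemma lin_on_scale_left: "lin_on V f \<Longrightarrow> lin_on V (\<lambda>x. f x *\<^sub>R v)"
  by (auto simp: lin_on_def algebra_simps)

lemma lin_on_sum_fun: "(\<And>i. i \<in> I \<Longrightarrow> lin_on V (f i)) \<Longrightarrow> lin_on V (\<lambda>x. \<Sum>i\<in>I. f i x)"
  by (auto simp: lin_on_def sum.distrib scaleR_sum_right intro!: sum.cong)

lemma lin_on_comp: "lin_on V f \<Longrightarrow> (\<And>x. x \<in> V \<Longrightarrow> f x \<in> V) \<Longrightarrow> lin_on V g \<Longrightarrow> lin_on V (\<lambda>x. g (f x))"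
  by (auto simp: lin_on_def)

lemma lin_on_cong: "subspace V \<Longrightarrow> (\<And>v. v \<in> V \<Longrightarrow> f v = h v) \<Longrightarrow> lin_on V h \<Longrightarrow> lin_on V f"
  by (simp add: lin_on_def subspace_add subspace_scale)

lemma lin_on_ident: "lin_on V (\<lambda>x. x)"
  by (auto simp: lin_on_def)

lemma lin_on_eqI:
  fixes s :: "'k::finite \<Rightarrow> 'p \<Rightarrow> 'w::real_vector"
  assumes s: "basis_at s x V" and "lin_on V f" "lin_on V g" "\<And>k. f (s k x) = g (s k x)" "v \<in> V"
  shows "f v = g v"
  using lin_on_expand[OF s assms(2,5)] lin_on_expand[OF s assms(3,5)] assms(4) by simp

lemma bilin_eqI:
  fixes s :: "'k::finite \<Rightarrow> 'p \<Rightarrow> 'w::real_vector"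
  assumes s: "basis_at s x V" and f: "\<And>v. v \<in> V \<Longrightarrow> lin_on V (f v)" "\<And>w. w \<in> V \<Longrightarrow> lin_on V (\<lambda>v. f v w)"
    and g: "\<And>v. v \<in> V \<Longrightarrow> lin_on V (g v)" "\<And>w. w \<in> V \<Longrightarrow> lin_on V (\<lambda>v. g v w)"
    and eq: "\<And>j k. f (s j x) (s k x) = g (s j x) (s k x)" and vw: "v \<in> V" "w \<in> V"
  shows "f v w = g v w"
proof (rule lin_on_eqI[OF s f(2)[OF vw(2)] g(2)[OF vw(2)] _ vw(1)])
  show "f (s j x) w = g (s j x) w" for j
    using lin_on_eqI[OF s f(1)[OF basis_at_in[OF s]] g(1)[OF basis_at_in[OF s]] eq vw(2)] .
qed

lemma sum_Plus_UNIV: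
  fixes f :: "'k::finite + 'e::finite \<Rightarrow> 'z::comm_monoid_add"
  shows "(\<Sum>k\<in>UNIV. f k) = (\<Sum>\<alpha>\<in>UNIV. f (Inl \<alpha>)) + (\<Sum>b\<in>UNIV. f (Inr b))"
  unfolding UNIV_Plus_UNIV[symmetric] by (subst sum.Plus) auto

lemma (in framed_bundle) tensor2_smooth:
  assumes W: "open_in (base B) W" and T: "tensor_field B W 0 2 T"
    and Y: "smooth_section B W Y" and Z: "smooth_section B W Z"
  shows "smooth_fun (base B) W (\<lambda>u. T u [] [Y u, Z u])"
proof (rule smooth_fun_local)
  fix u assume u: "u \<in> W"
  then have "u \<in> points (base B)" using open_in_subset_points[OF W] by blast
  then obtain U s where s: "(U, s) \<in> frames B" "u \<in> U" by (rule point_frame)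
  have o: "open_in (base B) (U \<inter> W)" using open_in_Int[OF frame_open[OF s(1)] W] .
  have "smooth_fun (base B) (U \<inter> W) (\<lambda>v. T v [] [s j v, s k v])" for j k
    using tensor_field_comp[OF T s(1), of "[]" "[j, k]"] by simp
  then have "smooth_fun (base B) (U \<inter> W)
      (\<lambda>v. \<Sum>j\<in>UNIV. coeff s v j (Y v) * (\<Sum>k\<in>UNIV. coeff s v k (Z v) * T v [] [s j v, s k v]))"
    by (intro smooth_fun_sum smooth_fun_mult o section_coeff[OF Y s(1)] section_coeff[OF Z s(1)])
  moreover have "(\<Sum>j\<in>UNIV. coeff s v j (Y v) * (\<Sum>k\<in>UNIV. coeff s v k (Z v) * T v [] [s j v, s k v])) =
      T v [] [Y v, Z v]" if v: "v \<in> U \<inter> W" for v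
  proof -
    have b: "basis_at s v (fibre B v)" using frame_basis[OF s(1)] v by blast
    note F = basis_at_subspace[OF b]
    have Tv: "tensor_at 0 2 (fibre B v) (T v)" using tensor_fieldD[OF T] v by blast
    have YZ: "Y v \<in> fibre B v" "Z v \<in> fibre B v" using sectionD[OF Y] sectionD[OF Z] v by auto
    have l1: "lin_on (fibre B v) (\<lambda>y. T v [] [y, Z v])"
      using tensor_at_vec_lin[OF Tv _ _ F, of "[]" "[Y v, Z v]" 0] YZ by (simp add: slots_def)
    have l2: "lin_on (fibre B v) (\<lambda>z. T v [] [s j v, z])" for j
      using tensor_at_vec_lin[OF Tv _ _ F, of "[]" "[s j v, Z v]" 1] YZ basis_at_in[OF b] by (simp add: slots_def)
    show ?thesis
      using lin_on_expand[OF b l1 YZ(1)] lin_on_expand[OF b l2 YZ(2)] by simp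
  qed
  ultimately have "smooth_fun (base B) (U \<inter> W) (\<lambda>u. T u [] [Y u, Z u])"
    using smooth_fun_cong[OF o, of "\<lambda>v. \<Sum>j\<in>UNIV. coeff s v j (Y v) * (\<Sum>k\<in>UNIV. coeff s v k (Z v) * T v [] [s j v, s k v])"
        "\<lambda>u. T u [] [Y u, Z u]"] by simp
  then show "\<exists>V. open_in (base B) V \<and> u \<in> V \<and> smooth_fun (base B) V (\<lambda>u. T u [] [Y u, Z u])"
    using o s(2) u by blast
qed

section \<open>Bundles with a vertical subbundle\<close>

text \<open>The common ground of the two bundles, with \<open>I\<close> indexing choices of charts
  and frames. By \<open>vert\<close> the vertical subspace does not depend on the choice.
  \<open>L_trans\<close> is the transformation law of structure functions, given on the base and
  evaluated at the foot point \<open>fst u\<close>. The assumptions \<open>basic_h\<close> and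
  \<open>basic_v\<close> express infinitesimally that the transition coefficients are constant along
  the fibres.\<close>

locale split_bundle = framed_bundle B
  for B :: "('p \<times> 'o, 'c::euclidean_space, 'w::real_vector, 'k::finite + 'e::finite) vbundle" +
  fixes a :: "'p \<times> 'o \<Rightarrow> 'w \<Rightarrow> ('p \<times> 'o \<Rightarrow> real) \<Rightarrow> real"
    and I :: "'i set" and dom :: "'i \<Rightarrow> ('p \<times> 'o) set" and fr :: "'i \<Rightarrow> 'k + 'e \<Rightarrow> 'p \<times> 'o \<Rightarrow> 'w"
    and L :: "'i \<Rightarrow> 'k \<Rightarrow> 'k \<Rightarrow> 'k \<Rightarrow> 'p \<Rightarrow> real"
  assumes frames_eq: "frames B = (\<lambda>i. (dom i, fr i)) ` I"
    and vert: "i \<in> I \<Longrightarrow> j \<in> I \<Longrightarrow> u \<in> dom i \<Longrightarrow> u \<in> dom j \<Longrightarrow> coeff (fr i) u (Inl \<alpha>) (fr j (Inr b) u) = 0"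
    and anchor_tangent: "u \<in> points (base B) \<Longrightarrow> w \<in> fibre B u \<Longrightarrow> a u w \<in> tangent_space (base B) u"
    and anchor_lin: "u \<in> points (base B) \<Longrightarrow> lin_on (fibre B u) (\<lambda>w. a u w f)"
    and L_smooth: "i \<in> I \<Longrightarrow> smooth_fun (base B) (dom i) (\<lambda>u. L i \<theta> \<gamma> \<beta> (fst u))"
    and L_anti: "i \<in> I \<Longrightarrow> u \<in> dom i \<Longrightarrow> L i \<theta> \<gamma> \<beta> (fst u) = - L i \<theta> \<beta> \<gamma> (fst u)"
    and L_trans: "i \<in> I \<Longrightarrow> j \<in> I \<Longrightarrow> u \<in> dom i \<Longrightarrow> u \<in> dom j \<Longrightarrow>
      (\<Sum>\<theta>\<in>UNIV. L j \<theta> \<gamma> \<beta> (fst u) * coeff (fr i) u (Inl \<tau>) (fr j (Inl \<theta>) u)) =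
      (\<Sum>\<mu>\<in>UNIV. \<Sum>\<nu>\<in>UNIV. coeff (fr i) u (Inl \<mu>) (fr j (Inl \<gamma>) u) * coeff (fr i) u (Inl \<nu>) (fr j (Inl \<beta>) u) *
        L i \<tau> \<mu> \<nu> (fst u)) +
      a u (fr j (Inl \<gamma>) u) (\<lambda>u. coeff (fr i) u (Inl \<tau>) (fr j (Inl \<beta>) u)) -
      a u (fr j (Inl \<beta>) u) (\<lambda>u. coeff (fr i) u (Inl \<tau>) (fr j (Inl \<gamma>) u))"
    and basic_h: "i \<in> I \<Longrightarrow> j \<in> I \<Longrightarrow> u \<in> dom i \<Longrightarrow> u \<in> dom j \<Longrightarrow>
      a u (fr j (Inr c) u) (\<lambda>u. coeff (fr i) u (Inl \<tau>) (fr j (Inl \<beta>) u)) = 0"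
    and basic_v: "i \<in> I \<Longrightarrow> j \<in> I \<Longrightarrow> u \<in> dom i \<Longrightarrow> u \<in> dom j \<Longrightarrow>
      a u (fr j (Inr c) u) (\<lambda>u. coeff (fr i) u (Inr b) (fr j (Inr d) u)) = 0"
begin

lemma frame_in: "i \<in> I \<Longrightarrow> (dom i, fr i) \<in> frames B"
  by (auto simp: frames_eq)

lemma dom_open: "i \<in> I \<Longrightarrow> open_in (base B) (dom i)"
  using frame_open frame_in by blast

lemma dom_points: "i \<in> I \<Longrightarrow> u \<in> dom i \<Longrightarrow> u \<in> points (base B)"
  using open_in_subset_points[OF dom_open] by blast

lemma fr_basis: "i \<in> I \<Longrightarrow> u \<in> dom i \<Longrightarrow> basis_at (fr i) u (fibre B u)"
  using frame_basis frame_in by blast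

lemma point_dom: 
  assumes "u \<in> points (base B)" obtains i where "i \<in> I" "u \<in> dom i"
  using point_frame[OF assms] frames_eq that by (auto simp: image_iff)

lemma vertical_span:
  assumes i: "i \<in> I" "u \<in> dom i"
  shows "w \<in> span (range (\<lambda>b. fr i (Inr b) u)) \<longleftrightarrow> w \<in> fibre B u \<and> (\<forall>\<alpha>. coeff (fr i) u (Inl \<alpha>) w = 0)"
proof
  let ?R = "range (\<lambda>b. fr i (Inr b) u)"
  note b = fr_basis[OF i]
  note F = basis_at_subspace[OF b]
  assume w: "w \<in> span ?R"
  have "subspace {w \<in> fibre B u. \<forall>\<alpha>. coeff (fr i) u (Inl \<alpha>) w = 0}"
    using F lin_on_zero[OF coeff_lin_on[OF b] F]
    by (auto simp: subspace_def lin_on_add[OF coeff_lin_on[OF b]] lin_on_scale[OF coeff_lin_on[OF b]])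
  moreover have "?R \<subseteq> {w \<in> fibre B u. \<forall>\<alpha>. coeff (fr i) u (Inl \<alpha>) w = 0}"
    by (auto simp: basis_at_in[OF b] coeff_basis[OF b])
  ultimately show "w \<in> fibre B u \<and> (\<forall>\<alpha>. coeff (fr i) u (Inl \<alpha>) w = 0)"
    using w span_minimal by blast
next
  note b = fr_basis[OF i]
  assume w: "w \<in> fibre B u \<and> (\<forall>\<alpha>. coeff (fr i) u (Inl \<alpha>) w = 0)"
  then have "w = (\<Sum>b\<in>UNIV. coeff (fr i) u (Inr b) w *\<^sub>R fr i (Inr b) u)"
    using coeff_expand[OF b, of w] by (simp add: sum_Plus_UNIV)
  also have "\<dots> \<in> span (range (\<lambda>b. fr i (Inr b) u))"
    by (intro span_sum span_scale span_base) auto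
  finally show "w \<in> span (range (\<lambda>b. fr i (Inr b) u))" .
qed

text \<open>The union in the definition of the vertical fibre is a single subspace: by
  \<open>vert\<close>, vanishing of the Greek coefficients in one frame implies it in every
  other.\<close>

lemma vertical_iff:
  assumes i: "i \<in> I" "u \<in> dom i"
  shows "w \<in> fibre (vertical B) u \<longleftrightarrow> w \<in> fibre B u \<and> (\<forall>\<alpha>. coeff (fr i) u (Inl \<alpha>) w = 0)"
proof -
  have "coeff (fr i) u (Inl \<alpha>) w = 0"
    if j: "j \<in> I" "u \<in> dom j" and w: "w \<in> fibre B u" "\<And>\<alpha>. coeff (fr j) u (Inl \<alpha>) w = 0" for j \<alpha> w
    using coeff_change[OF fr_basis[OF i] fr_basis[OF j] w(1), of "Inl \<alpha>"] vert[OF i(1) j(1) i(2) j(2)] w(2)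
    by (simp add: sum_Plus_UNIV)
  moreover have "w \<in> fibre (vertical B) u \<longleftrightarrow> (\<exists>j\<in>I. u \<in> dom j \<and> w \<in> span (range (\<lambda>b. fr j (Inr b) u)))"
    unfolding vertical_def frames_eq by auto
  ultimately show ?thesis using vertical_span i by metis
qed

end

section \<open>The splitting into horizontal and vertical vectors, and adapted frames\<close>

locale split_structure = split_bundle B a I dom fr L
  for B :: "('p \<times> 'o, 'c::euclidean_space, 'w::real_vector, 'k::finite + 'e::finite) vbundle"
    and a and I :: "'i set" and dom fr L +
  fixes \<Gamma> :: "'p \<times> 'o \<Rightarrow> 'w \<Rightarrow> 'w"
    and D0 :: "('p \<times> 'o \<Rightarrow> 'w) \<Rightarrow> ('p \<times> 'o \<Rightarrow> 'w tensor) \<Rightarrow> 'p \<times> 'o \<Rightarrow> 'w tensor"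
    and G :: "'p \<times> 'o \<Rightarrow> 'w tensor"
  assumes rho: "rho_connection B \<Gamma>" and dist: "distinguished B a \<Gamma> D0" and metric: "pseudometrical B \<Gamma> G"

sublocale split_structure \<subseteq> bundle_connection B a D0
  using dist by unfold_locales (simp add: distinguished_def)

context split_structure
begin

abbreviation dl where "dl i \<equiv> adapted \<Gamma> (fr i)"
abbreviation V where "V u \<equiv> fibre (vertical B) u"
abbreviation H where "H u \<equiv> horizontal B \<Gamma> u"

lemma
  assumes u: "u \<in> points (base B)"
  shows Gamma_lin: "lin_on (fibre B u) (\<Gamma> u)"
    and Gamma_V: "w \<in> fibre B u \<Longrightarrow> \<Gamma> u w \<in> V u"
    and Gamma_id: "w \<in> V u \<Longrightarrow> \<Gamma> u w = w"
    and V_fibre: "w \<in> V u \<Longrightarrow> w \<in> fibre B u"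
proof -
  have *: "\<forall>v\<in>fibre B u. \<Gamma> u v \<in> V u \<and> (\<forall>w\<in>fibre B u. \<Gamma> u (v + w) = \<Gamma> u v + \<Gamma> u w) \<and>
      (\<forall>r. \<Gamma> u (r *\<^sub>R v) = r *\<^sub>R \<Gamma> u v)"
    using rho u by (simp add: rho_connection_def bundle_morphism_def)
  then show "lin_on (fibre B u) (\<Gamma> u)" "w \<in> fibre B u \<Longrightarrow> \<Gamma> u w \<in> V u"
    by (auto simp: lin_on_def)
  show "w \<in> V u \<Longrightarrow> \<Gamma> u w = w" using rho u by (simp add: rho_connection_def)
  obtain i where "i \<in> I" "u \<in> dom i" using point_dom[OF u] .
  then show "w \<in> V u \<Longrightarrow> w \<in> fibre B u" by (simp add: vertical_iff)
qed

lemma Gamma_fibre: "u \<in> points (base B) \<Longrightarrow> w \<in> fibre B u \<Longrightarrow> \<Gamma> u w \<in> fibre B u"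
  using V_fibre Gamma_V by blast

lemma H_iff: "w \<in> H u \<longleftrightarrow> w \<in> fibre B u \<and> \<Gamma> u w = 0"
  by (auto simp: horizontal_def)

text \<open>\<open>rho_connection\<close> provides smoothness only with respect to the frames of the
  vertical subbundle. In a full frame the Greek coefficients vanish and the Latin ones agree with
  those of the vertical frame.\<close>

lemma Gamma_section:
  assumes W: "open_in (base B) W" and X: "smooth_section B W X"
  shows "smooth_section B W (\<lambda>u. \<Gamma> u (X u))"
proof (rule sectionI)
  have pt: "u \<in> points (base B)" if "u \<in> W" for u using open_in_subset_points[OF W] that by blast
  show "\<Gamma> u (X u) \<in> fibre B u" if "u \<in> W" for u
    using Gamma_fibre[OF pt[OF that] sectionD[OF X that]] .
  fix U s k assume s: "(U, s) \<in> frames B"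
  then obtain i where i: "i \<in> I" "U = dom i" "s = fr i" by (auto simp: frames_eq)
  have o: "open_in (base B) (U \<inter> W)" using open_in_Int[OF frame_open[OF s] W] .
  show "smooth_fun (base B) (U \<inter> W) (\<lambda>u. coeff s u k (\<Gamma> u (X u)))"
  proof (cases k)
    case (Inl \<alpha>)
    have "coeff s u k (\<Gamma> u (X u)) = 0" if "u \<in> U \<inter> W" for u
      using Gamma_V[OF pt[of u] sectionD[OF X, of u]] vertical_iff[of i u] that i Inl by auto
    then show ?thesis using smooth_fun_cong[OF o _ smooth_fun_const[of _ 0]] by simp
  next
    case (Inr b)
    have "smooth_section (vertical B) W (\<lambda>u. \<Gamma> u (X u))"
      using rho W X by (simp add: rho_connection_def bundle_morphism_def)
    then have sm: "smooth_fun (base B) (U \<inter> W) (\<lambda>u. coeff (\<lambda>b. s (Inr b)) u b (\<Gamma> u (X u)))"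
      using s by (auto simp: smooth_section_def vertical_def)
    show ?thesis
    proof (rule smooth_fun_cong[OF o _ sm])
      fix u assume u: "u \<in> U \<inter> W"
      have bs: "basis_at s u (fibre B u)" using frame_basis[OF s] u by blast
      have "range (\<lambda>b. s (Inr b) u) \<subseteq> range (\<lambda>k. s k u)" by auto
      then have bv: "basis_at (\<lambda>b. s (Inr b)) u (span (range (\<lambda>b. s (Inr b) u)))"
        using bs independent_mono by (fastforce simp: basis_at_def inj_def)
      have mem: "\<Gamma> u (X u) \<in> span (range (\<lambda>b. s (Inr b) u))"
        using Gamma_V[OF pt[of u] sectionD[OF X, of u]] vertical_iff[of i u] vertical_span[of i u] u i by auto
      have "coeff s u (Inr b) (\<Gamma> u (X u)) =
          coeff s u (Inr b) (\<Sum>k\<in>UNIV. (case k of Inl \<alpha> \<Rightarrow> 0 | Inr b \<Rightarrow> coeff (\<lambda>b. s (Inr b)) u b (\<Gamma> u (X u))) *\<^sub>R s k u)"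
        using coeff_expand[OF bv mem] by (simp add: sum_Plus_UNIV)
      then show "coeff (\<lambda>b. s (Inr b)) u b (\<Gamma> u (X u)) = coeff s u k (\<Gamma> u (X u))"
        unfolding coeff_lincomb[OF bs] by (simp add: Inr)
    qed
  qed
qed

lemma dl_Inr [simp]: "dl i (Inr b) u = fr i (Inr b) u"
  by (simp add: adapted_def)

text \<open>The minus sign in \<open>Gamma_comp\<close> makes the added combination equal to minus
  the vertical part, so an adapted vector is the horizontal projection of the frame vector.\<close>

lemma dl_Inl:
  assumes i: "i \<in> I" "u \<in> dom i"
  shows "dl i (Inl \<alpha>) u = fr i (Inl \<alpha>) u - \<Gamma> u (fr i (Inl \<alpha>) u)"
proof -
  note b = fr_basis[OF i] and pt = dom_points[OF i]
  have v: "\<Gamma> u (fr i (Inl \<alpha>) u) \<in> V u" using Gamma_V[OF pt basis_at_in[OF b]] .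
  then have "(\<Sum>b\<in>UNIV. coeff (fr i) u (Inr b) (\<Gamma> u (fr i (Inl \<alpha>) u)) *\<^sub>R fr i (Inr b) u) = \<Gamma> u (fr i (Inl \<alpha>) u)"
    using coeff_expand[OF b, of "\<Gamma> u (fr i (Inl \<alpha>) u)"] by (simp add: vertical_iff[OF i] sum_Plus_UNIV)
  then show ?thesis by (simp add: adapted_def Gamma_comp_def sum_negf)
qed

lemma dl_Inr_V: "i \<in> I \<Longrightarrow> u \<in> dom i \<Longrightarrow> dl i (Inr b) u \<in> V u"
  by (simp add: vertical_iff coeff_basis[OF fr_basis] basis_at_in[OF fr_basis])

lemma dl_Inl_H:
  assumes i: "i \<in> I" "u \<in> dom i" shows "dl i (Inl \<alpha>) u \<in> H u"
proof -
  note b = fr_basis[OF i] and pt = dom_points[OF i]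
  have f: "fr i (Inl \<alpha>) u \<in> fibre B u" using basis_at_in[OF b] .
  have "\<Gamma> u (fr i (Inl \<alpha>) u + (-1) *\<^sub>R \<Gamma> u (fr i (Inl \<alpha>) u)) = 0"
    using Gamma_fibre[OF pt f] basis_at_subspace[OF b] Gamma_id[OF pt Gamma_V[OF pt f]]
    by (subst lin_on_add[OF Gamma_lin[OF pt] f])
       (simp_all add: subspace_neg lin_on_scale[OF Gamma_lin[OF pt], where r = "-1", simplified])
  then show ?thesis
    using f Gamma_fibre[OF pt f] basis_at_subspace[OF b]
    by (simp add: H_iff dl_Inl[OF i] subspace_diff)
qed

text \<open>The passage from \<open>fr i\<close> to \<open>dl i\<close> is unitriangular: Greek
  vectors change by vertical ones and Latin vectors stay. A relation therefore has zero Greek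
  coefficients first, and then zero Latin ones.\<close>

lemma dl_basis:
  assumes i: "i \<in> I" "u \<in> dom i" shows "basis_at (dl i) u (fibre B u)"
proof (rule basis_atI)
  note b = fr_basis[OF i] and pt = dom_points[OF i]
  note F = basis_at_subspace[OF b]
  have fib: "dl i k u \<in> fibre B u" for k
    using dl_Inl_H[OF i] V_fibre[OF pt dl_Inr_V[OF i]] by (cases k) (auto simp: H_iff)
  have coeff_dl: "coeff (fr i) u (Inl \<alpha>) (dl i (Inl \<beta>) u) = (if \<alpha> = \<beta> then 1 else 0)" for \<alpha> \<beta>
  proof -
    have v: "\<Gamma> u (fr i (Inl \<beta>) u) \<in> V u" using Gamma_V[OF pt basis_at_in[OF b]] .
    have "coeff (fr i) u (Inl \<alpha>) (fr i (Inl \<beta>) u + (-1) *\<^sub>R \<Gamma> u (fr i (Inl \<beta>) u)) = (if \<alpha> = \<beta> then 1 else 0)"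
      using v V_fibre[OF pt v] F
      by (subst lin_on_add[OF coeff_lin_on[OF b] basis_at_in[OF b]])
         (simp_all add: subspace_neg lin_on_scale[OF coeff_lin_on[OF b], where r = "-1", simplified]
           coeff_basis[OF b] vertical_iff[OF i])
    then show ?thesis by (simp add: dl_Inl[OF i])
  qed
  show "span (range (\<lambda>k. dl i k u)) = fibre B u"
  proof
    show "span (range (\<lambda>k. dl i k u)) \<subseteq> fibre B u" using fib F by (intro span_minimal) auto
    have "fr i k u \<in> span (range (\<lambda>k. dl i k u))" for k
    proof (cases k)
      case (Inr b)
      then show ?thesis by (metis dl_Inr rangeI span_base)
    next
      case (Inl \<alpha>)
      have "\<Gamma> u (fr i (Inl \<alpha>) u) \<in> span (range (\<lambda>b. fr i (Inr b) u))"
        using Gamma_V[OF pt basis_at_in[OF b]] by (simp add: vertical_iff[OF i] vertical_span[OF i])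
      also have "\<dots> \<subseteq> span (range (\<lambda>k. dl i k u))"
      proof (intro span_mono subsetI)
        fix w assume "w \<in> range (\<lambda>b. fr i (Inr b) u)"
        then obtain b where "w = dl i (Inr b) u" by auto
        then show "w \<in> range (\<lambda>k. dl i k u)" by blast
      qed
      finally have "\<Gamma> u (fr i (Inl \<alpha>) u) \<in> span (range (\<lambda>k. dl i k u))" .
      then have "dl i (Inl \<alpha>) u + \<Gamma> u (fr i (Inl \<alpha>) u) \<in> span (range (\<lambda>k. dl i k u))"
        by (intro span_add) (auto intro: span_base)
      then show ?thesis by (simp add: dl_Inl[OF i] Inl)
    qed
    then have "span (range (\<lambda>k. fr i k u)) \<subseteq> span (range (\<lambda>k. dl i k u))"
      by (intro span_minimal) auto
    then show "fibre B u \<subseteq> span (range (\<lambda>k. dl i k u))" using b by (simp add: basis_at_def)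
  qed
  fix c k assume c: "(\<Sum>k\<in>UNIV. c k *\<^sub>R dl i k u) = 0"
  have *: "(\<Sum>k\<in>UNIV. c k * coeff (fr i) u l (dl i k u)) = 0" for l
  proof -
    have "coeff (fr i) u l (\<Sum>k\<in>UNIV. c k *\<^sub>R dl i k u) = (\<Sum>k\<in>UNIV. c k * coeff (fr i) u l (dl i k u))"
      using fib F by (subst lin_on_sum[OF coeff_lin_on[OF b]])
        (auto simp: subspace_scale lin_on_scale[OF coeff_lin_on[OF b]])
    then show ?thesis using c lin_on_zero[OF coeff_lin_on[OF b] F] by simp
  qed
  have l: "c (Inl \<alpha>) = 0" for \<alpha>
    using *[of "Inl \<alpha>"] by (simp add: sum_Plus_UNIV coeff_dl coeff_basis[OF b] if_distrib[of "(*) _"] cong: if_cong)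
  have r: "c (Inr d) = 0" for d
    using *[of "Inr d"] by (simp add: sum_Plus_UNIV l coeff_basis[OF b] if_distrib[of "(*) _"] cong: if_cong)
  show "c k = 0" using l r by (cases k) auto
qed

lemma dl_in: "i \<in> I \<Longrightarrow> u \<in> dom i \<Longrightarrow> dl i k u \<in> fibre B u"
  using basis_at_in[OF dl_basis] .

lemma dl_section: 
  assumes i: "i \<in> I" shows "smooth_section B (dom i) (dl i k)"
proof (cases k)
  case (Inr b)
  then show ?thesis
    using section_cong[OF dom_open[OF i] _ frame_section[OF frame_in[OF i], of "Inr b"], of "dl i k"] by simp
next
  case (Inl \<alpha>)
  have "smooth_section B (dom i) (\<lambda>u. (-1) *\<^sub>R \<Gamma> u (fr i (Inl \<alpha>) u) + fr i (Inl \<alpha>) u)"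
    by (intro section_lincomb Gamma_section smooth_fun_const dom_open i frame_section[OF frame_in])
  then show ?thesis
    by (rule section_cong[OF dom_open[OF i], rotated]) (simp add: Inl dl_Inl[OF i])
qed

lemma dl_frame: "i \<in> I \<Longrightarrow> local_frame (dom i) (dl i)"
  by (simp add: local_frame_def dom_open dl_basis dl_section)

lemma coeff_V:
  assumes i: "i \<in> I" "u \<in> dom i" and w: "w \<in> V u" shows "coeff (dl i) u (Inl \<alpha>) w = 0"
proof -
  note b = fr_basis[OF i]
  have fib: "w \<in> fibre B u" using w by (simp add: vertical_iff[OF i])
  have "coeff (dl i) u (Inl \<alpha>) (fr i (Inr b) u) = 0" for b
    using coeff_basis[OF dl_basis[OF i], of "Inl \<alpha>" "Inr b"] by simp
  then show ?thesis
    using coeff_change[OF dl_basis[OF i] b fib, of "Inl \<alpha>"] w by (simp add: sum_Plus_UNIV vertical_iff[OF i])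
qed

lemma coeff_H:
  assumes i: "i \<in> I" "u \<in> dom i" and w: "w \<in> H u" shows "coeff (dl i) u (Inr b) w = 0"
proof -
  note d = dl_basis[OF i] and pt = dom_points[OF i]
  have fib: "w \<in> fibre B u" and \<Gamma>: "\<Gamma> u w = 0" using w by (auto simp: H_iff)
  have "\<Gamma> u (dl i (Inl \<alpha>) u) = 0" for \<alpha> using dl_Inl_H[OF i] by (simp add: H_iff)
  then have "(\<Sum>b\<in>UNIV. coeff (dl i) u (Inr b) w *\<^sub>R dl i (Inr b) u) = 0"
    using lin_on_expand[OF d Gamma_lin[OF pt] fib] Gamma_id[OF pt dl_Inr_V[OF i]]
    by (simp add: sum_Plus_UNIV \<Gamma>)
  \<comment> \<open>The Latin coefficients are padded with zeros to a relation in the whole adapted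
    frame, whose independence then applies.\<close>
  then have "(\<Sum>k\<in>UNIV. (case k of Inl \<alpha> \<Rightarrow> 0 | Inr b \<Rightarrow> coeff (dl i) u (Inr b) w) *\<^sub>R dl i k u) = 0"
    by (simp add: sum_Plus_UNIV)
  then show ?thesis
    using coeff_lincomb[OF d, of "Inr b" "\<lambda>k. case k of Inl \<alpha> \<Rightarrow> 0 | Inr b \<Rightarrow> coeff (dl i) u (Inr b) w"]
      lin_on_zero[OF coeff_lin_on[OF d] basis_at_subspace[OF d]] by simp
qed

lemma H_iff_coeff:
  assumes i: "i \<in> I" "u \<in> dom i"
  shows "w \<in> H u \<longleftrightarrow> w \<in> fibre B u \<and> (\<forall>b. coeff (dl i) u (Inr b) w = 0)"
proof (intro iffI conjI allI)
  assume w: "w \<in> fibre B u \<and> (\<forall>b. coeff (dl i) u (Inr b) w = 0)"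
  have "\<Gamma> u (dl i (Inl \<alpha>) u) = 0" for \<alpha> using dl_Inl_H[OF i] by (simp add: H_iff)
  then have "\<Gamma> u w = 0"
    using lin_on_expand[OF dl_basis[OF i] Gamma_lin[OF dom_points[OF i]], of w] w by (simp add: sum_Plus_UNIV)
  then show "w \<in> H u" using w by (simp add: H_iff)
qed (use coeff_H[OF i] in \<open>auto simp: H_iff\<close>)

lemma V_iff_coeff:
  assumes i: "i \<in> I" "u \<in> dom i"
  shows "w \<in> V u \<longleftrightarrow> w \<in> fibre B u \<and> (\<forall>\<alpha>. coeff (dl i) u (Inl \<alpha>) w = 0)"
proof (intro iffI conjI allI)
  note b = fr_basis[OF i]
  assume w: "w \<in> fibre B u \<and> (\<forall>\<alpha>. coeff (dl i) u (Inl \<alpha>) w = 0)"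
  then have "coeff (fr i) u (Inl \<alpha>) w = 0" for \<alpha>
    using coeff_change[OF b dl_basis[OF i], of w "Inl \<alpha>"]
    by (simp add: sum_Plus_UNIV coeff_basis[OF b])
  then show "w \<in> V u" using w by (simp add: vertical_iff[OF i])
qed (use coeff_V[OF i] in \<open>auto simp: vertical_iff[OF i]\<close>)

definition hor where "hor u w = w - \<Gamma> u w"

lemma hor_lin: "u \<in> points (base B) \<Longrightarrow> lin_on (fibre B u) (hor u)"
  unfolding hor_def by (intro lin_on_diff_fun lin_on_ident Gamma_lin)

lemma hor_fibre: "u \<in> points (base B) \<Longrightarrow> w \<in> fibre B u \<Longrightarrow> hor u w \<in> fibre B u"
  unfolding hor_def by (intro subspace_diff subspace_fibre Gamma_fibre)

lemma hor_H: "w \<in> H u \<Longrightarrow> hor u w = w"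
  by (simp add: hor_def H_iff)

lemma hor_V: "u \<in> points (base B) \<Longrightarrow> w \<in> V u \<Longrightarrow> hor u w = 0"
  by (simp add: hor_def Gamma_id)

lemma Gamma_H: "w \<in> H u \<Longrightarrow> \<Gamma> u w = 0"
  by (simp add: H_iff)

lemma hor_section:
  assumes "open_in (base B) W" "smooth_section B W X" shows "smooth_section B W (\<lambda>u. hor u (X u))"
  using section_lincomb[OF assms(1) smooth_fun_const[of _ "-1"] Gamma_section[OF assms] assms(2)]
  by (simp add: hor_def)

section \<open>The metric as a nondegenerate form, and the raising of indices\<close>

abbreviation g where "g u v w \<equiv> G u [] [v, w]"

lemma G_field: "tensor_field B (points (base B)) 0 2 G"
  using metric by (simp add: pseudometrical_def)

lemma G_field_on: "open_in (base B) W \<Longrightarrow> tensor_field B W 0 2 G"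
  using tensor_field_subset[OF G_field open_in_subset_points] .

lemma form_lin:
  assumes T: "tensor_at 0 2 F T" and F: "subspace F" and v: "v \<in> F"
  shows "lin_on F (\<lambda>w. T [] [v, w])" "lin_on F (\<lambda>w. T [] [w, v])"
  using tensor_at_vec_lin[OF T _ _ F, of "[]" "[v, v]" 1] tensor_at_vec_lin[OF T _ _ F, of "[]" "[v, v]" 0] v
  by (simp_all add: slots_def)

lemma g_lin:
  assumes "u \<in> points (base B)" "v \<in> fibre B u"
  shows "lin_on (fibre B u) (\<lambda>w. g u v w)" "lin_on (fibre B u) (\<lambda>w. g u w v)"
  using form_lin[OF tensor_fieldD[OF G_field assms(1)] subspace_fibre[OF assms(1)] assms(2)] .

lemma metric_local:
  assumes i: "i \<in> I" "u \<in> dom i"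
  shows "G u = (\<Sum>\<alpha>\<in>UNIV. \<Sum>\<beta>\<in>UNIV. metric_h G (dl i) \<alpha> \<beta> u *\<^sub>R
            tensor_prod 0 1 (cov_tensor (coeff (dl i) u (Inl \<alpha>))) (cov_tensor (coeff (dl i) u (Inl \<beta>)))) +
         (\<Sum>a\<in>UNIV. \<Sum>b\<in>UNIV. metric_v G (dl i) a b u *\<^sub>R
            tensor_prod 0 1 (cov_tensor (coeff (dl i) u (Inr a))) (cov_tensor (coeff (dl i) u (Inr b))))"
      (is ?A)
    and "metric_h G (dl i) \<alpha> \<beta> u = metric_h G (dl i) \<beta> \<alpha> u" (is ?B)
    and "metric_v G (dl i) b d u = metric_v G (dl i) d b u" (is ?C)
    and "invertible (mat_of (metric_h G (dl i)) u)" (is ?D)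
    and "invertible (mat_of (metric_v G (dl i)) u)" (is ?E)
proof -
  have "\<forall>p\<in>frames B. \<forall>u\<in>fst p. let \<delta> = adapted \<Gamma> (snd p); g = metric_h G \<delta>; h = metric_v G \<delta> in
         G u = (\<Sum>\<alpha>\<in>UNIV. \<Sum>\<beta>\<in>UNIV. g \<alpha> \<beta> u *\<^sub>R
                  tensor_prod 0 1 (cov_tensor (coeff \<delta> u (Inl \<alpha>))) (cov_tensor (coeff \<delta> u (Inl \<beta>)))) +
               (\<Sum>a\<in>UNIV. \<Sum>b\<in>UNIV. h a b u *\<^sub>R
                  tensor_prod 0 1 (cov_tensor (coeff \<delta> u (Inr a))) (cov_tensor (coeff \<delta> u (Inr b)))) \<and>
         (\<forall>\<alpha> \<beta>. g \<alpha> \<beta> u = g \<beta> \<alpha> u) \<and> (\<forall>a b. h a b u = h b a u) \<and>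
         invertible (mat_of g u) \<and> invertible (mat_of h u)"
    using metric unfolding pseudometrical_def Let_def split_beta by blast
  from bspec[OF bspec[OF this frame_in[OF i(1)], unfolded fst_conv] i(2)]
  show ?A ?B ?C ?D ?E unfolding Let_def snd_conv by blast+
qed

text \<open>The block form of \<open>G\<close> in the adapted dual frame has no mixed terms.\<close>

lemma g_dl:
  assumes i: "i \<in> I" "u \<in> dom i"
  shows "g u (dl i (Inl \<alpha>) u) (dl i (Inr b) u) = 0" "g u (dl i (Inr b) u) (dl i (Inl \<alpha>) u) = 0"
  by (subst metric_local(1)[OF i], simp add: sum_apply scaleR_fun_def tensor_prod_def cov_tensor_def
      coeff_basis[OF dl_basis[OF i]] del: dl_Inr)+

lemma g_dl_sym:
  assumes i: "i \<in> I" "u \<in> dom i"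
  shows "g u (dl i j u) (dl i k u) = g u (dl i k u) (dl i j u)"
  using metric_local(2,3)[OF i] g_dl[OF i]
  by (cases j; cases k) (simp_all add: metric_h_def metric_v_def)

lemma g_sym:
  assumes u: "u \<in> points (base B)" and "v \<in> fibre B u" "w \<in> fibre B u"
  shows "g u v w = g u w v"
proof -
  obtain i where i: "i \<in> I" "u \<in> dom i" using point_dom[OF u] .
  show ?thesis
    by (rule bilin_eqI[OF dl_basis[OF i] g_lin(1)[OF u] g_lin(2)[OF u] g_lin(2)[OF u] g_lin(1)[OF u]
          g_dl_sym[OF i] assms(2,3)])
qed

lemma g_HV:
  assumes u: "u \<in> points (base B)" and v: "v \<in> H u" and w: "w \<in> V u"
  shows "g u v w = 0" "g u w v = 0"
proof -
  obtain i where i: "i \<in> I" "u \<in> dom i" using point_dom[OF u] .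
  have fib: "v \<in> fibre B u" "w \<in> fibre B u" using v V_fibre[OF u w] by (auto simp: H_iff)
  have "g u v w = (\<Sum>k\<in>UNIV. coeff (dl i) u k v * (\<Sum>l\<in>UNIV. coeff (dl i) u l w * g u (dl i k u) (dl i l u)))"
    using lin_on_expand[OF dl_basis[OF i] g_lin(2)[OF u fib(2)] fib(1)]
      lin_on_expand[OF dl_basis[OF i] g_lin(1)[OF u dl_in[OF i]] fib(2)] by simp
  also have "\<dots> = 0" using coeff_H[OF i v] coeff_V[OF i w] g_dl[OF i] by (simp add: sum_Plus_UNIV)
  finally show "g u v w = 0" .
  then show "g u w v = 0" using g_sym[OF u fib] by simp
qed

text \<open>Both inverse matrices together form the block-diagonal inverse of the matrix of
  \<open>G\<close> in the adapted frame; a single family over the sum type spares a separate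
  treatment of the two kinds of indices.\<close>

definition gi :: "_ \<Rightarrow> _ \<Rightarrow> _ \<Rightarrow> _ \<Rightarrow> real"
  where "gi i l m u = (case (l, m) of
     (Inl \<alpha>, Inl \<beta>) \<Rightarrow> inv_comp (metric_h G (dl i)) \<alpha> \<beta> u
   | (Inr b, Inr d) \<Rightarrow> inv_comp (metric_v G (dl i)) b d u
   | _ \<Rightarrow> 0)"

lemma gi_inverse:
  assumes i: "i \<in> I" "u \<in> dom i"
  shows "(\<Sum>l\<in>UNIV. g u (dl i k u) (dl i l u) * gi i l m u) = (if k = m then 1 else 0)" (is ?R)
    and "(\<Sum>l\<in>UNIV. gi i k l u * g u (dl i l u) (dl i m u)) = (if k = m then 1 else 0)" (is ?L)
proof -
  have inv: "(\<Sum>l\<in>UNIV. h j l u * inv_comp h l m u) = (if j = m then 1 else 0)"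
    "(\<Sum>l\<in>UNIV. inv_comp h j l u * h l m u) = (if j = m then 1 else 0)"
    if "invertible (mat_of h u)" for h :: "'n::finite \<Rightarrow> 'n \<Rightarrow> _" and j m
    using arg_cong[OF matrix_inv_right[OF that], of "\<lambda>M. M $ j $ m"]
      arg_cong[OF matrix_inv_left[OF that], of "\<lambda>M. M $ j $ m"]
    by (auto simp: matrix_matrix_mult_def mat_def mat_of_def inv_comp_def)
  have h: "(\<Sum>l\<in>UNIV. g u (dl i (Inl j) u) (dl i (Inl l) u) * inv_comp (metric_h G (dl i)) l m u) = (if j = m then 1 else 0)"
    "(\<Sum>l\<in>UNIV. inv_comp (metric_h G (dl i)) j l u * g u (dl i (Inl l) u) (dl i (Inl m) u)) = (if j = m then 1 else 0)" for j m
    using inv[OF metric_local(4)[OF i], of j m] unfolding metric_h_def[of G "dl i" _ _ u] by blast+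
  have v: "(\<Sum>l\<in>UNIV. g u (dl i (Inr j) u) (dl i (Inr l) u) * inv_comp (metric_v G (dl i)) l m u) = (if j = m then 1 else 0)"
    "(\<Sum>l\<in>UNIV. inv_comp (metric_v G (dl i)) j l u * g u (dl i (Inr l) u) (dl i (Inr m) u)) = (if j = m then 1 else 0)" for j m
    using inv[OF metric_local(5)[OF i], of j m] unfolding metric_v_def[of G "dl i" _ _ u] by blast+
  show ?R
    using h(1) v(1) g_dl[OF i] by (cases k; cases m) (simp_all add: sum_Plus_UNIV gi_def)
  show ?L
    using h(2) v(2) g_dl[OF i] by (cases k; cases m) (simp_all add: sum_Plus_UNIV gi_def)
qed

lemma gi_smooth:
  assumes i: "i \<in> I" shows "smooth_fun (base B) (dom i) (gi i l m)"
proof -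
  have gs: "smooth_fun (base B) (dom i) (\<lambda>u. g u (dl i j u) (dl i k u))" for j k
    by (intro tensor2_smooth dom_open G_field_on dl_section i)
  have "smooth_fun (base B) (dom i) (inv_comp (metric_h G (dl i)) \<alpha> \<beta>)" for \<alpha> \<beta>
    unfolding inv_comp_def[abs_def]
    using gs metric_local(4)[OF i]
    by (intro smooth_matrix_inv dom_open i) (auto simp: mat_of_def metric_h_def)
  moreover have "smooth_fun (base B) (dom i) (inv_comp (metric_v G (dl i)) b d)" for b d
    unfolding inv_comp_def[abs_def]
    using gs[of "Inr _" "Inr _"] metric_local(5)[OF i]
    by (intro smooth_matrix_inv dom_open i) (auto simp: mat_of_def metric_v_def)
  ultimately show ?thesis
    by (cases l; cases m) (simp_all add: gi_def[abs_def] smooth_fun_const)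
qed

lemma g_nondegenerate:
  assumes u: "u \<in> points (base B)" and z: "z \<in> fibre B u" and 0: "\<And>w. w \<in> fibre B u \<Longrightarrow> g u z w = 0"
  shows "z = 0"
proof -
  obtain i where i: "i \<in> I" "u \<in> dom i" using point_dom[OF u] .
  have "coeff (dl i) u m z = 0" for m
  proof -
    have "(\<Sum>l\<in>UNIV. (\<Sum>k\<in>UNIV. coeff (dl i) u k z * g u (dl i k u) (dl i l u)) * gi i l m u) = 0"
      using lin_on_expand[OF dl_basis[OF i] g_lin(2)[OF u dl_in[OF i]] z] 0[OF dl_in[OF i]] by simp
    moreover have "(\<Sum>l\<in>UNIV. (\<Sum>k\<in>UNIV. coeff (dl i) u k z * g u (dl i k u) (dl i l u)) * gi i l m u) =
      (\<Sum>k\<in>UNIV. coeff (dl i) u k z * (\<Sum>l\<in>UNIV. g u (dl i k u) (dl i l u) * gi i l m u))"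
      by (simp add: sum_distrib_left sum_distrib_right mult.assoc) (rule sum.swap)
    ultimately show ?thesis by (simp add: gi_inverse(1)[OF i] if_distrib[of "(*) _"] cong: if_cong)
  qed
  then show ?thesis using coeff_expand[OF dl_basis[OF i] z] by simp
qed

text \<open>The vector that represents a functional through \<open>g\<close>. Defining it without a
  frame makes everything built from it global; the frame formula \<open>sharp_frame\<close> then
  gives smoothness and components.\<close>

definition sharp where "sharp u \<kappa> = (THE z. z \<in> fibre B u \<and> (\<forall>w\<in>fibre B u. g u z w = \<kappa> w))"

lemma sharp_eqI:
  assumes u: "u \<in> points (base B)" and z: "z \<in> fibre B u" "\<And>w. w \<in> fibre B u \<Longrightarrow> g u z w = \<kappa> w"
  shows "sharp u \<kappa> = z"
  unfolding sharp_def
proof (rule the_equality)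
  fix z' assume z': "z' \<in> fibre B u \<and> (\<forall>w\<in>fibre B u. g u z' w = \<kappa> w)"
  have "g u (z' + (-1) *\<^sub>R z) w = 0" if w: "w \<in> fibre B u" for w
    using lin_on_add[OF g_lin(2)[OF u w], of z' "(-1) *\<^sub>R z"] lin_on_scale[OF g_lin(2)[OF u w] z(1), of "-1"]
      z z' w subspace_fibre[OF u] by (simp add: subspace_neg)
  then have "z' + (-1) *\<^sub>R z = 0"
    using z z' subspace_fibre[OF u] by (intro g_nondegenerate[OF u]) (simp_all add: subspace_diff)
  then show "z' = z" by simp
qed (use z in auto)

lemma
  assumes i: "i \<in> I" "u \<in> dom i" and \<kappa>: "lin_on (fibre B u) \<kappa>"
  shows sharp_frame: "sharp u \<kappa> = (\<Sum>l\<in>UNIV. (\<Sum>m\<in>UNIV. gi i l m u * \<kappa> (dl i m u)) *\<^sub>R dl i l u)" (is "_ = ?z")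
    and sharp_frame_in: "sharp u \<kappa> \<in> fibre B u"
    and sharp_frame_eq: "w \<in> fibre B u \<Longrightarrow> g u (sharp u \<kappa>) w = \<kappa> w"
proof -
  note u = dom_points[OF i]
  note F = subspace_fibre[OF u]
  have z: "?z \<in> fibre B u" using F dl_in[OF i] by (intro subspace_sum) (auto intro: subspace_scale)
  have eq: "g u ?z w = \<kappa> w" if w: "w \<in> fibre B u" for w
  proof (rule lin_on_eqI[OF dl_basis[OF i] g_lin(1)[OF u z] \<kappa> _ w])
    fix k
    have "g u ?z (dl i k u) = (\<Sum>l\<in>UNIV. (\<Sum>m\<in>UNIV. gi i l m u * \<kappa> (dl i m u)) * g u (dl i l u) (dl i k u))"
      using F dl_in[OF i]
      by (subst lin_on_sum[OF g_lin(2)[OF u dl_in[OF i]] F])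
         (auto simp: subspace_scale lin_on_scale[OF g_lin(2)[OF u dl_in[OF i]]])
    also have "\<dots> = (\<Sum>m\<in>UNIV. (\<Sum>l\<in>UNIV. g u (dl i k u) (dl i l u) * gi i l m u) * \<kappa> (dl i m u))"
      unfolding sum_distrib_right g_dl_sym[OF i, of _ k]
      by (subst sum.swap) (simp add: mult_ac)
    also have "\<dots> = \<kappa> (dl i k u)" by (simp add: gi_inverse(1)[OF i] if_distrib[of "\<lambda>x. x * _"] cong: if_cong)
    finally show "g u ?z (dl i k u) = \<kappa> (dl i k u)" .
  qed
  show *: "sharp u \<kappa> = ?z" by (rule sharp_eqI[OF u z eq])
  show "sharp u \<kappa> \<in> fibre B u" using z by (simp only: *)
  show "w \<in> fibre B u \<Longrightarrow> g u (sharp u \<kappa>) w = \<kappa> w" using eq by (simp only: *)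
qed

lemma
  assumes u: "u \<in> points (base B)" and \<kappa>: "lin_on (fibre B u) \<kappa>"
  shows sharp_in: "sharp u \<kappa> \<in> fibre B u"
    and sharp_eq: "w \<in> fibre B u \<Longrightarrow> g u (sharp u \<kappa>) w = \<kappa> w"
proof -
  obtain i where i: "i \<in> I" "u \<in> dom i" using point_dom[OF u] .
  show "sharp u \<kappa> \<in> fibre B u" "w \<in> fibre B u \<Longrightarrow> g u (sharp u \<kappa>) w = \<kappa> w"
    using sharp_frame_in[OF i \<kappa>] sharp_frame_eq[OF i \<kappa>] .
qed

section \<open>The covariant derivative of the metric and the torsion\<close>

text \<open>An arbitrary frame at each point, without any regularity in \<open>u\<close>. The
  quantities defined through it are afterwards identified with ones that are independent of the
  choice.\<close>

definition frame_of where "frame_of u = (SOME i. i \<in> I \<and> u \<in> dom i)"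

lemma frame_of: "u \<in> points (base B) \<Longrightarrow> frame_of u \<in> I" "u \<in> points (base B) \<Longrightarrow> u \<in> dom (frame_of u)"
  unfolding frame_of_def by (metis (mono_tags, lifting) point_dom someI_ex)+

text \<open>The derivative of \<open>G\<close> with respect to \<open>D0\<close> as a form in single
  vectors. A connection takes sections as directions, whereas \<open>S\<close> has to be prescribed
  point by point.\<close>

definition Q where "Q u x v w = (\<Sum>k\<in>UNIV. coeff (dl (frame_of u)) u k x * D0 (dl (frame_of u) k) G u [] [v, w])"

text \<open>Near \<open>u\<close> the direction is expanded in the adapted frame; linearity over
  functions then shows that only its value at \<open>u\<close> matters.\<close>

lemma D0_Q:
  assumes W: "open_in (base B) W" and X: "smooth_section B W X" and u: "u \<in> W"
  shows "D0 X G u [] [v, w] = Q u (X u) v w"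
proof -
  have pt: "u \<in> points (base B)" using open_in_subset_points[OF W] u by blast
  define i where "i = frame_of u"
  have i: "i \<in> I" "u \<in> dom i" using frame_of[OF pt] by (auto simp: i_def)
  let ?W = "dom i \<inter> W"
  have W': "open_in (base B) ?W" using open_in_Int[OF dom_open[OF i(1)] W] .
  have GW: "tensor_field B ?W 0 2 G" using G_field_on[OF W'] .
  have c: "smooth_fun (base B) ?W (\<lambda>u. coeff (dl i) u k (X u))" for k
    using local_frame_coeff[OF dl_frame[OF i(1)] W X] .
  have d: "smooth_section B ?W (dl i k)" for k by (rule section_subset[OF dl_section[OF i(1)]]) auto
  have "D0 X G u = D0 (\<lambda>u. \<Sum>k\<in>UNIV. coeff (dl i) u k (X u) *\<^sub>R dl i k u) G u"
    using coeff_expand[OF dl_basis[OF i(1)] sectionD[OF X]] u i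
    by (intro D_cong[OF W' _ GW]) (auto intro!: section_sum section_scale W' c d)
  also have "\<dots> = (\<Sum>k\<in>UNIV. coeff (dl i) u k (X u) *\<^sub>R D0 (dl i k) G u)"
    by (rule D_sum[OF W' GW c d]) (use u i in simp)
  finally show ?thesis by (simp add: Q_def i_def sum_apply scaleR_fun_def)
qed

lemma Q_lin1: "u \<in> points (base B) \<Longrightarrow> lin_on (fibre B u) (\<lambda>x. Q u x v w)"
  unfolding Q_def real_scaleR_def[symmetric]
  by (intro lin_on_sum_fun lin_on_scale_left coeff_lin_on dl_basis frame_of)

lemma Q_lin23:
  assumes u: "u \<in> points (base B)" and v: "v \<in> fibre B u"
  shows "lin_on (fibre B u) (\<lambda>w. Q u x v w)" "lin_on (fibre B u) (\<lambda>w. Q u x w v)"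
proof -
  let ?i = "frame_of u"
  have "tensor_at 0 2 (fibre B u) (D0 (dl ?i k) G u)" for k
    using tensor_fieldD[OF D_tensor[OF dom_open dl_section G_field_on[OF dom_open]]] frame_of[OF u] by blast
  note l = form_lin[OF this subspace_fibre[OF u] v]
  show "lin_on (fibre B u) (\<lambda>w. Q u x v w)" "lin_on (fibre B u) (\<lambda>w. Q u x w v)"
    unfolding Q_def real_scaleR_def[symmetric] by (intro lin_on_sum_fun lin_on_scale_fun l)+
qed

lemma cov_dl_in: "i \<in> I \<Longrightarrow> u \<in> dom i \<Longrightarrow> cov (dl i k) (dl i l) u \<in> fibre B u"
  using cov_in[OF dom_open dl_section dl_section] .

lemma
  assumes i: "i \<in> I" "u \<in> dom i"
  shows cov_dl_H: "cov (dl i k) (dl i (Inl \<beta>)) u \<in> H u"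
    and cov_dl_V: "cov (dl i k) (dl i (Inr b)) u \<in> V u"
proof -
  note pt = dom_points[OF i]
  note dv = D_vec[OF dom_open[OF i(1)] dl_section[OF i(1)] dl_section[OF i(1)] i(2)]
  have *: "z \<in> fibre B u \<Longrightarrow> D0 (dl i k) (vec_field B (dl i l)) u = vec_tensor (fibre B u) z \<Longrightarrow> cov (dl i k) (dl i l) u = z" for z l
    using cov_eqI[OF dom_open[OF i(1)] dl_section[OF i(1)] dl_section[OF i(1)] i(2)] .
  have ds: "((\<forall>u\<in>dom i. dl i l u \<in> H u) \<longrightarrow>
          (\<forall>u\<in>dom i. D0 (dl i k) (vec_field B (dl i l)) u \<in> vec_tensor (fibre B u) ` H u)) \<and>
       ((\<forall>u\<in>dom i. dl i l u \<in> V u) \<longrightarrow>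
          (\<forall>u\<in>dom i. D0 (dl i k) (vec_field B (dl i l)) u \<in> vec_tensor (fibre B u) ` V u))" for l
    using dist[unfolded distinguished_def, THEN conjunct2, rule_format, of "dom i" "dl i k" "dl i l"]
      dom_open[OF i(1)] dl_section[OF i(1)] by blast
  have "D0 (dl i k) (vec_field B (dl i (Inl \<beta>))) u \<in> vec_tensor (fibre B u) ` H u"
    using ds[of "Inl \<beta>"] dl_Inl_H[OF i(1)] i(2) by blast
  then show "cov (dl i k) (dl i (Inl \<beta>)) u \<in> H u" using *[of _ "Inl \<beta>"] by (auto simp: H_iff)
  have "D0 (dl i k) (vec_field B (dl i (Inr b))) u \<in> vec_tensor (fibre B u) ` V u"
    using ds[of "Inr b"] dl_Inr_V[OF i(1)] i(2) by blast
  then show "cov (dl i k) (dl i (Inr b)) u \<in> V u" using *[of _ "Inr b"] V_fibre[OF pt] by auto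
qed

lemma Q_dl:
  assumes i: "i \<in> I" "u \<in> dom i"
  shows "Q u (dl i k u) (dl i l u) (dl i m u) = a u (dl i k u) (\<lambda>u. g u (dl i l u) (dl i m u))
    - g u (cov (dl i k) (dl i l) u) (dl i m u) - g u (dl i l u) (cov (dl i k) (dl i m) u)"
  by (rule trans[OF D0_Q[OF dom_open[OF i(1)] dl_section[OF i(1), of k] i(2), symmetric]
      D_metric[OF dom_open[OF i(1)] dl_section[OF i(1)] dl_section[OF i(1)] dl_section[OF i(1)] i(2)
      G_field_on[OF dom_open[OF i(1)]]]])

lemma Q_sym:
  assumes u: "u \<in> points (base B)" and "x \<in> fibre B u" "v \<in> fibre B u" "w \<in> fibre B u"
  shows "Q u x v w = Q u x w v"
proof -
  obtain i where i: "i \<in> I" "u \<in> dom i" using point_dom[OF u] .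
  have *: "Q u (dl i k u) (dl i l u) (dl i m u) = Q u (dl i k u) (dl i m u) (dl i l u)" for k l m
  proof -
    have "a u (dl i k u) (\<lambda>u. g u (dl i l u) (dl i m u)) = a u (dl i k u) (\<lambda>u. g u (dl i m u) (dl i l u))"
      by (rule tangent_cong[OF anchor_tangent[OF u dl_in[OF i]] dom_open[OF i(1)] i(2) g_dl_sym[OF i(1)]])
    then show ?thesis
      unfolding Q_dl[OF i] using g_sym[OF u cov_dl_in[OF i] dl_in[OF i]] by simp
  qed
  have "Q u (dl i k u) v w = Q u (dl i k u) w v" for k
    by (rule bilin_eqI[OF dl_basis[OF i], where f = "Q u (dl i k u)" and g = "\<lambda>v w. Q u (dl i k u) w v"])
       (rule Q_lin23[OF u] * assms | assumption)+
  then show ?thesis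
    by (intro lin_on_eqI[OF dl_basis[OF i] Q_lin1[OF u] Q_lin1[OF u] _ assms(2)])
qed

text \<open>On mixed frame pairs each of the three terms in \<open>Q_dl\<close> is zero:
  \<open>g\<close> vanishes on such pairs in a whole neighbourhood, so its derivative vanishes, and
  \<open>D0\<close> preserves both subbundles, so the other two terms are again mixed.\<close>

lemma Q_HV:
  assumes u: "u \<in> points (base B)" and x: "x \<in> fibre B u" and v: "v \<in> H u" and w: "w \<in> V u"
  shows "Q u x v w = 0" "Q u x w v = 0"
proof -
  obtain i where i: "i \<in> I" "u \<in> dom i" using point_dom[OF u] .
  have fib: "v \<in> fibre B u" "w \<in> fibre B u" using v V_fibre[OF u w] by (auto simp: H_iff)
  have 0: "Q u (dl i k u) (dl i (Inl \<alpha>) u) (dl i (Inr b) u) = 0" for k \<alpha> b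
  proof -
    have "a u (dl i k u) (\<lambda>u. g u (dl i (Inl \<alpha>) u) (dl i (Inr b) u)) = a u (dl i k u) (\<lambda>u. 0)"
      by (rule tangent_cong[OF anchor_tangent[OF u dl_in[OF i]] dom_open[OF i(1)] i(2) g_dl(1)[OF i(1)]])
    also have "\<dots> = 0" by (rule tangent_const[OF anchor_tangent[OF u dl_in[OF i]]])
    finally show ?thesis
      unfolding Q_dl[OF i]
      using g_HV(1)[OF u cov_dl_H[OF i] dl_Inr_V[OF i]] g_HV(1)[OF u dl_Inl_H[OF i] cov_dl_V[OF i]] by simp
  qed
  have "Q u (dl i k u) v w = 0" for k
    using lin_on_expand[OF dl_basis[OF i] Q_lin23(2)[OF u fib(2)] fib(1)]
      lin_on_expand[OF dl_basis[OF i] Q_lin23(1)[OF u dl_in[OF i]] fib(2)]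
      coeff_H[OF i v] coeff_V[OF i w] 0
    by (simp add: sum_Plus_UNIV del: dl_Inr)
  then show "Q u x v w = 0" using lin_on_expand[OF dl_basis[OF i] Q_lin1[OF u] x] by simp
  then show "Q u x w v = 0" using Q_sym[OF u x fib] by simp
qed

text \<open>Structure functions for all index triples. Vertical pairs get 0, as the coordinate
  fields of the fibres commute.\<close>

definition Lf :: "'i \<Rightarrow> 'k + 'e \<Rightarrow> 'k + 'e \<Rightarrow> 'k + 'e \<Rightarrow> 'p \<times> 'o \<Rightarrow> real"
  where "Lf i l j k u = (case (l, j, k) of (Inl \<theta>, Inl \<beta>, Inl \<gamma>) \<Rightarrow> L i \<theta> \<beta> \<gamma> (fst u) | _ \<Rightarrow> 0)"

definition same :: "'x + 'y \<Rightarrow> 'x + 'y \<Rightarrow> bool" where "same j k \<longleftrightarrow> (isl j \<longleftrightarrow> isl k)"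

text \<open>The torsion of \<open>D0\<close> with the bracket of adapted sections replaced by the
  combination with coefficients \<open>Lf\<close>.\<close>

definition tor0 where "tor0 i j k u =
  cov (dl i j) (dl i k) u - cov (dl i k) (dl i j) u - (\<Sum>l\<in>UNIV. Lf i l j k u *\<^sub>R dl i l u)"

text \<open>Cut off on mixed pairs, where \<open>tor0\<close> is not tensorial in general:
  horizontal derivatives of the vertical transition coefficients would remain in its transformation
  law.\<close>

definition tor where "tor i j k u = (if same j k then tor0 i j k u else 0)"

definition Tor where "Tor i u x v =
  (\<Sum>j\<in>UNIV. \<Sum>k\<in>UNIV. (coeff (dl i) u j x * coeff (dl i) u k v) *\<^sub>R tor i j k u)"

lemma tor_fibre:
  assumes i: "i \<in> I" "u \<in> dom i" shows "tor i j k u \<in> fibre B u"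
proof -
  note F = subspace_fibre[OF dom_points[OF i]]
  show ?thesis
    unfolding tor_def tor0_def
    by (simp add: subspace_0[OF F] subspace_diff[OF F] subspace_sum[OF F] subspace_scale[OF F]
        cov_dl_in[OF i] dl_in[OF i])
qed

lemma Tor_fibre:
  assumes i: "i \<in> I" "u \<in> dom i" shows "Tor i u x v \<in> fibre B u"
  unfolding Tor_def
  by (intro subspace_sum subspace_scale subspace_fibre[OF dom_points[OF i]] tor_fibre[OF i])

lemma Tor_lin:
  assumes "i \<in> I" "u \<in> dom i"
  shows "lin_on (fibre B u) (\<lambda>x. Tor i u x v)" "lin_on (fibre B u) (\<lambda>x. Tor i u v x)"
  unfolding Tor_def scaleR_scaleR[symmetric]
  by (intro lin_on_sum_fun lin_on_scale_left lin_on_scale_fun coeff_lin_on dl_basis assms)+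

lemma Tor_dl:
  assumes i: "i \<in> I" "u \<in> dom i" shows "Tor i u (dl i j u) (dl i k u) = tor i j k u"
proof -
  have *: "(\<Sum>k\<in>UNIV. (c * (if k = k0 then 1 else 0)) *\<^sub>R f k) = c *\<^sub>R f k0"
    for c k0 and f :: "'k + 'e \<Rightarrow> 'w"
    by (subst sum.remove[of _ k0]) (auto intro!: sum.neutral)
  show ?thesis
    unfolding Tor_def coeff_basis[OF dl_basis[OF i]] *
    using *[of 1 j "\<lambda>j. tor i j k u"] by simp
qed

lemma tor_anti: "i \<in> I \<Longrightarrow> u \<in> dom i \<Longrightarrow> tor i j k u = - tor i k j u"
proof -
  assume i: "i \<in> I" "u \<in> dom i"
  have "(\<Sum>l\<in>UNIV. Lf i l j k u *\<^sub>R dl i l u) = (\<Sum>l\<in>UNIV. - (Lf i l k j u *\<^sub>R dl i l u))"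
  proof (intro sum.cong refl)
    fix l
    have *: "Lf i l j k u = - Lf i l k j u"
      by (auto simp: Lf_def split: sum.split intro: L_anti[OF i])
    show "Lf i l j k u *\<^sub>R dl i l u = - (Lf i l k j u *\<^sub>R dl i l u)" by (subst *) (rule scaleR_minus_left)
  qed
  then have "tor0 i j k u = - tor0 i k j u" by (simp add: tor0_def sum_negf)
  then show ?thesis by (auto simp: tor_def same_def)
qed

lemma Tor_anti:
  assumes i: "i \<in> I" "u \<in> dom i"
  shows "Tor i u x v = - Tor i u v x"
proof -
  have "Tor i u x v = (\<Sum>j\<in>UNIV. \<Sum>k\<in>UNIV. (coeff (dl i) u j x * coeff (dl i) u k v) *\<^sub>R - tor i k j u)"
    unfolding Tor_def by (intro sum.cong refl arg_cong[of _ _ "scaleR _"] tor_anti[OF i])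
  also have "\<dots> = (\<Sum>k\<in>UNIV. \<Sum>j\<in>UNIV. (coeff (dl i) u j x * coeff (dl i) u k v) *\<^sub>R - tor i k j u)"
    by (rule sum.swap)
  finally show ?thesis by (simp add: Tor_def sum_negf mult.commute)
qed

lemma Lf_zero [simp]: "Lf i (Inr b) j k u = 0" "Lf i l (Inr b) k u = 0" "Lf i l j (Inr b) u = 0"
  by (auto simp: Lf_def split: sum.split)

section \<open>Change of the adapted frame and tensoriality of the restricted torsion\<close>

context
  fixes i j assumes i: "i \<in> I" and j: "j \<in> I"
begin

definition P where "P m k v = coeff (dl i) v m (dl j k v)"

lemma P_smooth: "smooth_fun (base B) (dom i \<inter> dom j) (P m k)"
  using local_frame_coeff[OF dl_frame[OF i] dom_open[OF j] dl_section[OF j]] by (simp add: P_def[abs_def])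

lemma P_expand:
  assumes "v \<in> dom i" "v \<in> dom j" shows "dl j k v = (\<Sum>m\<in>UNIV. P m k v *\<^sub>R dl i m v)"
  using coeff_expand[OF dl_basis[OF i assms(1)] dl_in[OF j assms(2)]] by (simp add: P_def)

text \<open>Both adapted frames respect the same splitting, so the transition matrix is
  block-diagonal.\<close>

lemma P_mixed:
  assumes v: "v \<in> dom i" "v \<in> dom j" and "\<not> same m k" shows "P m k v = 0"
  using coeff_V[OF i v(1) dl_Inr_V[OF j v(2)]] coeff_H[OF i v(1) dl_Inl_H[OF j v(2)]] assms(3)
  by (cases m; cases k) (auto simp: same_def P_def)

text \<open>The usual transformation law of connection coefficients. Its second sum is the
  inhomogeneous part, whose antisymmetrization the structure functions have to absorb.\<close>

lemma cov_change:
  assumes u: "u \<in> dom i" "u \<in> dom j"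
  shows "cov (dl j k) (dl j l) u =
    (\<Sum>m\<in>UNIV. \<Sum>n\<in>UNIV. (P m k u * P n l u) *\<^sub>R cov (dl i m) (dl i n) u) +
    (\<Sum>n\<in>UNIV. a u (dl j k u) (P n l) *\<^sub>R dl i n u)"
proof -
  let ?N = "dom i \<inter> dom j"
  have N: "open_in (base B) ?N" using open_in_Int[OF dom_open[OF i] dom_open[OF j]] .
  have uN: "u \<in> ?N" using u by blast
  have di: "smooth_section B ?N (dl i m)" for m by (rule section_subset[OF dl_section[OF i]]) auto
  have dj: "smooth_section B ?N (dl j m)" for m by (rule section_subset[OF dl_section[OF j]]) auto
  have di_sum: "smooth_section B ?N (\<lambda>v. \<Sum>m\<in>UNIV. P m k v *\<^sub>R dl i m v)" for k
    by (intro section_sum section_scale N P_smooth di)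
  have 1: "cov (dl j k) (dl i n) u = (\<Sum>m\<in>UNIV. P m k u *\<^sub>R cov (dl i m) (dl i n) u)" for n
  proof -
    have "cov (dl j k) (dl i n) u = cov (\<lambda>v. \<Sum>m\<in>UNIV. P m k v *\<^sub>R dl i m v) (dl i n) u"
      by (rule cov_cong[OF N di_sum di uN]) (auto intro: P_expand)
    also have "\<dots> = (\<Sum>m\<in>UNIV. P m k u *\<^sub>R cov (dl i m) (dl i n) u)"
      by (rule cov_sum_left[OF N P_smooth di di uN])
    finally show ?thesis .
  qed
  have "cov (dl j k) (dl j l) u = cov (dl j k) (\<lambda>v. \<Sum>n\<in>UNIV. P n l v *\<^sub>R dl i n v) u"
    by (rule cov_cong[OF N dj di_sum uN]) (auto intro: P_expand)
  also have "\<dots> = (\<Sum>n\<in>UNIV. P n l u *\<^sub>R cov (dl j k) (dl i n) u + a u (dl j k u) (P n l) *\<^sub>R dl i n u)"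
    by (rule cov_sum_right[OF N P_smooth di dj uN])
  also have "\<dots> = (\<Sum>n\<in>UNIV. \<Sum>m\<in>UNIV. (P m k u * P n l u) *\<^sub>R cov (dl i m) (dl i n) u) +
      (\<Sum>n\<in>UNIV. a u (dl j k u) (P n l) *\<^sub>R dl i n u)"
    by (simp add: 1 sum.distrib scaleR_sum_right mult.commute)
  finally show ?thesis by (subst sum.swap)
qed

text \<open>Greek coefficients do not see vertical parts, so \<Gamma> drops out. The Greek block for
  adapted frames is that of the original frames, to which the assumptions of the locale
  refer.\<close>

lemma P_Inl:
  assumes v: "v \<in> dom i" "v \<in> dom j"
  shows "P (Inl \<tau>) (Inl \<beta>) v = coeff (fr i) v (Inl \<tau>) (fr j (Inl \<beta>) v)"
proof -
  have pt: "v \<in> points (base B)" by (rule dom_points[OF i v(1)])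
  note F = subspace_fibre[OF pt] and c = coeff_lin_on[OF dl_basis[OF i v(1)], of "Inl \<tau>"]
  have w: "fr j (Inl \<beta>) v \<in> fibre B v" by (rule basis_at_in[OF fr_basis[OF j v(2)]])
  have *: "coeff (fr i) v (Inl \<tau>) (dl i (Inl \<alpha>) v) = (if \<tau> = \<alpha> then 1 else 0)" for \<alpha>
  proof -
    have f: "fr i (Inl \<alpha>) v \<in> fibre B v" by (rule basis_at_in[OF fr_basis[OF i v(1)]])
    have "coeff (fr i) v (Inl \<tau>) (fr i (Inl \<alpha>) v) = coeff (fr i) v (Inl \<tau>) (dl i (Inl \<alpha>) v + \<Gamma> v (fr i (Inl \<alpha>) v))"
      by (simp add: dl_Inl[OF i v(1)])
    also have "\<dots> = coeff (fr i) v (Inl \<tau>) (dl i (Inl \<alpha>) v) + coeff (fr i) v (Inl \<tau>) (\<Gamma> v (fr i (Inl \<alpha>) v))"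
      by (rule lin_on_add[OF coeff_lin_on[OF fr_basis[OF i v(1)]] dl_in[OF i v(1)] Gamma_fibre[OF pt f]])
    finally show ?thesis
      using Gamma_V[OF pt f] by (simp add: coeff_basis[OF fr_basis[OF i v(1)]] vertical_iff[OF i v(1)])
  qed
  have "coeff (fr i) v (Inl \<tau>) (fr j (Inl \<beta>) v) = coeff (dl i) v (Inl \<tau>) (fr j (Inl \<beta>) v)"
    using coeff_change[OF fr_basis[OF i v(1)] dl_basis[OF i v(1)] w, of "Inl \<tau>"]
    by (simp add: sum_Plus_UNIV * coeff_basis[OF fr_basis[OF i v(1)]] if_distrib[of "\<lambda>x. x * _"] cong: if_cong)
  also have "\<dots> = coeff (dl i) v (Inl \<tau>) (dl j (Inl \<beta>) v + \<Gamma> v (fr j (Inl \<beta>) v))"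
    by (simp add: dl_Inl[OF j v(2)])
  also have "\<dots> = coeff (dl i) v (Inl \<tau>) (dl j (Inl \<beta>) v) + coeff (dl i) v (Inl \<tau>) (\<Gamma> v (fr j (Inl \<beta>) v))"
    by (rule lin_on_add[OF c dl_in[OF j v(2)] Gamma_fibre[OF pt w]])
  also have "coeff (dl i) v (Inl \<tau>) (\<Gamma> v (fr j (Inl \<beta>) v)) = 0"
    by (rule coeff_V[OF i v(1) Gamma_V[OF pt w]])
  finally show ?thesis by (simp add: P_def)
qed

lemma P_Inr:
  assumes v: "v \<in> dom i" "v \<in> dom j"
  shows "P (Inr b) (Inr d) v = coeff (fr i) v (Inr b) (fr j (Inr d) v)"
proof -
  have w: "fr j (Inr d) v \<in> fibre B v" by (rule basis_at_in[OF fr_basis[OF j v(2)]])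
  have "coeff (dl i) v (Inl \<alpha>) (fr j (Inr d) v) = 0" for \<alpha>
    using coeff_V[OF i v(1) dl_Inr_V[OF j v(2)]] by simp
  then show ?thesis
    using coeff_change[OF fr_basis[OF i v(1)] dl_basis[OF i v(1)] w, of "Inr b"]
    by (simp add: P_def sum_Plus_UNIV coeff_basis[OF fr_basis[OF i v(1)]] if_distrib[of "\<lambda>x. x * _"] cong: if_cong)
qed

lemma anchor_P_cong:
  assumes u: "u \<in> dom i" "u \<in> dom j" and w: "w \<in> fibre B u"
    and eq: "\<And>v. v \<in> dom i \<Longrightarrow> v \<in> dom j \<Longrightarrow> P m k v = f v"
  shows "a u w (P m k) = a u w f"
  using u by (intro tangent_cong[OF anchor_tangent[OF dom_points[OF i u(1)] w]
        open_in_Int[OF dom_open[OF i] dom_open[OF j]]]) (auto intro: eq)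

lemma anchor_P_mixed:
  assumes u: "u \<in> dom i" "u \<in> dom j" and w: "w \<in> fibre B u" and m: "\<not> same m k"
  shows "a u w (P m k) = 0"
proof -
  have "a u w (P m k) = a u w (\<lambda>v. 0)" by (rule anchor_P_cong[OF u w P_mixed[OF _ _ m]])
  also have "\<dots> = 0" by (rule tangent_const[OF anchor_tangent[OF dom_points[OF i u(1)] w]])
  finally show ?thesis .
qed

lemma anchor_P_Inr:
  assumes u: "u \<in> dom i" "u \<in> dom j"
  shows "a u (dl j (Inr c) u) (P (Inr b) (Inr d)) = 0"
  using anchor_P_cong[OF u dl_in[OF j u(2), of "Inr c"] P_Inr] basic_v[OF i j u] by simp

text \<open>The adapted vector differs from the frame vector by a vertical one, and by
  \<open>basic_h\<close> vertical vectors annihilate the Greek transition coefficients.\<close>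

lemma anchor_P_Inl:
  assumes u: "u \<in> dom i" "u \<in> dom j"
  shows "a u (dl j (Inl \<gamma>) u) (P (Inl \<tau>) (Inl \<beta>)) =
    a u (fr j (Inl \<gamma>) u) (\<lambda>u. coeff (fr i) u (Inl \<tau>) (fr j (Inl \<beta>) u))"
proof -
  let ?M = "\<lambda>u. coeff (fr i) u (Inl \<tau>) (fr j (Inl \<beta>) u)"
  have pt: "u \<in> points (base B)" by (rule dom_points[OF i u(1)])
  note lin = anchor_lin[OF pt, of ?M]
  have f: "fr j (Inl \<gamma>) u \<in> fibre B u" by (rule basis_at_in[OF fr_basis[OF j u(2)]])
  have "a u (\<Gamma> u (fr j (Inl \<gamma>) u)) ?M = 0"
    using lin_on_expand[OF fr_basis[OF j u(2)] lin Gamma_fibre[OF pt f]] Gamma_V[OF pt f] basic_h[OF i j u]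
    by (simp add: sum_Plus_UNIV vertical_iff[OF j u(2)])
  moreover have "a u (fr j (Inl \<gamma>) u) ?M = a u (dl j (Inl \<gamma>) u) ?M + a u (\<Gamma> u (fr j (Inl \<gamma>) u)) ?M"
    using lin_on_add[OF lin dl_in[OF j u(2), of "Inl \<gamma>"] Gamma_fibre[OF pt f]] by (simp add: dl_Inl[OF j u(2)])
  ultimately show ?thesis using anchor_P_cong[OF u dl_in[OF j u(2)] P_Inl] by simp
qed

text \<open>For a horizontal pair the Greek components are \<open>L_trans\<close>, and in the Latin
  components everything vanishes because the transition matrix is block-diagonal. For a vertical
  pair all terms vanish, the derivatives by block-diagonality or by \<open>basic_v\<close>.\<close>

lemma Lf_trans:
  assumes u: "u \<in> dom i" "u \<in> dom j" and kl: "same k l"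
  shows "(\<Sum>\<theta>\<in>UNIV. Lf j \<theta> k l u * P n \<theta> u) =
    (\<Sum>m\<in>UNIV. \<Sum>p\<in>UNIV. P m k u * P p l u * Lf i n m p u) + a u (dl j k u) (P n l) - a u (dl j l u) (P n k)"
proof (cases k)
  case (Inl \<gamma>)
  then obtain \<beta> where l: "l = Inl \<beta>" using kl by (cases l) (auto simp: same_def)
  show ?thesis
  proof (cases n)
    case n: (Inl \<tau>)
    have "(\<Sum>\<theta>\<in>UNIV. Lf j \<theta> k l u * P n \<theta> u) =
        (\<Sum>\<theta>\<in>UNIV. L j \<theta> \<gamma> \<beta> (fst u) * coeff (fr i) u (Inl \<tau>) (fr j (Inl \<theta>) u))"
      by (simp add: sum_Plus_UNIV Lf_def Inl l n P_Inl[OF u])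
    moreover have "(\<Sum>m\<in>UNIV. \<Sum>p\<in>UNIV. P m k u * P p l u * Lf i n m p u) =
        (\<Sum>\<mu>\<in>UNIV. \<Sum>\<nu>\<in>UNIV. coeff (fr i) u (Inl \<mu>) (fr j (Inl \<gamma>) u) * coeff (fr i) u (Inl \<nu>) (fr j (Inl \<beta>) u) *
        L i \<tau> \<mu> \<nu> (fst u))"
      by (simp add: sum_Plus_UNIV Lf_def Inl l n P_Inl[OF u])
    ultimately show ?thesis
      using L_trans[OF i j u, of \<gamma> \<beta> \<tau>] by (simp add: Inl l n anchor_P_Inl[OF u])
  next
    case n: (Inr b)
    have "P (Inr b) (Inl \<alpha>) u = 0" for \<alpha> by (rule P_mixed[OF u]) (simp add: same_def)
    then have "(\<Sum>\<theta>\<in>UNIV. Lf j \<theta> k l u * P n \<theta> u) = 0"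
      by (simp add: sum_Plus_UNIV Lf_def Inl l n)
    moreover have "a u (dl j k u) (P n l) = 0" "a u (dl j l u) (P n k) = 0"
      by (rule anchor_P_mixed[OF u dl_in[OF j u(2)]]; simp add: same_def Inl l n)+
    ultimately show ?thesis by (simp add: n)
  qed
next
  case (Inr c)
  then obtain d where l: "l = Inr d" using kl by (cases l) (auto simp: same_def)
  have "P (Inl \<alpha>) (Inr b) u = 0" for \<alpha> b by (rule P_mixed[OF u]) (simp add: same_def)
  then have "(\<Sum>m\<in>UNIV. \<Sum>p\<in>UNIV. P m k u * P p l u * Lf i n m p u) = 0"
    by (simp add: sum_Plus_UNIV Inr l)
  moreover have "a u (dl j k u) (P n l) = 0" "a u (dl j l u) (P n k) = 0"
  proof (cases n, goal_cases)
    case (1 \<alpha>) then show ?case by (intro anchor_P_mixed[OF u dl_in[OF j u(2)]]) (simp add: same_def l)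
  next
    case (2 b) then show ?case using anchor_P_Inr[OF u] by (simp add: Inr l)
  next
    case 3 then show ?case
    proof (cases n)
      case (Inl \<alpha>) then show ?thesis by (intro anchor_P_mixed[OF u dl_in[OF j u(2)]]) (simp add: same_def \<open>k = Inr c\<close>)
    next
      case (Inr b) then show ?thesis using anchor_P_Inr[OF u] by (simp add: \<open>k = Inr c\<close> l)
    qed
  qed
  ultimately show ?thesis by (simp add: Inr l)
qed

text \<open>For pairs of the same kind, the antisymmetrized inhomogeneous terms of
  \<open>cov_change\<close> are exactly the derivative terms of \<open>Lf_trans\<close>, and the two
  cancel.\<close>

lemma tor_change:
  assumes u: "u \<in> dom i" "u \<in> dom j"
  shows "tor j k l u = (\<Sum>m\<in>UNIV. \<Sum>n\<in>UNIV. (P m k u * P n l u) *\<^sub>R tor i m n u)"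
proof (cases "same k l")
  case False
  \<comment> \<open>For a mixed pair every term of the double sum is zero: either an entry of the
    transition matrix is off the diagonal blocks, or the pair \<open>m\<close>, \<open>n\<close> is
    mixed too and \<open>tor\<close> is cut off.\<close>
  have *: "(P m k u * P n l u) *\<^sub>R tor i m n u = 0" for m n
  proof (cases "same m k \<and> same n l")
    case True
    then have "\<not> same m n" using False by (auto simp: same_def)
    then show ?thesis by (simp add: tor_def)
  qed (use P_mixed[OF u] in auto)
  show ?thesis unfolding * using False by (simp add: tor_def)
next
  case True
  let ?c = "\<lambda>m n. cov (dl i m) (dl i n) u"
  have "(\<Sum>\<theta>\<in>UNIV. Lf j \<theta> k l u *\<^sub>R dl j \<theta> u) = (\<Sum>n\<in>UNIV. (\<Sum>\<theta>\<in>UNIV. Lf j \<theta> k l u * P n \<theta> u) *\<^sub>R dl i n u)"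
    unfolding P_expand[OF u] scaleR_sum_left scaleR_sum_right scaleR_scaleR by (rule sum.swap)
  also have "\<dots> = (\<Sum>n\<in>UNIV. (\<Sum>m\<in>UNIV. \<Sum>p\<in>UNIV. P m k u * P p l u * Lf i n m p u) *\<^sub>R dl i n u)
      + (\<Sum>n\<in>UNIV. a u (dl j k u) (P n l) *\<^sub>R dl i n u) - (\<Sum>n\<in>UNIV. a u (dl j l u) (P n k) *\<^sub>R dl i n u)"
    unfolding Lf_trans[OF u True] by (simp add: scaleR_add_left scaleR_diff_left sum.distrib sum_subtractf)
  also have "(\<Sum>n\<in>UNIV. (\<Sum>m\<in>UNIV. \<Sum>p\<in>UNIV. P m k u * P p l u * Lf i n m p u) *\<^sub>R dl i n u) =
      (\<Sum>m\<in>UNIV. \<Sum>p\<in>UNIV. (P m k u * P p l u) *\<^sub>R (\<Sum>n\<in>UNIV. Lf i n m p u *\<^sub>R dl i n u))"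
    unfolding scaleR_sum_left scaleR_sum_right scaleR_scaleR
    by (rule trans[OF sum.swap sum.cong[OF refl sum.swap]])
  finally have L: "(\<Sum>\<theta>\<in>UNIV. Lf j \<theta> k l u *\<^sub>R dl j \<theta> u) =
      (\<Sum>m\<in>UNIV. \<Sum>p\<in>UNIV. (P m k u * P p l u) *\<^sub>R (\<Sum>n\<in>UNIV. Lf i n m p u *\<^sub>R dl i n u))
      + (\<Sum>n\<in>UNIV. a u (dl j k u) (P n l) *\<^sub>R dl i n u) - (\<Sum>n\<in>UNIV. a u (dl j l u) (P n k) *\<^sub>R dl i n u)" .
  have sw: "(\<Sum>m\<in>UNIV. \<Sum>n\<in>UNIV. (P m l u * P n k u) *\<^sub>R ?c m n) =
      (\<Sum>m\<in>UNIV. \<Sum>n\<in>UNIV. (P m k u * P n l u) *\<^sub>R ?c n m)"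
    by (subst sum.swap) (simp add: mult.commute)
  have "tor0 j k l u = (\<Sum>m\<in>UNIV. \<Sum>n\<in>UNIV. (P m k u * P n l u) *\<^sub>R tor0 i m n u)"
    unfolding tor0_def[of j] L cov_change[OF u] sw tor0_def[of i] scaleR_diff_right sum_subtractf
    by simp
  moreover have "(P m k u * P n l u) *\<^sub>R tor0 i m n u = (P m k u * P n l u) *\<^sub>R tor i m n u" for m n
  proof (cases "same m n")
    case False
    then have "\<not> same m k \<or> \<not> same n l" using True by (auto simp: same_def)
    then show ?thesis using P_mixed[OF u] by auto
  qed (simp add: tor_def)
  ultimately show ?thesis using True by (simp add: tor_def)
qed

lemma Tor_change:
  assumes u: "u \<in> dom i" "u \<in> dom j" and "x \<in> fibre B u" "v \<in> fibre B u"
  shows "Tor j u x v = Tor i u x v"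
proof (rule bilin_eqI[OF dl_basis[OF j u(2)], where f = "Tor j u" and g = "Tor i u"])
  show "Tor j u (dl j k u) (dl j l u) = Tor i u (dl j k u) (dl j l u)" for k l
    unfolding Tor_dl[OF j u(2)] tor_change[OF u] by (simp add: Tor_def P_def)
qed (use Tor_lin[OF i u(1)] Tor_lin[OF j u(2)] assms in auto)

end

abbreviation T where "T u \<equiv> Tor (frame_of u) u"

lemma T_frame:
  assumes "i \<in> I" "u \<in> dom i" "x \<in> fibre B u" "v \<in> fibre B u"
  shows "T u x v = Tor i u x v"
  using Tor_change[OF assms(1) frame_of(1)[OF dom_points[OF assms(1,2)]] assms(2)
      frame_of(2)[OF dom_points[OF assms(1,2)]] assms(3,4)] .

lemma T_dl: "i \<in> I \<Longrightarrow> u \<in> dom i \<Longrightarrow> T u (dl i j u) (dl i k u) = tor i j k u"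
  by (simp add: T_frame dl_in Tor_dl del: dl_Inr)

lemma T_fibre: "u \<in> points (base B) \<Longrightarrow> T u x v \<in> fibre B u"
  using Tor_fibre frame_of by blast

lemma T_lin:
  assumes "u \<in> points (base B)"
  shows "lin_on (fibre B u) (\<lambda>x. T u x v)" "lin_on (fibre B u) (T u v)"
  using Tor_lin[OF frame_of[OF assms]] .

lemma T_anti: "u \<in> points (base B) \<Longrightarrow> T u x v = - T u v x"
  using Tor_anti[OF frame_of] .

lemma subspace_H: "u \<in> points (base B) \<Longrightarrow> subspace (H u)"
  using subspace_fibre[of u] Gamma_lin[of u] lin_on_zero[OF Gamma_lin subspace_fibre, of u]
  by (auto simp: subspace_def H_iff lin_on_def)

lemma subspace_V: 
  assumes u: "u \<in> points (base B)" shows "subspace (V u)"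
proof -
  obtain i where i: "i \<in> I" "u \<in> dom i" using point_dom[OF u] .
  have "V u = span (range (\<lambda>b. fr i (Inr b) u))" by (auto simp: vertical_iff[OF i] vertical_span[OF i])
  then show ?thesis by simp
qed

lemma tor_H: 
  assumes i: "i \<in> I" "u \<in> dom i" shows "tor i k (Inl \<beta>) u \<in> H u"
proof (cases k)
  case (Inl \<alpha>)
  note S = subspace_H[OF dom_points[OF i]]
  have "(\<Sum>l\<in>UNIV. Lf i l (Inl \<alpha>) (Inl \<beta>) u *\<^sub>R dl i l u) \<in> H u"
  proof (intro subspace_sum[OF S])
    show "Lf i l (Inl \<alpha>) (Inl \<beta>) u *\<^sub>R dl i l u \<in> H u" for l
      by (cases l) (auto simp: Lf_def subspace_0[OF S] intro: subspace_scale[OF S] dl_Inl_H[OF i])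
  qed
  then show ?thesis
    using cov_dl_H[OF i] by (simp add: Inl tor_def same_def tor0_def subspace_diff[OF S])
qed (simp add: tor_def same_def subspace_0[OF subspace_H[OF dom_points[OF i]]])

lemma tor_V: 
  assumes i: "i \<in> I" "u \<in> dom i" shows "tor i k (Inr b) u \<in> V u"
proof (cases k)
  case (Inr c)
  note S = subspace_V[OF dom_points[OF i]]
  show ?thesis
    using cov_dl_V[OF i] by (simp add: Inr tor_def same_def tor0_def subspace_diff[OF S])
qed (simp add: tor_def same_def subspace_0[OF subspace_V[OF dom_points[OF i]]])

lemma T_H:
  assumes u: "u \<in> points (base B)" and v: "v \<in> H u" shows "T u x v \<in> H u"
proof -
  note f = frame_of[OF u] and S = subspace_H[OF u]
  have "(coeff (dl (frame_of u)) u j x * coeff (dl (frame_of u)) u k v) *\<^sub>R tor (frame_of u) j k u \<in> H u" for j k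
    using tor_H[OF f] coeff_H[OF f v] by (cases k) (auto intro: subspace_scale[OF S] simp: subspace_0[OF S])
  then show ?thesis unfolding Tor_def by (intro subspace_sum[OF S])
qed

lemma T_V:
  assumes u: "u \<in> points (base B)" and v: "v \<in> V u" shows "T u x v \<in> V u"
proof -
  note f = frame_of[OF u] and S = subspace_V[OF u]
  have "(coeff (dl (frame_of u)) u j x * coeff (dl (frame_of u)) u k v) *\<^sub>R tor (frame_of u) j k u \<in> V u" for j k
    using tor_V[OF f] coeff_V[OF f v] by (cases k) (auto intro: subspace_scale[OF S] simp: subspace_0[OF S])
  then show ?thesis unfolding Tor_def by (intro subspace_sum[OF S])
qed

text \<open>By antisymmetry the value inherits the type of either argument, so it is both horizontal
  and vertical.\<close>

lemma T_HV:
  assumes u: "u \<in> points (base B)" and v: "v \<in> H u" and w: "w \<in> V u"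
  shows "T u v w = 0" "T u w v = 0"
proof -
  have "T u v w \<in> H u"
    using T_H[OF u v, of w] subspace_neg[OF subspace_H[OF u]] T_anti[OF u, of v w] by simp
  moreover have "T u v w \<in> V u" by (rule T_V[OF u w])
  ultimately show "T u v w = 0" using Gamma_id[OF u] by (simp add: H_iff)
  then show "T u w v = 0" using T_anti[OF u, of w v] by simp
qed

section \<open>The metric connection\<close>

text \<open>For given derivative \<open>Q\<close> of the metric and given torsion \<open>T\<close> on the horizontal and on the
  vertical part, the Koszul formula determines the difference \<open>S\<close> of the new connection and \<open>D0\<close>
  by \<open>2 g(S x v, w) = K x v w\<close>. In the mixed directions \<open>K x v w = Q x w v\<close> is the classical choice.\<close>

definition K where "K u x v w = Q u x w v
  + (Q u (hor u v) (hor u w) (hor u x) - Q u (hor u w) (hor u v) (hor u x))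
  + (Q u (\<Gamma> u v) (\<Gamma> u w) (\<Gamma> u x) - Q u (\<Gamma> u w) (\<Gamma> u v) (\<Gamma> u x))
  + (g u (T u x w) v - g u (T u x v) w + g u (T u v w) x)"

lemma K_lin:
  assumes u: "u \<in> points (base B)" and v: "v \<in> fibre B u" and w: "w \<in> fibre B u"
  shows "lin_on (fibre B u) (K u v w)" "lin_on (fibre B u) (\<lambda>x. K u v x w)" "lin_on (fibre B u) (\<lambda>x. K u x v w)"
proof -
  note h = hor_lin[OF u] hor_fibre[OF u] and c = Gamma_lin[OF u] Gamma_fibre[OF u]
  note q1 = Q_lin1[OF u] and q2 = Q_lin23(2)[OF u] and q3 = Q_lin23(1)[OF u]
  note hq = lin_on_comp[OF h q1] lin_on_comp[OF h q2] lin_on_comp[OF h q3]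
    lin_on_comp[OF c q1] lin_on_comp[OF c q2] lin_on_comp[OF c q3]
  note t1 = T_lin(1)[OF u] T_fibre[OF u] and t2 = T_lin(2)[OF u] T_fibre[OF u]
  note gt = lin_on_comp[OF t1 g_lin(2)[OF u]] lin_on_comp[OF t2 g_lin(2)[OF u]] g_lin(1)[OF u T_fibre[OF u]]
  note hv = h(2)[OF v] h(2)[OF w] c(2)[OF v] c(2)[OF w]
  show "lin_on (fibre B u) (K u v w)"
    unfolding K_def[abs_def]
    by (intro lin_on_add_fun lin_on_diff_fun q1 q2 q3 hq gt v w hv)
  show "lin_on (fibre B u) (\<lambda>x. K u v x w)"
    unfolding K_def
    by (intro lin_on_add_fun lin_on_diff_fun q1 q2 q3 hq gt v w hv)
  show "lin_on (fibre B u) (\<lambda>x. K u x v w)"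
    unfolding K_def
    by (intro lin_on_add_fun lin_on_diff_fun q1 q2 q3 hq gt g_lin(1)[OF u T_fibre[OF u]] v w hv)
qed

lemma Q_zero:
  assumes "u \<in> points (base B)" "v \<in> fibre B u"
  shows "Q u 0 x y = 0" "Q u x 0 v = 0" "Q u x v 0 = 0"
  using lin_on_zero[OF Q_lin1[OF assms(1)] subspace_fibre[OF assms(1)]]
    lin_on_zero[OF Q_lin23(1)[OF assms] subspace_fibre[OF assms(1)]]
    lin_on_zero[OF Q_lin23(2)[OF assms] subspace_fibre[OF assms(1)]] by auto

lemma g_zero:
  assumes "u \<in> points (base B)" "v \<in> fibre B u"
  shows "g u 0 v = 0" "g u v 0 = 0"
  using lin_on_zero[OF g_lin(1)[OF assms] subspace_fibre[OF assms(1)]]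
    lin_on_zero[OF g_lin(2)[OF assms] subspace_fibre[OF assms(1)]] by auto

lemma g_minus:
  assumes "u \<in> points (base B)" "v \<in> fibre B u" "w \<in> fibre B u"
  shows "g u (- v) w = - g u v w"
  using lin_on_scale[OF g_lin(2)[OF assms(1,3)] assms(2), of "-1"] by simp

text \<open>This makes \<open>S\<close> preserve the splitting: a vector whose pairings with the
  whole opposite subbundle vanish lies in its own subbundle.\<close>

lemma K_mixed:
  assumes u: "u \<in> points (base B)" and x: "x \<in> fibre B u" and v: "v \<in> H u" and w: "w \<in> V u"
  shows "K u x v w = 0" "K u x w v = 0"
proof -
  have fib: "v \<in> fibre B u" "w \<in> fibre B u" "hor u x \<in> fibre B u" "\<Gamma> u x \<in> fibre B u"
    using v V_fibre[OF u w] hor_fibre[OF u x] Gamma_fibre[OF u x] by (auto simp: H_iff)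
  note z = Q_zero[OF u fib(1)] Q_zero[OF u fib(2)] Q_zero[OF u fib(3)] Q_zero[OF u fib(4)]
    Gamma_H[OF v] hor_V[OF u w] hor_H[OF v] Gamma_id[OF u w] Q_HV[OF u x v w]
    g_HV[OF u v T_V[OF u w]] g_HV[OF u T_H[OF u v] w] T_HV[OF u v w] g_zero[OF u x]
  show "K u x v w = 0" "K u x w v = 0" unfolding K_def z by simp_all
qed

text \<open>One of the two projections is the identity on all three arguments and the other is zero,
  so the full Koszul expression appears.\<close>

lemma K_same:
  assumes u: "u \<in> points (base B)" and "x \<in> H u \<and> v \<in> H u \<and> w \<in> H u \<or> x \<in> V u \<and> v \<in> V u \<and> w \<in> V u"
  shows "K u x v w = Q u x w v + Q u v w x - Q u w v x + (g u (T u x w) v - g u (T u x v) w + g u (T u v w) x)"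
  using assms(2)
proof (elim disjE conjE)
  assume "x \<in> H u" "v \<in> H u" "w \<in> H u"
  then show ?thesis
    using Q_zero(1)[OF u subspace_0[OF subspace_fibre[OF u]]] by (simp add: K_def hor_H Gamma_H)
next
  assume "x \<in> V u" "v \<in> V u" "w \<in> V u"
  then show ?thesis
    using Q_zero(1)[OF u subspace_0[OF subspace_fibre[OF u]]] by (simp add: K_def hor_V[OF u] Gamma_id[OF u])
qed

text \<open>The projected terms have a zero argument, and each torsion term is either a mixed
  torsion or a pairing of a horizontal with a vertical vector.\<close>

lemma K_diff:
  assumes u: "u \<in> points (base B)" and x: "x \<in> H u \<and> v \<in> V u \<and> w \<in> V u \<or> x \<in> V u \<and> v \<in> H u \<and> w \<in> H u"
  shows "K u x v w = Q u x w v"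
  using x
proof (elim disjE conjE)
  assume a: "x \<in> H u" "v \<in> V u" "w \<in> V u"
  then have fib: "x \<in> fibre B u" "v \<in> fibre B u" "w \<in> fibre B u" using V_fibre[OF u] by (auto simp: H_iff)
  show ?thesis
    using Q_zero[OF u fib(2)] Q_zero[OF u fib(3)] g_HV(2)[OF u a(1) T_V[OF u a(3)]] g_zero(1)[OF u fib(2)] g_zero(1)[OF u fib(3)]
    by (simp add: K_def hor_H[OF a(1)] Gamma_H[OF a(1)] hor_V[OF u a(2)] hor_V[OF u a(3)] Gamma_id[OF u a(2)] Gamma_id[OF u a(3)]
        T_HV[OF u a(1) a(2)] T_HV[OF u a(1) a(3)])
next
  assume a: "x \<in> V u" "v \<in> H u" "w \<in> H u"
  then have fib: "x \<in> fibre B u" "v \<in> fibre B u" "w \<in> fibre B u" using V_fibre[OF u] by (auto simp: H_iff)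
  show ?thesis
    using Q_zero[OF u fib(2)] Q_zero[OF u fib(3)] g_HV(1)[OF u T_H[OF u a(3)] a(1)] g_zero(1)[OF u fib(2)] g_zero(1)[OF u fib(3)]
    by (simp add: K_def hor_V[OF u a(1)] Gamma_id[OF u a(1)] hor_H[OF a(2)] hor_H[OF a(3)] Gamma_H[OF a(2)] Gamma_H[OF a(3)]
        T_HV[OF u a(2) a(1)] T_HV[OF u a(3) a(1)])
qed

text \<open>Every bracket in \<open>K\<close> other than the leading term is antisymmetric in
  \<open>v\<close> and \<open>w\<close>: the first two visibly, the torsion bracket by
  \<open>T_anti\<close>. The leading term is symmetric by \<open>Q_sym\<close>.\<close>

lemma K_sym_part:
  assumes u: "u \<in> points (base B)" and x: "x \<in> fibre B u" and v: "v \<in> fibre B u" and w: "w \<in> fibre B u"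
  shows "K u x v w + K u x w v = 2 * Q u x v w"
proof -
  have "g u (T u w v) x = - g u (T u v w) x"
    unfolding T_anti[OF u, of w v] by (rule g_minus[OF u T_fibre[OF u] x])
  then show ?thesis using Q_sym[OF u x v w] by (simp add: K_def)
qed

text \<open>Half the Koszul expression with its last index raised; the value 0 outside the fibre is
  the convention of \<open>endo\<close>.\<close>

definition S where "S u x v = (if v \<in> fibre B u then sharp u (\<lambda>w. K u x v w / 2) else 0)"

lemma K_half_lin: 
  assumes "u \<in> points (base B)" "x \<in> fibre B u" "v \<in> fibre B u"
  shows "lin_on (fibre B u) (\<lambda>w. K u x v w / 2)"
  using lin_on_scale_fun[OF K_lin(1)[OF assms], of "1/2"] by simp

lemma S_in: "u \<in> points (base B) \<Longrightarrow> x \<in> fibre B u \<Longrightarrow> v \<in> fibre B u \<Longrightarrow> S u x v \<in> fibre B u"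
  by (simp add: S_def sharp_in[OF _ K_half_lin])

lemma g_S: "u \<in> points (base B) \<Longrightarrow> x \<in> fibre B u \<Longrightarrow> v \<in> fibre B u \<Longrightarrow> w \<in> fibre B u \<Longrightarrow>
    g u (S u x v) w = K u x v w / 2"
  by (simp add: S_def sharp_eq[OF _ K_half_lin])

lemma S_frame:
  assumes i: "i \<in> I" "u \<in> dom i" and "x \<in> fibre B u" "v \<in> fibre B u"
  shows "S u x v = (\<Sum>l\<in>UNIV. (\<Sum>m\<in>UNIV. gi i l m u * (K u x v (dl i m u) / 2)) *\<^sub>R dl i l u)"
  using sharp_frame[OF i K_half_lin[OF dom_points[OF i] assms(3,4)]] assms(4) by (simp add: S_def)

lemma S_lin:
  assumes u: "u \<in> points (base B)" and y: "y \<in> fibre B u"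
  shows "lin_on (fibre B u) (\<lambda>v. S u y v)" "lin_on (fibre B u) (\<lambda>x. S u x y)"
proof -
  obtain i where i: "i \<in> I" "u \<in> dom i" using point_dom[OF u] .
  \<comment> \<open>The frame formula written with \<open>*\<^sub>R\<close> throughout, the form to
    which the rules for \<open>lin_on\<close> apply.\<close>
  let ?f = "\<lambda>x v. \<Sum>l\<in>UNIV. (\<Sum>m\<in>UNIV. gi i l m u *\<^sub>R ((1/2) *\<^sub>R K u x v (dl i m u))) *\<^sub>R dl i l u"
  have eq: "S u x v = ?f x v" if "x \<in> fibre B u" "v \<in> fibre B u" for x v
    using S_frame[OF i that] by simp
  have "lin_on (fibre B u) (\<lambda>v. ?f y v)" 
    by (intro lin_on_sum_fun lin_on_scale_left lin_on_scale_fun K_lin(2)[OF u y dl_in[OF i]])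
  then show "lin_on (fibre B u) (\<lambda>v. S u y v)"
    by (rule lin_on_cong[OF subspace_fibre[OF u], rotated]) (rule eq[OF y])
  have "lin_on (fibre B u) (\<lambda>x. ?f x y)" 
    by (intro lin_on_sum_fun lin_on_scale_left lin_on_scale_fun K_lin(3)[OF u y dl_in[OF i]])
  then show "lin_on (fibre B u) (\<lambda>x. S u x y)"
    by (rule lin_on_cong[OF subspace_fibre[OF u], rotated]) (rule eq[OF _ y])
qed

lemma S_endo: "u \<in> points (base B) \<Longrightarrow> x \<in> fibre B u \<Longrightarrow> endo (fibre B u) (S u x)"
  unfolding endo_def by (intro conjI ballI allI impI S_lin(1) S_in) (simp_all add: S_def)

lemma S_H:
  assumes u: "u \<in> points (base B)" and x: "x \<in> fibre B u" and v: "v \<in> H u"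
  shows "S u x v \<in> H u"
proof -
  obtain i where i: "i \<in> I" "u \<in> dom i" using point_dom[OF u] .
  have fib: "v \<in> fibre B u" using v by (simp add: H_iff)
  have "coeff (dl i) u (Inr b) (S u x v) = 0" for b
    unfolding S_frame[OF i x fib] coeff_lincomb[OF dl_basis[OF i]]
    using K_mixed(1)[OF u x v dl_Inr_V[OF i]] by (simp add: sum_Plus_UNIV gi_def)
  then show ?thesis using S_in[OF u x fib] by (simp add: H_iff_coeff[OF i])
qed

lemma S_V:
  assumes u: "u \<in> points (base B)" and x: "x \<in> fibre B u" and v: "v \<in> V u"
  shows "S u x v \<in> V u"
proof -
  obtain i where i: "i \<in> I" "u \<in> dom i" using point_dom[OF u] .
  have fib: "v \<in> fibre B u" using V_fibre[OF u v] .
  have "coeff (dl i) u (Inl \<alpha>) (S u x v) = 0" for \<alpha>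
    unfolding S_frame[OF i x fib] coeff_lincomb[OF dl_basis[OF i]]
    using K_mixed(2)[OF u x dl_Inl_H[OF i] v] by (simp add: sum_Plus_UNIV gi_def)
  then show ?thesis using S_in[OF u x fib] by (simp add: V_iff_coeff[OF i])
qed

lemma tor_section:
  assumes i: "i \<in> I" shows "smooth_section B (dom i) (tor i j k)"
proof -
  have "smooth_fun (base B) (dom i) (Lf i l j k)" for l
    using L_smooth[OF i] by (cases l; cases j; cases k) (auto simp: Lf_def[abs_def] smooth_fun_const)
  then have s: "smooth_section B (dom i) (\<lambda>u. \<Sum>l\<in>UNIV. Lf i l j k u *\<^sub>R dl i l u)"
    by (intro section_sum section_scale dom_open i dl_section)
  have c: "smooth_section B (dom i) (cov (dl i j) (dl i k))" for j k
    by (intro cov_section dom_open i dl_section)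
  have "smooth_section B (dom i) (\<lambda>u. (-1) *\<^sub>R (\<Sum>l\<in>UNIV. Lf i l j k u *\<^sub>R dl i l u) +
      ((-1) *\<^sub>R cov (dl i k) (dl i j) u + cov (dl i j) (dl i k) u))"
    by (intro section_lincomb smooth_fun_const dom_open i s c)
  then have "smooth_section B (dom i) (tor0 i j k)"
    by (rule section_cong[OF dom_open[OF i], rotated]) (simp add: tor0_def)
  then show ?thesis
    by (cases "same j k") (simp_all add: tor_def[abs_def] section_zero dom_open i)
qed

lemma T_section:
  assumes W: "open_in (base B) W" and X: "smooth_section B W X" and Y: "smooth_section B W Y"
  shows "smooth_section B W (\<lambda>u. T u (X u) (Y u))"
proof (rule section_local)
  fix u assume u: "u \<in> W"
  obtain i where i: "i \<in> I" "u \<in> dom i" using point_dom open_in_subset_points[OF W] u by blast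
  let ?W = "dom i \<inter> W"
  have o: "open_in (base B) ?W" using open_in_Int[OF dom_open[OF i(1)] W] .
  have "smooth_section B ?W (\<lambda>u. \<Sum>j\<in>UNIV. \<Sum>k\<in>UNIV.
      (coeff (dl i) u j (X u) * coeff (dl i) u k (Y u)) *\<^sub>R tor i j k u)"
    by (intro section_sum section_scale smooth_fun_mult o local_frame_coeff[OF dl_frame[OF i(1)] W X]
        local_frame_coeff[OF dl_frame[OF i(1)] W Y] section_subset[OF tor_section[OF i(1)]]) auto
  then have "smooth_section B ?W (\<lambda>u. T u (X u) (Y u))"
    by (rule section_cong[OF o, rotated])
       (use T_frame[OF i(1)] sectionD[OF X] sectionD[OF Y] in \<open>simp add: Tor_def\<close>)
  then show "\<exists>V. open_in (base B) V \<and> u \<in> V \<and> smooth_section B V (\<lambda>u. T u (X u) (Y u))"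
    using o u i by blast
qed

lemma K_smooth:
  assumes W: "open_in (base B) W" and X: "smooth_section B W X" and Y: "smooth_section B W Y"
    and Z: "smooth_section B W Z"
  shows "smooth_fun (base B) W (\<lambda>u. K u (X u) (Y u) (Z u))"
proof -
  have q: "smooth_fun (base B) W (\<lambda>u. Q u (X u) (Y u) (Z u))"
    if "smooth_section B W X" "smooth_section B W Y" "smooth_section B W Z" for X Y Z
  proof (rule smooth_fun_cong[OF W _ tensor2_smooth[OF W D_tensor[OF W that(1) G_field_on[OF W]] that(2,3)]])
    show "D0 X G u [] [Y u, Z u] = Q u (X u) (Y u) (Z u)" if "u \<in> W" for u
      by (rule D0_Q[OF W \<open>smooth_section B W X\<close> that])
  qed
  have t: "smooth_fun (base B) W (\<lambda>u. g u (T u (X u) (Y u)) (Z u))"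
    if "smooth_section B W X" "smooth_section B W Y" "smooth_section B W Z" for X Y Z
    by (intro tensor2_smooth W G_field_on T_section that)
  show ?thesis
    unfolding K_def
    by (intro smooth_fun_add smooth_fun_diff W q t hor_section Gamma_section X Y Z)
qed

lemma S_section:
  assumes W: "open_in (base B) W" and X: "smooth_section B W X" and Y: "smooth_section B W Y"
  shows "smooth_section B W (\<lambda>u. S u (X u) (Y u))"
proof (rule section_local)
  fix u assume u: "u \<in> W"
  obtain i where i: "i \<in> I" "u \<in> dom i" using point_dom open_in_subset_points[OF W] u by blast
  let ?W = "dom i \<inter> W"
  have o: "open_in (base B) ?W" using open_in_Int[OF dom_open[OF i(1)] W] .
  have k: "smooth_fun (base B) ?W (\<lambda>u. K u (X u) (Y u) (dl i m u))" for m
    by (intro K_smooth o section_subset[OF X] section_subset[OF Y] section_subset[OF dl_section[OF i(1)]]) auto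
  have "smooth_section B ?W (\<lambda>u. \<Sum>l\<in>UNIV. (\<Sum>m\<in>UNIV. gi i l m u * (K u (X u) (Y u) (dl i m u) * (1 / 2))) *\<^sub>R dl i l u)"
    by (intro section_sum section_scale smooth_fun_sum smooth_fun_mult o k smooth_fun_const
        smooth_fun_subset[OF gi_smooth[OF i(1)]] section_subset[OF dl_section[OF i(1)]]) auto
  then have "smooth_section B ?W (\<lambda>u. S u (X u) (Y u))"
    by (rule section_cong[OF o, rotated])
       (use S_frame[OF i(1)] sectionD[OF X] sectionD[OF Y] in \<open>simp\<close>)
  then show "\<exists>V. open_in (base B) V \<and> u \<in> V \<and> smooth_section B V (\<lambda>u. S u (X u) (Y u))"
    using o u i by blast
qed

section \<open>The new connection: axioms, preservation of the splitting, compatibility with the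
  metric\<close>

definition D where "D X \<tau> u = D0 X \<tau> u + act (fibre B u) (S u (X u)) (\<tau> u)"

lemma D_linear: "linear_connection B a D"
  unfolding D_def[abs_def]
proof (rule add_endomorphism[OF S_endo _ S_section])
  fix u x y c v assume u: "u \<in> points (base B)" "x \<in> fibre B u" "y \<in> fibre B u"
  show "S u (c *\<^sub>R x + y) v = c *\<^sub>R S u x v + S u y v"
  proof (cases "v \<in> fibre B u")
    case True
    show ?thesis
      using lin_on_add[OF S_lin(2)[OF u(1) True] subspace_scale[OF subspace_fibre[OF u(1)] u(2)] u(3)]
        lin_on_scale[OF S_lin(2)[OF u(1) True] u(2)] by simp
  qed (simp add: S_def)
qed

lemma D_vec_eq:
  assumes W: "open_in (base B) W" and X: "smooth_section B W X" and Y: "smooth_section B W Y" and u: "u \<in> W"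
  shows "D X (vec_field B Y) u = vec_tensor (fibre B u) (cov X Y u + S u (X u) (Y u))"
proof -
  have pt: "u \<in> points (base B)" using open_in_subset_points[OF W] u by blast
  note F = subspace_fibre[OF pt]
  show ?thesis
    unfolding D_def D_vec[OF W X Y u]
      act_vec_tensor[OF S_endo[OF pt sectionD[OF X u]] sectionD[OF Y u] F]
    using vec_tensor_lincomb[OF cov_in[OF W X Y u] S_in[OF pt sectionD[OF X u] sectionD[OF Y u]] F, of 1] by simp
qed

lemma D_distinguished: "distinguished B a \<Gamma> D"
  unfolding distinguished_def
proof (intro conjI allI impI D_linear ballI; elim conjE)
  fix W X Y u assume W: "open_in (base B) W" and X: "smooth_section B W X" and Y: "smooth_section B W Y"
    and u: "u \<in> W"
  have pt: "u \<in> points (base B)" using open_in_subset_points[OF W] u by blast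
  have *: "z = cov X Y u" if "D0 X (vec_field B Y) u = vec_tensor (fibre B u) z" "z \<in> fibre B u" for z
    using cov_eqI[OF W X Y u that(2,1)] by simp
  have ds: "((\<forall>u\<in>W. Y u \<in> H u) \<longrightarrow> (\<forall>u\<in>W. D0 X (vec_field B Y) u \<in> vec_tensor (fibre B u) ` H u)) \<and>
       ((\<forall>u\<in>W. Y u \<in> V u) \<longrightarrow> (\<forall>u\<in>W. D0 X (vec_field B Y) u \<in> vec_tensor (fibre B u) ` V u))"
    using dist[unfolded distinguished_def, THEN conjunct2, rule_format, of W X Y] W X Y by blast
  {
    assume YH: "\<forall>u\<in>W. Y u \<in> H u"
    then obtain z where "z \<in> H u" "D0 X (vec_field B Y) u = vec_tensor (fibre B u) z" using ds u by blast
    then have "cov X Y u \<in> H u" using *[of z] by (simp add: H_iff)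
    then have "cov X Y u + S u (X u) (Y u) \<in> H u"
      using YH u by (intro subspace_add[OF subspace_H[OF pt]] S_H[OF pt sectionD[OF X u]]) auto
    then show "D X (vec_field B Y) u \<in> vec_tensor (fibre B u) ` H u" unfolding D_vec_eq[OF W X Y u] by (rule imageI)
  next
    assume YV: "\<forall>u\<in>W. Y u \<in> V u"
    then obtain z where "z \<in> V u" "D0 X (vec_field B Y) u = vec_tensor (fibre B u) z" using ds u by blast
    then have "cov X Y u \<in> V u" using *[of z] V_fibre[OF pt] by simp
    then have "cov X Y u + S u (X u) (Y u) \<in> V u"
      using YV u by (intro subspace_add[OF subspace_V[OF pt]] S_V[OF pt sectionD[OF X u]]) auto
    then show "D X (vec_field B Y) u \<in> vec_tensor (fibre B u) ` V u" unfolding D_vec_eq[OF W X Y u] by (rule imageI)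
  }
qed

lemma D_metric_zero:
  assumes W: "open_in (base B) W" and X: "smooth_section B W X" and u: "u \<in> W"
  shows "D X G u = 0"
proof (intro ext)
  fix ws vs
  have pt: "u \<in> points (base B)" using open_in_subset_points[OF W] u by blast
  \<comment> \<open>This supplies that \<open>D X G\<close> is a tensor, hence 0 on all argument
    lists other than one pair of fibre vectors.\<close>
  interpret new: bundle_connection B a D by unfold_locales (rule D_linear)
  show "D X G u ws vs = (0 :: 'w tensor) ws vs"
  proof (cases "slots 0 2 (fibre B u) ws vs")
    case True
    then obtain v w where vw: "ws = []" "vs = [v, w]" "v \<in> fibre B u" "w \<in> fibre B u"
      by (auto simp: slots_def numeral_2_eq_2 length_Suc_conv)
    note x = sectionD[OF X u]
    have "D X G u [] [v, w] = Q u (X u) v w - g u (S u (X u) v) w - g u v (S u (X u) w)"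
      using D0_Q[OF W X u, of v w] act_02[OF vw(3,4), of "S u (X u)" "G u"] by (simp add: D_def)
    also have "g u v (S u (X u) w) = g u (S u (X u) w) v" by (rule g_sym[OF pt vw(3) S_in[OF pt x vw(4)]])
    finally show ?thesis
      using K_sym_part[OF pt x vw(3,4)] by (simp add: vw g_S[OF pt x])
  next
    case False
    then show ?thesis
      using tensor_at_outside[OF tensor_fieldD[OF new.D_tensor[OF W X G_field_on[OF W]] u] False] by simp
  qed
qed

section \<open>Components\<close>

text \<open>Lowering and then raising an index. In the component formulas it turns a pairing with a
  \<open>D0\<close>-derivative back into a component of \<open>D0\<close>.\<close>

lemma gi_coeff:
  assumes i: "i \<in> I" "u \<in> dom i" and z: "z \<in> fibre B u"
  shows "(\<Sum>m\<in>UNIV. gi i l m u * g u (dl i m u) z) = coeff (dl i) u l z"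
proof -
  have "(\<Sum>m\<in>UNIV. gi i l m u * g u (dl i m u) z) =
      (\<Sum>m\<in>UNIV. gi i l m u * (\<Sum>k\<in>UNIV. coeff (dl i) u k z * g u (dl i m u) (dl i k u)))"
    using lin_on_expand[OF dl_basis[OF i] g_lin(1)[OF dom_points[OF i] dl_in[OF i]] z] by simp
  also have "\<dots> = (\<Sum>k\<in>UNIV. (\<Sum>m\<in>UNIV. gi i l m u * g u (dl i m u) (dl i k u)) * coeff (dl i) u k z)"
    unfolding sum_distrib_left sum_distrib_right by (subst sum.swap) (simp add: mult_ac)
  also have "\<dots> = coeff (dl i) u l z"
    by (simp add: gi_inverse(2)[OF i] if_distrib[of "\<lambda>x. x * _"] cong: if_cong)
  finally show ?thesis .
qed

lemma conn_coeff_cov: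
  "i \<in> I \<Longrightarrow> u \<in> dom i \<Longrightarrow> conn_coeff B D0 (dl i) l k j u = coeff (dl i) u l (cov (dl i j) (dl i k) u)"
  unfolding conn_coeff_def using D_vec[OF dom_open dl_section dl_section, of i u j k] vec_tensor_coeff[OF dl_basis]
  by simp

lemma g_tor0:
  assumes i: "i \<in> I" "u \<in> dom i" and w: "w \<in> fibre B u"
  shows "g u (tor0 i j k u) w = g u (cov (dl i j) (dl i k) u) w - g u (cov (dl i k) (dl i j) u) w
    - (\<Sum>l\<in>UNIV. Lf i l j k u * g u (dl i l u) w)"
proof -
  note pt = dom_points[OF i]
  note F = subspace_fibre[OF pt] and lin = g_lin(2)[OF pt w]
  have d: "g u (x - y) w = g u x w - g u y w" if "x \<in> fibre B u" "y \<in> fibre B u" for x y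
    using lin_on_add[OF lin that(1) subspace_neg[OF F that(2)]] g_minus[OF pt that(2) w] by simp
  have s: "(\<Sum>l\<in>UNIV. Lf i l j k u *\<^sub>R dl i l u) \<in> fibre B u"
    by (intro subspace_sum[OF F] subspace_scale[OF F] dl_in[OF i])
  have "g u (\<Sum>l\<in>UNIV. Lf i l j k u *\<^sub>R dl i l u) w = (\<Sum>l\<in>UNIV. Lf i l j k u * g u (dl i l u) w)"
    using subspace_scale[OF F dl_in[OF i]]
    by (subst lin_on_sum[OF lin F]) (simp_all add: lin_on_scale[OF lin dl_in[OF i]])
  then show ?thesis
    unfolding tor0_def by (simp add: d cov_dl_in[OF i] s subspace_diff[OF F])
qed

text \<open>Written out in the frame, the derivatives along \<open>D0\<close> contained in
  \<open>Q\<close> and in the torsion cancel in pairs, apart from two copies of one of them. After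
  halving and raising the index, this remainder is exactly minus the component of
  \<open>D0\<close>.\<close>

lemma K_dl_same:
  assumes i: "i \<in> I" "u \<in> dom i" and s: "same k j" "same k m"
  shows "K u (dl i k u) (dl i j u) (dl i m u) =
     a u (dl i k u) (\<lambda>u. g u (dl i m u) (dl i j u)) + a u (dl i j u) (\<lambda>u. g u (dl i m u) (dl i k u))
     - a u (dl i m u) (\<lambda>u. g u (dl i j u) (dl i k u))
     + (\<Sum>l\<in>UNIV. Lf i l k j u * g u (dl i l u) (dl i m u))
     - (\<Sum>l\<in>UNIV. Lf i l k m u * g u (dl i l u) (dl i j u))
     - (\<Sum>l\<in>UNIV. Lf i l j m u * g u (dl i l u) (dl i k u))
     - 2 * g u (dl i m u) (cov (dl i k) (dl i j) u)"
proof -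
  note pt = dom_points[OF i]
  have HV: "dl i k u \<in> H u \<and> dl i j u \<in> H u \<and> dl i m u \<in> H u \<or> dl i k u \<in> V u \<and> dl i j u \<in> V u \<and> dl i m u \<in> V u"
    using s dl_Inl_H[OF i] dl_Inr_V[OF i] by (cases k; cases j; cases m) (auto simp: same_def)
  have s': "same j m" using s by (auto simp: same_def)
  have c: "g u x (dl i l u) = g u (dl i l u) x" if "x \<in> fibre B u" for x l
    by (rule g_sym[OF pt that dl_in[OF i]])
  have sw: "g u (dl i l u) (cov (dl i p) (dl i q) u) = g u (cov (dl i p) (dl i q) u) (dl i l u)" for l p q
    by (rule g_sym[OF pt dl_in[OF i] cov_dl_in[OF i]])
  show ?thesis
    unfolding K_same[OF pt HV] Q_dl[OF i] T_dl[OF i] tor_def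
    using s s' by (simp add: g_tor0[OF i dl_in[OF i]] sw del: dl_Inr)
qed

lemma K_dl_diff:
  assumes i: "i \<in> I" "u \<in> dom i" and s: "\<not> same k j" "same j m"
  shows "K u (dl i k u) (dl i j u) (dl i m u) = a u (dl i k u) (\<lambda>u. g u (dl i m u) (dl i j u))
    - g u (cov (dl i k) (dl i m) u) (dl i j u) - g u (dl i m u) (cov (dl i k) (dl i j) u)"
proof -
  have HV: "dl i k u \<in> H u \<and> dl i j u \<in> V u \<and> dl i m u \<in> V u \<or> dl i k u \<in> V u \<and> dl i j u \<in> H u \<and> dl i m u \<in> H u"
    using s dl_Inl_H[OF i] dl_Inr_V[OF i] by (cases k; cases j; cases m) (auto simp: same_def)
  show ?thesis unfolding K_diff[OF dom_points[OF i] HV] Q_dl[OF i] ..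
qed

text \<open>The derivative along \<open>D0\<close> of a horizontal frame section and its image under
  \<open>S\<close> are both horizontal, so the comparison of Greek coefficients suffices.\<close>

lemma cov_S_Inl:
  assumes i: "i \<in> I" "u \<in> dom i"
    and c: "\<And>\<alpha>. coeff (dl i) u (Inl \<alpha>) (cov (dl i k) (dl i (Inl \<beta>)) u) +
      (\<Sum>\<epsilon>\<in>UNIV. inv_comp (metric_h G (dl i)) \<alpha> \<epsilon> u * (K u (dl i k u) (dl i (Inl \<beta>) u) (dl i (Inl \<epsilon>) u) / 2)) = c \<alpha>"
  shows "D (dl i k) (vec_field B (dl i (Inl \<beta>))) u = vec_tensor (fibre B u) (\<Sum>\<alpha>\<in>UNIV. c \<alpha> *\<^sub>R dl i (Inl \<alpha>) u)"
proof -
  note pt = dom_points[OF i]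
  have 1: "cov (dl i k) (dl i (Inl \<beta>)) u =
      (\<Sum>\<alpha>\<in>UNIV. coeff (dl i) u (Inl \<alpha>) (cov (dl i k) (dl i (Inl \<beta>)) u) *\<^sub>R dl i (Inl \<alpha>) u)"
    using coeff_expand[OF dl_basis[OF i] cov_dl_in[OF i], of k "Inl \<beta>"] coeff_H[OF i cov_dl_H[OF i]]
    by (simp add: sum_Plus_UNIV)
  have 2: "S u (dl i k u) (dl i (Inl \<beta>) u) = (\<Sum>\<alpha>\<in>UNIV.
      (\<Sum>\<epsilon>\<in>UNIV. inv_comp (metric_h G (dl i)) \<alpha> \<epsilon> u * (K u (dl i k u) (dl i (Inl \<beta>) u) (dl i (Inl \<epsilon>) u) / 2)) *\<^sub>R dl i (Inl \<alpha>) u)"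
    unfolding S_frame[OF i dl_in[OF i] dl_in[OF i]]
    using K_mixed(1)[OF pt dl_in[OF i] dl_Inl_H[OF i] dl_Inr_V[OF i]]
    by (simp add: sum_Plus_UNIV gi_def del: dl_Inr)
  show ?thesis
    unfolding D_vec_eq[OF dom_open[OF i(1)] dl_section[OF i(1)] dl_section[OF i(1)] i(2)] 2
    by (subst 1) (simp add: c[symmetric] scaleR_add_left sum.distrib)
qed

lemma cov_S_Inr:
  assumes i: "i \<in> I" "u \<in> dom i"
    and c: "\<And>b. coeff (dl i) u (Inr b) (cov (dl i k) (dl i (Inr d)) u) +
      (\<Sum>e\<in>UNIV. inv_comp (metric_v G (dl i)) b e u * (K u (dl i k u) (dl i (Inr d) u) (dl i (Inr e) u) / 2)) = c b"
  shows "D (dl i k) (vec_field B (dl i (Inr d))) u = vec_tensor (fibre B u) (\<Sum>b\<in>UNIV. c b *\<^sub>R dl i (Inr b) u)"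
proof -
  note pt = dom_points[OF i]
  have 1: "cov (dl i k) (dl i (Inr d)) u =
      (\<Sum>b\<in>UNIV. coeff (dl i) u (Inr b) (cov (dl i k) (dl i (Inr d)) u) *\<^sub>R dl i (Inr b) u)"
    using coeff_expand[OF dl_basis[OF i] cov_dl_in[OF i], of k "Inr d"] coeff_V[OF i cov_dl_V[OF i]]
    by (simp add: sum_Plus_UNIV)
  have 2: "S u (dl i k u) (dl i (Inr d) u) = (\<Sum>b\<in>UNIV.
      (\<Sum>e\<in>UNIV. inv_comp (metric_v G (dl i)) b e u * (K u (dl i k u) (dl i (Inr d) u) (dl i (Inr e) u) / 2)) *\<^sub>R dl i (Inr b) u)"
    unfolding S_frame[OF i dl_in[OF i] dl_in[OF i]]
    using K_mixed(2)[OF pt dl_in[OF i] dl_Inl_H[OF i] dl_Inr_V[OF i]]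
    by (simp add: sum_Plus_UNIV gi_def del: dl_Inr)
  show ?thesis
    unfolding D_vec_eq[OF dom_open[OF i(1)] dl_section[OF i(1)] dl_section[OF i(1)] i(2)] 2
    by (subst 1) (simp add: c[symmetric] scaleR_add_left sum.distrib)
qed

lemma inv_h_coeff:
  assumes i: "i \<in> I" "u \<in> dom i" and z: "z \<in> H u"
  shows "(\<Sum>\<epsilon>\<in>UNIV. inv_comp (metric_h G (dl i)) \<alpha> \<epsilon> u * g u (dl i (Inl \<epsilon>) u) z) = coeff (dl i) u (Inl \<alpha>) z"
  using gi_coeff[OF i, of z "Inl \<alpha>"] z by (simp add: sum_Plus_UNIV gi_def H_iff)

lemma inv_v_coeff:
  assumes i: "i \<in> I" "u \<in> dom i" and z: "z \<in> V u"
  shows "(\<Sum>e\<in>UNIV. inv_comp (metric_v G (dl i)) b e u * g u (dl i (Inr e) u) z) = coeff (dl i) u (Inr b) z"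
  using gi_coeff[OF i, of z "Inr b"] V_fibre[OF dom_points[OF i] z] by (simp add: sum_Plus_UNIV gi_def)

lemma g_H_expand:
  assumes i: "i \<in> I" "u \<in> dom i" and z: "z \<in> H u" and w: "w \<in> fibre B u"
  shows "g u z w = (\<Sum>\<theta>\<in>UNIV. coeff (dl i) u (Inl \<theta>) z * g u (dl i (Inl \<theta>) u) w)"
  using lin_on_expand[OF dl_basis[OF i] g_lin(2)[OF dom_points[OF i] w]] z coeff_H[OF i z]
  by (simp add: sum_Plus_UNIV H_iff)

lemma g_V_expand:
  assumes i: "i \<in> I" "u \<in> dom i" and z: "z \<in> V u" and w: "w \<in> fibre B u"
  shows "g u z w = (\<Sum>d\<in>UNIV. coeff (dl i) u (Inr d) z * g u (dl i (Inr d) u) w)"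
  using lin_on_expand[OF dl_basis[OF i] g_lin(2)[OF dom_points[OF i] w] V_fibre[OF dom_points[OF i] z]] coeff_V[OF i z]
  by (simp add: sum_Plus_UNIV)

text \<open>In the two pure cases the component of \<open>D0\<close> is cancelled by the last term
  of \<open>K_dl_same\<close>, leaving the formulas of Christoffel type. In the two mixed cases it
  survives, and \<open>K\<close> is the covariant derivative of the metric components with respect
  to \<open>D0\<close>.\<close>

lemma D_components:
  assumes i: "i \<in> I"
  shows "has_components B D (dom i) (dl i) (new_H a G (dl i) (L i)) (new_Hv B a D0 G (dl i))
    (new_V B a D0 G (dl i)) (new_Vv a G (dl i))"
  unfolding has_components_def
proof (intro conjI allI ballI)
  fix \<beta> \<gamma> u assume u: "u \<in> dom i"
  note pt = dom_points[OF i u] and iu = i u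
  let ?g = "\<lambda>\<epsilon>. g u (dl i (Inl \<epsilon>) u)"
  show "D (dl i (Inl \<gamma>)) (vec_field B (dl i (Inl \<beta>))) u =
       vec_tensor (fibre B u) (\<Sum>\<alpha>\<in>UNIV. new_H a G (dl i) (L i) \<alpha> \<beta> \<gamma> u *\<^sub>R dl i (Inl \<alpha>) u)"
  proof (rule cov_S_Inl[OF iu])
    fix \<alpha>
    let ?z = "cov (dl i (Inl \<gamma>)) (dl i (Inl \<beta>)) u"
    define N where "N = (\<lambda>\<epsilon>. a u (dl i (Inl \<gamma>) u) (metric_h G (dl i) \<epsilon> \<beta>) + a u (dl i (Inl \<beta>) u) (metric_h G (dl i) \<epsilon> \<gamma>)
       - a u (dl i (Inl \<epsilon>) u) (metric_h G (dl i) \<beta> \<gamma>)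
       + (\<Sum>\<theta>\<in>UNIV. metric_h G (dl i) \<theta> \<epsilon> u * L i \<theta> \<gamma> \<beta> (fst u))
       - (\<Sum>\<theta>\<in>UNIV. metric_h G (dl i) \<beta> \<theta> u * L i \<theta> \<gamma> \<epsilon> (fst u))
       - (\<Sum>\<theta>\<in>UNIV. metric_h G (dl i) \<theta> \<gamma> u * L i \<theta> \<beta> \<epsilon> (fst u)))"
    \<comment> \<open>The second sum with \<open>L\<close> arises with the metric indices in the
      order \<theta>, \<beta>; symmetry of the metric gives the order used in the formula.\<close>
    have K: "K u (dl i (Inl \<gamma>) u) (dl i (Inl \<beta>) u) (dl i (Inl \<epsilon>) u) = N \<epsilon> - 2 * ?g \<epsilon> ?z" for \<epsilon>
      using metric_local(2)[OF iu, of \<beta>]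
      by (subst K_dl_same[OF iu]) (simp_all add: N_def same_def sum_Plus_UNIV Lf_def metric_h_def[abs_def] mult.commute)
    have "(\<Sum>\<epsilon>\<in>UNIV. inv_comp (metric_h G (dl i)) \<alpha> \<epsilon> u * (K u (dl i (Inl \<gamma>) u) (dl i (Inl \<beta>) u) (dl i (Inl \<epsilon>) u) / 2)) =
       1 / 2 * (\<Sum>\<epsilon>\<in>UNIV. inv_comp (metric_h G (dl i)) \<alpha> \<epsilon> u * N \<epsilon>) -
       (\<Sum>\<epsilon>\<in>UNIV. inv_comp (metric_h G (dl i)) \<alpha> \<epsilon> u * ?g \<epsilon> ?z)"
      unfolding K by (simp add: diff_divide_distrib right_diff_distrib sum_subtractf sum_divide_distrib)
    then show "coeff (dl i) u (Inl \<alpha>) ?z +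
        (\<Sum>\<epsilon>\<in>UNIV. inv_comp (metric_h G (dl i)) \<alpha> \<epsilon> u * (K u (dl i (Inl \<gamma>) u) (dl i (Inl \<beta>) u) (dl i (Inl \<epsilon>) u) / 2)) =
        new_H a G (dl i) (L i) \<alpha> \<beta> \<gamma> u"
      unfolding inv_h_coeff[OF iu cov_dl_H[OF iu]] by (simp add: new_H_def Let_def N_def)
  qed
next
  fix d \<gamma> u assume u: "u \<in> dom i"
  note pt = dom_points[OF i u] and iu = i u
  show "D (dl i (Inl \<gamma>)) (vec_field B (dl i (Inr d))) u =
       vec_tensor (fibre B u) (\<Sum>b\<in>UNIV. new_Hv B a D0 G (dl i) d b \<gamma> u *\<^sub>R dl i (Inr b) u)"
  proof (rule cov_S_Inr[OF iu])
    fix b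
    have K: "K u (dl i (Inl \<gamma>) u) (dl i (Inr d) u) (dl i (Inr e) u) = cov_deriv_v B a D0 G (dl i) e d \<gamma> u" for e
    proof -
      have "g u (dl i (Inr e) u) (cov (dl i (Inl \<gamma>)) (dl i (Inr d)) u) =
          g u (cov (dl i (Inl \<gamma>)) (dl i (Inr d)) u) (dl i (Inr e) u)"
        by (rule g_sym[OF pt dl_in[OF iu] cov_dl_in[OF iu]])
      then show ?thesis
        using metric_local(3)[OF iu, of _ e]
        by (subst K_dl_diff[OF iu])
           (simp_all add: same_def cov_deriv_v_def comp_Hv_def conn_coeff_cov[OF iu] metric_v_def[abs_def]
             g_V_expand[OF iu cov_dl_V[OF iu] dl_in[OF iu]] del: dl_Inr)
    qed
    show "coeff (dl i) u (Inr b) (cov (dl i (Inl \<gamma>)) (dl i (Inr d)) u) +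
      (\<Sum>e\<in>UNIV. inv_comp (metric_v G (dl i)) b e u * (K u (dl i (Inl \<gamma>) u) (dl i (Inr d) u) (dl i (Inr e) u) / 2)) =
      new_Hv B a D0 G (dl i) d b \<gamma> u"
      unfolding K by (simp add: new_Hv_def comp_Hv_def conn_coeff_cov[OF iu] sum_divide_distrib)
  qed
next
  fix \<beta> c u assume u: "u \<in> dom i"
  note pt = dom_points[OF i u] and iu = i u
  show "D (dl i (Inr c)) (vec_field B (dl i (Inl \<beta>))) u =
       vec_tensor (fibre B u) (\<Sum>\<alpha>\<in>UNIV. new_V B a D0 G (dl i) \<alpha> \<beta> c u *\<^sub>R dl i (Inl \<alpha>) u)"
  proof (rule cov_S_Inl[OF iu])
    fix \<alpha>
    have K: "K u (dl i (Inr c) u) (dl i (Inl \<beta>) u) (dl i (Inl \<epsilon>) u) = cov_deriv_h B a D0 G (dl i) \<epsilon> \<beta> c u" for \<epsilon>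
    proof -
      have "g u (dl i (Inl \<epsilon>) u) (cov (dl i (Inr c)) (dl i (Inl \<beta>)) u) =
          g u (cov (dl i (Inr c)) (dl i (Inl \<beta>)) u) (dl i (Inl \<epsilon>) u)"
        by (rule g_sym[OF pt dl_in[OF iu] cov_dl_in[OF iu]])
      then show ?thesis
        using metric_local(2)[OF iu, of _ \<epsilon>]
        by (subst K_dl_diff[OF iu])
           (simp_all add: same_def cov_deriv_h_def comp_V_def conn_coeff_cov[OF iu] metric_h_def[abs_def]
             g_H_expand[OF iu cov_dl_H[OF iu] dl_in[OF iu]] del: dl_Inr)
    qed
    show "coeff (dl i) u (Inl \<alpha>) (cov (dl i (Inr c)) (dl i (Inl \<beta>)) u) +
      (\<Sum>\<epsilon>\<in>UNIV. inv_comp (metric_h G (dl i)) \<alpha> \<epsilon> u * (K u (dl i (Inr c) u) (dl i (Inl \<beta>) u) (dl i (Inl \<epsilon>) u) / 2)) =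
      new_V B a D0 G (dl i) \<alpha> \<beta> c u"
      unfolding K by (simp add: new_V_def comp_V_def conn_coeff_cov[OF iu] sum_divide_distrib)
  qed
next
  fix d c u assume u: "u \<in> dom i"
  note pt = dom_points[OF i u] and iu = i u
  let ?g = "\<lambda>e. g u (dl i (Inr e) u)"
  show "D (dl i (Inr c)) (vec_field B (dl i (Inr d))) u =
       vec_tensor (fibre B u) (\<Sum>b\<in>UNIV. new_Vv a G (dl i) d b c u *\<^sub>R dl i (Inr b) u)"
  proof (rule cov_S_Inr[OF iu])
    fix b
    let ?z = "cov (dl i (Inr c)) (dl i (Inr d)) u"
    define N where "N = (\<lambda>e. a u (dl i (Inr c) u) (metric_v G (dl i) e d) + a u (dl i (Inr d) u) (metric_v G (dl i) e c)
       - a u (dl i (Inr e) u) (metric_v G (dl i) d c))"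
    have K: "K u (dl i (Inr c) u) (dl i (Inr d) u) (dl i (Inr e) u) = N e - 2 * ?g e ?z" for e
      by (subst K_dl_same[OF iu]) (simp_all add: N_def same_def metric_v_def[abs_def])
    have "(\<Sum>e\<in>UNIV. inv_comp (metric_v G (dl i)) b e u * (K u (dl i (Inr c) u) (dl i (Inr d) u) (dl i (Inr e) u) / 2)) =
       1 / 2 * (\<Sum>e\<in>UNIV. inv_comp (metric_v G (dl i)) b e u * N e) -
       (\<Sum>e\<in>UNIV. inv_comp (metric_v G (dl i)) b e u * ?g e ?z)"
      unfolding K by (simp add: diff_divide_distrib right_diff_distrib sum_subtractf sum_divide_distrib)
    then show "coeff (dl i) u (Inr b) ?z +
        (\<Sum>e\<in>UNIV. inv_comp (metric_v G (dl i)) b e u * (K u (dl i (Inr c) u) (dl i (Inr d) u) (dl i (Inr e) u) / 2)) =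
        new_Vv a G (dl i) d b c u"
      unfolding inv_v_coeff[OF iu cov_dl_V[OF iu]] by (simp add: new_Vv_def Let_def N_def)
  qed
qed

end

section \<open>The tangent bundle\<close>

definition basis_enum :: "('k \<Rightarrow> 'c::euclidean_space) \<Rightarrow> bool"
  where "basis_enum b \<longleftrightarrow> inj b \<and> range b = Basis"

lemma basis_enum_inner: "basis_enum b \<Longrightarrow> b j \<bullet> b k = (if j = k then 1 else 0)"
  unfolding basis_enum_def by (metis inner_Basis inj_eq rangeI)

lemma basis_enum_sum: "basis_enum b \<Longrightarrow> (\<Sum>v\<in>Basis. f v) = (\<Sum>k\<in>UNIV. f (b k))"
  by (metis basis_enum_def sum.reindex_cong)

lemma basis_enum_base_dir: "basis_enum base_dir"
  by (auto simp: basis_enum_def inj_def base_dir_def axis_eq_axis Basis_vec_def)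

lemma basis_enum_total_dir: "basis_enum total_dir"
proof -
  have "inj total_dir"
    by (auto simp: inj_def total_dir_def axis_eq_axis axis_eq_0_iff split: sum.splits)
  moreover have "range total_dir = Basis"
    unfolding UNIV_sum image_Un image_image Basis_prod_def Basis_vec_def by (auto simp: total_dir_def)
  ultimately show ?thesis by (simp add: basis_enum_def)
qed

context smooth_manifold
begin

lemma tangent_frame_expand:
  fixes b :: "'k::finite \<Rightarrow> 'c"
  assumes b: "basis_enum b" and c: "c \<in> A" "x \<in> fst c" and X: "X \<in> tangent_space A x"
  shows "X = (\<Sum>k\<in>UNIV. X (\<lambda>y. snd c y \<bullet> b k) *\<^sub>R coord_frame b A c k x)"
proof
  fix f
  show "X f = (\<Sum>k\<in>UNIV. X (\<lambda>y. snd c y \<bullet> b k) *\<^sub>R coord_frame b A c k x) f"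
    unfolding tangent_expand[OF X c, of f] basis_enum_sum[OF b]
    by (simp add: sum_apply scaleR_fun_def coord_frame_def)
qed

lemma coord_frame_basis:
  fixes b :: "'k::finite \<Rightarrow> 'c"
  assumes b: "basis_enum b" and c: "c \<in> A" "x \<in> fst c"
  shows "basis_at (coord_frame b A c) x (tangent_space A x)"
proof (rule basis_atI)
  note sub = subspace_tangent_space[OF subsetD[OF open_in_subset_points[OF open_in_chart[OF c(1)]] c(2)]]
  fix r k assume "(\<Sum>k\<in>UNIV. r k *\<^sub>R coord_frame b A c k x) = 0"
  then have "(\<Sum>k\<in>UNIV. r k *\<^sub>R coord_frame b A c k x) (\<lambda>y. snd c y \<bullet> b k) = 0" by simp
  then show "r k = 0"
    by (simp add: sum_apply scaleR_fun_def coord_frame_def partial_coord[OF c] basis_enum_inner[OF b]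
        if_distrib[of "(*) _"] cong: if_cong)
next
  note sub = subspace_tangent_space[OF subsetD[OF open_in_subset_points[OF open_in_chart[OF c(1)]] c(2)]]
  show "span (range (\<lambda>k. coord_frame b A c k x)) = tangent_space A x"
  proof
    show "span (range (\<lambda>k. coord_frame b A c k x)) \<subseteq> tangent_space A x"
      by (rule span_minimal[OF _ sub]) (auto simp: coord_frame_def intro: partial_in_tangent c)
    show "tangent_space A x \<subseteq> span (range (\<lambda>k. coord_frame b A c k x))"
    proof
      fix X assume X: "X \<in> tangent_space A x"
      have "X = (\<Sum>k\<in>UNIV. X (\<lambda>y. snd c y \<bullet> b k) *\<^sub>R coord_frame b A c k x)"
        by (rule tangent_frame_expand[OF b c X])
      also have "\<dots> \<in> span (range (\<lambda>k. coord_frame b A c k x))"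
        by (intro span_sum span_scale span_base) auto
      finally show "X \<in> span (range (\<lambda>k. coord_frame b A c k x))" .
    qed
  qed
qed

lemma coeff_coord_frame:
  fixes b :: "'k::finite \<Rightarrow> 'c"
  assumes b: "basis_enum b" and c: "c \<in> A" "x \<in> fst c" and X: "X \<in> tangent_space A x"
  shows "coeff (coord_frame b A c) x k X = X (\<lambda>y. snd c y \<bullet> b k)"
  by (subst tangent_frame_expand[OF b c X]) (rule coeff_lincomb[OF coord_frame_basis[OF b c]])

lemma coord_frame_in: "c \<in> A \<Longrightarrow> x \<in> fst c \<Longrightarrow> coord_frame b A c k x \<in> tangent_space A x"
  by (simp add: coord_frame_def partial_in_tangent)

lemma tangent_frames: "frames (tangent_bundle b A) = (\<lambda>c. (fst c, coord_frame b A c)) ` A"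
  unfolding tangent_bundle_def vbundle.simps by blast

lemma tangent_bundle_simps [simp]:
  "base (tangent_bundle b A) = A" "fibre (tangent_bundle b A) = tangent_space A"
  by (simp_all add: tangent_bundle_def)

lemma coord_frame_smooth:
  fixes b :: "'k::finite \<Rightarrow> 'c"
  assumes b: "basis_enum b" and c: "c \<in> A" and c': "c' \<in> A"
  shows "smooth_fun A (fst c \<inter> fst c') (\<lambda>x. coeff (coord_frame b A c) x j (coord_frame b A c' k x))"
proof -
  have o: "open_in A (fst c \<inter> fst c')" by (intro open_in_Int open_in_chart c c')
  have "smooth_fun A (fst c \<inter> fst c') (\<lambda>x. coord_frame b A c' k x (\<lambda>y. snd c y \<bullet> b j))"
    unfolding coord_frame_def by (intro partial_smooth c' o smooth_fun_subset[OF smooth_fun_coord[OF c]]) auto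
  then show ?thesis
    by (rule smooth_fun_cong[OF o, rotated])
       (simp add: coeff_coord_frame[OF b c] coord_frame_in[OF c'])
qed

lemma tangent_bundle_framed:
  fixes b :: "'k::finite \<Rightarrow> 'c"
  assumes b: "basis_enum b" shows "framed_bundle (tangent_bundle b A)"
proof (unfold_locales, unfold tangent_bundle_simps)
  show "\<Union> (fst ` frames (tangent_bundle b A)) = points A" by (auto simp: tangent_frames points_def)
qed (auto simp: tangent_frames atlas intro: open_in_chart coord_frame_basis[OF b] coord_frame_smooth[OF b])

end

section \<open>The total space of the dual bundle\<close>

locale dual_bundle = framed_bundle E
  for E :: "('p, real^'m::finite, 'w::real_vector, 'e::finite) vbundle"
begin

text \<open>The part of the dual bundle over \<open>W\<close>. All chart domains of the total space
  and all frame domains of the generalized tangent bundle have this form.\<close>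

definition lift :: "'p set \<Rightarrow> ('p \<times> ('w \<Rightarrow> real)) set"
  where "lift W = {(x, p). x \<in> W \<and> p \<in> dual_space (fibre E x)}"

lemma in_lift: "u \<in> lift W \<longleftrightarrow> fst u \<in> W \<and> snd u \<in> dual_space (fibre E (fst u))"
  by (cases u) (simp add: lift_def)

abbreviation dc where "dc \<equiv> dual_chart E"

lemma dc_dom: "fst (dc c s) = lift (fst c \<inter> fst s)"
  by (simp add: dual_chart_def lift_def)

lemma dc_map: "snd (dc c s) u = (snd c (fst u), \<chi> a. snd u (snd s a (fst u)))"
  by (simp add: dual_chart_def split_beta)

lemma sE_basis: "s \<in> frames E \<Longrightarrow> x \<in> fst s \<Longrightarrow> basis_at (snd s) x (fibre E x)"
  using frame_basis[of "fst s" "snd s"] by simp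

lemma sE_open: "s \<in> frames E \<Longrightarrow> open_in (base E) (fst s)"
  using frame_open[of "fst s" "snd s"] by simp

lemma sE_smooth: "s \<in> frames E \<Longrightarrow> t \<in> frames E \<Longrightarrow>
    smooth_fun (base E) (fst s \<inter> fst t) (\<lambda>x. coeff (snd s) x j (snd t k x))"
  using frame_smooth[of "fst s" "snd s" "fst t" "snd t"] by simp

lemma point_sE: "x \<in> points (base E) \<Longrightarrow> \<exists>s\<in>frames E. x \<in> fst s"
  using frames_cover by blast

lemma dc_inj:
  assumes c: "c \<in> base E" and s: "s \<in> frames E"
  shows "inj_on (snd (dc c s)) (fst (dc c s))"
proof (rule inj_onI)
  fix u v assume u: "u \<in> fst (dc c s)" and v: "v \<in> fst (dc c s)" and eq: "snd (dc c s) u = snd (dc c s) v"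
  have x: "fst u = fst v"
    using inj_onD[OF chart_inj[OF c], of "fst u" "fst v"] u v eq by (simp add: dc_dom in_lift dc_map)
  have "snd u (snd s a (fst u)) = snd v (snd s a (fst u))" for a
    using eq by (simp add: dc_map x vec_eq_iff)
  then have "snd u = snd v"
    using dual_expand[OF sE_basis[OF s], of "fst u" "snd u"] dual_expand[OF sE_basis[OF s], of "fst u" "snd v"] u v x
    by (simp add: dc_dom in_lift)
  with x show "u = v" by (rule prod_eqI)
qed

text \<open>The covector with prescribed fibre coordinates \<open>y\<close>; it gives the inverse of
  a dual chart explicitly.\<close>

definition covec where "covec s x y = (\<Sum>a\<in>UNIV. (y $ a) *\<^sub>R coeff (snd s) x a)"

lemma covec_dual: "s \<in> frames E \<Longrightarrow> x \<in> fst s \<Longrightarrow> covec s x y \<in> dual_space (fibre E x)"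
  unfolding covec_def
  by (intro subspace_sum subspace_scale subspace_dual_space coeff_in_dual sE_basis)

lemma covec_frame: "s \<in> frames E \<Longrightarrow> x \<in> fst s \<Longrightarrow> covec s x y (snd s a x) = y $ a"
  by (simp add: covec_def sum_apply scaleR_fun_def coeff_basis[OF sE_basis] if_distrib[of "(*) _"] cong: if_cong)

text \<open>Fibre coordinates are arbitrary, so the image of a set lifted from the base is a full
  cylinder; openness upstairs thus reduces to openness on the base.\<close>

lemma dc_image:
  assumes c: "c \<in> base E" and s: "s \<in> frames E"
  shows "snd (dc c s) ` (fst (dc c s) \<inter> lift W) = (snd c ` (fst c \<inter> (fst s \<inter> W))) \<times> UNIV"
proof (intro equalityI subsetI)
  fix z assume "z \<in> (snd c ` (fst c \<inter> (fst s \<inter> W))) \<times> (UNIV :: (real^'e) set)"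
  then obtain x y where x: "x \<in> fst c" "x \<in> fst s" "x \<in> W" "z = (snd c x, y)" by auto
  then have "z = snd (dc c s) (x, covec s x y)" by (simp add: dc_map covec_frame[OF s] vec_eq_iff)
  moreover have "(x, covec s x y) \<in> fst (dc c s) \<inter> lift W"
    using x covec_dual[OF s] by (simp add: dc_dom in_lift)
  ultimately show "z \<in> snd (dc c s) ` (fst (dc c s) \<inter> lift W)" by blast
qed (auto simp: dc_dom in_lift dc_map)

lemma dc_inv:
  assumes c: "c \<in> base E" and s: "s \<in> frames E" and x: "x \<in> fst c" "x \<in> fst s"
  shows "chart_inv (dc c s) (snd c x, y) = (x, covec s x y)"
proof (rule inv_into_f_eq[OF dc_inj[OF c s]])
  show "(x, covec s x y) \<in> fst (dc c s)" using x covec_dual[OF s] by (simp add: dc_dom in_lift)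
  show "snd (dc c s) (x, covec s x y) = (snd c x, y)" using x by (simp add: dc_map covec_frame[OF s] vec_eq_iff)
qed

lemma dc_open:
  assumes c: "c \<in> base E" and s: "s \<in> frames E" and W: "open_in (base E) W"
  shows "open (snd (dc c s) ` (fst (dc c s) \<inter> lift W))"
  unfolding dc_image[OF c s] by (intro open_Times open_UNIV chart_open c open_in_Int sE_open s W)

lemma smooth_dc:
  assumes c: "c \<in> base E" and s: "s \<in> frames E" and W: "open_in (base E) W"
    and f: "smooth_fun (base E) W f"
  shows "smooth_on (snd (dc c s) ` (fst (dc c s) \<inter> lift W)) (\<lambda>z. f (chart_inv c (fst z)))"
proof (rule smooth_on_compose[OF dc_open[OF c s W], where f = fst and g = "\<lambda>x. f (chart_inv c x)"])
  show "smooth_on (snd (dc c s) ` (fst (dc c s) \<inter> lift W)) fst"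
    by (rule smooth_on_bounded_linear[OF bounded_linear_fst])
  show "smooth_on (snd c ` (fst c \<inter> W)) (\<lambda>x. f (chart_inv c x))" using f c by (simp add: smooth_fun_iff)
  show "fst ` snd (dc c s) ` (fst (dc c s) \<inter> lift W) \<subseteq> snd c ` (fst c \<inter> W)"
    by (auto simp: dc_dom in_lift dc_map)
qed

lemma dc_in: "c \<in> base E \<Longrightarrow> s \<in> frames E \<Longrightarrow> dc c s \<in> dual_atlas E"
  unfolding dual_atlas_def by blast

lemma dual_atlasE:
  assumes "d \<in> dual_atlas E" obtains c s where "d = dc c s" "c \<in> base E" "s \<in> frames E"
  using assms unfolding dual_atlas_def by blast

text \<open>A coordinate change of the total space is one of the base together with a map that is
  linear in the fibre coordinates, whose matrix is the transition matrix of \<open>E\<close> and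
  depends on the base point alone.\<close>

lemma dual_atlas_smooth: "smooth_atlas (dual_atlas E)"
proof -
  have "inj_on (snd d) (fst d) \<and> open (snd d ` fst d) \<and> open (snd d ` (fst d \<inter> fst d')) \<and>
      smooth_on (snd d ` (fst d \<inter> fst d')) (snd d' \<circ> chart_inv d)"
    if dd: "d \<in> dual_atlas E" "d' \<in> dual_atlas E" for d d'
  proof -
    obtain c s where d: "d = dc c s" "c \<in> base E" "s \<in> frames E" using dd(1) by (rule dual_atlasE)
    obtain c' s' where d': "d' = dc c' s'" "c' \<in> base E" "s' \<in> frames E" using dd(2) by (rule dual_atlasE)
    note d = d d'
    \<comment> \<open>\<open>fst s\<close> is included so that the transition coefficients between
      both frames of \<open>E\<close> are smooth on all of \<open>W\<close>.\<close>
    define W where "W = fst c' \<inter> (fst s' \<inter> fst s)"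
    have W: "open_in (base E) W" unfolding W_def by (intro open_in_Int open_in_chart sE_open d)
    have dom: "fst d \<inter> fst d' = fst (dc c s) \<inter> lift W" by (auto simp: d W_def dc_dom in_lift)
    let ?S = "snd (dc c s) ` (fst (dc c s) \<inter> lift W)"
    have o: "open ?S" by (rule dc_open[OF d(2,3) W])
    have "fst d = fst (dc c s) \<inter> lift (fst c)" by (auto simp: d dc_dom in_lift)
    then have o': "open (snd d ` fst d)" using dc_open[OF d(2,3) open_in_chart[OF d(2)]] by (simp add: d(1))
    have fb: "smooth_on ?S (\<lambda>z. snd c' (chart_inv c (fst z)) \<bullet> b)" for b
      by (intro smooth_dc d W smooth_fun_subset[OF smooth_fun_coord[OF d(5)]]) (simp add: W_def)
    have fa: "smooth_on ?S (\<lambda>z. \<Sum>b\<in>UNIV. coeff (snd s) (chart_inv c (fst z)) b (snd s' a (chart_inv c (fst z))) * (snd z $ b))" for a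
      by (intro smooth_on_sum smooth_on_mult o smooth_dc[where f = "\<lambda>x. coeff (snd s) x _ (snd s' a x)"] d W
          smooth_fun_subset[OF sE_smooth[OF d(3,6)]]
          smooth_on_bounded_linear[OF bounded_linear_compose[OF bounded_linear_vec_nth bounded_linear_snd]])
        (auto simp: W_def)
    have "smooth_on ?S (\<lambda>z. (snd c' (chart_inv c (fst z)),
        \<chi> a. \<Sum>b\<in>UNIV. coeff (snd s) (chart_inv c (fst z)) b (snd s' a (chart_inv c (fst z))) * (snd z $ b)))"
    proof (rule smooth_on_components[OF o])
      fix b :: "(real^'m) \<times> (real^'e)" assume "b \<in> Basis"
      then consider v where "b = (v, 0)" | a where "b = (0, axis a 1)"
        by (auto simp: Basis_prod_def Basis_vec_def)
      then show "smooth_on ?S (\<lambda>z. (snd c' (chart_inv c (fst z)),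
          \<chi> a. \<Sum>b\<in>UNIV. coeff (snd s) (chart_inv c (fst z)) b (snd s' a (chart_inv c (fst z))) * (snd z $ b)) \<bullet> b)"
        by cases (use fa fb in \<open>simp_all add: inner_axis\<close>)
    qed
    then have "smooth_on ?S (snd d' \<circ> chart_inv d)"
    proof (rule smooth_on_cong[OF o, rotated])
      fix z assume "z \<in> ?S"
      then obtain x y where x: "x \<in> fst c" "x \<in> fst s" "x \<in> W" "z = (snd c x, y)"
        unfolding dc_image[OF d(2,3)] by auto
      have "covec s x y (snd s' a x) = (\<Sum>b\<in>UNIV. coeff (snd s) x b (snd s' a x) * y $ b)" for a
        by (simp add: covec_def sum_apply scaleR_fun_def mult.commute)
      then show "(snd c' (chart_inv c (fst z)),
          \<chi> a. \<Sum>b\<in>UNIV. coeff (snd s) (chart_inv c (fst z)) b (snd s' a (chart_inv c (fst z))) * (snd z $ b)) =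
          (snd d' \<circ> chart_inv d) z"
        using x by (simp add: d dc_inv dc_map chart_inv_left)
    qed
    then show ?thesis using o o' dc_inj[OF d(2,3)] unfolding dom unfolding d(1) by blast
  qed
  then show ?thesis unfolding smooth_atlas_def split_beta by blast
qed

end

sublocale dual_bundle \<subseteq> dual: smooth_manifold "dual_atlas E"
  by unfold_locales (rule dual_atlas_smooth)

context dual_bundle
begin

lemma dual_points: "points (dual_atlas E) = lift (points (base E))"
proof -
  have "u \<in> points (dual_atlas E) \<longleftrightarrow> (\<exists>c\<in>base E. \<exists>s\<in>frames E. u \<in> fst (dc c s))" for u
    unfolding points_def dual_atlas_def by blast
  then show ?thesis
    using points_chart point_sE open_in_subset_points[OF open_in_chart] by (fastforce simp: in_lift dc_dom)
qed

lemma lift_open: assumes "open_in (base E) W" shows "open_in (dual_atlas E) (lift W)"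
  unfolding dual.open_in_iff dual_points
proof (intro conjI ballI)
  show "lift W \<subseteq> lift (points (base E))" using open_in_subset_points[OF assms] by (auto simp: in_lift)
  fix d assume "d \<in> dual_atlas E"
  then obtain c s where d: "d = dc c s" "c \<in> base E" "s \<in> frames E" by (rule dual_atlasE)
  show "open (snd d ` (fst d \<inter> lift W))" unfolding d(1) by (rule dc_open[OF d(2,3) assms])
qed

lemma lift_smooth:
  assumes W: "open_in (base E) W" and f: "smooth_fun (base E) W f"
  shows "smooth_fun (dual_atlas E) (lift W) (\<lambda>u. f (fst u))"
  unfolding dual.smooth_fun_iff
proof
  fix d assume "d \<in> dual_atlas E"
  then obtain c s where d: "d = dc c s" and c: "c \<in> base E" and s: "s \<in> frames E"
    by (rule dual_atlasE)
  show "smooth_on (snd d ` (fst d \<inter> lift W)) (\<lambda>z. f (fst (chart_inv d z)))"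
    unfolding d
  proof (rule smooth_on_cong[OF dc_open[OF c s W] _ smooth_dc[OF c s W f]])
    fix z assume "z \<in> snd (dc c s) ` (fst (dc c s) \<inter> lift W)"
    then obtain x y where "x \<in> fst c" "x \<in> fst s" "z = (snd c x, y)" unfolding dc_image[OF c s] by auto
    then show "f (chart_inv c (fst z)) = f (fst (chart_inv (dc c s) z))"
      by (simp add: dc_inv[OF c s] chart_inv_left[OF c])
  qed
qed

lemma lift_near:
  assumes "smooth_near (base E) (fst u) f" "snd u \<in> dual_space (fibre E (fst u))"
  shows "smooth_near (dual_atlas E) u (\<lambda>u. f (fst u))"
proof -
  obtain W where "open_in (base E) W" "fst u \<in> W" "smooth_fun (base E) W f"
    using assms(1) by (auto simp: smooth_near_def)
  then show ?thesis using assms(2) by (intro dual.smooth_nearI[OF lift_open _ lift_smooth]) (auto simp: in_lift)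
qed

section \<open>Coordinate vector fields on the total space and their action on lifted functions and
  fibre coordinates\<close>

definition cframe where "cframe c s = coord_frame total_dir (dual_atlas E) (dc c s)"

lemma cframe_tangent: "c \<in> base E \<Longrightarrow> s \<in> frames E \<Longrightarrow> u \<in> fst (dc c s) \<Longrightarrow>
    cframe c s k u \<in> tangent_space (dual_atlas E) u"
  unfolding cframe_def by (intro dual.coord_frame_in dc_in)

text \<open>In a dual chart a lifted function depends on the first coordinate alone, so the chain
  rule with \<open>fst\<close> gives the derivative on the base.\<close>

lemma partial_lift:
  assumes c: "c \<in> base E" and s: "s \<in> frames E" and u: "u \<in> fst (dc c s)" and f: "smooth_near (base E) (fst u) f"
  shows "partial (dual_atlas E) (dc c s) v u (\<lambda>u. f (fst u)) = partial (base E) c (fst v) (fst u) f"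
proof -
  have uc: "fst u \<in> fst c" "fst u \<in> fst s" "snd u \<in> dual_space (fibre E (fst u))" using u by (auto simp: dc_dom in_lift)
  show ?thesis
  proof (rule dual.partial_eqI[OF dc_in[OF c s] u lift_near[OF f uc(3)]])
    have d: "((\<lambda>z. f (chart_inv c z)) has_derivative (\<lambda>v. partial (base E) c v (fst u) f)) (at (fst (snd (dc c s) u)))"
      using near_has_derivative[OF c uc(1) f] by (simp add: dc_map)
    have "(fst has_derivative fst) (at (snd (dc c s) u))"
      by (rule bounded_linear_imp_has_derivative[OF bounded_linear_fst])
    from has_derivative_compose[OF this d]
    have "((\<lambda>z. f (chart_inv c (fst z))) has_derivative (\<lambda>v. partial (base E) c (fst v) (fst u) f)) (at (snd (dc c s) u))" .
    moreover have "open (snd (dc c s) ` fst (dc c s))"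
      using dual.chart_open[OF dc_in[OF c s] dual.open_in_chart[OF dc_in[OF c s]]] by simp
    ultimately show "((\<lambda>z. f (fst (chart_inv (dc c s) z))) has_derivative (\<lambda>v. partial (base E) c (fst v) (fst u) f)) (at (snd (dc c s) u))"
    proof (rule has_derivative_transform_within_open)
      show "snd (dc c s) u \<in> snd (dc c s) ` fst (dc c s)" using u by simp
      fix z assume "z \<in> snd (dc c s) ` fst (dc c s)"
      then obtain w where w: "z = snd (dc c s) w" "w \<in> fst (dc c s)" by auto
      then have "chart_inv (dc c s) z = w" using dual.chart_inv_left[OF dc_in[OF c s]] by simp
      then show "f (chart_inv c (fst z)) = f (fst (chart_inv (dc c s) z))"
        using w chart_inv_left[OF c] by (simp add: dc_map dc_dom in_lift)
    qed
  qed
qed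

lemma cframe_lift:
  assumes "c \<in> base E" "s \<in> frames E" "u \<in> fst (dc c s)" "smooth_near (base E) (fst u) f"
  shows "cframe c s (Inl i) u (\<lambda>u. f (fst u)) = coord_frame base_dir (base E) c i (fst u) f"
    and "cframe c s (Inr b) u (\<lambda>u. f (fst u)) = 0"
  using partial_lift[OF assms] partial_zero[OF assms(1), of "fst u" f] assms(3)
  by (simp_all add: cframe_def coord_frame_def total_dir_def base_dir_def dc_dom in_lift)

text \<open>The coordinate p_a of the frame \<open>s\<close> as a function on the total space,
  independent of any chart of the base.\<close>

definition fcoord :: "'p set \<times> ('e \<Rightarrow> 'p \<Rightarrow> 'w) \<Rightarrow> 'e \<Rightarrow> 'p \<times> ('w \<Rightarrow> real) \<Rightarrow> real"
  where "fcoord s a = (\<lambda>u. snd u (snd s a (fst u)))"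

lemma dc_coord:
  "(\<lambda>u. snd (dc c s) u \<bullet> total_dir (Inl i)) = (\<lambda>u. snd c (fst u) \<bullet> base_dir i)"
  "(\<lambda>u. snd (dc c s) u \<bullet> total_dir (Inr b)) = fcoord s b"
  by (auto simp: dc_map total_dir_def base_dir_def inner_axis fcoord_def fun_eq_iff)

lemma fcoord_smooth:
  assumes s: "s \<in> frames E" shows "smooth_fun (dual_atlas E) (lift (fst s)) (fcoord s b)"
proof (rule dual.smooth_fun_local)
  fix u assume u: "u \<in> lift (fst s)"
  then have "fst u \<in> points (base E)" using open_in_subset_points[OF sE_open[OF s]] by (auto simp: in_lift)
  then obtain c where c: "c \<in> base E" "fst u \<in> fst c" using points_chart by blast
  then have "u \<in> fst (dc c s)" using u by (simp add: dc_dom in_lift)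
  then show "\<exists>V. open_in (dual_atlas E) V \<and> u \<in> V \<and> smooth_fun (dual_atlas E) V (fcoord s b)"
    using dual.open_in_chart[OF dc_in[OF c(1) s]] dual.smooth_fun_coord[OF dc_in[OF c(1) s], of "total_dir (Inr b)"]
    unfolding dc_coord by blast
qed

lemma cframe_basis:
  assumes "c \<in> base E" "s \<in> frames E" "u \<in> fst (dc c s)"
  shows "basis_at (cframe c s) u (tangent_space (dual_atlas E) u)"
  unfolding cframe_def by (rule dual.coord_frame_basis[OF basis_enum_total_dir dc_in[OF assms(1,2)] assms(3)])

lemma coeff_cframe:
  assumes "c \<in> base E" "s \<in> frames E" "u \<in> fst (dc c s)" "X \<in> tangent_space (dual_atlas E) u"
  shows "coeff (cframe c s) u (Inl i) X = X (\<lambda>u. snd c (fst u) \<bullet> base_dir i)"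
    "coeff (cframe c s) u (Inr b) X = X (fcoord s b)"
  unfolding cframe_def dual.coeff_coord_frame[OF basis_enum_total_dir dc_in[OF assms(1,2)] assms(3,4)] dc_coord
  by simp_all

text \<open>The fibre coordinates of \<open>s'\<close> are combinations of those of \<open>s\<close>
  with coefficients lifted from the base. The vertical derivative annihilates these coefficients and
  selects the one belonging to \<open>b\<close>.\<close>

lemma cframe_Inr_fcoord:
  assumes c: "c \<in> base E" and s: "s \<in> frames E" and s': "s' \<in> frames E" and u: "u \<in> fst (dc c s)" "fst u \<in> fst s'"
  shows "cframe c s (Inr b) u (fcoord s' d) = coeff (snd s) (fst u) b (snd s' d (fst u))"
proof -
  have uu: "fst u \<in> fst c" "fst u \<in> fst s" "snd u \<in> dual_space (fibre E (fst u))" using u by (auto simp: dc_dom in_lift)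
  let ?f = "\<lambda>e x. coeff (snd s) x e (snd s' d x)"
  let ?W = "lift (fst s \<inter> fst s')"
  note X = cframe_tangent[OF c s u(1), of "Inr b"]
  have Wb: "open_in (base E) (fst s \<inter> fst s')" by (intro open_in_Int sE_open s s')
  have W: "open_in (dual_atlas E) ?W" "u \<in> ?W" using lift_open[OF Wb] uu u by (auto simp: in_lift)
  have f: "smooth_near (base E) (fst u) (?f e)" for e
    using smooth_nearI[OF Wb _ sE_smooth[OF s s']] uu u by simp
  have p: "smooth_near (dual_atlas E) u (fcoord s e)" for e
    using dual.smooth_nearI[OF lift_open[OF sE_open[OF s]] _ fcoord_smooth[OF s]] uu by (simp add: in_lift)
  have exp: "fcoord s' d v = (\<Sum>e\<in>UNIV. ?f e (fst v) * fcoord s e v)" if v: "v \<in> ?W" for v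
  proof -
    have v': "fst v \<in> fst s" "fst v \<in> fst s'" "snd v \<in> dual_space (fibre E (fst v))" using v by (auto simp: in_lift)
    have "lin_on (fibre E (fst v)) (snd v)" using v'(3) by (simp add: dual_space_iff)
    from lin_on_expand[OF sE_basis[OF s v'(1)] this basis_at_in[OF sE_basis[OF s' v'(2)]], of d]
    show ?thesis by (simp add: fcoord_def)
  qed
  have d: "cframe c s (Inr b) u (fcoord s e) = (if b = e then 1 else 0)" for e
    using coeff_cframe(2)[OF c s u(1) X, of e] coeff_basis[OF cframe_basis[OF c s u(1)], of "Inr e" "Inr b"] by auto
  have "cframe c s (Inr b) u (fcoord s' d) = cframe c s (Inr b) u (\<lambda>v. \<Sum>e\<in>UNIV. ?f e (fst v) * fcoord s e v)"
    by (rule dual.tangent_cong[OF X W exp])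
  also have "\<dots> = (\<Sum>e\<in>UNIV. cframe c s (Inr b) u (\<lambda>v. ?f e (fst v) * fcoord s e v))"
    by (rule dual.tangent_sum[OF X dual.smooth_near_mult[OF lift_near[OF f uu(3)] p]])
  also have "\<dots> = (\<Sum>e\<in>UNIV. ?f e (fst u) * (if b = e then 1 else 0))"
    unfolding dual.tangent_mult[OF X lift_near[OF f uu(3)] p] d cframe_lift(2)[OF c s u(1) f] by simp
  also have "\<dots> = ?f b (fst u)" by (simp add: if_distrib[of "(*) _"] cong: if_cong)
  finally show ?thesis .
qed

lemma cframe_smooth:
  assumes c: "c \<in> base E" and s: "s \<in> frames E" and W: "open_in (dual_atlas E) W" "W \<subseteq> fst (dc c s)"
    and f: "smooth_fun (dual_atlas E) W f"
  shows "smooth_fun (dual_atlas E) W (\<lambda>u. cframe c s k u f)"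
  unfolding cframe_def coord_frame_def by (rule dual.partial_smooth[OF dc_in[OF c s] W f])

section \<open>The tangent bundle of the dual bundle\<close>

text \<open>A version of \<open>cframe_lift\<close> for functions that are known to be lifts only in
  a neighbourhood of \<open>u\<close>.\<close>

lemma cframe_basic:
  assumes c: "c \<in> base E" and s: "s \<in> frames E" and u: "u \<in> fst (dc c s)"
    and W: "open_in (dual_atlas E) W" "u \<in> W" and eq: "\<And>v. v \<in> W \<Longrightarrow> f v = h (fst v)"
    and h: "smooth_near (base E) (fst u) h"
  shows "cframe c s (Inl i) u f = coord_frame base_dir (base E) c i (fst u) h"
    and "cframe c s (Inr b) u f = 0"
  using dual.tangent_cong[OF cframe_tangent[OF c s u] W eq] cframe_lift[OF c s u h] by simp_all

lemma dc_Int_open: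
  assumes "c \<in> base E" "s \<in> frames E" "c' \<in> base E" "s' \<in> frames E"
  shows "open_in (dual_atlas E) (fst (dc c s) \<inter> fst (dc c' s'))"
  using assms by (intro dual.open_in_Int dual.open_in_chart dc_in)

text \<open>The functions in question are transition coefficients of \<open>E\<close> and hence
  lifted from the base. This gives \<open>basic_v\<close> in both instances.\<close>

lemma cframe_vertical_basic:
  assumes c: "c \<in> base E" "c' \<in> base E" and s: "s \<in> frames E" "s' \<in> frames E"
    and u: "u \<in> fst (dc c s)" "u \<in> fst (dc c' s')"
    and W: "open_in (dual_atlas E) W" "u \<in> W" "W \<subseteq> fst (dc c s) \<inter> fst (dc c' s')"
    and eq: "\<And>v. v \<in> W \<Longrightarrow> f v = cframe c' s' (Inr d) v (fcoord s b)"
  shows "cframe c' s' (Inr e) u f = 0"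
proof (rule cframe_basic(2)[OF c(2) s(2) u(2) W(1,2)])
  show "f v = coeff (snd s') (fst v) d (snd s b (fst v))" if "v \<in> W" for v
    using that W(3) eq[OF that] by (subst cframe_Inr_fcoord[OF c(2) s(2,1), symmetric]) (auto simp: dc_dom in_lift)
  have "open_in (base E) (fst s' \<inter> fst s)" by (intro open_in_Int sE_open s)
  then show "smooth_near (base E) (fst u) (\<lambda>x. coeff (snd s') x d (snd s b x))"
    using u by (intro smooth_nearI[OF _ _ sE_smooth[OF s(2,1)]]) (auto simp: dc_dom in_lift)
qed

abbreviation TE where "TE \<equiv> tangent_bundle total_dir (dual_atlas E)"

lemma coord_change_near:
  assumes c: "c \<in> base E" "c' \<in> base E" and x: "x \<in> fst c" "x \<in> fst c'"
  shows "smooth_near (base E) x (\<lambda>x. coord_frame base_dir (base E) c' \<beta> x (\<lambda>y. snd c y \<bullet> b))"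
proof (rule smooth_nearI)
  show o: "open_in (base E) (fst c \<inter> fst c')" by (intro open_in_Int open_in_chart c)
  show "smooth_fun (base E) (fst c \<inter> fst c') (\<lambda>x. coord_frame base_dir (base E) c' \<beta> x (\<lambda>y. snd c y \<bullet> b))"
    unfolding coord_frame_def
    by (rule partial_smooth[OF c(2) o _ smooth_fun_subset[OF smooth_fun_coord[OF c(1)]]]) auto
qed (use x in auto)

text \<open>With zero structure functions the transformation law says that the mixed second
  derivatives of the old coordinates in the new ones agree. The Greek transition coefficients are
  the first derivatives of the base coordinates, which do not vary along the fibres.\<close>

lemma tangent_split:
  "split_bundle TE (\<lambda>u w. w) (base E \<times> frames E) (\<lambda>(c, s). fst (dc c s)) (\<lambda>(c, s). cframe c s)
     (\<lambda>_ _ _ _ _. 0)"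
proof -
  interpret TE: framed_bundle TE by (rule dual.tangent_bundle_framed[OF basis_enum_total_dir])
  have Inl: "coeff (cframe c s) v (Inl \<tau>) (cframe c' s' (Inl \<beta>) v) =
      coord_frame base_dir (base E) c' \<beta> (fst v) (\<lambda>y. snd c y \<bullet> base_dir \<tau>)"
    if "c \<in> base E" "s \<in> frames E" "c' \<in> base E" "s' \<in> frames E" "v \<in> fst (dc c s)" "v \<in> fst (dc c' s')" for c s c' s' v \<tau> \<beta>
    using that coeff_cframe(1)[OF that(1,2,5) cframe_tangent[OF that(3,4,6)]]
      cframe_lift(1)[OF that(3,4,6) smooth_near_coord[OF that(1)]] by (simp add: dc_dom in_lift)
  have Inr: "coeff (cframe c s) v (Inr b) (cframe c' s' (Inr d) v) = cframe c' s' (Inr d) v (fcoord s b)"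
    if "c \<in> base E" "s \<in> frames E" "c' \<in> base E" "s' \<in> frames E" "v \<in> fst (dc c s)" "v \<in> fst (dc c' s')" for c s c' s' v b d
    using coeff_cframe(2)[OF that(1,2,5) cframe_tangent[OF that(3,4,6)]] .
  show ?thesis
  proof (unfold_locales, unfold dual.tangent_bundle_simps)
    show "frames TE = (\<lambda>i. (case i of (c, s) \<Rightarrow> fst (dc c s), case i of (c, s) \<Rightarrow> cframe c s)) ` (base E \<times> frames E)"
      unfolding dual.tangent_frames by (force simp: dual_atlas_def cframe_def image_iff)
    fix i j u and b :: 'e and \<alpha> :: 'm
    assume ij: "i \<in> base E \<times> frames E" "j \<in> base E \<times> frames E"
      and u: "u \<in> (case i of (c, s) \<Rightarrow> fst (dc c s))" "u \<in> (case j of (c, s) \<Rightarrow> fst (dc c s))"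
    obtain c s c' s' where e: "i = (c, s)" "j = (c', s')" "c \<in> base E" "s \<in> frames E" "c' \<in> base E" "s' \<in> frames E"
      using ij by (cases i; cases j) auto
    have u': "u \<in> fst (dc c s)" "u \<in> fst (dc c' s')" using u e by auto
    have x: "fst u \<in> fst c" "fst u \<in> fst c'" using u' by (auto simp: dc_dom in_lift)
    show "coeff (case i of (c, s) \<Rightarrow> cframe c s) u (Inl \<alpha>) ((case j of (c, s) \<Rightarrow> cframe c s) (Inr b) u) = 0"
      using coeff_cframe(1)[OF e(3,4) u'(1) cframe_tangent[OF e(5,6) u'(2)]]
        cframe_lift(2)[OF e(5,6) u'(2) smooth_near_coord[OF e(3) x(1)]] by (simp add: e)
    fix \<tau> \<beta> \<gamma> :: 'm and d f :: 'e
    have W: "open_in (dual_atlas E) (fst (dc c s) \<inter> fst (dc c' s'))" by (rule dc_Int_open[OF e(3-6)])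
    note M = cframe_basic[OF e(5,6) u'(2) W IntI[OF u'] Inl[OF e(3-6)] coord_change_near[OF e(3,5) x]]
    show "(\<Sum>\<theta>\<in>UNIV. 0 * coeff (case i of (c, s) \<Rightarrow> cframe c s) u (Inl \<tau>) ((case j of (c, s) \<Rightarrow> cframe c s) (Inl \<theta>) u)) =
      (\<Sum>\<mu>\<in>UNIV. \<Sum>\<nu>\<in>UNIV. coeff (case i of (c, s) \<Rightarrow> cframe c s) u (Inl \<mu>) ((case j of (c, s) \<Rightarrow> cframe c s) (Inl \<gamma>) u) *
         coeff (case i of (c, s) \<Rightarrow> cframe c s) u (Inl \<nu>) ((case j of (c, s) \<Rightarrow> cframe c s) (Inl \<beta>) u) * 0) +
      (case j of (c, s) \<Rightarrow> cframe c s) (Inl \<gamma>) u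
        (\<lambda>u. coeff (case i of (c, s) \<Rightarrow> cframe c s) u (Inl \<tau>) ((case j of (c, s) \<Rightarrow> cframe c s) (Inl \<beta>) u)) -
      (case j of (c, s) \<Rightarrow> cframe c s) (Inl \<beta>) u
        (\<lambda>u. coeff (case i of (c, s) \<Rightarrow> cframe c s) u (Inl \<tau>) ((case j of (c, s) \<Rightarrow> cframe c s) (Inl \<gamma>) u))"
    proof -
      have "cframe c' s' (Inl \<gamma>) u (\<lambda>u. coeff (cframe c s) u (Inl \<tau>) (cframe c' s' (Inl \<beta>) u)) =
          coord_frame base_dir (base E) c' \<gamma> (fst u) (\<lambda>x. coord_frame base_dir (base E) c' \<beta> x (\<lambda>y. snd c y \<bullet> base_dir \<tau>))"
        for \<gamma> \<beta> by (rule M(1)) auto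
      then show ?thesis
        using partial_commute[OF e(5) x(2) smooth_near_coord[OF e(3) x(1)]] by (simp add: e coord_frame_def)
    qed
    have "cframe c' s' (Inr d) u (\<lambda>u. coeff (cframe c s) u (Inl \<tau>) (cframe c' s' (Inl \<beta>) u)) = 0"
      by (rule M(2)) auto
    then show "(case j of (c, s) \<Rightarrow> cframe c s) (Inr d) u
        (\<lambda>u. coeff (case i of (c, s) \<Rightarrow> cframe c s) u (Inl \<tau>) ((case j of (c, s) \<Rightarrow> cframe c s) (Inl \<beta>) u)) = 0"
      by (simp add: e)
    have "cframe c' s' (Inr d) u (\<lambda>u. coeff (cframe c s) u (Inr b) (cframe c' s' (Inr f) u)) = 0"
      by (rule cframe_vertical_basic[OF e(3,5,4,6) u' W IntI[OF u'] subset_refl]) (auto intro: Inr e)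
    then show "(case j of (c, s) \<Rightarrow> cframe c s) (Inr d) u
        (\<lambda>u. coeff (case i of (c, s) \<Rightarrow> cframe c s) u (Inr b) ((case j of (c, s) \<Rightarrow> cframe c s) (Inr f) u)) = 0"
      by (simp add: e)
  next
    show "lin_on (tangent_space (dual_atlas E) u) (\<lambda>w. w f)" for u f
      by (simp add: lin_on_def scaleR_fun_def)
  qed (auto simp: dual.smooth_fun_const)
qed

lemma classical_structure_functions:
  assumes c: "c \<in> base E" and x: "x \<in> fst c"
  shows "struct_fun (lie_bracket (base E)) (coord_frame base_dir (base E) c) k i j x = 0"
proof -
  have "lie_bracket (base E) (coord_frame base_dir (base E) c i) (coord_frame base_dir (base E) c j) x = 0"
    using partial_commute[OF c x] by (auto simp: lie_bracket_def coord_frame_def fun_eq_iff)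
  then show ?thesis
    using lin_on_zero[OF coeff_lin_on[OF coord_frame_basis[OF basis_enum_base_dir c x]]
        basis_at_subspace[OF coord_frame_basis[OF basis_enum_base_dir c x]]]
    by (simp add: struct_fun_def)
qed

end

text \<open>Biorthogonality gives independence and reconstruction gives spanning. A frame is thus
  recognised from explicit candidates for its dual, without a prior dimension count.\<close>

lemma basis_at_dual:
  fixes s :: "'k::finite \<Rightarrow> 'p \<Rightarrow> 'w::real_vector"
  assumes V: "subspace V" and s: "\<And>k. s k x \<in> V" and lin: "\<And>k. lin_on V (\<kappa> k)"
    and dual: "\<And>j k. \<kappa> j (s k x) = (if j = k then 1 else 0)"
    and exp: "\<And>w. w \<in> V \<Longrightarrow> (\<Sum>k\<in>UNIV. \<kappa> k w *\<^sub>R s k x) = w"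
  shows "basis_at s x V" and "w \<in> V \<Longrightarrow> coeff s x k w = \<kappa> k w"
proof -
  show b: "basis_at s x V"
  proof (rule basis_atI)
    show "span (range (\<lambda>k. s k x)) = V"
    proof
      show "span (range (\<lambda>k. s k x)) \<subseteq> V" using s by (intro span_minimal V) auto
      show "V \<subseteq> span (range (\<lambda>k. s k x))"
      proof
        fix w assume "w \<in> V"
        from exp[OF this, symmetric] show "w \<in> span (range (\<lambda>k. s k x))"
          by (rule ssubst) (intro span_sum span_scale span_base, auto)
      qed
    qed
    fix c k assume "(\<Sum>k\<in>UNIV. c k *\<^sub>R s k x) = 0"
    then have "\<kappa> k (\<Sum>j\<in>UNIV. c j *\<^sub>R s j x) = 0" using lin_on_zero[OF lin V] by simp
    then show "c k = 0"
      using s V by (subst (asm) lin_on_sum[OF lin V])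
        (auto simp: subspace_scale lin_on_scale[OF lin] dual if_distrib[of "(*) _"] cong: if_cong)
  qed
  assume w: "w \<in> V"
  show "coeff s x k w = \<kappa> k w"
    using coeff_lincomb[OF b, of k "\<lambda>k. \<kappa> k w"] by (simp add: exp[OF w])
qed

lemma scaleR_apply: "(r *\<^sub>R f) x = r *\<^sub>R f x" for f :: "'x \<Rightarrow> 'y::real_vector"
  by (simp add: scaleR_fun_def)

section \<open>The generalized tangent bundle\<close>

text \<open>The part of the theory that is governed by the anchor alone. It is instantiated by a Lie
  algebroid and also by the tangent bundle of the base with the identity as anchor.\<close>

locale anchored_bundle = dual_bundle E
  for E :: "('p, real^'m::finite, 'w::real_vector, 'e::finite) vbundle" +
  fixes F :: "('p, real^'m, 'f::real_vector, 'k::finite) vbundle"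
    and \<rho> :: "'p \<Rightarrow> 'f \<Rightarrow> ('p \<Rightarrow> real) \<Rightarrow> real"
  assumes F: "framed_bundle F" and base_F: "base F = base E"
    and morphism: "bundle_morphism F (tangent_bundle base_dir (base E)) \<rho>"
begin

abbreviation GT where "GT \<equiv> gen_tangent F \<rho> E"
abbreviation gt where "gt c t s \<equiv> gt_frame \<rho> E c t s"

lemma tF:
  assumes "t \<in> frames F"
  shows tF_open: "open_in (base E) (fst t)"
    and tF_basis: "x \<in> fst t \<Longrightarrow> basis_at (snd t) x (fibre F x)"
    and tF_smooth: "t' \<in> frames F \<Longrightarrow> smooth_fun (base E) (fst t \<inter> fst t') (\<lambda>x. coeff (snd t) x j (snd t' k x))"
    and tF_section: "smooth_section F (fst t) (snd t k)"
  using framed_bundle.frame_open[OF F, of "fst t" "snd t"] framed_bundle.frame_basis[OF F, of "fst t" "snd t"]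
    framed_bundle.frame_smooth[OF F, of "fst t" "snd t" "fst t'" "snd t'"]
    framed_bundle.frame_section[OF F, of "fst t" "snd t"] assms
  by (simp_all add: base_F)

lemma point_tF: "x \<in> points (base E) \<Longrightarrow> \<exists>t\<in>frames F. x \<in> fst t"
  using framed_bundle.frames_cover[OF F] by (auto simp: base_F)

lemma rho_tangent: "x \<in> points (base E) \<Longrightarrow> v \<in> fibre F x \<Longrightarrow> \<rho> x v \<in> tangent_space (base E) x"
  using morphism by (simp add: bundle_morphism_def base_F)

lemma rho_lin: "x \<in> points (base E) \<Longrightarrow> lin_on (fibre F x) (\<rho> x)"
  using morphism by (simp add: bundle_morphism_def base_F lin_on_def)

text \<open>The local components rho^i_alpha of the anchor.\<close>

definition rc where "rc c t i \<alpha> x = coeff (coord_frame base_dir (base E) c) x i (\<rho> x (snd t \<alpha> x))"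

lemma rc_smooth:
  assumes c: "c \<in> base E" and t: "t \<in> frames F"
  shows "smooth_fun (base E) (fst c \<inter> fst t) (rc c t i \<alpha>)"
proof -
  have "smooth_section (tangent_bundle base_dir (base E)) (fst t) (\<lambda>x. \<rho> x (snd t \<alpha> x))"
    using morphism tF_open[OF t] tF_section[OF t] by (simp add: bundle_morphism_def base_F)
  moreover have "(fst c, coord_frame base_dir (base E) c) \<in> frames (tangent_bundle base_dir (base E))"
    using c by (simp add: tangent_frames)
  ultimately show ?thesis by (auto simp: smooth_section_def rc_def[abs_def])
qed

lemma gt_dom_lift: "gt_dom E c t s = lift (fst c \<inter> fst t \<inter> fst s)"
  by (simp add: gt_dom_def lift_def)

lemma gt_Inl: "gt c t s (Inl \<alpha>) u = (snd t \<alpha> (fst u), \<Sum>i\<in>UNIV. rc c t i \<alpha> (fst u) *\<^sub>R cframe c s (Inl i) u)"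
  and gt_Inr: "gt c t s (Inr b) u = (0, cframe c s (Inr b) u)"
  by (simp_all add: gt_frame_def split_beta rc_def cframe_def)

text \<open>A description of the fibre without frames: the pairs of Z and Y for which the projection
  of Y to the base is the image of Z under the anchor, that is, the fibre product over the tangent
  bundle of the base. It shows that the spans of the various frames coincide.\<close>

definition gtf where "gtf u = {(Z, Y). Z \<in> fibre F (fst u) \<and> Y \<in> tangent_space (dual_atlas E) u \<and>
   (\<forall>f. smooth_near (base E) (fst u) f \<longrightarrow> Y (\<lambda>v. f (fst v)) = \<rho> (fst u) Z f)}"

lemma gtf_iff: "w \<in> gtf u \<longleftrightarrow> fst w \<in> fibre F (fst u) \<and> snd w \<in> tangent_space (dual_atlas E) u \<and>
   (\<forall>f. smooth_near (base E) (fst u) f \<longrightarrow> snd w (\<lambda>v. f (fst v)) = \<rho> (fst u) (fst w) f)"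
  by (cases w) (simp add: gtf_def)

text \<open>The dual functionals are the coefficients of Z and the values of Y on the fibre
  coordinates. They determine the pair, since the components of Y along the base are prescribed by
  Z.\<close>

lemma gt_basis_coeff:
  assumes c: "c \<in> base E" and t: "t \<in> frames F" and s: "s \<in> frames E" and u: "u \<in> gt_dom E c t s"
  shows gt_basis: "basis_at (gt c t s) u (gtf u)"
    and coeff_gt: "w \<in> gtf u \<Longrightarrow> coeff (gt c t s) u k w =
      (case k of Inl \<alpha> \<Rightarrow> coeff (snd t) (fst u) \<alpha> (fst w) | Inr b \<Rightarrow> snd w (fcoord s b))"
proof -
  let ?x = "fst u"
  have x: "?x \<in> fst c" "?x \<in> fst t" "?x \<in> fst s" and ud: "u \<in> fst (dc c s)"
    using u by (auto simp: gt_dom_lift in_lift dc_dom)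
  have pt: "?x \<in> points (base E)" using open_in_subset_points[OF open_in_chart[OF c]] x by blast
  have ud': "u \<in> points (dual_atlas E)" using dual.open_in_subset_points[OF dual.open_in_chart[OF dc_in[OF c s]]] ud by blast
  note tb = tF_basis[OF t x(2)] and cb = cframe_basis[OF c s ud] and T = dual.subspace_tangent_space[OF ud']
    and mb = coord_frame_basis[OF basis_enum_base_dir c x(1)]
  note FS = basis_at_subspace[OF tb] and r = rho_lin[OF pt]
  have r0: "\<rho> ?x 0 = 0" by (rule lin_on_zero[OF r FS])
  have \<rho>rc: "\<rho> ?x (snd t \<alpha> ?x) = (\<Sum>i\<in>UNIV. rc c t i \<alpha> ?x *\<^sub>R coord_frame base_dir (base E) c i ?x)" for \<alpha>
    using coeff_expand[OF mb rho_tangent[OF pt basis_at_in[OF tb]]] by (simp add: rc_def)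
  have sub: "subspace (gtf u)"
    unfolding subspace_def
  proof (intro conjI ballI allI)
    show "0 \<in> gtf u" using subspace_0[OF FS] subspace_0[OF T] r0 by (simp add: gtf_iff)
    show "v + w \<in> gtf u" if "v \<in> gtf u" "w \<in> gtf u" for v w
      using that by (simp add: gtf_iff subspace_add[OF FS] subspace_add[OF T] lin_on_add[OF r])
    show "k *\<^sub>R v \<in> gtf u" if "v \<in> gtf u" for k v
      using that by (simp add: gtf_iff subspace_scale[OF FS] subspace_scale[OF T] lin_on_scale[OF r] scaleR_apply)
  qed
  have cf: "cframe c s k u (fcoord s b) = (if k = Inr b then 1 else 0)" for k b
    using coeff_cframe(2)[OF c s ud cframe_tangent[OF c s ud, of k], of b] coeff_basis[OF cb, of "Inr b" k] by auto
  have mem: "gt c t s k u \<in> gtf u" for k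
  proof (cases k)
    case (Inl \<alpha>)
    have "(\<Sum>i\<in>UNIV. rc c t i \<alpha> ?x *\<^sub>R cframe c s (Inl i) u) \<in> tangent_space (dual_atlas E) u"
      by (intro subspace_sum[OF T] subspace_scale[OF T] cframe_tangent c s ud)
    then show ?thesis
      using basis_at_in[OF tb]
      by (simp add: Inl gt_Inl gtf_iff sum_apply scaleR_fun_def cframe_lift(1)[OF c s ud] \<rho>rc)
  next
    case (Inr b)
    then show ?thesis
      using cframe_tangent[OF c s ud] subspace_0[OF FS]
      by (simp add: gt_Inr gtf_iff cframe_lift(2)[OF c s ud] r0)
  qed
  define \<kappa> where "\<kappa> = (\<lambda>k w. case k of Inl \<alpha> \<Rightarrow> coeff (snd t) ?x \<alpha> (fst w) | Inr b \<Rightarrow> snd w (fcoord s b))"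
  have lin: "lin_on (gtf u) (\<kappa> k)" for k
    by (cases k) (auto simp: \<kappa>_def lin_on_def gtf_iff scaleR_fun_def
        lin_on_add[OF coeff_lin_on[OF tb]] lin_on_scale[OF coeff_lin_on[OF tb]])
  have dual: "\<kappa> j (gt c t s k u) = (if j = k then 1 else 0)" for j k
    using lin_on_zero[OF coeff_lin_on[OF tb] FS]
    by (cases j; cases k) (auto simp: \<kappa>_def gt_Inl gt_Inr coeff_basis[OF tb] cf sum_apply scaleR_fun_def)
  have exp: "(\<Sum>k\<in>UNIV. \<kappa> k w *\<^sub>R gt c t s k u) = w" if w: "w \<in> gtf u" for w
  proof (rule prod_eqI)
    have w': "fst w \<in> fibre F ?x" "snd w \<in> tangent_space (dual_atlas E) u"
      and wf: "\<And>f. smooth_near (base E) ?x f \<Longrightarrow> snd w (\<lambda>v. f (fst v)) = \<rho> ?x (fst w) f"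
      using w by (auto simp: gtf_iff)
    show "fst (\<Sum>k\<in>UNIV. \<kappa> k w *\<^sub>R gt c t s k u) = fst w"
      using coeff_expand[OF tb w'(1)] by (simp add: sum_Plus_UNIV fst_sum gt_Inl gt_Inr \<kappa>_def)
    \<comment> \<open>The components of Y along the base are found by testing the compatibility
      condition on the coordinate functions of the chart.\<close>
    have "coeff (cframe c s) u (Inl i) (snd w) = (\<Sum>\<alpha>\<in>UNIV. coeff (snd t) ?x \<alpha> (fst w) * rc c t i \<alpha> ?x)" for i
    proof -
      have near: "smooth_near (base E) ?x (\<lambda>y. snd c y \<bullet> base_dir i)" by (rule smooth_near_coord[OF c x(1)])
      have "coeff (cframe c s) u (Inl i) (snd w) = \<rho> ?x (fst w) (\<lambda>y. snd c y \<bullet> base_dir i)"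
        using coeff_cframe(1)[OF c s ud w'(2)] wf[OF near] by simp
      also have "\<dots> = coeff (coord_frame base_dir (base E) c) ?x i (\<rho> ?x (fst w))"
        by (rule coeff_coord_frame[OF basis_enum_base_dir c x(1) rho_tangent[OF pt w'(1)], symmetric])
      also have "\<dots> = (\<Sum>\<alpha>\<in>UNIV. coeff (snd t) ?x \<alpha> (fst w) * rc c t i \<alpha> ?x)"
      proof -
        have "lin_on (fibre F ?x) (\<lambda>v. coeff (coord_frame base_dir (base E) c) ?x i (\<rho> ?x v))"
          using r coeff_lin_on[OF mb] rho_tangent[OF pt] by (auto simp: lin_on_def)
        from lin_on_expand[OF tb this w'(1)] show ?thesis by (simp add: rc_def)
      qed
      finally show ?thesis .
    qed
    then have "snd w = (\<Sum>i\<in>UNIV. (\<Sum>\<alpha>\<in>UNIV. coeff (snd t) ?x \<alpha> (fst w) * rc c t i \<alpha> ?x) *\<^sub>R cframe c s (Inl i) u) +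
        (\<Sum>b\<in>UNIV. snd w (fcoord s b) *\<^sub>R cframe c s (Inr b) u)"
      using coeff_expand[OF cb w'(2)] coeff_cframe(2)[OF c s ud w'(2)] by (simp add: sum_Plus_UNIV)
    also have "(\<Sum>i\<in>UNIV. (\<Sum>\<alpha>\<in>UNIV. coeff (snd t) ?x \<alpha> (fst w) * rc c t i \<alpha> ?x) *\<^sub>R cframe c s (Inl i) u) =
        (\<Sum>\<alpha>\<in>UNIV. coeff (snd t) ?x \<alpha> (fst w) *\<^sub>R (\<Sum>i\<in>UNIV. rc c t i \<alpha> ?x *\<^sub>R cframe c s (Inl i) u))"
      unfolding scaleR_sum_left scaleR_sum_right scaleR_scaleR by (rule sum.swap)
    also have "(\<Sum>\<alpha>\<in>UNIV. coeff (snd t) ?x \<alpha> (fst w) *\<^sub>R (\<Sum>i\<in>UNIV. rc c t i \<alpha> ?x *\<^sub>R cframe c s (Inl i) u)) +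
        (\<Sum>b\<in>UNIV. snd w (fcoord s b) *\<^sub>R cframe c s (Inr b) u) = snd (\<Sum>k\<in>UNIV. \<kappa> k w *\<^sub>R gt c t s k u)"
      by (simp add: sum_Plus_UNIV snd_sum gt_Inl gt_Inr \<kappa>_def)
    finally show "snd (\<Sum>k\<in>UNIV. \<kappa> k w *\<^sub>R gt c t s k u) = snd w" by (rule sym)
  qed
  show "basis_at (gt c t s) u (gtf u)" by (rule basis_at_dual(1)[where s = "gt c t s" and x = u, OF sub mem lin dual exp])
  show "w \<in> gtf u \<Longrightarrow> coeff (gt c t s) u k w =
      (case k of Inl \<alpha> \<Rightarrow> coeff (snd t) (fst u) \<alpha> (fst w) | Inr b \<Rightarrow> snd w (fcoord s b))"
    using basis_at_dual(2)[where s = "gt c t s" and x = u, OF sub mem lin dual exp] by (simp add: \<kappa>_def)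
qed

lemma gt_in: "c \<in> base E \<Longrightarrow> t \<in> frames F \<Longrightarrow> s \<in> frames E \<Longrightarrow> u \<in> gt_dom E c t s \<Longrightarrow> gt c t s k u \<in> gtf u"
  using basis_at_in[OF gt_basis] .

lemma gt_dom_open: "c \<in> base E \<Longrightarrow> t \<in> frames F \<Longrightarrow> s \<in> frames E \<Longrightarrow> open_in (dual_atlas E) (gt_dom E c t s)"
  unfolding gt_dom_lift by (intro lift_open open_in_Int open_in_chart tF_open sE_open)

lemma point_gt_dom:
  assumes "u \<in> points (dual_atlas E)"
  obtains c t s where "c \<in> base E" "t \<in> frames F" "s \<in> frames E" "u \<in> gt_dom E c t s"
proof -
  have x: "fst u \<in> points (base E)" "snd u \<in> dual_space (fibre E (fst u))" using assms by (auto simp: dual_points in_lift)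
  obtain c where c: "c \<in> base E" "fst u \<in> fst c" using points_chart[OF x(1)] by blast
  obtain t where t: "t \<in> frames F" "fst u \<in> fst t" using point_tF[OF x(1)] by blast
  obtain s where s: "s \<in> frames E" "fst u \<in> fst s" using point_sE[OF x(1)] by blast
  show thesis using c t s x(2) by (intro that[of c t s]) (auto simp: gt_dom_lift in_lift)
qed

lemma GT_base [simp]: "base GT = dual_atlas E"
  by (simp add: gen_tangent_def)

lemma GT_fibre: assumes "u \<in> points (dual_atlas E)" shows "fibre GT u = gtf u"
proof (intro equalityI subsetI)
  have eq: "fibre GT u = \<Union> {span (range (\<lambda>k. gt c t s k u)) |c t s.
      c \<in> base E \<and> t \<in> frames F \<and> s \<in> frames E \<and> u \<in> gt_dom E c t s}" by (simp add: gen_tangent_def)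
  have sp: "span (range (\<lambda>k. gt c t s k u)) = gtf u"
    if "c \<in> base E" "t \<in> frames F" "s \<in> frames E" "u \<in> gt_dom E c t s" for c t s
    using gt_basis[OF that] by (simp add: basis_at_def)
  {
    fix w assume "w \<in> fibre GT u"
    then obtain c t s where "w \<in> span (range (\<lambda>k. gt c t s k u))" "c \<in> base E" "t \<in> frames F" "s \<in> frames E" "u \<in> gt_dom E c t s"
      unfolding eq by blast
    then show "w \<in> gtf u" using sp by simp
  next
    fix w assume w: "w \<in> gtf u"
    obtain c t s where cts: "c \<in> base E" "t \<in> frames F" "s \<in> frames E" "u \<in> gt_dom E c t s"
      using assms by (rule point_gt_dom)
    have "w \<in> span (range (\<lambda>k. gt c t s k u))" unfolding sp[OF cts] by (rule w)
    then show "w \<in> fibre GT u" unfolding eq using cts by blast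
  }
qed

lemma GT_frames: "frames GT = (\<lambda>(c, t, s). (gt_dom E c t s, gt c t s)) ` (base E \<times> frames F \<times> frames E)"
proof (intro equalityI subsetI)
  fix p assume "p \<in> frames GT"
  then obtain c t s where "p = (gt_dom E c t s, gt c t s)" "c \<in> base E" "t \<in> frames F" "s \<in> frames E"
    unfolding gen_tangent_def vbundle.simps by blast
  then show "p \<in> (\<lambda>(c, t, s). (gt_dom E c t s, gt c t s)) ` (base E \<times> frames F \<times> frames E)"
    by (intro image_eqI[of _ _ "(c, t, s)"]) auto
next
  fix p assume "p \<in> (\<lambda>(c, t, s). (gt_dom E c t s, gt c t s)) ` (base E \<times> frames F \<times> frames E)"
  then obtain i where i: "p = (case i of (c, t, s) \<Rightarrow> (gt_dom E c t s, gt c t s))" "i \<in> base E \<times> frames F \<times> frames E"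
    by (rule imageE)
  obtain c t s where "i = (c, t, s)" by (rule prod_cases3)
  with i have "p = (gt_dom E c t s, gt c t s) \<and> c \<in> base E \<and> t \<in> frames F \<and> s \<in> frames E" by simp
  then show "p \<in> frames GT" unfolding gen_tangent_def vbundle.simps by blast
qed

lemma gt_dom_dc: "u \<in> gt_dom E c t s \<Longrightarrow> u \<in> fst (dc c s)"
  by (auto simp: gt_dom_lift dc_dom in_lift)

lemma gt_dom_points:
  "c \<in> base E \<Longrightarrow> t \<in> frames F \<Longrightarrow> s \<in> frames E \<Longrightarrow> u \<in> gt_dom E c t s \<Longrightarrow> u \<in> points (dual_atlas E)"
  using dual.open_in_subset_points[OF gt_dom_open] by blast

lemma snd_gt_smooth:
  assumes c: "c \<in> base E" and t: "t \<in> frames F" and s: "s \<in> frames E"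
    and W: "open_in (dual_atlas E) W" "W \<subseteq> gt_dom E c t s" and f: "smooth_fun (dual_atlas E) W f"
  shows "smooth_fun (dual_atlas E) W (\<lambda>u. snd (gt c t s k u) f)"
proof -
  have Wd: "W \<subseteq> fst (dc c s)" using W gt_dom_dc by blast
  have cf: "smooth_fun (dual_atlas E) W (\<lambda>u. cframe c s k u f)" for k
    by (rule cframe_smooth[OF c s W(1) Wd f])
  have o: "open_in (base E) (fst c \<inter> fst t)" by (intro open_in_Int open_in_chart tF_open c t)
  have r: "smooth_fun (dual_atlas E) W (\<lambda>u. rc c t i \<alpha> (fst u))" for i \<alpha>
    by (rule dual.smooth_fun_subset[OF lift_smooth[OF o rc_smooth[OF c t]]])
       (use W in \<open>auto simp: gt_dom_lift in_lift\<close>)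
  show ?thesis
  proof (cases k)
    case (Inl \<alpha>)
    have "smooth_fun (dual_atlas E) W (\<lambda>u. \<Sum>i\<in>UNIV. rc c t i \<alpha> (fst u) * cframe c s (Inl i) u f)"
      by (intro dual.smooth_fun_sum dual.smooth_fun_mult W r cf)
    then show ?thesis by (simp add: Inl gt_Inl sum_apply scaleR_fun_def)
  qed (simp add: gt_Inr cf)
qed

lemma coeff_gt_smooth:
  assumes c: "c \<in> base E" and t: "t \<in> frames F" and s: "s \<in> frames E"
    and c': "c' \<in> base E" and t': "t' \<in> frames F" and s': "s' \<in> frames E"
  shows "smooth_fun (dual_atlas E) (gt_dom E c t s \<inter> gt_dom E c' t' s') (\<lambda>u. coeff (gt c t s) u j (gt c' t' s' k u))"
proof -
  let ?W = "gt_dom E c t s \<inter> gt_dom E c' t' s'"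
  have W: "open_in (dual_atlas E) ?W" by (intro dual.open_in_Int gt_dom_open assms)
  have co: "coeff (gt c t s) u j (gt c' t' s' k u) =
      (case j of Inl \<alpha> \<Rightarrow> coeff (snd t) (fst u) \<alpha> (fst (gt c' t' s' k u)) | Inr b \<Rightarrow> snd (gt c' t' s' k u) (fcoord s b))"
    if "u \<in> ?W" for u j k
    using that by (intro coeff_gt[OF c t s] gt_in[OF c' t' s']) auto
  have "smooth_fun (dual_atlas E) ?W (\<lambda>u. case j of Inl \<alpha> \<Rightarrow> coeff (snd t) (fst u) \<alpha> (fst (gt c' t' s' k u))
      | Inr b \<Rightarrow> snd (gt c' t' s' k u) (fcoord s b))"
  proof (cases j)
    case (Inr b)
    have "smooth_fun (dual_atlas E) ?W (fcoord s b)"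
      by (rule dual.smooth_fun_subset[OF fcoord_smooth[OF s]]) (auto simp: gt_dom_lift in_lift)
    then show ?thesis using snd_gt_smooth[OF c' t' s' W _ , of "fcoord s b" k] by (simp add: Inr)
  next
    case j: (Inl \<alpha>)
    show ?thesis
    proof (cases k)
      case (Inl \<beta>)
      have o: "open_in (base E) (fst t \<inter> fst t')" by (intro open_in_Int tF_open t t')
      have "smooth_fun (dual_atlas E) ?W (\<lambda>u. coeff (snd t) (fst u) \<alpha> (snd t' \<beta> (fst u)))"
        by (rule dual.smooth_fun_subset[OF lift_smooth[OF o tF_smooth[OF t t']]]) (auto simp: gt_dom_lift in_lift)
      then show ?thesis by (simp add: j Inl gt_Inl)
    next
      case (Inr d)
      have "coeff (snd t) (fst u) \<alpha> 0 = 0" if "u \<in> ?W" for u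
        using that lin_on_zero[OF coeff_lin_on[OF tF_basis[OF t]] basis_at_subspace[OF tF_basis[OF t]], of "fst u" \<alpha>]
        by (auto simp: gt_dom_lift in_lift)
      then show ?thesis
        using dual.smooth_fun_cong[OF W, of "\<lambda>u. 0" "\<lambda>u. coeff (snd t) (fst u) \<alpha> 0"]
        by (simp add: j Inr gt_Inr dual.smooth_fun_const)
    qed
  qed
  then show ?thesis
    by (rule dual.smooth_fun_cong[OF W, rotated]) (rule co[symmetric])
qed

lemma GT_framed: "framed_bundle GT"
proof (unfold_locales, unfold GT_base)
  show "smooth_atlas (dual_atlas E)" by (rule dual_atlas_smooth)
  show "\<Union> (fst ` frames GT) = points (dual_atlas E)"
  proof (intro equalityI subsetI)
    fix u assume "u \<in> points (dual_atlas E)"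
    then obtain c t s where "c \<in> base E" "t \<in> frames F" "s \<in> frames E" "u \<in> gt_dom E c t s"
      by (rule point_gt_dom)
    then show "u \<in> \<Union> (fst ` frames GT)" unfolding GT_frames by force
  qed (auto simp: GT_frames intro: gt_dom_points)
  fix U s V t j k u assume U: "(U, s) \<in> frames GT"
  then obtain c1 t1 s1 where 1: "U = gt_dom E c1 t1 s1" "s = gt c1 t1 s1" "c1 \<in> base E" "t1 \<in> frames F" "s1 \<in> frames E"
    unfolding GT_frames by auto
  show "open_in (dual_atlas E) U" unfolding 1(1) by (rule gt_dom_open[OF 1(3-5)])
  show "basis_at s u (fibre GT u)" if "u \<in> U"
  proof -
    have u: "u \<in> gt_dom E c1 t1 s1" using that 1 by simp
    show ?thesis
      unfolding 1(2) GT_fibre[OF gt_dom_points[OF 1(3-5) u]] by (rule gt_basis[OF 1(3-5) u])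
  qed
  assume "(V, t) \<in> frames GT"
  then obtain c2 t2 s2 where 2: "V = gt_dom E c2 t2 s2" "t = gt c2 t2 s2" "c2 \<in> base E" "t2 \<in> frames F" "s2 \<in> frames E"
    unfolding GT_frames by auto
  show "smooth_fun (dual_atlas E) (U \<inter> V) (\<lambda>x. coeff s x j (t k x))"
    unfolding 1(1,2) 2(1,2) by (rule coeff_gt_smooth[OF 1(3-5) 2(3-5)])
qed

end

section \<open>Structure functions of a Lie algebroid under a change of frame, and the first
  instance\<close>

locale dual_algebroid = dual_bundle E
  for E :: "('p, real^'m::finite, 'w::real_vector, 'e::finite) vbundle" +
  fixes F :: "('p, real^'m, 'f::real_vector, 'k::finite) vbundle"
    and br :: "('p \<Rightarrow> 'f) \<Rightarrow> ('p \<Rightarrow> 'f) \<Rightarrow> 'p \<Rightarrow> 'f"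
    and \<rho> :: "'p \<Rightarrow> 'f \<Rightarrow> ('p \<Rightarrow> real) \<Rightarrow> real"
  assumes algebroid: "lie_algebroid F br \<rho>" and base_E: "base F = base E"

sublocale dual_algebroid \<subseteq> anchored_bundle E F \<rho>
proof (intro anchored_bundle.intro anchored_bundle_axioms.intro dual_bundle_axioms base_E)
  show "framed_bundle F"
    using algebroid unfolding lie_algebroid_def by (intro vector_bundle_framed) (rule conjunct1)
  show "bundle_morphism F (tangent_bundle base_dir (base E)) \<rho>"
    using algebroid unfolding lie_algebroid_def base_E by (rule conjunct1[OF conjunct2])
qed

context dual_algebroid
begin

lemma
  assumes W: "open_in (base E) W" and X: "smooth_section F W X" and Y: "smooth_section F W Y"
  shows br_section: "smooth_section F W (br X Y)"
    and br_cong: "\<And>X' Y' x. (\<And>x. x \<in> W \<Longrightarrow> X' x = X x) \<Longrightarrow> (\<And>x. x \<in> W \<Longrightarrow> Y' x = Y x) \<Longrightarrow> x \<in> W \<Longrightarrow> br X' Y' x = br X Y x"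
    and br_anti: "\<And>x. x \<in> W \<Longrightarrow> br X Y x = - br Y X x"
    and br_scale: "\<And>f x. smooth_fun (base E) W f \<Longrightarrow> x \<in> W \<Longrightarrow>
      br X (\<lambda>y. f y *\<^sub>R Y y) x = f x *\<^sub>R br X Y x + \<rho> x (X x) f *\<^sub>R Y x"
    and br_add: "\<And>Z x. smooth_section F W Z \<Longrightarrow> x \<in> W \<Longrightarrow> br X (\<lambda>y. Y y + Z y) x = br X Y x + br X Z x"
proof -
  have "(\<forall>X Y. smooth_section F W X \<and> smooth_section F W Y \<longrightarrow>
         smooth_section F W (br X Y) \<and>
         (\<forall>X' Y'. (\<forall>x\<in>W. X' x = X x \<and> Y' x = Y x) \<longrightarrow> (\<forall>x\<in>W. br X' Y' x = br X Y x)) \<and>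
         (\<forall>x\<in>W. br X Y x = - br Y X x) \<and>
         (\<forall>f. smooth_fun (base F) W f \<longrightarrow>
            (\<forall>x\<in>W. br X (\<lambda>y. f y *\<^sub>R Y y) x = f x *\<^sub>R br X Y x + \<rho> x (X x) f *\<^sub>R Y x) \<and>
            (\<forall>x\<in>W. \<rho> x (br X Y x) f =
               \<rho> x (X x) (\<lambda>y. \<rho> y (Y y) f) - \<rho> x (Y x) (\<lambda>y. \<rho> y (X y) f)))) \<and>
      (\<forall>X Y Z. smooth_section F W X \<and> smooth_section F W Y \<and> smooth_section F W Z \<longrightarrow>
         (\<forall>x\<in>W. br X (\<lambda>y. Y y + Z y) x = br X Y x + br X Z x) \<and>
         (\<forall>x\<in>W. br X (br Y Z) x + br Y (br Z X) x + br Z (br X Y) x = 0))"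
    by (rule algebroid[unfolded lie_algebroid_def, THEN conjunct2, THEN conjunct2, THEN spec, THEN mp, OF W[folded base_E]])
  note 1 = this[THEN conjunct1, THEN spec, THEN spec, THEN mp, OF conjI[OF X Y]]
    and 2 = this[THEN conjunct2, THEN spec, THEN spec, THEN spec, THEN mp, OF conjI[OF X conjI[OF Y]], THEN conjunct1]
  show "smooth_section F W (br X Y)" by (rule 1[THEN conjunct1])
  show "br X' Y' x = br X Y x" if "\<And>x. x \<in> W \<Longrightarrow> X' x = X x" "\<And>x. x \<in> W \<Longrightarrow> Y' x = Y x" "x \<in> W" for X' Y' x
    by (rule 1[THEN conjunct2, THEN conjunct1, THEN spec, THEN spec, THEN mp, THEN bspec]) (simp_all add: that)
  show "br X Y x = - br Y X x" if "x \<in> W" for x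
    by (rule 1[THEN conjunct2, THEN conjunct2, THEN conjunct1, THEN bspec, OF that])
  show "br X (\<lambda>y. f y *\<^sub>R Y y) x = f x *\<^sub>R br X Y x + \<rho> x (X x) f *\<^sub>R Y x"
    if "smooth_fun (base E) W f" "x \<in> W" for f x
    by (rule 1[THEN conjunct2, THEN conjunct2, THEN conjunct2, THEN spec, THEN mp, THEN conjunct1, THEN bspec])
       (simp_all add: that base_E)
  show "br X (\<lambda>y. Y y + Z y) x = br X Y x + br X Z x" if "smooth_section F W Z" "x \<in> W" for Z x
    by (rule 2[OF that(1), THEN bspec, OF that(2)])
qed

lemma br_sum:
  assumes W: "open_in (base E) W" and X: "smooth_section F W X" and Y: "\<And>k. smooth_section F W (Y k)"
    and f: "\<And>k. smooth_fun (base E) W (f k)" and x: "x \<in> W"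
  shows "br X (\<lambda>y. \<Sum>k\<in>I. f k y *\<^sub>R Y k y) x = (\<Sum>k\<in>I. f k x *\<^sub>R br X (Y k) x + \<rho> x (X x) (f k) *\<^sub>R Y k x)"
proof -
  interpret F: framed_bundle F by (rule F)
  have W': "open_in (base F) W" using W by (simp add: base_E)
  have f': "smooth_fun (base F) W (f k)" for k using f by (simp add: base_E)
  show ?thesis
  proof (induction I rule: infinite_finite_induct)
    case (insert k I)
    have "br X (\<lambda>y. f k y *\<^sub>R Y k y + (\<Sum>k\<in>I. f k y *\<^sub>R Y k y)) x =
       br X (\<lambda>y. f k y *\<^sub>R Y k y) x + br X (\<lambda>y. \<Sum>k\<in>I. f k y *\<^sub>R Y k y) x"
      by (intro br_add[OF W X _ _ x] F.section_sum F.section_scale W' f' Y)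
    then show ?case using insert br_scale[OF W X Y f x] by simp
  qed (use br_add[OF W X F.section_zero[OF W'] F.section_zero[OF W'] x] in simp_all)
qed

lemma struct_fun_smooth:
  assumes "t \<in> frames F" shows "smooth_fun (base E) (fst t) (struct_fun br (snd t) \<theta> \<gamma> \<beta>)"
proof -
  have "smooth_section F (fst t) (br (snd t \<gamma>) (snd t \<beta>))"
    by (intro br_section tF_open tF_section assms)
  from framed_bundle.section_coeff[OF F this, of "fst t" "snd t" \<theta>] show ?thesis
    using assms by (simp add: struct_fun_def[abs_def] base_E)
qed

lemma struct_fun_anti:
  assumes t: "t \<in> frames F" "x \<in> fst t"
  shows "struct_fun br (snd t) \<theta> \<gamma> \<beta> x = - struct_fun br (snd t) \<theta> \<beta> \<gamma> x"
proof -
  have "br (snd t \<beta>) (snd t \<gamma>) x \<in> fibre F x"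
    using framed_bundle.sectionD[OF F br_section[OF tF_open tF_section tF_section] t(2)] t by blast
  from lin_on_scale[OF coeff_lin_on[OF tF_basis[OF t]] this, of \<theta> "-1"] show ?thesis
    unfolding struct_fun_def br_anti[OF tF_open[OF t(1)] tF_section[OF t(1)] tF_section[OF t(1)] t(2), of \<gamma> \<beta>] by simp
qed

text \<open>The new frame is expanded in the old one and the Leibniz rule is applied in both
  arguments of the bracket; the two derivative terms are its inhomogeneous parts.\<close>

lemma struct_fun_change:
  assumes t: "t \<in> frames F" "x \<in> fst t" and t': "t' \<in> frames F" "x \<in> fst t'"
  defines "M \<equiv> \<lambda>\<tau> \<beta> x. coeff (snd t) x \<tau> (snd t' \<beta> x)"
  shows "(\<Sum>\<theta>\<in>UNIV. struct_fun br (snd t') \<theta> \<gamma> \<beta> x * M \<tau> \<theta> x) =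
      (\<Sum>\<mu>\<in>UNIV. \<Sum>\<nu>\<in>UNIV. M \<mu> \<gamma> x * M \<nu> \<beta> x * struct_fun br (snd t) \<tau> \<mu> \<nu> x) +
      \<rho> x (snd t' \<gamma> x) (M \<tau> \<beta>) - \<rho> x (snd t' \<beta> x) (M \<tau> \<gamma>)"
proof -
  interpret F: framed_bundle F by (rule F)
  let ?W = "fst t \<inter> fst t'"
  have W: "open_in (base E) ?W" by (intro open_in_Int tF_open t t')
  have xW: "x \<in> ?W" using t t' by blast
  have s: "smooth_section F ?W (snd t k)" for k by (rule F.section_subset[OF tF_section[OF t(1)]]) auto
  have s': "smooth_section F ?W (snd t' k)" for k by (rule F.section_subset[OF tF_section[OF t'(1)]]) auto
  have M: "smooth_fun (base E) ?W (M \<tau> \<beta>)" for \<tau> \<beta> unfolding M_def by (rule tF_smooth[OF t(1) t'(1)])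
  have sM: "smooth_section F ?W (\<lambda>y. \<Sum>\<nu>\<in>UNIV. M \<nu> \<beta> y *\<^sub>R snd t \<nu> y)" for \<beta>
    using W M by (intro F.section_sum F.section_scale s) (simp_all add: base_E)
  have exp: "snd t' \<beta> y = (\<Sum>\<nu>\<in>UNIV. M \<nu> \<beta> y *\<^sub>R snd t \<nu> y)" if "y \<in> ?W" for \<beta> y
    using coeff_expand[OF tF_basis[OF t(1)] basis_at_in[OF tF_basis[OF t'(1)]], of y \<beta>] that by (simp add: M_def)
  have tb: "basis_at (snd t) x (fibre F x)" by (rule tF_basis[OF t])
  have tb': "basis_at (snd t') x (fibre F x)" by (rule tF_basis[OF t'])
  note FS = basis_at_subspace[OF tb] and lin = coeff_lin_on[OF tb, of \<tau>]
  have brin: "br (snd t \<mu>) (snd t \<nu>) x \<in> fibre F x" for \<mu> \<nu> by (rule F.sectionD[OF br_section[OF W s s] xW])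
  have brin': "br (snd t' \<gamma>) (snd t' \<beta>) x \<in> fibre F x" by (rule F.sectionD[OF br_section[OF W s' s'] xW])
  have tin: "snd t \<mu> x \<in> fibre F x" for \<mu> by (rule basis_at_in[OF tb])
  \<comment> \<open>The axiom gives the Leibniz rule in the second argument; antisymmetry moves the
    expansion there and back, hence the minus sign at the derivative term.\<close>
  have 1: "br (snd t' \<gamma>) (snd t \<nu>) x = (\<Sum>\<mu>\<in>UNIV. M \<mu> \<gamma> x *\<^sub>R br (snd t \<mu>) (snd t \<nu>) x - \<rho> x (snd t \<nu> x) (M \<mu> \<gamma>) *\<^sub>R snd t \<mu> x)" for \<nu>
  proof -
    have "br (snd t' \<gamma>) (snd t \<nu>) x = - br (snd t \<nu>) (snd t' \<gamma>) x" by (rule br_anti[OF W s' s xW])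
    also have "br (snd t \<nu>) (snd t' \<gamma>) x = br (snd t \<nu>) (\<lambda>y. \<Sum>\<mu>\<in>UNIV. M \<mu> \<gamma> y *\<^sub>R snd t \<mu> y) x"
      by (rule br_cong[OF W s sM _ _ xW]) (auto intro: exp)
    also have "\<dots> = (\<Sum>\<mu>\<in>UNIV. M \<mu> \<gamma> x *\<^sub>R br (snd t \<nu>) (snd t \<mu>) x + \<rho> x (snd t \<nu> x) (M \<mu> \<gamma>) *\<^sub>R snd t \<mu> x)"
      by (rule br_sum[OF W s s M xW])
    also have "\<dots> = (\<Sum>\<mu>\<in>UNIV. M \<mu> \<gamma> x *\<^sub>R - br (snd t \<mu>) (snd t \<nu>) x + \<rho> x (snd t \<nu> x) (M \<mu> \<gamma>) *\<^sub>R snd t \<mu> x)"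
      by (simp only: br_anti[OF W s s xW, of \<nu>])
    finally show ?thesis by (simp add: sum_negf[symmetric] minus_add_distrib algebra_simps)
  qed
  have "br (snd t' \<gamma>) (snd t' \<beta>) x = br (snd t' \<gamma>) (\<lambda>y. \<Sum>\<nu>\<in>UNIV. M \<nu> \<beta> y *\<^sub>R snd t \<nu> y) x"
    by (rule br_cong[OF W s' sM _ _ xW]) (auto intro: exp)
  also have "\<dots> = (\<Sum>\<nu>\<in>UNIV. M \<nu> \<beta> x *\<^sub>R br (snd t' \<gamma>) (snd t \<nu>) x + \<rho> x (snd t' \<gamma> x) (M \<nu> \<beta>) *\<^sub>R snd t \<nu> x)"
    by (rule br_sum[OF W s' s M xW])
  finally have 2: "br (snd t' \<gamma>) (snd t' \<beta>) x =
     (\<Sum>\<nu>\<in>UNIV. M \<nu> \<beta> x *\<^sub>R (\<Sum>\<mu>\<in>UNIV. M \<mu> \<gamma> x *\<^sub>R br (snd t \<mu>) (snd t \<nu>) x - \<rho> x (snd t \<nu> x) (M \<mu> \<gamma>) *\<^sub>R snd t \<mu> x)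
       + \<rho> x (snd t' \<gamma> x) (M \<nu> \<beta>) *\<^sub>R snd t \<nu> x)"
    unfolding 1 .
  have c_sum: "coeff (snd t) x \<tau> (\<Sum>k\<in>UNIV. f k) = (\<Sum>k\<in>UNIV. coeff (snd t) x \<tau> (f k))"
    if "\<And>k. f k \<in> fibre F x" for f :: "'k \<Rightarrow> 'f" by (rule lin_on_sum[OF lin FS that])
  have c_add: "coeff (snd t) x \<tau> (v + w) = coeff (snd t) x \<tau> v + coeff (snd t) x \<tau> w" if "v \<in> fibre F x" "w \<in> fibre F x" for v w
    by (rule lin_on_add[OF lin that])
  have c_diff: "coeff (snd t) x \<tau> (v - w) = coeff (snd t) x \<tau> v - coeff (snd t) x \<tau> w" if "v \<in> fibre F x" "w \<in> fibre F x" for v w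
    using lin_on_add[OF lin that(1) subspace_neg[OF FS that(2)]] lin_on_scale[OF lin that(2), of "-1"] by simp
  have c_scale: "coeff (snd t) x \<tau> (r *\<^sub>R v) = r * coeff (snd t) x \<tau> v" if "v \<in> fibre F x" for v r
    using lin_on_scale[OF lin that] by simp
  have \<delta>: "(\<Sum>\<nu>\<in>UNIV. f \<nu> * (if \<tau> = \<nu> then 1 else 0)) = f \<tau>" for f :: "'k \<Rightarrow> real"
    by (simp add: if_distrib[of "(*) _"] cong: if_cong)
  have in1: "(\<Sum>\<mu>\<in>UNIV. M \<mu> \<gamma> x *\<^sub>R br (snd t \<mu>) (snd t \<nu>) x - \<rho> x (snd t \<nu> x) (M \<mu> \<gamma>) *\<^sub>R snd t \<mu> x) \<in> fibre F x" for \<nu>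
    by (intro subspace_sum[OF FS] subspace_diff[OF FS] subspace_scale[OF FS] brin tin)
  have "coeff (snd t) x \<tau> (br (snd t' \<gamma>) (snd t' \<beta>) x) =
     (\<Sum>\<nu>\<in>UNIV. M \<nu> \<beta> x * (\<Sum>\<mu>\<in>UNIV. M \<mu> \<gamma> x * struct_fun br (snd t) \<tau> \<mu> \<nu> x - \<rho> x (snd t \<nu> x) (M \<mu> \<gamma>) * (if \<tau> = \<mu> then 1 else 0))
       + \<rho> x (snd t' \<gamma> x) (M \<nu> \<beta>) * (if \<tau> = \<nu> then 1 else 0))"
    unfolding 2
    by (simp only: c_sum c_add c_diff c_scale subspace_add[OF FS] subspace_diff[OF FS] subspace_scale[OF FS]
        brin tin in1 coeff_basis[OF tb] struct_fun_def)
  also have "\<dots> = (\<Sum>\<nu>\<in>UNIV. \<Sum>\<mu>\<in>UNIV. M \<mu> \<gamma> x * M \<nu> \<beta> x * struct_fun br (snd t) \<tau> \<mu> \<nu> x)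
      - (\<Sum>\<nu>\<in>UNIV. M \<nu> \<beta> x * \<rho> x (snd t \<nu> x) (M \<tau> \<gamma>)) + \<rho> x (snd t' \<gamma> x) (M \<tau> \<beta>)"
    unfolding sum.distrib sum_subtractf \<delta> right_diff_distrib sum_distrib_left by (simp add: mult_ac)
  also have "(\<Sum>\<nu>\<in>UNIV. M \<nu> \<beta> x * \<rho> x (snd t \<nu> x) (M \<tau> \<gamma>)) = \<rho> x (snd t' \<beta> x) (M \<tau> \<gamma>)"
  proof -
    have "x \<in> points (base E)" using open_in_subset_points[OF W] xW by blast
    from rho_lin[OF this] have "lin_on (fibre F x) (\<lambda>v. \<rho> x v (M \<tau> \<gamma>))" by (simp add: lin_on_def scaleR_fun_def)
    from lin_on_expand[OF tb this basis_at_in[OF tb']] show ?thesis by (simp add: M_def)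
  qed
  also have "(\<Sum>\<nu>\<in>UNIV. \<Sum>\<mu>\<in>UNIV. M \<mu> \<gamma> x * M \<nu> \<beta> x * struct_fun br (snd t) \<tau> \<mu> \<nu> x) =
      (\<Sum>\<mu>\<in>UNIV. \<Sum>\<nu>\<in>UNIV. M \<mu> \<gamma> x * M \<nu> \<beta> x * struct_fun br (snd t) \<tau> \<mu> \<nu> x)"
    by (rule sum.swap)
  also have "coeff (snd t) x \<tau> (br (snd t' \<gamma>) (snd t' \<beta>) x) = (\<Sum>\<theta>\<in>UNIV. struct_fun br (snd t') \<theta> \<gamma> \<beta> x * M \<tau> \<theta> x)"
    using coeff_change[OF tb tb' brin'] by (simp add: struct_fun_def M_def mult.commute)
  finally show ?thesis by simp
qed

text \<open>Greek transition coefficients are those of \<open>F\<close> lifted to the total space,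
  and Latin ones are transition coefficients of \<open>E\<close>. Thus \<open>L_trans\<close>
  becomes \<open>struct_fun_change\<close> on the base, and both constancy conditions along the
  fibres hold.\<close>

lemma GT_split:
  "split_bundle GT gt_anchor (base E \<times> frames F \<times> frames E) (\<lambda>(c, t, s). gt_dom E c t s) (\<lambda>(c, t, s). gt c t s)
     (\<lambda>(c, t, s). struct_fun br (snd t))"
proof -
  interpret GT: framed_bundle GT by (rule GT_framed)
  have tri: "(\<exists>c t s. i = (c, t, s) \<and> c \<in> base E \<and> t \<in> frames F \<and> s \<in> frames E)"
    if "i \<in> base E \<times> frames F \<times> frames E" for i using that by (cases i) auto
  show ?thesis
  proof (unfold_locales, unfold GT_base)
    show "frames GT = (\<lambda>i. (case i of (c, t, s) \<Rightarrow> gt_dom E c t s, case i of (c, t, s) \<Rightarrow> gt c t s)) ` (base E \<times> frames F \<times> frames E)"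
      unfolding GT_frames by (rule image_cong) auto
    show "lin_on (fibre GT u) (\<lambda>w. gt_anchor u w f)" for u f
      by (simp add: lin_on_def gt_anchor_def scaleR_fun_def)
    show "gt_anchor u w \<in> tangent_space (dual_atlas E) u" if "u \<in> points (dual_atlas E)" "w \<in> fibre GT u" for u w
      using that by (simp add: GT_fibre gtf_iff gt_anchor_def)
    fix i j u assume i: "i \<in> base E \<times> frames F \<times> frames E"
    obtain c t s where 1: "i = (c, t, s)" "c \<in> base E" "t \<in> frames F" "s \<in> frames E" using tri[OF i] by blast
    show "smooth_fun (dual_atlas E) (case i of (c, t, s) \<Rightarrow> gt_dom E c t s)
        (\<lambda>u. (case i of (c, t, s) \<Rightarrow> struct_fun br (snd t)) \<theta> \<gamma> \<beta> (fst u))" for \<theta> \<gamma> \<beta>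
    proof -
      have "gt_dom E c t s \<subseteq> lift (fst t)" by (auto simp: gt_dom_lift in_lift)
      from dual.smooth_fun_subset[OF lift_smooth[OF tF_open[OF 1(3)] struct_fun_smooth[OF 1(3)]] this]
      show ?thesis by (simp add: 1(1))
    qed
    assume u: "u \<in> (case i of (c, t, s) \<Rightarrow> gt_dom E c t s)"
    then have u1: "u \<in> gt_dom E c t s" by (simp add: 1(1))
    have x1: "fst u \<in> fst c" "fst u \<in> fst t" "fst u \<in> fst s" using u1 by (auto simp: gt_dom_lift in_lift)
    show "(case i of (c, t, s) \<Rightarrow> struct_fun br (snd t)) \<theta> \<gamma> \<beta> (fst u) =
        - (case i of (c, t, s) \<Rightarrow> struct_fun br (snd t)) \<theta> \<beta> \<gamma> (fst u)" for \<theta> \<gamma> \<beta>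
      unfolding 1(1) prod.case by (rule struct_fun_anti[OF 1(3) x1(2)])
    assume j: "j \<in> base E \<times> frames F \<times> frames E" and "u \<in> (case j of (c, t, s) \<Rightarrow> gt_dom E c t s)"
    moreover obtain c' t' s' where 2: "j = (c', t', s')" "c' \<in> base E" "t' \<in> frames F" "s' \<in> frames E" using tri[OF j] by blast
    ultimately have u2: "u \<in> gt_dom E c' t' s'" by simp
    have x2: "fst u \<in> fst c'" "fst u \<in> fst t'" "fst u \<in> fst s'" using u2 by (auto simp: gt_dom_lift in_lift)
    let ?W = "gt_dom E c t s \<inter> gt_dom E c' t' s'"
    have W: "open_in (dual_atlas E) ?W" "u \<in> ?W" using u1 u2 by (auto intro: dual.open_in_Int gt_dom_open 1 2)
    have Wb: "open_in (base E) (fst t \<inter> fst t')" by (intro open_in_Int tF_open 1 2)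
    have co: "coeff (gt c t s) v l (gt c' t' s' k v) =
      (case l of Inl \<alpha> \<Rightarrow> coeff (snd t) (fst v) \<alpha> (fst (gt c' t' s' k v)) | Inr b \<Rightarrow> snd (gt c' t' s' k v) (fcoord s b))"
      if "v \<in> ?W" for v l k
      using that by (intro coeff_gt[OF 1(2-4)] gt_in[OF 2(2-4)]) auto
    have co_Inl: "coeff (gt c t s) v (Inl \<tau>) (gt c' t' s' (Inl \<beta>) v) = coeff (snd t) (fst v) \<tau> (snd t' \<beta> (fst v))"
      if "v \<in> ?W" for v \<tau> \<beta> using co[OF that, of "Inl \<tau>" "Inl \<beta>"] by (simp add: gt_Inl)
    have co_Inr: "coeff (gt c t s) v (Inr b) (gt c' t' s' (Inr e) v) = cframe c' s' (Inr e) v (fcoord s b)"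
      if "v \<in> ?W" for v b e using co[OF that, of "Inr b" "Inr e"] by (simp add: gt_Inr)
    have M: "smooth_near (base E) (fst u) (\<lambda>x. coeff (snd t) x \<tau> (snd t' \<beta> x))" for \<tau> \<beta>
      using x1 x2 by (intro smooth_nearI[OF Wb _ tF_smooth[OF 1(3) 2(3)]]) auto
    show "coeff (case i of (c, t, s) \<Rightarrow> gt c t s) u (Inl \<alpha>) ((case j of (c, t, s) \<Rightarrow> gt c t s) (Inr b) u) = 0" for \<alpha> b
      using co[OF W(2), of "Inl \<alpha>" "Inr b"]
        lin_on_zero[OF coeff_lin_on[OF tF_basis[OF 1(3) x1(2)]] basis_at_subspace[OF tF_basis[OF 1(3) x1(2)]]]
      by (simp add: 1(1) 2(1) gt_Inr)
    \<comment> \<open>The Greek coefficient is a lifted function, so the compatibility condition in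
      \<open>gtf\<close> converts its derivative on the total space into one by the anchor on the
      base.\<close>
    have a: "snd (gt c' t' s' (Inl \<gamma>) u) (\<lambda>v. coeff (gt c t s) v (Inl \<tau>) (gt c' t' s' (Inl \<beta>) v)) =
        \<rho> (fst u) (snd t' \<gamma> (fst u)) (\<lambda>x. coeff (snd t) x \<tau> (snd t' \<beta> x))" for \<gamma> \<tau> \<beta>
    proof -
      have g: "gt c' t' s' (Inl \<gamma>) u \<in> gtf u" by (rule gt_in[OF 2(2-4) u2])
      then have "snd (gt c' t' s' (Inl \<gamma>) u) \<in> tangent_space (dual_atlas E) u" by (simp add: gtf_iff)
      from dual.tangent_cong[OF this W co_Inl]
      have "snd (gt c' t' s' (Inl \<gamma>) u) (\<lambda>v. coeff (gt c t s) v (Inl \<tau>) (gt c' t' s' (Inl \<beta>) v)) =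
        snd (gt c' t' s' (Inl \<gamma>) u) (\<lambda>v. coeff (snd t) (fst v) \<tau> (snd t' \<beta> (fst v)))" .
      also have "\<dots> = \<rho> (fst u) (fst (gt c' t' s' (Inl \<gamma>) u)) (\<lambda>x. coeff (snd t) x \<tau> (snd t' \<beta> x))"
      proof -
        have "\<forall>f. smooth_near (base E) (fst u) f \<longrightarrow> snd (gt c' t' s' (Inl \<gamma>) u) (\<lambda>v. f (fst v)) =
            \<rho> (fst u) (fst (gt c' t' s' (Inl \<gamma>) u)) f" using g by (simp add: gtf_iff)
        from mp[OF spec[OF this, of "\<lambda>x. coeff (snd t) x \<tau> (snd t' \<beta> x)"] M] show ?thesis .
      qed
      finally show ?thesis by (simp add: gt_Inl)
    qed
    show "(\<Sum>\<theta>\<in>UNIV. (case j of (c, t, s) \<Rightarrow> struct_fun br (snd t)) \<theta> \<gamma> \<beta> (fst u) *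
          coeff (case i of (c, t, s) \<Rightarrow> gt c t s) u (Inl \<tau>) ((case j of (c, t, s) \<Rightarrow> gt c t s) (Inl \<theta>) u)) =
        (\<Sum>\<mu>\<in>UNIV. \<Sum>\<nu>\<in>UNIV. coeff (case i of (c, t, s) \<Rightarrow> gt c t s) u (Inl \<mu>) ((case j of (c, t, s) \<Rightarrow> gt c t s) (Inl \<gamma>) u) *
          coeff (case i of (c, t, s) \<Rightarrow> gt c t s) u (Inl \<nu>) ((case j of (c, t, s) \<Rightarrow> gt c t s) (Inl \<beta>) u) *
          (case i of (c, t, s) \<Rightarrow> struct_fun br (snd t)) \<tau> \<mu> \<nu> (fst u)) +
        gt_anchor u ((case j of (c, t, s) \<Rightarrow> gt c t s) (Inl \<gamma>) u)
          (\<lambda>u. coeff (case i of (c, t, s) \<Rightarrow> gt c t s) u (Inl \<tau>) ((case j of (c, t, s) \<Rightarrow> gt c t s) (Inl \<beta>) u)) -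
        gt_anchor u ((case j of (c, t, s) \<Rightarrow> gt c t s) (Inl \<beta>) u)
          (\<lambda>u. coeff (case i of (c, t, s) \<Rightarrow> gt c t s) u (Inl \<tau>) ((case j of (c, t, s) \<Rightarrow> gt c t s) (Inl \<gamma>) u))"
      for \<tau> \<gamma> \<beta>
      using struct_fun_change[OF 1(3) x1(2) 2(3) x2(2), of \<gamma> \<beta> \<tau>]
      by (simp add: 1(1) 2(1) gt_anchor_def a co_Inl[OF W(2)])
    have Wd: "?W \<subseteq> fst (dc c s) \<inter> fst (dc c' s')" using gt_dom_dc by blast
    show "gt_anchor u ((case j of (c, t, s) \<Rightarrow> gt c t s) (Inr d) u)
          (\<lambda>u. coeff (case i of (c, t, s) \<Rightarrow> gt c t s) u (Inl \<tau>) ((case j of (c, t, s) \<Rightarrow> gt c t s) (Inl \<beta>) u)) = 0" for d \<tau> \<beta>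
      using cframe_basic(2)[OF 2(2,4) gt_dom_dc[OF u2] W co_Inl M]
      by (simp add: 1(1) 2(1) gt_anchor_def gt_Inr)
    have "cframe c' s' (Inr d) u (\<lambda>u. coeff (gt c t s) u (Inr b) (gt c' t' s' (Inr e) u)) = 0" for d b e
      by (rule cframe_vertical_basic[where d = e and b = b, OF 1(2) 2(2) 1(4) 2(4) gt_dom_dc[OF u1] gt_dom_dc[OF u2] W Wd]) (rule co_Inr)
    then show "gt_anchor u ((case j of (c, t, s) \<Rightarrow> gt c t s) (Inr d) u)
          (\<lambda>u. coeff (case i of (c, t, s) \<Rightarrow> gt c t s) u (Inr b) ((case j of (c, t, s) \<Rightarrow> gt c t s) (Inr e) u)) = 0" for d b e
      by (simp add: 1(1) 2(1) gt_anchor_def gt_Inr)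
  qed
qed

end

text \<open>Exports the construction from the locale with its parameters as hypotheses, so that it
  can be applied to two different bundles.\<close>

lemma split_structure_connection:
  assumes "split_bundle B a I U fr L" and "rho_connection B \<Gamma>" "distinguished B a \<Gamma> D0" "pseudometrical B \<Gamma> G"
  shows "\<exists>D. distinguished B a \<Gamma> D \<and>
    (\<forall>i\<in>I. let \<delta> = adapted \<Gamma> (fr i) in has_components B D (U i) \<delta>
       (new_H a G \<delta> (L i)) (new_Hv B a D0 G \<delta>) (new_V B a D0 G \<delta>) (new_Vv a G \<delta>)) \<and>
    (\<forall>W X. open_in (base B) W \<and> smooth_section B W X \<longrightarrow> (\<forall>u\<in>W. D X G u = 0))"
proof -
  interpret split_structure B a I U fr L \<Gamma> D0 G
    using assms by (simp add: split_structure_def split_structure_axioms_def)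
  show ?thesis
    using D_distinguished D_components D_metric_zero by (intro exI[of _ D]) (auto simp: Let_def)
qed

theorem corollary5p1:
  fixes E :: "('p, real^'m::finite, 'w::real_vector, 'e::finite) vbundle"
    and F :: "('p, real^'m, 'f::real_vector, 'k::finite) vbundle"
  assumes E: "vector_bundle E"
  shows
    "(\<forall>br \<rho> \<Gamma> D0 G.
        let B = gen_tangent F \<rho> E in
        lie_algebroid F br \<rho> \<and> base F = base E \<and>
        rho_connection B \<Gamma> \<and> distinguished B gt_anchor \<Gamma> D0 \<and>
        (pseudometrical B \<Gamma> G \<or> metrical B \<Gamma> G) \<longrightarrow>
        (\<exists>D. distinguished B gt_anchor \<Gamma> D \<and>
           (\<forall>c\<in>base E. \<forall>t\<in>frames F. \<forall>s\<in>frames E.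
              let \<delta> = adapted \<Gamma> (gt_frame \<rho> E c t s) in
              has_components B D (gt_dom E c t s) \<delta>
                (new_H gt_anchor G \<delta> (struct_fun br (snd t)))
                (new_Hv B gt_anchor D0 G \<delta>)
                (new_V B gt_anchor D0 G \<delta>)
                (new_Vv gt_anchor G \<delta>)) \<and>
           (\<forall>W X. open_in (base B) W \<and> smooth_section B W X \<longrightarrow> (\<forall>u\<in>W. D X G u = 0))))
     \<and>
     (let TM = tangent_bundle base_dir (base E);
          B = gen_tangent TM (\<lambda>x v. v) E;
          TE = tangent_bundle total_dir (dual_atlas E);
          coord = (\<lambda>c s. coord_frame total_dir (dual_atlas E) (dual_chart E c s))
      in
        (\<forall>u\<in>points (dual_atlas E). bij_betw (gt_anchor u) (fibre B u) (fibre TE u)) \<and>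
        (\<forall>c\<in>base E. \<forall>s\<in>frames E. \<forall>u\<in>fst (dual_chart E c s). \<forall>k.
           gt_anchor u (gt_frame (\<lambda>x v. v) E c (fst c, coord_frame base_dir (base E) c) s k u)
             = coord c s k u) \<and>
        (\<forall>\<Gamma> D0 G.
           rho_connection TE \<Gamma> \<and> distinguished TE (\<lambda>u w. w) \<Gamma> D0 \<and>
           (pseudometrical TE \<Gamma> G \<or> metrical TE \<Gamma> G) \<longrightarrow>
           (\<forall>c\<in>base E. \<forall>s\<in>frames E. \<forall>u\<in>fst (dual_chart E c s).
              let \<delta> = adapted \<Gamma> (coord c s);
                  L = struct_fun (lie_bracket (base E)) (coord_frame base_dir (base E) c)
              in
                (\<forall>i j k. new_H (\<lambda>u w. w) G \<delta> L i j k u = classical_H G \<delta> i j k u) \<and>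
                (\<forall>a b k. new_Hv TE (\<lambda>u w. w) D0 G \<delta> a b k u = classical_Hv TE D0 G \<delta> a b k u) \<and>
                (\<forall>i j a. new_V TE (\<lambda>u w. w) D0 G \<delta> i j a u = classical_V TE D0 G \<delta> i j a u) \<and>
                (\<forall>a b d. new_Vv (\<lambda>u w. w) G \<delta> a b d u = classical_Vv G \<delta> a b d u)) \<and>
           (\<exists>D. distinguished TE (\<lambda>u w. w) \<Gamma> D \<and>
              (\<forall>c\<in>base E. \<forall>s\<in>frames E.
                 let \<delta> = adapted \<Gamma> (coord c s) in
                 has_components TE D (fst (dual_chart E c s)) \<delta>
                   (classical_H G \<delta>) (classical_Hv TE D0 G \<delta>)
                   (classical_V TE D0 G \<delta>) (classical_Vv G \<delta>)) \<and>
              (\<forall>W X. open_in (dual_atlas E) W \<and> smooth_section TE W X \<longrightarrow> (\<forall>u\<in>W. D X G u = 0)))))"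
proof -
  interpret dual_bundle E unfolding dual_bundle_def by (rule vector_bundle_framed[OF E])
  let ?A = "base E"
  let ?TM = "tangent_bundle base_dir ?A"
  \<comment> \<open>The case of the tangent bundle of the base with identity anchor; it makes the
    frame-free description \<open>gtf\<close> available for the identification with the tangent
    bundle of the total space.\<close>
  interpret TM: anchored_bundle E ?TM "\<lambda>x v. v"
  proof (intro anchored_bundle.intro anchored_bundle_axioms.intro dual_bundle_axioms)
    show "framed_bundle ?TM" by (rule tangent_bundle_framed[OF basis_enum_base_dir])
    show "bundle_morphism ?TM ?TM (\<lambda>x v. v)"
      using subspace_tangent_space by (auto simp: bundle_morphism_def)
  qed simp
  have chart_frame: "(fst c, coord_frame base_dir ?A c) \<in> frames ?TM" if "c \<in> ?A" for c
    using that by (simp add: tangent_frames)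
  have part1: "\<exists>D. distinguished (gen_tangent F \<rho> E) gt_anchor \<Gamma> D \<and>
      (\<forall>c\<in>base E. \<forall>t\<in>frames F. \<forall>s\<in>frames E.
        let \<delta> = adapted \<Gamma> (gt_frame \<rho> E c t s) in
        has_components (gen_tangent F \<rho> E) D (gt_dom E c t s) \<delta>
          (new_H gt_anchor G \<delta> (struct_fun br (snd t)))
          (new_Hv (gen_tangent F \<rho> E) gt_anchor D0 G \<delta>)
          (new_V (gen_tangent F \<rho> E) gt_anchor D0 G \<delta>)
          (new_Vv gt_anchor G \<delta>)) \<and>
      (\<forall>W X. open_in (base (gen_tangent F \<rho> E)) W \<and> smooth_section (gen_tangent F \<rho> E) W X \<longrightarrow> (\<forall>u\<in>W. D X G u = 0))"
    if "lie_algebroid F br \<rho>" "base F = base E" and B: "rho_connection (gen_tangent F \<rho> E) \<Gamma>"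
      "distinguished (gen_tangent F \<rho> E) gt_anchor \<Gamma> D0" "pseudometrical (gen_tangent F \<rho> E) \<Gamma> G" for br \<rho> \<Gamma> D0 G
  proof -
    interpret dual_algebroid E F br \<rho> by unfold_locales (rule that)+
    obtain D where D: "distinguished (gen_tangent F \<rho> E) gt_anchor \<Gamma> D"
      "\<forall>i\<in>base E \<times> frames F \<times> frames E. let \<delta> = adapted \<Gamma> (case i of (c, t, s) \<Rightarrow> gt_frame \<rho> E c t s) in
         has_components (gen_tangent F \<rho> E) D (case i of (c, t, s) \<Rightarrow> gt_dom E c t s) \<delta>
          (new_H gt_anchor G \<delta> (case i of (c, t, s) \<Rightarrow> struct_fun br (snd t))) (new_Hv (gen_tangent F \<rho> E) gt_anchor D0 G \<delta>)
          (new_V (gen_tangent F \<rho> E) gt_anchor D0 G \<delta>) (new_Vv gt_anchor G \<delta>)"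
      "\<forall>W X. open_in (base (gen_tangent F \<rho> E)) W \<and> smooth_section (gen_tangent F \<rho> E) W X \<longrightarrow> (\<forall>u\<in>W. D X G u = 0)"
      using split_structure_connection[OF GT_split B] by blast
    have "let \<delta> = adapted \<Gamma> (gt_frame \<rho> E c t s) in
        has_components (gen_tangent F \<rho> E) D (gt_dom E c t s) \<delta>
          (new_H gt_anchor G \<delta> (struct_fun br (snd t)))
          (new_Hv (gen_tangent F \<rho> E) gt_anchor D0 G \<delta>)
          (new_V (gen_tangent F \<rho> E) gt_anchor D0 G \<delta>)
          (new_Vv gt_anchor G \<delta>)" if "c \<in> base E" "t \<in> frames F" "s \<in> frames E" for c t s
      using bspec[OF D(2), of "(c, t, s)"] that by simp
    then show ?thesis using D(1,3) by blast
  qed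
  \<comment> \<open>Injectivity holds because Y determines the values of Z on all functions smooth
    near the foot point; a preimage of Y pairs it with its projection to the base.\<close>
  have bij: "bij_betw (gt_anchor u) (fibre (gen_tangent ?TM (\<lambda>x v. v) E) u) (fibre TE u)"
    if u: "u \<in> points (dual_atlas E)" for u
    unfolding TM.GT_fibre[OF u] dual.tangent_bundle_simps
  proof (rule bij_betwI')
    fix v w assume v: "v \<in> TM.gtf u" and w: "w \<in> TM.gtf u"
    show "gt_anchor u v = gt_anchor u w \<longleftrightarrow> v = w"
    proof
      assume eq: "gt_anchor u v = gt_anchor u w"
      have "fst v f = fst w f" for f
      proof (cases "smooth_near ?A (fst u) f")
        case True
        then show ?thesis using v w eq by (simp add: TM.gtf_iff gt_anchor_def)
      next
        \<comment> \<open>Both vectors are 0 on functions that are not smooth near the foot point,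
          by the default value of tangent vectors.\<close>
        case False
        then show ?thesis using v w tangent_not_near[OF _ False, of "fst v"] tangent_not_near[OF _ False, of "fst w"]
          by (simp add: TM.gtf_iff)
      qed
      then show "v = w" using eq by (intro prod_eqI) (auto simp: gt_anchor_def)
    qed simp
  next
    show "gt_anchor u v \<in> tangent_space (dual_atlas E) u" if "v \<in> TM.gtf u" for v
      using that by (simp add: TM.gtf_iff gt_anchor_def)
  next
    fix Y assume Y: "Y \<in> tangent_space (dual_atlas E) u"
    have x: "fst u \<in> points ?A" "snd u \<in> dual_space (fibre E (fst u))" using u by (auto simp: dual_points in_lift)
    obtain c where c: "c \<in> ?A" "fst u \<in> fst c" using points_chart[OF x(1)] by blast
    obtain s where s: "s \<in> frames E" "fst u \<in> fst s" using point_sE[OF x(1)] by blast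
    have ud: "u \<in> fst (dc c s)" using c s x by (simp add: dc_dom in_lift)
    \<comment> \<open>The image of Y under the differential of the bundle projection, in
      coordinates.\<close>
    define Z where "Z = (\<Sum>i\<in>UNIV. coeff (cframe c s) u (Inl i) Y *\<^sub>R coord_frame base_dir ?A c i (fst u))"
    have Z: "Z \<in> tangent_space ?A (fst u)"
      unfolding Z_def by (intro subspace_sum[OF subspace_tangent_space[OF x(1)]] subspace_scale[OF subspace_tangent_space[OF x(1)]]
          coord_frame_in c)
    have "Y (\<lambda>v. f (fst v)) = Z f" if f: "smooth_near ?A (fst u) f" for f
    proof -
      have "Y (\<lambda>v. f (fst v)) = (\<Sum>k\<in>UNIV. coeff (cframe c s) u k Y *\<^sub>R cframe c s k u) (\<lambda>v. f (fst v))"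
        using coeff_expand[OF cframe_basis[OF c(1) s(1) ud] Y] by simp
      also have "\<dots> = Z f"
        by (simp add: sum_Plus_UNIV sum_apply scaleR_fun_def Z_def cframe_lift[OF c(1) s(1) ud f])
      finally show ?thesis .
    qed
    then have "(Z, Y) \<in> TM.gtf u" using Y Z by (simp add: TM.gtf_iff)
    then show "\<exists>w\<in>TM.gtf u. Y = gt_anchor u w" by (intro bexI[of _ "(Z, Y)"]) (simp_all add: gt_anchor_def)
  qed
  have frame: "gt_anchor u (gt_frame (\<lambda>x v. v) E c (fst c, coord_frame base_dir ?A c) s k u)
      = coord_frame total_dir (dual_atlas E) (dc c s) k u"
    if c: "c \<in> ?A" and s: "s \<in> frames E" and u: "u \<in> fst (dc c s)" for c s u k
  proof (cases k)
    case (Inl j)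
    have x: "fst u \<in> fst c" using u by (simp add: dc_dom in_lift)
    have "TM.rc c (fst c, coord_frame base_dir ?A c) i j (fst u) = (if i = j then 1 else 0)" for i
      using coeff_basis[OF coord_frame_basis[OF basis_enum_base_dir c x], of i j] by (simp add: TM.rc_def)
    then show ?thesis
      by (simp add: Inl TM.gt_Inl gt_anchor_def cframe_def if_distrib[of "\<lambda>r. r *\<^sub>R _"] cong: if_cong)
  qed (simp add: TM.gt_Inr gt_anchor_def cframe_def)
  \<comment> \<open>With the constant \<open>L = 0\<close>, with which the connection on the tangent
    bundle is constructed, and with the identity in place of the anchor, the general formulas are
    the classical ones as functions.\<close>
  have classical: "new_H (\<lambda>u w. w) G \<delta> (\<lambda>_ _ _ _. 0) = classical_H G \<delta>"
    "new_Hv TE (\<lambda>u w. w) D0 G \<delta> = classical_Hv TE D0 G \<delta>"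
    "new_V TE (\<lambda>u w. w) D0 G \<delta> = classical_V TE D0 G \<delta>"
    "new_Vv (\<lambda>u w. w) G \<delta> = classical_Vv G \<delta>" for G \<delta> D0
    by (simp_all add: fun_eq_iff new_H_def classical_H_def new_Hv_def classical_Hv_def cov_deriv_v_def
        new_V_def classical_V_def cov_deriv_h_def new_Vv_def classical_Vv_def Let_def)
  \<comment> \<open>Here \<open>L\<close> consists of the actual structure functions of the
    coordinate frame. They are known to vanish over the chart domain, hence the equation at single
    points.\<close>
  have H: "new_H (\<lambda>u w. w) G \<delta> (struct_fun (lie_bracket ?A) (coord_frame base_dir ?A c)) i j k u = classical_H G \<delta> i j k u"
    if "c \<in> ?A" "u \<in> fst (dc c s)" for G \<delta> c s i j k u
    using that by (simp add: new_H_def classical_H_def Let_def classical_structure_functions dc_dom in_lift)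
  have part2: "\<exists>D. distinguished TE (\<lambda>u w. w) \<Gamma> D \<and>
      (\<forall>c\<in>base E. \<forall>s\<in>frames E.
         let \<delta> = adapted \<Gamma> (coord_frame total_dir (dual_atlas E) (dc c s)) in
         has_components TE D (fst (dc c s)) \<delta>
           (classical_H G \<delta>) (classical_Hv TE D0 G \<delta>) (classical_V TE D0 G \<delta>) (classical_Vv G \<delta>)) \<and>
      (\<forall>W X. open_in (dual_atlas E) W \<and> smooth_section TE W X \<longrightarrow> (\<forall>u\<in>W. D X G u = 0))"
    if B: "rho_connection TE \<Gamma>" "distinguished TE (\<lambda>u w. w) \<Gamma> D0" "pseudometrical TE \<Gamma> G" for \<Gamma> D0 G
  proof -
    obtain D where D: "distinguished TE (\<lambda>u w. w) \<Gamma> D"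
      "\<forall>i\<in>base E \<times> frames E. let \<delta> = adapted \<Gamma> (case i of (c, s) \<Rightarrow> cframe c s) in
         has_components TE D (case i of (c, s) \<Rightarrow> fst (dc c s)) \<delta>
          (new_H (\<lambda>u w. w) G \<delta> (\<lambda>_ _ _ _. 0)) (new_Hv TE (\<lambda>u w. w) D0 G \<delta>)
          (new_V TE (\<lambda>u w. w) D0 G \<delta>) (new_Vv (\<lambda>u w. w) G \<delta>)"
      "\<forall>W X. open_in (base TE) W \<and> smooth_section TE W X \<longrightarrow> (\<forall>u\<in>W. D X G u = 0)"
      using split_structure_connection[OF tangent_split B] by blast
    have "let \<delta> = adapted \<Gamma> (coord_frame total_dir (dual_atlas E) (dc c s)) in
         has_components TE D (fst (dc c s)) \<delta>
           (classical_H G \<delta>) (classical_Hv TE D0 G \<delta>) (classical_V TE D0 G \<delta>) (classical_Vv G \<delta>)"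
      if "c \<in> base E" "s \<in> frames E" for c s
      using bspec[OF D(2), of "(c, s)"] that by (simp add: classical cframe_def)
    then show ?thesis using D(1,3) by auto
  qed
  \<comment> \<open>A metrical structure is pseudometrical, which reduces both readings of the
    statement to one.\<close>
  have pseudo: "pseudometrical B \<Gamma> G \<or> metrical B \<Gamma> G \<Longrightarrow> pseudometrical B \<Gamma> G" 
    for B :: "('q, 'c::euclidean_space, 'x::real_vector, 'r::finite + 't::finite) vbundle" and \<Gamma> G
    by (auto simp: metrical_def)
  show ?thesis
    unfolding Let_def
  proof (intro conjI allI impI ballI; (elim conjE)?)
    fix br \<rho> \<Gamma> D0 G
    assume "lie_algebroid F br \<rho>" "base F = base E" "rho_connection (gen_tangent F \<rho> E) \<Gamma>"
      "distinguished (gen_tangent F \<rho> E) gt_anchor \<Gamma> D0"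
      "pseudometrical (gen_tangent F \<rho> E) \<Gamma> G \<or> metrical (gen_tangent F \<rho> E) \<Gamma> G"
    from part1[OF this(1-4) pseudo[OF this(5)], unfolded Let_def] show "\<exists>D. distinguished (gen_tangent F \<rho> E) gt_anchor \<Gamma> D \<and>
      (\<forall>c\<in>base E. \<forall>t\<in>frames F. \<forall>s\<in>frames E.
        has_components (gen_tangent F \<rho> E) D (gt_dom E c t s) (adapted \<Gamma> (gt_frame \<rho> E c t s))
          (new_H gt_anchor G (adapted \<Gamma> (gt_frame \<rho> E c t s)) (struct_fun br (snd t)))
          (new_Hv (gen_tangent F \<rho> E) gt_anchor D0 G (adapted \<Gamma> (gt_frame \<rho> E c t s)))
          (new_V (gen_tangent F \<rho> E) gt_anchor D0 G (adapted \<Gamma> (gt_frame \<rho> E c t s)))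
          (new_Vv gt_anchor G (adapted \<Gamma> (gt_frame \<rho> E c t s)))) \<and>
      (\<forall>W X. open_in (base (gen_tangent F \<rho> E)) W \<and> smooth_section (gen_tangent F \<rho> E) W X \<longrightarrow> (\<forall>u\<in>W. D X G u = 0))" .
  next
    fix \<Gamma> D0 G
    assume "rho_connection TE \<Gamma>" "distinguished TE (\<lambda>u w. w) \<Gamma> D0" "pseudometrical TE \<Gamma> G \<or> metrical TE \<Gamma> G"
    from part2[OF this(1,2) pseudo[OF this(3)], unfolded Let_def] show "\<exists>D. distinguished TE (\<lambda>u w. w) \<Gamma> D \<and>
      (\<forall>c\<in>base E. \<forall>s\<in>frames E.
         has_components TE D (fst (dc c s)) (adapted \<Gamma> (coord_frame total_dir (dual_atlas E) (dc c s)))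
           (classical_H G (adapted \<Gamma> (coord_frame total_dir (dual_atlas E) (dc c s))))
           (classical_Hv TE D0 G (adapted \<Gamma> (coord_frame total_dir (dual_atlas E) (dc c s))))
           (classical_V TE D0 G (adapted \<Gamma> (coord_frame total_dir (dual_atlas E) (dc c s))))
           (classical_Vv G (adapted \<Gamma> (coord_frame total_dir (dual_atlas E) (dc c s))))) \<and>
      (\<forall>W X. open_in (dual_atlas E) W \<and> smooth_section TE W X \<longrightarrow> (\<forall>u\<in>W. D X G u = 0))" .
  qed (rule bij frame H fun_cong[OF fun_cong[OF fun_cong[OF fun_cong[OF classical(2)]]]]
      fun_cong[OF fun_cong[OF fun_cong[OF fun_cong[OF classical(3)]]]]
      fun_cong[OF fun_cong[OF fun_cong[OF fun_cong[OF classical(4)]]]]; assumption)+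
qed

end
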